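(* Let $R$ be a commutative Noetherian local ring, and let $M$ and $N$ be finitely generated $R$-modules such that $\operatorname{qpd}_RM<\infty$ and $\operatorname{Tor}^R_i(M,N)=0$ for all $i\geq 1$. Then $$\operatorname{depth}_RM+\operatorname{depth}_RN=\operatorname{depth} R+\operatorname{depth}_R(M\otimes_RN).$$
   Context: For a complex $X$ of $R$-modules put $\sup X=\sup\{i: X_i\neq 0\}$, $\inf X=\inf\{i: X_i\neq0\}$ and $\operatorname{hsup}X=\sup\{i: H_i(X)\neq0\}$. A quasi-projective resolution of an $R$-module $M$ is a bounded below complex $P$ of projective $R$-modules such that for all $i\ge\inf P$ there are integers $a_i\ge0$, not all zero, with $H_i(P)\cong M^{\oplus a_i}$; it is finite if $P$ is bounded. The quasi-projective dimension of $M\ne0$ is $\operatorname{qpd}_RM=\inf\{\sup P-\operatorname{hsup}P : P \text{ a finite quasi-projective resolution of } M\}$ (so $=\infty$ if there is no finite quasi-projective resolution), and $\operatorname{qpd}_R 0=-\infty$. The notation $\operatorname{qpd}_RM<\infty$ includes the case $-\infty$; the zero module has depth $\infty$. *)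

theory Defs
  imports "HOL-Algebra.Module" "HOL-Algebra.Ring_Divisibility" "HOL-Library.Extended_Real"
begin

section \<open>Rings and modules\<close>

locale noetherian_local_ring = noetherian_ring R + cring R for R (structure) +
  assumes unique_maximalideal: "\<exists>!I. maximalideal I R"

definition max_ideal :: "('a, 'r) ring_scheme \<Rightarrow> 'a set" where
  "max_ideal R = (THE I. maximalideal I R)"

text \<open>The record type of modules extends that of rings, so every module carries two irrelevant fields,
  the product and the unit. No definition below reads them for a module.\<close>

definition self_module :: "('a, 'r) ring_scheme \<Rightarrow> ('a, 'a) module" where
  "self_module R = \<lparr>carrier = carrier R, monoid.mult = monoid.mult R, one = one R, ring.zero = ring.zero R, add = add R,
     smult = monoid.mult R\<rparr>"

definition zero_module :: "('a, 'm, 's) module_scheme \<Rightarrow> bool" where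
  "zero_module M \<longleftrightarrow> carrier M = {\<zero>\<^bsub>M\<^esub>}"

definition mod_hom ::
    "('a, 'r) ring_scheme \<Rightarrow> ('a, 'm, 's) module_scheme \<Rightarrow> ('a, 'n, 't) module_scheme \<Rightarrow> ('m \<Rightarrow> 'n) set" where
  "mod_hom R M N = {f \<in> hom (add_monoid M) (add_monoid N).
     \<forall>r\<in>carrier R. \<forall>x\<in>carrier M. f (r \<odot>\<^bsub>M\<^esub> x) = r \<odot>\<^bsub>N\<^esub> f x}"

definition mod_iso ::
    "('a, 'r) ring_scheme \<Rightarrow> ('a, 'm, 's) module_scheme \<Rightarrow> ('a, 'n, 't) module_scheme \<Rightarrow> bool" where
  "mod_iso R M N \<longleftrightarrow> (\<exists>f\<in>mod_hom R M N. bij_betw f (carrier M) (carrier N))"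

definition mod_span :: "('a, 'r) ring_scheme \<Rightarrow> ('a, 'm, 's) module_scheme \<Rightarrow> 'm set \<Rightarrow> 'm set" where
  "mod_span R M S = (\<lambda>H. submodule H R M) hull S"

definition fin_gen :: "('a, 'r) ring_scheme \<Rightarrow> ('a, 'm, 's) module_scheme \<Rightarrow> bool" where
  "fin_gen R M \<longleftrightarrow> (\<exists>S. finite S \<and> S \<subseteq> carrier M \<and> mod_span R M S = carrier M)"

text \<open>The elements of the quotient are the cosets of \<open>H\<close>. For a coset \<open>X\<close> the cosets of \<open>r \<odot> x\<close>,
  \<open>x \<in> X\<close>, all coincide, so their union is the coset \<open>r \<odot> X\<close>.\<close>

definition quot_module :: "('a, 'm, 's) module_scheme \<Rightarrow> 'm set \<Rightarrow> ('a, 'm set) module" where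
  "quot_module M H = \<lparr>carrier = a_rcosets\<^bsub>M\<^esub> H, monoid.mult = undefined, one = undefined,
     ring.zero = H, add = set_add M, smult = (\<lambda>r X. \<Union>x\<in>X. H +>\<^bsub>M\<^esub> (r \<odot>\<^bsub>M\<^esub> x))\<rparr>"

definition mod_power :: "('a, 'm, 's) module_scheme \<Rightarrow> nat \<Rightarrow> ('a, nat \<Rightarrow> 'm) module" where
  "mod_power M n = \<lparr>carrier = {..<n} \<rightarrow>\<^sub>E carrier M, monoid.mult = undefined, one = undefined,
     ring.zero = (\<lambda>i\<in>{..<n}. \<zero>\<^bsub>M\<^esub>), add = (\<lambda>f g. \<lambda>i\<in>{..<n}. f i \<oplus>\<^bsub>M\<^esub> g i),
     smult = (\<lambda>r f. \<lambda>i\<in>{..<n}. r \<odot>\<^bsub>M\<^esub> f i)\<rparr>"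

definition free_module :: "('a, 'r) ring_scheme \<Rightarrow> 'i set \<Rightarrow> ('a, 'i \<Rightarrow> 'a) module" where
  "free_module R B = \<lparr>carrier = {f. (\<forall>i. f i \<in> carrier R) \<and> finite {i. f i \<noteq> \<zero>\<^bsub>R\<^esub>} \<and> {i. f i \<noteq> \<zero>\<^bsub>R\<^esub>} \<subseteq> B},
     monoid.mult = undefined, one = undefined, ring.zero = (\<lambda>i. \<zero>\<^bsub>R\<^esub>), add = (\<lambda>f g i. f i \<oplus>\<^bsub>R\<^esub> g i),
     smult = (\<lambda>r f i. r \<otimes>\<^bsub>R\<^esub> f i)\<rparr>"

definition free_basis :: "('a, 'r) ring_scheme \<Rightarrow> 'i \<Rightarrow> 'i \<Rightarrow> 'a" where
  "free_basis R i = (\<lambda>j. if j = i then \<one>\<^bsub>R\<^esub> else \<zero>\<^bsub>R\<^esub>)"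

text \<open>A definition cannot quantify over types, so the lifting property is required only against
  modules with elements in two fixed types. These are large enough for the free module on the elements
  of \<open>P\<close> and its canonical surjection onto \<open>P\<close>; the lemma \<open>projective_lift\<close> below recovers the
  lifting property against modules with elements in arbitrary types.\<close>

definition projective :: "('a, 'r) ring_scheme \<Rightarrow> ('a, 'p) module \<Rightarrow> bool" where
  "projective R P \<longleftrightarrow> module R P \<and>
     (\<forall>(A :: ('a, 'p \<Rightarrow> 'a) module) (B :: ('a, 'p) module) g f.
        module R A \<longrightarrow> module R B \<longrightarrow> g \<in> mod_hom R A B \<longrightarrow> g ` carrier A = carrier B \<longrightarrow>
        f \<in> mod_hom R P B \<longrightarrow> (\<exists>h\<in>mod_hom R P A. \<forall>x\<in>carrier P. g (h x) = f x))"


section \<open>Tensor products\<close>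

definition tensor_relations ::
    "('a, 'r) ring_scheme \<Rightarrow> ('a, 'm, 's) module_scheme \<Rightarrow> ('a, 'n, 't) module_scheme \<Rightarrow> ('m \<times> 'n \<Rightarrow> 'a) set" where
  "tensor_relations R M N = (let F = free_module R (carrier M \<times> carrier N); e = free_basis R in
     {e (x \<oplus>\<^bsub>M\<^esub> x', y) \<ominus>\<^bsub>F\<^esub> (e (x, y) \<oplus>\<^bsub>F\<^esub> e (x', y)) |x x' y. x \<in> carrier M \<and> x' \<in> carrier M \<and> y \<in> carrier N} \<union>
     {e (x, y \<oplus>\<^bsub>N\<^esub> y') \<ominus>\<^bsub>F\<^esub> (e (x, y) \<oplus>\<^bsub>F\<^esub> e (x, y')) |x y y'. x \<in> carrier M \<and> y \<in> carrier N \<and> y' \<in> carrier N} \<union>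
     {e (r \<odot>\<^bsub>M\<^esub> x, y) \<ominus>\<^bsub>F\<^esub> r \<odot>\<^bsub>F\<^esub> e (x, y) |r x y. r \<in> carrier R \<and> x \<in> carrier M \<and> y \<in> carrier N} \<union>
     {e (x, r \<odot>\<^bsub>N\<^esub> y) \<ominus>\<^bsub>F\<^esub> r \<odot>\<^bsub>F\<^esub> e (x, y) |r x y. r \<in> carrier R \<and> x \<in> carrier M \<and> y \<in> carrier N})"

definition tensor_kernel ::
    "('a, 'r) ring_scheme \<Rightarrow> ('a, 'm, 's) module_scheme \<Rightarrow> ('a, 'n, 't) module_scheme \<Rightarrow> ('m \<times> 'n \<Rightarrow> 'a) set" where
  "tensor_kernel R M N = mod_span R (free_module R (carrier M \<times> carrier N)) (tensor_relations R M N)"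

definition tensor ::
    "('a, 'r) ring_scheme \<Rightarrow> ('a, 'm, 's) module_scheme \<Rightarrow> ('a, 'n, 't) module_scheme \<Rightarrow> ('a, ('m \<times> 'n \<Rightarrow> 'a) set) module" where
  "tensor R M N = quot_module (free_module R (carrier M \<times> carrier N)) (tensor_kernel R M N)"

definition pure_tensor ::
    "('a, 'r) ring_scheme \<Rightarrow> ('a, 'm, 's) module_scheme \<Rightarrow> ('a, 'n, 't) module_scheme \<Rightarrow> 'm \<Rightarrow> 'n \<Rightarrow> ('m \<times> 'n \<Rightarrow> 'a) set" where
  "pure_tensor R M N x y = tensor_kernel R M N +>\<^bsub>free_module R (carrier M \<times> carrier N)\<^esub> free_basis R (x, y)"

text \<open>For \<open>f : M \<rightarrow> M'\<close>, the map \<open>f \<otimes> id : M \<otimes> N \<rightarrow> M' \<otimes> N\<close>; see \<open>tensor_map_ex1\<close> below.\<close>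

definition tensor_map ::
    "('a, 'r) ring_scheme \<Rightarrow> ('a, 'm, 's) module_scheme \<Rightarrow> ('a, 'k, 'u) module_scheme \<Rightarrow> ('a, 'n, 't) module_scheme \<Rightarrow>
     ('m \<Rightarrow> 'k) \<Rightarrow> ('m \<times> 'n \<Rightarrow> 'a) set \<Rightarrow> ('k \<times> 'n \<Rightarrow> 'a) set" where
  "tensor_map R M M' N f = (THE h. h \<in> mod_hom R (tensor R M N) (tensor R M' N) \<and>
     h \<in> extensional (carrier (tensor R M N)) \<and>
     (\<forall>x\<in>carrier M. \<forall>y\<in>carrier N. h (pure_tensor R M N x y) = pure_tensor R M' N (f x) y))"


section \<open>Complexes\<close>

text \<open>Complexes are indexed homologically: \<open>cdiff X i\<close> maps \<open>cobj X i\<close> to \<open>cobj X (i - 1)\<close>.\<close>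

record ('a, 'p) mod_complex =
  cobj :: "int \<Rightarrow> ('a, 'p) module"
  cdiff :: "int \<Rightarrow> 'p \<Rightarrow> 'p"

definition is_complex :: "('a, 'r) ring_scheme \<Rightarrow> ('a, 'p) mod_complex \<Rightarrow> bool" where
  "is_complex R X \<longleftrightarrow> (\<forall>i. module R (cobj X i) \<and> cdiff X i \<in> mod_hom R (cobj X i) (cobj X (i - 1)) \<and>
     (\<forall>x\<in>carrier (cobj X i). cdiff X (i - 1) (cdiff X i x) = \<zero>\<^bsub>cobj X (i - 1 - 1)\<^esub>))"

definition cycles :: "('a, 'p) mod_complex \<Rightarrow> int \<Rightarrow> 'p set" where
  "cycles X i = {x \<in> carrier (cobj X i). cdiff X i x = \<zero>\<^bsub>cobj X (i - 1)\<^esub>}"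

definition boundaries :: "('a, 'p) mod_complex \<Rightarrow> int \<Rightarrow> 'p set" where
  "boundaries X i = cdiff X (i + 1) ` carrier (cobj X (i + 1))"

definition homology :: "('a, 'p) mod_complex \<Rightarrow> int \<Rightarrow> ('a, 'p set) module" where
  "homology X i = quot_module ((cobj X i)\<lparr>carrier := cycles X i\<rparr>) (boundaries X i)"

definition csup :: "('a, 'p) mod_complex \<Rightarrow> ereal" where
  "csup X = (SUP i\<in>{i. \<not> zero_module (cobj X i)}. ereal (of_int i))"

definition cinf :: "('a, 'p) mod_complex \<Rightarrow> ereal" where
  "cinf X = (INF i\<in>{i. \<not> zero_module (cobj X i)}. ereal (of_int i))"

definition hsup :: "('a, 'p) mod_complex \<Rightarrow> ereal" where
  "hsup X = (SUP i\<in>{i. \<not> zero_module (homology X i)}. ereal (of_int i))"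

definition tensor_complex ::
    "('a, 'r) ring_scheme \<Rightarrow> ('a, 'p) mod_complex \<Rightarrow> ('a, 'n, 't) module_scheme \<Rightarrow> ('a, ('p \<times> 'n \<Rightarrow> 'a) set) mod_complex" where
  "tensor_complex R X N = \<lparr>cobj = (\<lambda>i. tensor R (cobj X i) N),
     cdiff = (\<lambda>i. tensor_map R (cobj X i) (cobj X (i - 1)) N (cdiff X i))\<rparr>"

definition projective_resolution ::
    "('a, 'r) ring_scheme \<Rightarrow> ('a, 'p) mod_complex \<Rightarrow> ('a, 'm, 's) module_scheme \<Rightarrow> bool" where
  "projective_resolution R P M \<longleftrightarrow> is_complex R P \<and> (\<forall>i. projective R (cobj P i)) \<and>
     (\<forall>i<0. zero_module (cobj P i)) \<and> (\<forall>i>0. cycles P i = boundaries P i) \<and>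
     (\<exists>\<epsilon>\<in>mod_hom R (cobj P 0) M. \<epsilon> ` carrier (cobj P 0) = carrier M \<and>
        {x \<in> carrier (cobj P 0). \<epsilon> x = \<zero>\<^bsub>M\<^esub>} = boundaries P 0)"

text \<open>The element type of the chosen resolution is large enough for every module to have a
  resolution in it, see \<open>projective_resolution_exists\<close> below.\<close>

definition chosen_resolution ::
    "('a, 'r) ring_scheme \<Rightarrow> ('a, 'm, 's) module_scheme \<Rightarrow> ('a, ('a + 'm) list \<Rightarrow> 'a) mod_complex" where
  "chosen_resolution R M = (SOME P. projective_resolution R P M)"

definition Tor ::
    "('a, 'r) ring_scheme \<Rightarrow> nat \<Rightarrow> ('a, 'm, 's) module_scheme \<Rightarrow> ('a, 'n, 't) module_scheme \<Rightarrow>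
     ('a, ((('a + 'm) list \<Rightarrow> 'a) \<times> 'n \<Rightarrow> 'a) set set) module" where
  "Tor R i M N = homology (tensor_complex R (chosen_resolution R M) N) (int i)"


section \<open>Quasi-projective dimension\<close>

definition quasi_projective_resolution ::
    "('a, 'r) ring_scheme \<Rightarrow> ('a, 'p) mod_complex \<Rightarrow> ('a, 'm, 's) module_scheme \<Rightarrow> bool" where
  "quasi_projective_resolution R P M \<longleftrightarrow> is_complex R P \<and> (\<forall>i. projective R (cobj P i)) \<and> cinf P > -\<infinity> \<and>
     (\<exists>a :: int \<Rightarrow> nat. (\<exists>i. cinf P \<le> ereal (of_int i) \<and> a i \<noteq> 0) \<and>
        (\<forall>i. cinf P \<le> ereal (of_int i) \<longrightarrow> mod_iso R (homology P i) (mod_power M (a i))))"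

definition finite_quasi_projective_resolution ::
    "('a, 'r) ring_scheme \<Rightarrow> ('a, 'p) mod_complex \<Rightarrow> ('a, 'm, 's) module_scheme \<Rightarrow> bool" where
  "finite_quasi_projective_resolution R P M \<longleftrightarrow> quasi_projective_resolution R P M \<and> csup P < \<infinity>"

text \<open>The type argument is the type of the elements of the projective modules occurring in resolutions.
  A statement with an arbitrary \<open>'p\<close> covers resolutions by projective modules of any size.\<close>

definition qpd :: "'p itself \<Rightarrow> ('a, 'r) ring_scheme \<Rightarrow> ('a, 'm, 's) module_scheme \<Rightarrow> ereal" where
  "qpd _ R M = (if zero_module M then -\<infinity>
     else INF P\<in>{P :: ('a, 'p) mod_complex. finite_quasi_projective_resolution R P M}. csup P - hsup P)"


section \<open>Depth\<close>

definition quot_by_seq ::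
    "('a, 'r) ring_scheme \<Rightarrow> ('a, 'm, 's) module_scheme \<Rightarrow> 'a list \<Rightarrow> ('a, 'm set) module" where
  "quot_by_seq R M xs = quot_module M (mod_span R M {r \<odot>\<^bsub>M\<^esub> x |r x. r \<in> set xs \<and> x \<in> carrier M})"

definition regular_on :: "('a, 'm, 's) module_scheme \<Rightarrow> 'a \<Rightarrow> bool" where
  "regular_on M r \<longleftrightarrow> (\<forall>x\<in>carrier M. r \<odot>\<^bsub>M\<^esub> x = \<zero>\<^bsub>M\<^esub> \<longrightarrow> x = \<zero>\<^bsub>M\<^esub>)"

definition regular_sequence :: "('a, 'r) ring_scheme \<Rightarrow> ('a, 'm, 's) module_scheme \<Rightarrow> 'a list \<Rightarrow> bool" where
  "regular_sequence R M xs \<longleftrightarrow> set xs \<subseteq> carrier R \<and>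
     (\<forall>i<length xs. regular_on (quot_by_seq R M (take i xs)) (xs ! i)) \<and>
     \<not> zero_module (quot_by_seq R M xs)"

text \<open>The common length of the maximal regular sequences in the maximal ideal. For \<open>M = 0\<close> no
  sequence, not even the empty one, is regular; the depth is then \<open>\<infinity>\<close> by convention.\<close>

definition depth :: "('a, 'r) ring_scheme \<Rightarrow> ('a, 'm, 's) module_scheme \<Rightarrow> enat" where
  "depth R M = (if zero_module M then \<infinity>
     else SUP xs\<in>{xs. regular_sequence R M xs \<and> set xs \<subseteq> max_ideal R}. enat (length xs))"


section \<open>Well-definedness\<close>

subsection \<open>Homomorphisms and spans\<close>

lemma mod_homI:
  assumes "\<And>x. x \<in> carrier M \<Longrightarrow> f x \<in> carrier N"
    and "\<And>x y. x \<in> carrier M \<Longrightarrow> y \<in> carrier M \<Longrightarrow> f (x \<oplus>\<^bsub>M\<^esub> y) = f x \<oplus>\<^bsub>N\<^esub> f y"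
    and "\<And>r x. r \<in> carrier R \<Longrightarrow> x \<in> carrier M \<Longrightarrow> f (r \<odot>\<^bsub>M\<^esub> x) = r \<odot>\<^bsub>N\<^esub> f x"
  shows "f \<in> mod_hom R M N"
  using assms by (auto simp: mod_hom_def hom_def)

lemma mod_homD:
  assumes "f \<in> mod_hom R M N"
  shows mod_hom_closed: "x \<in> carrier M \<Longrightarrow> f x \<in> carrier N"
    and mod_hom_add: "x \<in> carrier M \<Longrightarrow> y \<in> carrier M \<Longrightarrow> f (x \<oplus>\<^bsub>M\<^esub> y) = f x \<oplus>\<^bsub>N\<^esub> f y"
    and mod_hom_smult: "r \<in> carrier R \<Longrightarrow> x \<in> carrier M \<Longrightarrow> f (r \<odot>\<^bsub>M\<^esub> x) = r \<odot>\<^bsub>N\<^esub> f x"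
  using assms by (auto simp: mod_hom_def hom_def)

lemma mod_hom_zero:
  assumes "module R M" "module R N" "f \<in> mod_hom R M N"
  shows "f \<zero>\<^bsub>M\<^esub> = \<zero>\<^bsub>N\<^esub>"
proof -
  interpret M: module R M by fact
  interpret N: module R N by fact
  have "f (\<zero>\<^bsub>R\<^esub> \<odot>\<^bsub>M\<^esub> \<zero>\<^bsub>M\<^esub>) = \<zero>\<^bsub>R\<^esub> \<odot>\<^bsub>N\<^esub> f \<zero>\<^bsub>M\<^esub>"
    using mod_hom_smult[OF assms(3), of "\<zero>\<^bsub>R\<^esub>" "\<zero>\<^bsub>M\<^esub>"] by simp
  then show ?thesis using mod_hom_closed[OF assms(3)] by simp
qed

lemma mod_hom_minus:
  assumes "module R M" "module R N" "f \<in> mod_hom R M N" "x \<in> carrier M" "y \<in> carrier M"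
  shows "f (x \<ominus>\<^bsub>M\<^esub> y) = f x \<ominus>\<^bsub>N\<^esub> f y"
proof -
  interpret M: module R M by fact
  interpret N: module R N by fact
  have *: "\<ominus>\<^bsub>M\<^esub> y = (\<ominus>\<^bsub>R\<^esub> \<one>\<^bsub>R\<^esub>) \<odot>\<^bsub>M\<^esub> y" "\<ominus>\<^bsub>N\<^esub> f y = (\<ominus>\<^bsub>R\<^esub> \<one>\<^bsub>R\<^esub>) \<odot>\<^bsub>N\<^esub> f y"
    using assms mod_hom_closed[OF assms(3)] by (simp_all add: M.smult_l_minus N.smult_l_minus)
  show ?thesis
    unfolding a_minus_def * using assms mod_homD[OF assms(3)] by simp
qed

lemma (in abelian_group) minus_eq_zero_iff:
  assumes "x \<in> carrier G" "y \<in> carrier G"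
  shows "x \<ominus> y = \<zero> \<longleftrightarrow> x = y"
  using assms by (metis a_inv_closed minus_eq minus_equality minus_minus r_neg)

lemma mod_hom_comp:
  assumes "f \<in> mod_hom R M N" "g \<in> mod_hom R N K"
  shows "(\<lambda>x. g (f x)) \<in> mod_hom R M K"
  using mod_homD[OF assms(1)] mod_homD[OF assms(2)] by (intro mod_homI) auto

lemma kernel_submodule:
  assumes "module R M" "module R N" "f \<in> mod_hom R M N"
  shows "submodule {x \<in> carrier M. f x = \<zero>\<^bsub>N\<^esub>} R M"
proof -
  interpret M: module R M by fact
  interpret N: module R N by fact
  show ?thesis
  proof (rule M.submoduleI)
    fix a assume a: "a \<in> {x \<in> carrier M. f x = \<zero>\<^bsub>N\<^esub>}"
    have "f (\<zero>\<^bsub>M\<^esub> \<ominus>\<^bsub>M\<^esub> a) = \<zero>\<^bsub>N\<^esub>"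
      using a mod_hom_minus[OF assms, of "\<zero>\<^bsub>M\<^esub>" a] mod_hom_zero[OF assms] by (simp add: a_minus_def)
    then show "\<ominus>\<^bsub>M\<^esub> a \<in> {x \<in> carrier M. f x = \<zero>\<^bsub>N\<^esub>}"
      using a by (simp add: a_minus_def)
  qed (use mod_homD[OF assms(3)] mod_hom_zero[OF assms] in auto)
qed

lemma mod_span_submodule:
  assumes "module R M" "S \<subseteq> carrier M"
  shows "submodule (mod_span R M S) R M"
proof -
  interpret M: module R M by fact
  have c: "submodule (carrier M) R M" by (rule M.carrier_is_submodule)
  show ?thesis
  proof (rule M.submoduleI)
    show "mod_span R M S \<subseteq> carrier M"
      using c assms(2) by (auto simp: mod_span_def hull_def)
    show "\<zero>\<^bsub>M\<^esub> \<in> mod_span R M S"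
      by (auto simp: mod_span_def hull_def intro: subgroup.one_closed[of _ "add_monoid M", simplified] dest: submodule.axioms(1))
  next
    fix a b assume "a \<in> mod_span R M S" "b \<in> mod_span R M S"
    then show "a \<oplus>\<^bsub>M\<^esub> b \<in> mod_span R M S"
      using M.submoduleE(5) by (auto simp: mod_span_def hull_def)
  next
    fix a assume "a \<in> mod_span R M S"
    then show "\<ominus>\<^bsub>M\<^esub> a \<in> mod_span R M S"
      using M.submoduleE(3) by (auto simp: mod_span_def hull_def)
  next
    fix r a assume "r \<in> carrier R" "a \<in> mod_span R M S"
    then show "r \<odot>\<^bsub>M\<^esub> a \<in> mod_span R M S"
      using M.submoduleE(4) by (auto simp: mod_span_def hull_def)
  qed
qed

lemma mod_span_subset: "submodule H R M \<Longrightarrow> S \<subseteq> H \<Longrightarrow> mod_span R M S \<subseteq> H"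
  by (simp add: mod_span_def hull_minimal)

lemma mod_span_superset: "S \<subseteq> mod_span R M S"
  by (simp add: mod_span_def hull_subset)

subsection \<open>Quotients\<close>

lemma abelian_subgroup_of_submodule:
  assumes "module R M" "submodule H R M"
  shows "abelian_subgroup H M"
proof -
  interpret M: module R M by fact
  show ?thesis
    using submodule.axioms(1)[OF assms(2)]
    by (intro abelian_subgroupI3 additive_subgroup.intro) (auto simp: M.abelian_group_axioms)
qed

lemma quot_module:
  assumes "module R M" "submodule H R M"
  shows quot_carrier: "carrier (quot_module M H) = {H +>\<^bsub>M\<^esub> x |x. x \<in> carrier M}"
    and quot_add: "\<And>x y. x \<in> carrier M \<Longrightarrow> y \<in> carrier M \<Longrightarrow>
        (H +>\<^bsub>M\<^esub> x) \<oplus>\<^bsub>quot_module M H\<^esub> (H +>\<^bsub>M\<^esub> y) = H +>\<^bsub>M\<^esub> (x \<oplus>\<^bsub>M\<^esub> y)"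
    and quot_smult: "\<And>r x. r \<in> carrier R \<Longrightarrow> x \<in> carrier M \<Longrightarrow>
        r \<odot>\<^bsub>quot_module M H\<^esub> (H +>\<^bsub>M\<^esub> x) = H +>\<^bsub>M\<^esub> (r \<odot>\<^bsub>M\<^esub> x)"
    and quot_zero: "\<zero>\<^bsub>quot_module M H\<^esub> = H +>\<^bsub>M\<^esub> \<zero>\<^bsub>M\<^esub>"
    and quot_eq: "\<And>x y. x \<in> carrier M \<Longrightarrow> y \<in> carrier M \<Longrightarrow> 
        H +>\<^bsub>M\<^esub> x = H +>\<^bsub>M\<^esub> y \<longleftrightarrow> x \<ominus>\<^bsub>M\<^esub> y \<in> H"
    and quot_is_module: "module R (quot_module M H)"
proof -
  interpret M: module R M by fact
  interpret H: submodule H R M by fact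
  interpret A: abelian_subgroup H M by (rule abelian_subgroup_of_submodule[OF assms])
  show c: "carrier (quot_module M H) = {H +>\<^bsub>M\<^esub> x |x. x \<in> carrier M}"
    by (auto simp: quot_module_def A_RCOSETS_def' )
  show a: "(H +>\<^bsub>M\<^esub> x) \<oplus>\<^bsub>quot_module M H\<^esub> (H +>\<^bsub>M\<^esub> y) = H +>\<^bsub>M\<^esub> (x \<oplus>\<^bsub>M\<^esub> y)"
    if "x \<in> carrier M" "y \<in> carrier M" for x y
    using that by (simp add: quot_module_def A.a_rcos_sum)
  show z: "\<zero>\<^bsub>quot_module M H\<^esub> = H +>\<^bsub>M\<^esub> \<zero>\<^bsub>M\<^esub>"
    by (simp add: quot_module_def M.a_coset_add_zero A.a_subset)
  show e: "H +>\<^bsub>M\<^esub> x = H +>\<^bsub>M\<^esub> y \<longleftrightarrow> x \<ominus>\<^bsub>M\<^esub> y \<in> H" if "x \<in> carrier M" "y \<in> carrier M" for x y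
  proof -
    have "x \<in> H +>\<^bsub>M\<^esub> y \<longleftrightarrow> x \<ominus>\<^bsub>M\<^esub> y \<in> H"
      using A.a_rcos_module[OF that(2,1)] by (simp add: M.minus_eq)
    moreover have "x \<in> H +>\<^bsub>M\<^esub> y" if "H +>\<^bsub>M\<^esub> x = H +>\<^bsub>M\<^esub> y"
      using A.a_rcos_self[OF \<open>x \<in> carrier M\<close>] that by simp
    moreover have "H +>\<^bsub>M\<^esub> y = H +>\<^bsub>M\<^esub> x" if "x \<in> H +>\<^bsub>M\<^esub> y"
      using A.a_repr_independence'[OF that \<open>y \<in> carrier M\<close>] .
    ultimately show ?thesis by metis
  qed
  show s: "r \<odot>\<^bsub>quot_module M H\<^esub> (H +>\<^bsub>M\<^esub> x) = H +>\<^bsub>M\<^esub> (r \<odot>\<^bsub>M\<^esub> x)"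
    if "r \<in> carrier R" "x \<in> carrier M" for r x
  proof -
    have *: "H +>\<^bsub>M\<^esub> (r \<odot>\<^bsub>M\<^esub> y) = H +>\<^bsub>M\<^esub> (r \<odot>\<^bsub>M\<^esub> x)" if y: "y \<in> H +>\<^bsub>M\<^esub> x" for y
    proof -
      obtain h where h: "h \<in> H" "y = h \<oplus>\<^bsub>M\<^esub> x" using y by (auto simp: a_r_coset_def')
      have hc: "h \<in> carrier M" using h A.a_subset by auto
      have "r \<odot>\<^bsub>M\<^esub> y \<ominus>\<^bsub>M\<^esub> r \<odot>\<^bsub>M\<^esub> x = r \<odot>\<^bsub>M\<^esub> h"
        using h hc \<open>r \<in> carrier R\<close> \<open>x \<in> carrier M\<close>
        by (simp add: M.smult_r_distr a_minus_def M.a_assoc M.r_neg)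
      then show ?thesis using e h hc \<open>r \<in> carrier R\<close> \<open>x \<in> carrier M\<close> by simp
    qed
    have "(\<Union>y\<in>H +>\<^bsub>M\<^esub> x. H +>\<^bsub>M\<^esub> (r \<odot>\<^bsub>M\<^esub> y)) = (\<Union>y\<in>H +>\<^bsub>M\<^esub> x. H +>\<^bsub>M\<^esub> (r \<odot>\<^bsub>M\<^esub> x))"
      by (intro SUP_cong refl *)
    also have "\<dots> = H +>\<^bsub>M\<^esub> (r \<odot>\<^bsub>M\<^esub> x)"
      using A.a_rcos_self[OF that(2)] by (subst SUP_const) auto
    finally show ?thesis by (simp add: quot_module_def)
  qed
  show "module R (quot_module M H)"
  proof (rule moduleI)
    show "cring R" by (rule M.R.is_cring)
    show "abelian_group (quot_module M H)"
    proof (rule abelian_groupI)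
      fix X assume "X \<in> carrier (quot_module M H)"
      then obtain x where x: "x \<in> carrier M" "X = H +>\<^bsub>M\<^esub> x" by (auto simp: c)
      show "\<exists>Y\<in>carrier (quot_module M H). Y \<oplus>\<^bsub>quot_module M H\<^esub> X = \<zero>\<^bsub>quot_module M H\<^esub>"
        using x by (intro bexI[of _ "H +>\<^bsub>M\<^esub> (\<ominus>\<^bsub>M\<^esub> x)"]) (auto simp: a z c M.l_neg)
    next
      fix X Y assume "X \<in> carrier (quot_module M H)" "Y \<in> carrier (quot_module M H)"
      then show "X \<oplus>\<^bsub>quot_module M H\<^esub> Y \<in> carrier (quot_module M H)"
        using M.a_closed by (fastforce simp: c a)
    qed (auto simp: c a z M.a_ac intro: M.a_closed)
  next
    fix r X assume "r \<in> carrier R" "X \<in> carrier (quot_module M H)"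
    then show "r \<odot>\<^bsub>quot_module M H\<^esub> X \<in> carrier (quot_module M H)"
      using M.smult_closed by (fastforce simp: c s)
  qed (auto simp: c a s M.smult_l_distr M.smult_r_distr M.smult_assoc1)
qed

lemma quot_proj_hom:
  assumes "module R M" "submodule H R M"
  shows "(\<lambda>x. H +>\<^bsub>M\<^esub> x) \<in> mod_hom R M (quot_module M H)"
  using quot_module[OF assms] by (intro mod_homI) auto

lemma quot_lift:
  assumes "module R M" "submodule H R M" "module R N" "f \<in> mod_hom R M N" "\<And>x. x \<in> H \<Longrightarrow> f x = \<zero>\<^bsub>N\<^esub>"
  shows "\<exists>h\<in>mod_hom R (quot_module M H) N. \<forall>x\<in>carrier M. h (H +>\<^bsub>M\<^esub> x) = f x"
proof -
  interpret M: module R M by fact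
  interpret N: module R N by fact
  note q = quot_module[OF assms(1,2)]
  define h where "h X = f (SOME x. x \<in> carrier M \<and> X = H +>\<^bsub>M\<^esub> x)" for X
  have h: "h (H +>\<^bsub>M\<^esub> x) = f x" if x: "x \<in> carrier M" for x
  proof -
    define y where "y = (SOME y. y \<in> carrier M \<and> H +>\<^bsub>M\<^esub> x = H +>\<^bsub>M\<^esub> y)"
    have y: "y \<in> carrier M \<and> H +>\<^bsub>M\<^esub> x = H +>\<^bsub>M\<^esub> y"
      unfolding y_def by (rule someI[of _ x]) (simp add: x)
    then have "f (x \<ominus>\<^bsub>M\<^esub> y) = \<zero>\<^bsub>N\<^esub>" using q(5) x assms(5) by blast
    then have "f x \<ominus>\<^bsub>N\<^esub> f y = \<zero>\<^bsub>N\<^esub>" using mod_hom_minus[OF assms(1,3,4)] x y by auto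
    then have "f x = f y" using x y mod_hom_closed[OF assms(4)] by (simp add: N.minus_eq_zero_iff)
    then show ?thesis by (simp add: h_def y_def)
  qed
  have "h \<in> mod_hom R (quot_module M H) N"
    using mod_homD[OF assms(4)] by (intro mod_homI) (auto simp: q h)
  then show ?thesis using h by blast
qed

subsection \<open>Free and projective modules\<close>

lemma free_module_simps:
  "u \<in> carrier (free_module R B) \<longleftrightarrow> (\<forall>i. u i \<in> carrier R) \<and> finite {i. u i \<noteq> \<zero>\<^bsub>R\<^esub>} \<and> {i. u i \<noteq> \<zero>\<^bsub>R\<^esub>} \<subseteq> B"
  "\<zero>\<^bsub>free_module R B\<^esub> = (\<lambda>i. \<zero>\<^bsub>R\<^esub>)"
  "u \<oplus>\<^bsub>free_module R B\<^esub> v = (\<lambda>i. u i \<oplus>\<^bsub>R\<^esub> v i)"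
  "r \<odot>\<^bsub>free_module R B\<^esub> u = (\<lambda>i. r \<otimes>\<^bsub>R\<^esub> u i)"
  by (auto simp: free_module_def)

lemma free_module_is_module:
  assumes "cring R"
  shows "module R (free_module R B)"
proof -
  interpret R: cring R by fact
  have add: "u \<oplus>\<^bsub>free_module R B\<^esub> v \<in> carrier (free_module R B)"
    if "u \<in> carrier (free_module R B)" "v \<in> carrier (free_module R B)" for u v
  proof -
    have "{i. u i \<oplus>\<^bsub>R\<^esub> v i \<noteq> \<zero>\<^bsub>R\<^esub>} \<subseteq> {i. u i \<noteq> \<zero>\<^bsub>R\<^esub>} \<union> {i. v i \<noteq> \<zero>\<^bsub>R\<^esub>}"
      using that by (auto simp: free_module_simps)
    then show ?thesis using that
      by (auto simp: free_module_simps intro: finite_subset[of _ "{i. u i \<noteq> \<zero>\<^bsub>R\<^esub>} \<union> {i. v i \<noteq> \<zero>\<^bsub>R\<^esub>}"])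
  qed
  have smult: "r \<odot>\<^bsub>free_module R B\<^esub> u \<in> carrier (free_module R B)"
    if "r \<in> carrier R" "u \<in> carrier (free_module R B)" for r u
  proof -
    have "{i. r \<otimes>\<^bsub>R\<^esub> u i \<noteq> \<zero>\<^bsub>R\<^esub>} \<subseteq> {i. u i \<noteq> \<zero>\<^bsub>R\<^esub>}"
      using that by (auto simp: free_module_simps)
    then show ?thesis using that
      by (auto simp: free_module_simps intro: finite_subset[of _ "{i. u i \<noteq> \<zero>\<^bsub>R\<^esub>}"])
  qed
  show ?thesis
  proof (rule moduleI)
    show "abelian_group (free_module R B)"
    proof (rule abelian_groupI)
      fix u assume u: "u \<in> carrier (free_module R B)"
      show "\<exists>v\<in>carrier (free_module R B). v \<oplus>\<^bsub>free_module R B\<^esub> u = \<zero>\<^bsub>free_module R B\<^esub>"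
        using u smult[of "\<ominus>\<^bsub>R\<^esub> \<one>\<^bsub>R\<^esub>" u]
        by (intro bexI[of _ "(\<ominus>\<^bsub>R\<^esub> \<one>\<^bsub>R\<^esub>) \<odot>\<^bsub>free_module R B\<^esub> u"])
          (auto simp: free_module_simps R.l_minus R.l_neg)
    qed (use add in \<open>auto simp: free_module_simps R.a_ac\<close>)
  qed (use smult R.is_cring in \<open>auto simp: free_module_simps R.l_distr R.r_distr R.m_assoc\<close>)
qed

lemma free_basis_closed: "cring R \<Longrightarrow> i \<in> B \<Longrightarrow> free_basis R i \<in> carrier (free_module R B)"
  by (auto simp: free_module_simps free_basis_def cring.cring_simprules intro: finite_subset[of _ "{i}"])

lemma free_induct:
  assumes "cring R" "submodule H R (free_module R B)" "\<And>i. i \<in> B \<Longrightarrow> free_basis R i \<in> H"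
    and "u \<in> carrier (free_module R B)"
  shows "u \<in> H"
proof -
  interpret R: cring R by fact
  interpret F: module R "free_module R B" by (rule free_module_is_module) fact
  note H = F.submoduleE[OF assms(2)]
  have "\<forall>u\<in>carrier (free_module R B). {i. u i \<noteq> \<zero>\<^bsub>R\<^esub>} \<subseteq> A \<longrightarrow> u \<in> H" if "finite A" for A
    using that
  proof (induction A rule: finite_induct)
    case empty
    have "\<zero>\<^bsub>free_module R B\<^esub> \<in> H"
      using subgroup.one_closed[OF submodule.axioms(1)[OF assms(2)]] by simp
    moreover have "u = \<zero>\<^bsub>free_module R B\<^esub>" if "{i. u i \<noteq> \<zero>\<^bsub>R\<^esub>} \<subseteq> {}" for u
      using that by (auto simp: free_module_simps)
    ultimately show ?case by blast
  next
    case (insert a A)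
    show ?case
    proof (intro ballI impI)
      fix u assume u: "u \<in> carrier (free_module R B)" "{i. u i \<noteq> \<zero>\<^bsub>R\<^esub>} \<subseteq> insert a A"
      show "u \<in> H"
      proof (cases "u a = \<zero>\<^bsub>R\<^esub>")
        case True
        then have "{i. u i \<noteq> \<zero>\<^bsub>R\<^esub>} \<subseteq> A" using u by auto
        then show ?thesis using insert u by auto
      next
        case False
        then have aB: "a \<in> B" using u by (auto simp: free_module_simps)
        define v where "v = u(a := \<zero>\<^bsub>R\<^esub>)"
        have "{i. v i \<noteq> \<zero>\<^bsub>R\<^esub>} \<subseteq> {i. u i \<noteq> \<zero>\<^bsub>R\<^esub>}" by (auto simp: v_def)
        then have "v \<in> carrier (free_module R B)"
          using u by (auto simp: free_module_simps v_def intro: finite_subset[of _ "{i. u i \<noteq> \<zero>\<^bsub>R\<^esub>}"])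
        moreover have "{i. v i \<noteq> \<zero>\<^bsub>R\<^esub>} \<subseteq> A" using u by (auto simp: v_def)
        ultimately have "v \<in> H" using insert by blast
        moreover have "u = u a \<odot>\<^bsub>free_module R B\<^esub> free_basis R a \<oplus>\<^bsub>free_module R B\<^esub> v"
          using u by (auto simp: free_module_simps free_basis_def v_def)
        ultimately show ?thesis
          using H(4,5) assms(3)[OF aB] u by (metis free_module_simps(1))
      qed
    qed
  qed
  then show ?thesis using assms(4) by (auto simp: free_module_simps)
qed

lemma hom_agree_submodule:
  assumes "module R M" "module R N" "f \<in> mod_hom R M N" "g \<in> mod_hom R M N"
  shows "submodule {x \<in> carrier M. f x = g x} R M"
proof -
  interpret M: module R M by fact
  interpret N: module R N by fact
  show ?thesis
  proof (rule M.submoduleI)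
    fix a assume a: "a \<in> {x \<in> carrier M. f x = g x}"
    have "f (\<zero>\<^bsub>M\<^esub> \<ominus>\<^bsub>M\<^esub> a) = g (\<zero>\<^bsub>M\<^esub> \<ominus>\<^bsub>M\<^esub> a)"
      using a mod_hom_minus[OF assms(1,2,3) M.zero_closed, of a] mod_hom_minus[OF assms(1,2,4) M.zero_closed, of a]
        mod_hom_zero[OF assms(1,2,3)] mod_hom_zero[OF assms(1,2,4)] by simp
    then show "\<ominus>\<^bsub>M\<^esub> a \<in> {x \<in> carrier M. f x = g x}"
      using a by (simp add: a_minus_def)
  qed (use mod_homD[OF assms(3)] mod_homD[OF assms(4)] mod_hom_zero[OF assms(1,2,3)] mod_hom_zero[OF assms(1,2,4)] in auto)
qed

lemma free_lift:
  fixes R :: "('a, 'r) ring_scheme"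
  assumes "module R M" "\<And>i. i \<in> B \<Longrightarrow> \<phi> i \<in> carrier M"
  shows "\<exists>h\<in>mod_hom R (free_module R B) M. \<forall>i\<in>B. h (free_basis R i) = \<phi> i"
proof -
  interpret M: module R M by fact
  define h where "h u = (\<Oplus>\<^bsub>M\<^esub>i\<in>{i. u i \<noteq> \<zero>\<^bsub>R\<^esub>}. u i \<odot>\<^bsub>M\<^esub> \<phi> i)" for u
  have h: "h u = (\<Oplus>\<^bsub>M\<^esub>i\<in>A. u i \<odot>\<^bsub>M\<^esub> \<phi> i)"
    if "u \<in> carrier (free_module R B)" "finite A" "{i. u i \<noteq> \<zero>\<^bsub>R\<^esub>} \<subseteq> A" "A \<subseteq> B" for u A
    unfolding h_def using that assms(2)
    by (intro M.add.finprod_mono_neutral_cong_left) (auto simp: free_module_simps subset_iff)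
  have cl: "(\<lambda>i. u i \<odot>\<^bsub>M\<^esub> \<phi> i) \<in> A \<rightarrow> carrier M" if "u \<in> carrier (free_module R B)" "A \<subseteq> B" for u A
    using that assms(2) by (auto simp: free_module_simps)
  interpret F: module R "free_module R B" by (rule free_module_is_module) (rule M.R.is_cring)
  have "h \<in> mod_hom R (free_module R B) M"
  proof (rule mod_homI)
    fix u assume u: "u \<in> carrier (free_module R B)"
    show "h u \<in> carrier M"
      unfolding h_def using u by (intro M.finsum_closed cl) (auto simp: free_module_simps)
    fix v assume v: "v \<in> carrier (free_module R B)"
    let ?A = "{i. u i \<noteq> \<zero>\<^bsub>R\<^esub>} \<union> {i. v i \<noteq> \<zero>\<^bsub>R\<^esub>}"
    have A: "finite ?A" "?A \<subseteq> B" using u v by (auto simp: free_module_simps)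
    have s: "{i. (u \<oplus>\<^bsub>free_module R B\<^esub> v) i \<noteq> \<zero>\<^bsub>R\<^esub>} \<subseteq> ?A"
      using u v by (auto simp: free_module_simps)
    have "h (u \<oplus>\<^bsub>free_module R B\<^esub> v) = (\<Oplus>\<^bsub>M\<^esub>i\<in>?A. (u i \<odot>\<^bsub>M\<^esub> \<phi> i) \<oplus>\<^bsub>M\<^esub> (v i \<odot>\<^bsub>M\<^esub> \<phi> i))"
      unfolding h[OF F.a_closed[OF u v] A(1) s A(2)] using u v A assms(2)
      by (intro M.finsum_cong') (auto simp: free_module_simps M.smult_l_distr subset_iff)
    also have "\<dots> = h u \<oplus>\<^bsub>M\<^esub> h v"
      using h[OF u A(1) _ A(2)] h[OF v A(1) _ A(2)] cl[OF u A(2)] cl[OF v A(2)] by (simp add: M.finsum_addf)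
    finally show "h (u \<oplus>\<^bsub>free_module R B\<^esub> v) = h u \<oplus>\<^bsub>M\<^esub> h v" .
  next
    fix r u assume r: "r \<in> carrier R" and u: "u \<in> carrier (free_module R B)"
    let ?A = "{i. u i \<noteq> \<zero>\<^bsub>R\<^esub>}"
    have A: "finite ?A" "?A \<subseteq> B" using u by (auto simp: free_module_simps)
    have s: "{i. (r \<odot>\<^bsub>free_module R B\<^esub> u) i \<noteq> \<zero>\<^bsub>R\<^esub>} \<subseteq> ?A"
      using u r by (auto simp: free_module_simps)
    have "h (r \<odot>\<^bsub>free_module R B\<^esub> u) = (\<Oplus>\<^bsub>M\<^esub>i\<in>?A. r \<odot>\<^bsub>M\<^esub> (u i \<odot>\<^bsub>M\<^esub> \<phi> i))"
      unfolding h[OF F.smult_closed[OF r u] A(1) s A(2)] using u r A assms(2)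
      by (intro M.finsum_cong') (auto simp: free_module_simps M.smult_assoc1 subset_iff)
    also have "\<dots> = r \<odot>\<^bsub>M\<^esub> h u"
      unfolding h_def using M.finsum_smult_ldistr[OF A(1) r cl[OF u A(2)]] by simp
    finally show "h (r \<odot>\<^bsub>free_module R B\<^esub> u) = r \<odot>\<^bsub>M\<^esub> h u" .
  qed
  moreover have "h (free_basis R i) = \<phi> i" if i: "i \<in> B" for i
  proof -
    have "h (free_basis R i) = (\<Oplus>\<^bsub>M\<^esub>j\<in>{i}. free_basis R i j \<odot>\<^bsub>M\<^esub> \<phi> j)"
      using i by (intro h free_basis_closed M.R.is_cring) (auto simp: free_basis_def)
    also have "\<dots> = \<phi> i" using assms(2)[OF i] by (simp add: free_basis_def)
    finally show ?thesis .
  qed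
  ultimately show ?thesis by blast
qed

lemma free_projective_lift:
  assumes "module R A" "module R B" "g \<in> mod_hom R A B" "g ` carrier A = carrier B"
    "f \<in> mod_hom R (free_module R I) B"
  shows "\<exists>h\<in>mod_hom R (free_module R I) A. \<forall>x\<in>carrier (free_module R I). g (h x) = f x"
proof -
  interpret A: module R A by fact
  have F: "module R (free_module R I)" by (rule free_module_is_module) (rule A.R.is_cring)
  have "\<exists>a\<in>carrier A. g a = f (free_basis R i)" if "i \<in> I" for i
    using mod_hom_closed[OF assms(5) free_basis_closed[OF A.R.is_cring that]] assms(4) by (metis imageE)
  then obtain \<phi> where \<phi>: "\<And>i. i \<in> I \<Longrightarrow> \<phi> i \<in> carrier A \<and> g (\<phi> i) = f (free_basis R i)" by metis
  obtain h where h: "h \<in> mod_hom R (free_module R I) A" "\<forall>i\<in>I. h (free_basis R i) = \<phi> i"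
    using free_lift[OF assms(1), of I \<phi>] \<phi> by auto
  have gh: "(\<lambda>x. g (h x)) \<in> mod_hom R (free_module R I) B" by (rule mod_hom_comp[OF h(1) assms(3)])
  have "x \<in> {x \<in> carrier (free_module R I). g (h x) = f x}" if "x \<in> carrier (free_module R I)" for x
    by (rule free_induct[OF A.R.is_cring hom_agree_submodule[OF F assms(2) gh assms(5)] _ that])
      (use \<phi> h free_basis_closed[OF A.R.is_cring] in auto)
  then show ?thesis using h(1) by blast
qed

lemma free_projective: "cring R \<Longrightarrow> projective R (free_module R I)"
  unfolding projective_def by (intro conjI allI impI free_module_is_module free_projective_lift)

lemma projective_lift:
  fixes P :: "('a, 'p) module" and A :: "('a, 'm, 's) module_scheme" and B :: "('a, 'n, 't) module_scheme"
  assumes P: "projective R P"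
    and "module R A" "module R B" "g \<in> mod_hom R A B" "g ` carrier A = carrier B" "f \<in> mod_hom R P B"
  shows "\<exists>h\<in>mod_hom R P A. \<forall>x\<in>carrier P. g (h x) = f x"
proof -
  interpret P: module R P using P by (simp add: projective_def)
  let ?F = "free_module R (carrier P)"
  have F: "module R ?F" by (rule free_module_is_module) (rule P.R.is_cring)
  obtain p where p: "p \<in> mod_hom R ?F P" "\<And>x. x \<in> carrier P \<Longrightarrow> p (free_basis R x) = x"
    using free_lift[OF P.module_axioms, of "carrier P" "\<lambda>x. x"] by auto
  have ps: "p ` carrier ?F = carrier P"
  proof
    show "p ` carrier ?F \<subseteq> carrier P" using mod_hom_closed[OF p(1)] by auto
    show "carrier P \<subseteq> p ` carrier ?F"
    proof
      fix x assume x: "x \<in> carrier P"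
      show "x \<in> p ` carrier ?F"
        by (rule image_eqI[of _ _ "free_basis R x"]) (simp_all add: p(2) x free_basis_closed P.R.is_cring)
    qed
  qed
  have "(\<lambda>x. x) \<in> mod_hom R P P" by (intro mod_homI) auto
  then have "\<exists>s\<in>mod_hom R P ?F. \<forall>x\<in>carrier P. p (s x) = x"
    using P[unfolded projective_def, THEN conjunct2, rule_format, OF F P.module_axioms p(1) ps] by simp
  then obtain s where s: "s \<in> mod_hom R P ?F" "\<And>x. x \<in> carrier P \<Longrightarrow> p (s x) = x" by blast
  obtain h where h: "h \<in> mod_hom R ?F A" "\<And>x. x \<in> carrier ?F \<Longrightarrow> g (h x) = f (p x)"
    using free_projective_lift[OF assms(2-5) mod_hom_comp[OF p(1) assms(6)]] by blast
  show ?thesis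
    using mod_hom_comp[OF s(1) h(1)] h(2) s(2) mod_hom_closed[OF s(1)] by (intro bexI) auto
qed

subsection \<open>The universal property of the tensor product\<close>

lemma tensor_relations_closed:
  assumes "module R M" "module R N"
  shows "tensor_relations R M N \<subseteq> carrier (free_module R (carrier M \<times> carrier N))"
proof -
  interpret M: module R M by fact
  interpret N: module R N by fact
  interpret F: module R "free_module R (carrier M \<times> carrier N)" by (rule free_module_is_module) (rule M.R.is_cring)
  have "free_basis R (x, y) \<in> carrier (free_module R (carrier M \<times> carrier N))"
    if "x \<in> carrier M" "y \<in> carrier N" for x y
    using that by (intro free_basis_closed M.R.is_cring) auto
  then show ?thesis by (auto simp: tensor_relations_def Let_def)
qed

lemma tensor_kernel_submodule:
  assumes "module R M" "module R N"
  shows "submodule (tensor_kernel R M N) R (free_module R (carrier M \<times> carrier N))"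
  unfolding tensor_kernel_def using assms
  by (intro mod_span_submodule free_module_is_module tensor_relations_closed) (auto simp: module_def)

lemma tensor_is_module:
  assumes "module R M" "module R N"
  shows "module R (tensor R M N)"
  unfolding tensor_def using assms
  by (intro quot_is_module tensor_kernel_submodule free_module_is_module) (auto simp: module_def)

lemma pure_tensor_closed:
  assumes "module R M" "module R N" "x \<in> carrier M" "y \<in> carrier N"
  shows "pure_tensor R M N x y \<in> carrier (tensor R M N)"
proof -
  have R: "cring R" using assms(1) by (simp add: module_def)
  show ?thesis
    unfolding tensor_def pure_tensor_def
    by (rule mod_hom_closed[OF quot_proj_hom[OF free_module_is_module[OF R] tensor_kernel_submodule[OF assms(1,2)]]])
      (use assms(3,4) in \<open>auto intro: free_basis_closed[OF R]\<close>)
qed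

lemma tensor_relation_eq:
  assumes "module R M" "module R N"
    and u: "u \<in> carrier (free_module R (carrier M \<times> carrier N))"
    and v: "v \<in> carrier (free_module R (carrier M \<times> carrier N))"
    and rel: "u \<ominus>\<^bsub>free_module R (carrier M \<times> carrier N)\<^esub> v \<in> tensor_relations R M N"
  shows "tensor_kernel R M N +>\<^bsub>free_module R (carrier M \<times> carrier N)\<^esub> u
       = tensor_kernel R M N +>\<^bsub>free_module R (carrier M \<times> carrier N)\<^esub> v"
proof -
  have R: "cring R" using assms(1) by (simp add: module_def)
  have "u \<ominus>\<^bsub>free_module R (carrier M \<times> carrier N)\<^esub> v \<in> tensor_kernel R M N"
    unfolding tensor_kernel_def by (rule subsetD[OF mod_span_superset rel])
  then show ?thesis
    by (rule iffD2[OF quot_eq[OF free_module_is_module[OF R] tensor_kernel_submodule[OF assms(1,2)] u v]])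
qed

lemma pure_tensor_bilinear:
  assumes "module R M" "module R N" "x \<in> carrier M" "y \<in> carrier N"
  shows "x' \<in> carrier M \<Longrightarrow> pure_tensor R M N (x \<oplus>\<^bsub>M\<^esub> x') y = pure_tensor R M N x y \<oplus>\<^bsub>tensor R M N\<^esub> pure_tensor R M N x' y"
    and "y' \<in> carrier N \<Longrightarrow> pure_tensor R M N x (y \<oplus>\<^bsub>N\<^esub> y') = pure_tensor R M N x y \<oplus>\<^bsub>tensor R M N\<^esub> pure_tensor R M N x y'"
    and "r \<in> carrier R \<Longrightarrow> pure_tensor R M N (r \<odot>\<^bsub>M\<^esub> x) y = r \<odot>\<^bsub>tensor R M N\<^esub> pure_tensor R M N x y"
    and "r \<in> carrier R \<Longrightarrow> pure_tensor R M N x (r \<odot>\<^bsub>N\<^esub> y) = r \<odot>\<^bsub>tensor R M N\<^esub> pure_tensor R M N x y"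
proof -
  interpret M: module R M by fact
  interpret N: module R N by fact
  let ?F = "free_module R (carrier M \<times> carrier N)"
  interpret F: module R ?F by (rule free_module_is_module) (rule M.R.is_cring)
  have b: "free_basis R (x, y) \<in> carrier ?F" if "x \<in> carrier M" "y \<in> carrier N" for x y
    using that by (intro free_basis_closed M.R.is_cring) auto
  note q = quot_add[OF F.module_axioms tensor_kernel_submodule[OF assms(1,2)]]
    quot_smult[OF F.module_axioms tensor_kernel_submodule[OF assms(1,2)]]
  note t = pure_tensor_def tensor_def
  let ?p = "\<lambda>u. tensor_kernel R M N +>\<^bsub>?F\<^esub> u"
  show "pure_tensor R M N (x \<oplus>\<^bsub>M\<^esub> x') y = pure_tensor R M N x y \<oplus>\<^bsub>tensor R M N\<^esub> pure_tensor R M N x' y"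
    if "x' \<in> carrier M"
  proof -
    have "?p (free_basis R (x \<oplus>\<^bsub>M\<^esub> x', y)) = ?p (free_basis R (x, y) \<oplus>\<^bsub>?F\<^esub> free_basis R (x', y))"
    proof (rule tensor_relation_eq[OF assms(1,2)])
      show "free_basis R (x \<oplus>\<^bsub>M\<^esub> x', y) \<in> carrier ?F" "free_basis R (x, y) \<oplus>\<^bsub>?F\<^esub> free_basis R (x', y) \<in> carrier ?F"
        using that assms(3,4) b by simp_all
      show "free_basis R (x \<oplus>\<^bsub>M\<^esub> x', y) \<ominus>\<^bsub>?F\<^esub> (free_basis R (x, y) \<oplus>\<^bsub>?F\<^esub> free_basis R (x', y)) \<in> tensor_relations R M N"
        unfolding tensor_relations_def Let_def using that assms(3,4) by blast
    qed
    then show ?thesis unfolding t using that assms(3,4) b by (simp add: q)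
  qed
  show "pure_tensor R M N x (y \<oplus>\<^bsub>N\<^esub> y') = pure_tensor R M N x y \<oplus>\<^bsub>tensor R M N\<^esub> pure_tensor R M N x y'"
    if "y' \<in> carrier N"
  proof -
    have "?p (free_basis R (x, y \<oplus>\<^bsub>N\<^esub> y')) = ?p (free_basis R (x, y) \<oplus>\<^bsub>?F\<^esub> free_basis R (x, y'))"
    proof (rule tensor_relation_eq[OF assms(1,2)])
      show "free_basis R (x, y \<oplus>\<^bsub>N\<^esub> y') \<in> carrier ?F" "free_basis R (x, y) \<oplus>\<^bsub>?F\<^esub> free_basis R (x, y') \<in> carrier ?F"
        using that assms(3,4) b by simp_all
      show "free_basis R (x, y \<oplus>\<^bsub>N\<^esub> y') \<ominus>\<^bsub>?F\<^esub> (free_basis R (x, y) \<oplus>\<^bsub>?F\<^esub> free_basis R (x, y')) \<in> tensor_relations R M N"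
        unfolding tensor_relations_def Let_def using that assms(3,4) by blast
    qed
    then show ?thesis unfolding t using that assms(3,4) b by (simp add: q)
  qed
  show "pure_tensor R M N (r \<odot>\<^bsub>M\<^esub> x) y = r \<odot>\<^bsub>tensor R M N\<^esub> pure_tensor R M N x y" if "r \<in> carrier R"
  proof -
    have "?p (free_basis R (r \<odot>\<^bsub>M\<^esub> x, y)) = ?p (r \<odot>\<^bsub>?F\<^esub> free_basis R (x, y))"
    proof (rule tensor_relation_eq[OF assms(1,2)])
      show "free_basis R (r \<odot>\<^bsub>M\<^esub> x, y) \<in> carrier ?F" "r \<odot>\<^bsub>?F\<^esub> free_basis R (x, y) \<in> carrier ?F"
        using that assms(3,4) b by simp_all
      show "free_basis R (r \<odot>\<^bsub>M\<^esub> x, y) \<ominus>\<^bsub>?F\<^esub> (r \<odot>\<^bsub>?F\<^esub> free_basis R (x, y)) \<in> tensor_relations R M N"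
        unfolding tensor_relations_def Let_def using that assms(3,4) by blast
    qed
    then show ?thesis unfolding t using that assms(3,4) b by (simp add: q)
  qed
  show "pure_tensor R M N x (r \<odot>\<^bsub>N\<^esub> y) = r \<odot>\<^bsub>tensor R M N\<^esub> pure_tensor R M N x y" if "r \<in> carrier R"
  proof -
    have "?p (free_basis R (x, r \<odot>\<^bsub>N\<^esub> y)) = ?p (r \<odot>\<^bsub>?F\<^esub> free_basis R (x, y))"
    proof (rule tensor_relation_eq[OF assms(1,2)])
      show "free_basis R (x, r \<odot>\<^bsub>N\<^esub> y) \<in> carrier ?F" "r \<odot>\<^bsub>?F\<^esub> free_basis R (x, y) \<in> carrier ?F"
        using that assms(3,4) b by simp_all
      show "free_basis R (x, r \<odot>\<^bsub>N\<^esub> y) \<ominus>\<^bsub>?F\<^esub> (r \<odot>\<^bsub>?F\<^esub> free_basis R (x, y)) \<in> tensor_relations R M N"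
        unfolding tensor_relations_def Let_def using that assms(3,4) by blast
    qed
    then show ?thesis unfolding t using that assms(3,4) b by (simp add: q)
  qed
qed

lemma tensor_hom_ext:
  assumes "module R M" "module R N" "module R K"
    and f: "f \<in> mod_hom R (tensor R M N) K" and g: "g \<in> mod_hom R (tensor R M N) K"
    and eq: "\<And>x y. x \<in> carrier M \<Longrightarrow> y \<in> carrier N \<Longrightarrow> f (pure_tensor R M N x y) = g (pure_tensor R M N x y)"
    and X: "X \<in> carrier (tensor R M N)"
  shows "f X = g X"
proof -
  have R: "cring R" using assms(1) by (simp add: module_def)
  let ?F = "free_module R (carrier M \<times> carrier N)"
  let ?p = "\<lambda>u. tensor_kernel R M N +>\<^bsub>?F\<^esub> u"
  have F: "module R ?F" by (rule free_module_is_module[OF R])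
  have p: "?p \<in> mod_hom R ?F (tensor R M N)"
    unfolding tensor_def by (rule quot_proj_hom[OF F tensor_kernel_submodule[OF assms(1,2)]])
  obtain u where u: "u \<in> carrier ?F" "X = ?p u"
    using X quot_carrier[OF F tensor_kernel_submodule[OF assms(1,2)]] by (auto simp: tensor_def)
  have "u \<in> {u \<in> carrier ?F. f (?p u) = g (?p u)}"
  proof (rule free_induct[OF R _ _ u(1)])
    show "submodule {u \<in> carrier ?F. f (?p u) = g (?p u)} R ?F"
      using hom_agree_submodule[OF F assms(3) mod_hom_comp[OF p f] mod_hom_comp[OF p g]] .
    fix i assume "i \<in> carrier M \<times> carrier N"
    then have "free_basis R i \<in> carrier ?F" "f (?p (free_basis R i)) = g (?p (free_basis R i))"
      using eq free_basis_closed[OF R, of i "carrier M \<times> carrier N"] by (auto simp: pure_tensor_def)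
    then show "free_basis R i \<in> {u \<in> carrier ?F. f (?p u) = g (?p u)}"
      by simp
  qed
  then show ?thesis using u by simp
qed

lemma tensor_lift:
  assumes M: "module R M" and N: "module R N" and K: "module R K"
    and cl: "\<And>x y. x \<in> carrier M \<Longrightarrow> y \<in> carrier N \<Longrightarrow> b x y \<in> carrier K"
    and "\<And>x x' y. x \<in> carrier M \<Longrightarrow> x' \<in> carrier M \<Longrightarrow> y \<in> carrier N \<Longrightarrow> b (x \<oplus>\<^bsub>M\<^esub> x') y = b x y \<oplus>\<^bsub>K\<^esub> b x' y"
    and "\<And>x y y'. x \<in> carrier M \<Longrightarrow> y \<in> carrier N \<Longrightarrow> y' \<in> carrier N \<Longrightarrow> b x (y \<oplus>\<^bsub>N\<^esub> y') = b x y \<oplus>\<^bsub>K\<^esub> b x y'"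
    and "\<And>r x y. r \<in> carrier R \<Longrightarrow> x \<in> carrier M \<Longrightarrow> y \<in> carrier N \<Longrightarrow> b (r \<odot>\<^bsub>M\<^esub> x) y = r \<odot>\<^bsub>K\<^esub> b x y"
    and "\<And>r x y. r \<in> carrier R \<Longrightarrow> x \<in> carrier M \<Longrightarrow> y \<in> carrier N \<Longrightarrow> b x (r \<odot>\<^bsub>N\<^esub> y) = r \<odot>\<^bsub>K\<^esub> b x y"
  shows "\<exists>h\<in>mod_hom R (tensor R M N) K. \<forall>x\<in>carrier M. \<forall>y\<in>carrier N. h (pure_tensor R M N x y) = b x y"
proof -
  interpret M: module R M by fact
  interpret N: module R N by fact
  interpret K: module R K by fact
  let ?F = "free_module R (carrier M \<times> carrier N)"
  interpret F: module R ?F by (rule free_module_is_module) (rule M.R.is_cring)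
  obtain h where h: "h \<in> mod_hom R ?F K"
      "\<And>x y. x \<in> carrier M \<Longrightarrow> y \<in> carrier N \<Longrightarrow> h (free_basis R (x, y)) = b x y"
    using free_lift[OF K, of "carrier M \<times> carrier N" "\<lambda>(x, y). b x y"] cl by auto
  have bs: "free_basis R (x, y) \<in> carrier ?F" if "x \<in> carrier M" "y \<in> carrier N" for x y
    using that by (intro free_basis_closed M.R.is_cring) auto
  have *: "tensor_relations R M N \<subseteq> {u \<in> carrier ?F. h u = \<zero>\<^bsub>K\<^esub>}"
  proof
    fix u assume u: "u \<in> tensor_relations R M N"
    then have "h u = \<zero>\<^bsub>K\<^esub>"
      using assms(5-8) bs cl
      by (auto simp: tensor_relations_def Let_def mod_hom_minus[OF F.module_axioms K h(1)]
          mod_hom_add[OF h(1)] mod_hom_smult[OF h(1)] h(2) K.minus_eq_zero_iff)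
    then show "u \<in> {u \<in> carrier ?F. h u = \<zero>\<^bsub>K\<^esub>}"
      using u tensor_relations_closed[OF M N] by blast
  qed
  have "tensor_kernel R M N \<subseteq> {u \<in> carrier ?F. h u = \<zero>\<^bsub>K\<^esub>}"
    unfolding tensor_kernel_def
    by (intro mod_span_subset kernel_submodule[OF F.module_axioms K h(1)] *)
  then obtain h' where "h' \<in> mod_hom R (tensor R M N) K"
      "\<And>u. u \<in> carrier ?F \<Longrightarrow> h' (tensor_kernel R M N +>\<^bsub>?F\<^esub> u) = h u"
    using quot_lift[OF F.module_axioms tensor_kernel_submodule[OF M N] K h(1)]
    unfolding tensor_def by blast
  then show ?thesis using bs h(2) by (intro bexI[of _ h']) (auto simp: pure_tensor_def)
qed

lemma tensor_map_ex1:
  assumes "module R M" "module R M'" "module R N" "f \<in> mod_hom R M M'"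
  shows "\<exists>!h. h \<in> mod_hom R (tensor R M N) (tensor R M' N) \<and> h \<in> extensional (carrier (tensor R M N)) \<and>
     (\<forall>x\<in>carrier M. \<forall>y\<in>carrier N. h (pure_tensor R M N x y) = pure_tensor R M' N (f x) y)"
proof -
  have T: "module R (tensor R M N)" "module R (tensor R M' N)"
    using assms by (auto intro: tensor_is_module)
  interpret T: module R "tensor R M N" by fact
  obtain h where h: "h \<in> mod_hom R (tensor R M N) (tensor R M' N)"
      "\<forall>x\<in>carrier M. \<forall>y\<in>carrier N. h (pure_tensor R M N x y) = pure_tensor R M' N (f x) y"
    using tensor_lift[OF assms(1,3) T(2), of "\<lambda>x y. pure_tensor R M' N (f x) y"]
      mod_homD[OF assms(4)] pure_tensor_closed[OF assms(2,3)] pure_tensor_bilinear[OF assms(2,3)]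
    by auto
  let ?h = "restrict h (carrier (tensor R M N))"
  have "?h \<in> mod_hom R (tensor R M N) (tensor R M' N)"
    using mod_homD[OF h(1)] by (intro mod_homI) auto
  then show ?thesis
  proof (intro ex1I[of _ ?h] conjI)
    fix g assume g: "g \<in> mod_hom R (tensor R M N) (tensor R M' N) \<and> g \<in> extensional (carrier (tensor R M N)) \<and>
     (\<forall>x\<in>carrier M. \<forall>y\<in>carrier N. g (pure_tensor R M N x y) = pure_tensor R M' N (f x) y)"
    show "g = ?h"
    proof (rule extensionalityI)
      fix X assume "X \<in> carrier (tensor R M N)"
      then show "g X = ?h X"
        using tensor_hom_ext[OF assms(1,3) T(2), of g h X] g h by simp
    qed (use g in auto)
  qed (use h pure_tensor_closed[OF assms(1,3)] in auto)
qed

subsection \<open>Existence of resolutions\<close>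

text \<open>A prefix code for words, extended to lists of words.\<close>

definition word_code :: "('a + 'm) list \<Rightarrow> ('a + 'm) list" where
  "word_code w = concat (map (\<lambda>s. [Inl undefined, s]) w) @ [Inr undefined]"

lemma word_code_inj:
  "word_code w @ u = word_code w' @ u' \<Longrightarrow> w = w' \<and> u = u'"
proof (induction w arbitrary: w')
  case Nil
  then show ?case by (cases w') (auto simp: word_code_def)
next
  case (Cons s w)
  then show ?case
  proof (cases w')
    case Nil
    then show ?thesis using Cons.prems by (auto simp: word_code_def)
  next
    case (Cons s' v)
    have "s = s'" "word_code w @ u = word_code v @ u'"
      using \<open>word_code (s # w) @ u = word_code w' @ u'\<close> by (simp_all add: Cons word_code_def)
    then show ?thesis using \<open>\<And>w'. word_code w @ u = word_code w' @ u' \<Longrightarrow> w = w' \<and> u = u'\<close> Cons by blast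
  qed
qed

lemma words_code_inj: "inj (\<lambda>ws. concat (map word_code ws))"
proof (rule injI)
  fix ws vs :: "('a + 'm) list list"
  assume "concat (map word_code ws) = concat (map word_code vs)"
  then show "ws = vs"
  proof (induction ws arbitrary: vs)
    case Nil
    then show ?case by (cases vs) (auto simp: word_code_def)
  next
    case (Cons w ws)
    then obtain v vs' where vs: "vs = v # vs'" by (cases vs) (auto simp: word_code_def)
    have "w = v \<and> concat (map word_code ws) = concat (map word_code vs')"
      by (rule word_code_inj) (use Cons.prems vs in simp)
    then show ?case using Cons.IH[of vs'] vs by blast
  qed
qed

lemma finsupp_inj:
  "\<exists>c :: (('a + 'm) list \<Rightarrow> 'a) \<Rightarrow> ('a + 'm) list. inj_on c {f. finite {t. f t \<noteq> z}}"
proof -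
  define L where "L f = (SOME ts. set ts = {t. f t \<noteq> z})" for f :: "('a + 'm) list \<Rightarrow> 'a"
  have L: "set (L f) = {t. f t \<noteq> z}" if "finite {t. f t \<noteq> z}" for f
    unfolding L_def using someI_ex[OF finite_list[OF that]] by simp
  define p where "p f t = word_code t @ [Inl (f t)]" for f :: "('a + 'm) list \<Rightarrow> 'a" and t
  define c where "c f = concat (map word_code (map (p f) (L f)))" for f
  have "inj_on c {f. finite {t. f t \<noteq> z}}"
  proof (rule inj_onI)
    fix f g assume fg: "f \<in> {f. finite {t. f t \<noteq> z}}" "g \<in> {f. finite {t. f t \<noteq> z}}" "c f = c g"
    have m: "map (p f) (L f) = map (p g) (L g)"
      by (rule injD[OF words_code_inj]) (use fg(3) in \<open>simp add: c_def\<close>)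
    then have s: "p f ` set (L f) = p g ` set (L g)" by (metis set_map)
    have pq: "t = t' \<and> f t = g t'" if "p f t = p g t'" for t t'
    proof -
      have "t = t'" "[Inl (f t) :: 'a + 'm] = [Inl (g t')]"
        using word_code_inj[OF that[unfolded p_def]] by blast+
      then show ?thesis by blast
    qed
    have 1: "g t = f t" if "t \<in> set (L f)" for t
    proof -
      have "p f t \<in> p g ` set (L g)" using s that by blast
      then obtain t' where "p f t = p g t'" by blast
      from pq[OF this] have tt: "t = t'" and ff: "f t = g t'" by blast+
      show ?thesis unfolding ff unfolding tt ..
    qed
    have 2: "g t = f t" if "t \<in> set (L g)" for t
    proof -
      have "p g t \<in> p f ` set (L f)" using s that by blast
      then obtain t' where "p g t = p f t'" by blast
      from pq[OF this[symmetric]] have tt: "t' = t" and ff: "f t' = g t" by blast+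
      show ?thesis using ff unfolding tt by (rule sym)
    qed
    show "f = g"
    proof
      fix t
      have "t \<in> set (L f) \<longleftrightarrow> f t \<noteq> z" "t \<in> set (L g) \<longleftrightarrow> g t \<noteq> z"
        using L[of f] L[of g] fg(1,2) by simp_all
      then show "f t = g t" using 1[of t] 2[of t] by metis
    qed
  qed
  then show ?thesis by blast
qed

lemma free_cover:
  fixes M :: "('a, 'm, 's) module_scheme" and c :: "'m \<Rightarrow> 'i"
  assumes "module R M" "inj_on c (carrier M)"
  shows "\<exists>B :: 'i set. \<exists>d\<in>mod_hom R (free_module R B) M. d ` carrier (free_module R B) = carrier M"
proof -
  interpret M: module R M by fact
  let ?B = "c ` carrier M"
  have ic: "inv_into (carrier M) c i \<in> carrier M" if "i \<in> ?B" for i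
    using that by (rule inv_into_into)
  obtain d where d: "d \<in> mod_hom R (free_module R ?B) M"
      "\<And>i. i \<in> ?B \<Longrightarrow> d (free_basis R i) = inv_into (carrier M) c i"
    using free_lift[OF assms(1), of ?B "inv_into (carrier M) c", OF ic] by blast
  have "d ` carrier (free_module R ?B) = carrier M"
  proof
    show "d ` carrier (free_module R ?B) \<subseteq> carrier M" using mod_hom_closed[OF d(1)] by auto
    show "carrier M \<subseteq> d ` carrier (free_module R ?B)"
    proof
      fix x assume x: "x \<in> carrier M"
      show "x \<in> d ` carrier (free_module R ?B)"
      proof (rule image_eqI[of _ _ "free_basis R (c x)"])
        show "x = d (free_basis R (c x))"
          by (rule trans[OF d(2)[OF imageI[OF x]] inv_into_f_f[OF assms(2) x], symmetric])
        show "free_basis R (c x) \<in> carrier (free_module R ?B)"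
          by (rule free_basis_closed[OF M.R.is_cring imageI[OF x]])
      qed
    qed
  qed
  then show ?thesis using d(1) by blast
qed

lemma projective_resolution_exists:
  fixes R :: "('a, 'r) ring_scheme" and M :: "('a, 'm, 's) module_scheme"
  assumes "module R M"
  shows "projective_resolution R (chosen_resolution R M) M"
proof -
  interpret M: module R M by fact
  let ?F = "free_module R :: ('a + 'm) list set \<Rightarrow> _"
  have F: "module R (?F B)" for B by (rule free_module_is_module) (rule M.R.is_cring)
  define PP where "PP = (\<lambda>n x. case x of (B, d :: (('a + 'm) list \<Rightarrow> 'a) \<Rightarrow> ('a + 'm) list \<Rightarrow> 'a, K) \<Rightarrow> submodule K R (?F B) \<and>
     (n = (0::nat) \<longrightarrow> (\<exists>\<epsilon>\<in>mod_hom R (?F B) M. \<epsilon> ` carrier (?F B) = carrier M \<and>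
        K = {u \<in> carrier (?F B). \<epsilon> u = \<zero>\<^bsub>M\<^esub>})))"
  define QQ where "QQ = (\<lambda>(n::nat) x y. case x of (B, d :: (('a + 'm) list \<Rightarrow> 'a) \<Rightarrow> ('a + 'm) list \<Rightarrow> 'a, K) \<Rightarrow>
     (case y of (B', d', K') \<Rightarrow>
      d' \<in> mod_hom R (?F B') (?F B) \<and> d' ` carrier (?F B') = K \<and>
      K' = {u \<in> carrier (?F B'). d' u = \<zero>\<^bsub>?F B\<^esub>}))"
  have "\<exists>f. \<forall>n. PP n (f n) \<and> QQ n (f n) (f (Suc n))"
  proof (rule dependent_nat_choice[of PP QQ])
    have "inj_on (\<lambda>m. [Inr m] :: ('a + 'm) list) (carrier M)" by (rule inj_onI) simp
    from free_cover[OF assms this] obtain B :: "('a + 'm) list set" and \<epsilon>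
      where e: "\<epsilon> \<in> mod_hom R (?F B) M" "\<epsilon> ` carrier (?F B) = carrier M" by blast
    have "PP 0 (B, undefined, {u \<in> carrier (?F B). \<epsilon> u = \<zero>\<^bsub>M\<^esub>})"
      unfolding PP_def prod.case by (intro conjI impI bexI[of _ \<epsilon>] kernel_submodule[OF F assms] e refl)
    then show "\<exists>x. PP 0 x" by blast
  next
    fix x n assume x: "PP n x"
    obtain B d K where x': "x = (B, d, K)" by (cases x)
    have K: "submodule K R (?F B)" using x unfolding x' PP_def prod.case by (rule conjunct1)
    interpret FB: module R "?F B" by (rule F)
    have KB: "K \<subseteq> carrier (?F B)" using FB.submoduleE(1)[OF K] .
    have mK: "module R ((?F B)\<lparr>carrier := K\<rparr>)" by (rule submodule.submodule_is_module[OF K F])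
    obtain c :: "(('a + 'm) list \<Rightarrow> 'a) \<Rightarrow> ('a + 'm) list"
      where "inj_on c {f. finite {t. f t \<noteq> \<zero>\<^bsub>R\<^esub>}}" by (rule exE[OF finsupp_inj])
    then have "inj_on c (carrier ((?F B)\<lparr>carrier := K\<rparr>))"
    proof (rule inj_on_subset)
      show "carrier ((?F B)\<lparr>carrier := K\<rparr>) \<subseteq> {f. finite {t. f t \<noteq> \<zero>\<^bsub>R\<^esub>}}"
      proof
        fix u assume "u \<in> carrier ((?F B)\<lparr>carrier := K\<rparr>)"
        then have "u \<in> carrier (?F B)" using KB by (simp add: subset_iff)
        then show "u \<in> {f. finite {t. f t \<noteq> \<zero>\<^bsub>R\<^esub>}}" by (simp add: free_module_simps(1))
      qed
    qed
    from free_cover[OF mK this] obtain B' :: "('a + 'm) list set" and d'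
      where d: "d' \<in> mod_hom R (?F B') ((?F B)\<lparr>carrier := K\<rparr>)"
        "d' ` carrier (?F B') = carrier ((?F B)\<lparr>carrier := K\<rparr>)" by blast
    have dK: "d' ` carrier (?F B') = K" using d(2) by simp
    have d': "d' \<in> mod_hom R (?F B') (?F B)"
    proof (rule mod_homI)
      fix u assume "u \<in> carrier (?F B')"
      then have "d' u \<in> K" using mod_hom_closed[OF d(1)] by simp
      then show "d' u \<in> carrier (?F B)" using KB by blast
    next
      fix u v assume "u \<in> carrier (?F B')" "v \<in> carrier (?F B')"
      from mod_hom_add[OF d(1) this] show "d' (u \<oplus>\<^bsub>?F B'\<^esub> v) = d' u \<oplus>\<^bsub>?F B\<^esub> d' v" by simp
    next
      fix r u assume "r \<in> carrier R" "u \<in> carrier (?F B')"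
      from mod_hom_smult[OF d(1) this] show "d' (r \<odot>\<^bsub>?F B'\<^esub> u) = r \<odot>\<^bsub>?F B\<^esub> d' u" by simp
    qed
    have "PP (Suc n) (B', d', {u \<in> carrier (?F B'). d' u = \<zero>\<^bsub>?F B\<^esub>})"
      unfolding PP_def prod.case by (intro conjI impI kernel_submodule[OF F F d']) simp
    moreover have "QQ n x (B', d', {u \<in> carrier (?F B'). d' u = \<zero>\<^bsub>?F B\<^esub>})"
      unfolding QQ_def x' prod.case by (intro conjI d' dK refl)
    ultimately show "\<exists>y. PP (Suc n) y \<and> QQ n x y" by blast
  qed
  then obtain f where f: "\<And>n. PP n (f n)" "\<And>n. QQ n (f n) (f (Suc n))" by blast
  define B where "B n = fst (f n)" for n
  define d where "d n = fst (snd (f n))" for n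
  define K where "K n = snd (snd (f n))" for n
  have fn: "f n = (B n, d n, K n)" for n by (simp add: B_def d_def K_def)
  obtain \<epsilon> where e: "\<epsilon> \<in> mod_hom R (?F (B 0)) M" "\<epsilon> ` carrier (?F (B 0)) = carrier M"
      "K 0 = {u \<in> carrier (?F (B 0)). \<epsilon> u = \<zero>\<^bsub>M\<^esub>}"
    using f(1)[of 0] unfolding fn PP_def prod.case by blast
  have d: "d (Suc n) \<in> mod_hom R (?F (B (Suc n))) (?F (B n))" "d (Suc n) ` carrier (?F (B (Suc n))) = K n"
      "K (Suc n) = {u \<in> carrier (?F (B (Suc n))). d (Suc n) u = \<zero>\<^bsub>?F (B n)\<^esub>}" for n
    using f(2)[of n] unfolding fn QQ_def prod.case by blast+
  define P where "P = \<lparr>cobj = (\<lambda>i. if i < 0 then ?F {} else ?F (B (nat i))),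
     cdiff = (\<lambda>i. if i \<le> 0 then (\<lambda>_. \<zero>\<^bsub>?F {}\<^esub>) else d (nat i))\<rparr>"
  have Pn: "cobj P (int n) = ?F (B n)" for n by (simp add: P_def)
  have dn: "cdiff P (int (Suc n)) = d (Suc n)" for n by (simp add: P_def nat_add_distrib)
  have P0: "cobj P i = ?F {}" if "i < 0" for i using that by (simp add: P_def)
  have d0: "cdiff P i = (\<lambda>_. \<zero>\<^bsub>?F {}\<^esub>)" if "i \<le> 0" for i using that by (simp add: P_def)
  have cn: "i < 0 \<or> i = 0 \<or> (\<exists>n. i = int (Suc n))" for i :: int
    
  proof (cases "i \<le> 0")
    case False
    then have "i = int (Suc (nat (i - 1)))" by simp
    then show ?thesis by blast
  qed auto
  have PZ: "\<zero>\<^bsub>cobj P i\<^esub> = \<zero>\<^bsub>?F {}\<^esub>" for i by (simp add: P_def free_module_simps(2))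
  have zc: "\<zero>\<^bsub>?F {}\<^esub> \<in> carrier (?F X)" for X
    by (auto simp: free_module_simps)
  have Pm: "module R (cobj P i)" for i by (simp add: P_def F)
  have bd: "boundaries P (int n) = K n" for n
    using d(2)[of n] Pn[of "Suc n"] dn[of n] by (simp add: boundaries_def add.commute)
  have cy: "cycles P (int (Suc n)) = K (Suc n)" for n
    using d(3)[of n] Pn[of "Suc n"] Pn[of n] dn[of n] unfolding cycles_def by simp
  have dh: "cdiff P i \<in> mod_hom R (cobj P i) (cobj P (i - 1))" for i
  proof -
    consider "i \<le> 0" | n where "i = int (Suc n)" using cn[of i] by fastforce
    then show ?thesis
    proof cases
      case 1
      then show ?thesis
        by (intro mod_homI) (auto simp: d0 P0 free_module_simps)
    next
      case 2
      then show ?thesis using d(1)[of n] Pn[of "Suc n"] Pn[of n] dn[of n] by simp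
    qed
  qed
  have dd: "cdiff P (i - 1) (cdiff P i x) = \<zero>\<^bsub>cobj P (i - 1 - 1)\<^esub>" if x: "x \<in> carrier (cobj P i)" for i x
  proof -
    consider "i - 1 \<le> 0" | n where "i = int (Suc (Suc n))"
    proof -
      assume a: "i - 1 \<le> 0 \<Longrightarrow> thesis" "\<And>n. i = int (Suc (Suc n)) \<Longrightarrow> thesis"
      show thesis
      proof (cases "i - 1 \<le> 0")
        case False
        then have "i = int (Suc (Suc (nat (i - 2))))" by simp
        then show ?thesis by (rule a(2))
      qed (rule a(1))
    qed
    then show ?thesis
    proof cases
      case 1
      then show ?thesis by (simp add: d0 PZ)
    next
      case 2
      have i1: "i - 1 = int (Suc n)" using 2 by simp
      have "cdiff P i x \<in> boundaries P (i - 1)" using x by (simp add: boundaries_def)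
      then have "cdiff P i x \<in> cycles P (i - 1)" unfolding i1 bd cy .
      then show ?thesis by (simp add: cycles_def)
    qed
  qed
  have "projective_resolution R P M"
    unfolding projective_resolution_def
  proof (intro conjI allI impI)
    show "is_complex R P" unfolding is_complex_def using Pm dh dd by blast
    show "projective R (cobj P i)" for i
      unfolding P_def by (simp add: free_projective M.R.is_cring)
    show "zero_module (cobj P i)" if "i < 0" for i
      using that by (auto simp: P0 zero_module_def free_module_simps)
    show "cycles P i = boundaries P i" if "0 < i" for i
    proof -
      obtain n where "i = int (Suc n)" using cn[of i] \<open>0 < i\<close> by auto
      then show ?thesis using cy bd by metis
    qed
    show "\<exists>\<epsilon>\<in>mod_hom R (cobj P 0) M. \<epsilon> ` carrier (cobj P 0) = carrier M \<and>
        {x \<in> carrier (cobj P 0). \<epsilon> x = \<zero>\<^bsub>M\<^esub>} = boundaries P 0"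
      using e Pn[of 0] bd[of 0] by (intro bexI[of _ \<epsilon>]) auto
  qed
  then show ?thesis unfolding chosen_resolution_def by (rule someI)
qed

subsection \<open>Homology and tensor products of complexes\<close>

lemma homology_is_module:
  assumes "is_complex R X"
  shows "module R (homology X i)"
proof -
  have m: "module R (cobj X j)" and h: "cdiff X j \<in> mod_hom R (cobj X j) (cobj X (j - 1))" for j
    using assms by (auto simp: is_complex_def)
  interpret X: module R "cobj X i" by (rule m)
  interpret Y: module R "cobj X (i + 1)" by (rule m)
  have h': "cdiff X (i + 1) \<in> mod_hom R (cobj X (i + 1)) (cobj X i)" using h[of "i + 1"] by simp
  have cyc: "submodule (cycles X i) R (cobj X i)"
    unfolding cycles_def by (rule kernel_submodule[OF m m h])
  have sub: "boundaries X i \<subseteq> cycles X i"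
  proof
    fix b assume "b \<in> boundaries X i"
    then obtain x where x: "x \<in> carrier (cobj X (i + 1))" "b = cdiff X (i + 1) x" by (auto simp: boundaries_def)
    have "cdiff X (i + 1 - 1) (cdiff X (i + 1) x) = \<zero>\<^bsub>cobj X (i + 1 - 1 - 1)\<^esub>"
      using assms x(1) unfolding is_complex_def by blast
    then show "b \<in> cycles X i" using mod_hom_closed[OF h' x(1)] x(2) by (simp add: cycles_def)
  qed
  have mZ: "module R ((cobj X i)\<lparr>carrier := cycles X i\<rparr>)"
    by (rule submodule.submodule_is_module[OF cyc m])
  have "module R ((cobj X i)\<lparr>carrier := boundaries X i\<rparr>)"
  proof (rule submodule.submodule_is_module[OF _ m], rule X.submoduleI)
    show "boundaries X i \<subseteq> carrier (cobj X i)" using sub X.submoduleE(1)[OF cyc] by blast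
    show "\<zero>\<^bsub>cobj X i\<^esub> \<in> boundaries X i"
      unfolding boundaries_def using mod_hom_zero[OF m m h'] Y.zero_closed by (metis image_eqI)
  next
    fix a assume "a \<in> boundaries X i"
    then obtain x where x: "x \<in> carrier (cobj X (i + 1))" "a = cdiff X (i + 1) x" by (auto simp: boundaries_def)
    have "cdiff X (i + 1) (\<zero>\<^bsub>cobj X (i + 1)\<^esub> \<ominus>\<^bsub>cobj X (i + 1)\<^esub> x) = \<ominus>\<^bsub>cobj X i\<^esub> a"
      using mod_hom_minus[OF m m h' Y.zero_closed x(1)] mod_hom_zero[OF m m h'] mod_hom_closed[OF h' x(1)] x(2)
      by (simp add: X.minus_eq)
    then show "\<ominus>\<^bsub>cobj X i\<^esub> a \<in> boundaries X i"
      unfolding boundaries_def using Y.minus_closed[OF Y.zero_closed x(1)] by (metis image_eqI)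
  next
    fix a b assume "a \<in> boundaries X i" "b \<in> boundaries X i"
    then obtain x y where x: "x \<in> carrier (cobj X (i + 1))" "a = cdiff X (i + 1) x"
      and y: "y \<in> carrier (cobj X (i + 1))" "b = cdiff X (i + 1) y" by (auto simp: boundaries_def)
    show "a \<oplus>\<^bsub>cobj X i\<^esub> b \<in> boundaries X i"
      unfolding boundaries_def x(2) y(2) mod_hom_add[OF h' x(1) y(1), symmetric]
      by (rule imageI[OF Y.a_closed[OF x(1) y(1)]])
  next
    fix r a assume r: "r \<in> carrier R" and "a \<in> boundaries X i"
    then obtain x where x: "x \<in> carrier (cobj X (i + 1))" "a = cdiff X (i + 1) x" by (auto simp: boundaries_def)
    show "r \<odot>\<^bsub>cobj X i\<^esub> a \<in> boundaries X i"
      unfolding boundaries_def x(2) mod_hom_smult[OF h' r x(1), symmetric]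
      by (rule imageI[OF Y.smult_closed[OF r x(1)]])
  qed
  then have "submodule (boundaries X i) R ((cobj X i)\<lparr>carrier := cycles X i\<rparr>)"
    by (intro module.module_incl_imp_submodule[OF mZ]) (simp_all add: sub)
  then show ?thesis unfolding homology_def by (rule quot_is_module[OF mZ])
qed

lemma tensor_map_hom:
  assumes "module R M" "module R M'" "module R N" "f \<in> mod_hom R M M'"
  shows "tensor_map R M M' N f \<in> mod_hom R (tensor R M N) (tensor R M' N)"
    and "x \<in> carrier M \<Longrightarrow> y \<in> carrier N \<Longrightarrow>
      tensor_map R M M' N f (pure_tensor R M N x y) = pure_tensor R M' N (f x) y"
  using theI'[OF tensor_map_ex1[OF assms]] unfolding tensor_map_def by blast+

lemma tensor_complex_is_complex:
  assumes "is_complex R X" "module R N"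
  shows "is_complex R (tensor_complex R X N)"
proof -
  have m: "module R (cobj X j)" and h: "cdiff X j \<in> mod_hom R (cobj X j) (cobj X (j - 1))"
    and d: "x \<in> carrier (cobj X j) \<Longrightarrow> cdiff X (j - 1) (cdiff X j x) = \<zero>\<^bsub>cobj X (j - 1 - 1)\<^esub>" for j x
    using assms(1) unfolding is_complex_def by blast+
  let ?T = "\<lambda>j. tensor R (cobj X j) N"
  let ?d = "\<lambda>j. tensor_map R (cobj X j) (cobj X (j - 1)) N (cdiff X j)"
  have T: "module R (?T j)" for j by (rule tensor_is_module[OF m assms(2)])
  note dh = tensor_map_hom(1)[OF m m assms(2) h] and dp = tensor_map_hom(2)[OF m m assms(2) h]
  have "?d (j - 1) (?d j t) = \<zero>\<^bsub>?T (j - 1 - 1)\<^esub>" if t: "t \<in> carrier (?T j)" for j t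
  proof -
    interpret T: module R "?T (j - 1 - 1)" by (rule T)
    interpret X: module R "cobj X (j - 1 - 1)" by (rule m)
    have z: "(\<lambda>_. \<zero>\<^bsub>?T (j - 1 - 1)\<^esub>) \<in> mod_hom R (?T j) (?T (j - 1 - 1))"
      by (rule mod_homI) (rule T.zero_closed T.l_zero[OF T.zero_closed, symmetric] | (rule T.smult_r_null[symmetric], assumption))+
    show ?thesis
    proof (rule tensor_hom_ext[OF m assms(2) T mod_hom_comp[OF dh dh] z _ t])
      fix x y assume x: "x \<in> carrier (cobj X j)" and y: "y \<in> carrier N"
      let ?z = "\<zero>\<^bsub>cobj X (j - 1 - 1)\<^esub>"
      have zc: "pure_tensor R (cobj X (j - 1 - 1)) N ?z y \<in> carrier (?T (j - 1 - 1))"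
        by (rule pure_tensor_closed[OF m assms(2) X.zero_closed y])
      have "?d (j - 1) (?d j (pure_tensor R (cobj X j) N x y)) = pure_tensor R (cobj X (j - 1 - 1)) N ?z y"
        unfolding dp[OF x y] dp[OF mod_hom_closed[OF h x] y] d[OF x] ..
      also have "\<dots> = pure_tensor R (cobj X (j - 1 - 1)) N (\<zero>\<^bsub>R\<^esub> \<odot>\<^bsub>cobj X (j - 1 - 1)\<^esub> ?z) y"
        by (simp only: X.smult_r_null[OF T.R.zero_closed])
      also have "\<dots> = \<zero>\<^bsub>R\<^esub> \<odot>\<^bsub>?T (j - 1 - 1)\<^esub> pure_tensor R (cobj X (j - 1 - 1)) N ?z y"
        by (rule pure_tensor_bilinear(3)[OF m assms(2) X.zero_closed y T.R.zero_closed])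
      also have "\<dots> = \<zero>\<^bsub>?T (j - 1 - 1)\<^esub>" by (rule T.smult_l_null[OF zc])
      finally show "?d (j - 1) (?d j (pure_tensor R (cobj X j) N x y)) = \<zero>\<^bsub>?T (j - 1 - 1)\<^esub>" .
    qed
  qed
  then show ?thesis unfolding is_complex_def tensor_complex_def using T dh by simp
qed

end

theory Submission
  imports Defs
begin

text \<open>Let \<open>P\<close> be a finite quasi-projective resolution of \<open>M\<close>, let \<open>s\<close> be its top homological degree, and
  let \<open>K\<close> be the Koszul complex on \<open>n\<close> generators of the maximal ideal. The top degree of
  nonvanishing homology of \<open>K \<otimes> P \<otimes> N\<close> is computed in two ways. Since \<open>P\<close> is a complex of projectives,
  passing from \<open>N\<close> to \<open>N / yN\<close> for a regular element \<open>y\<close> raises this degree by one, and noetherian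
  induction starting with the residue field shows that it equals \<open>c - depth N\<close> with \<open>c\<close> independent
  of \<open>N\<close>. On the other hand, Tor-independence gives \<open>H\<^sub>i(P \<otimes> N) \<cong> (M \<otimes> N)\<^bsup>a i\<^esup>\<close>, so that the degree is
  \<open>s + n - depth (M \<otimes> N)\<close>. For \<open>N = R\<close> it is \<open>s + n - depth M\<close>, and \<open>c\<close> can be eliminated.\<close>

subsection \<open>Homomorphisms and exact sequences\<close>

text \<open>Koszul complexes enter because the maximal ideal acts as zero on their homology. If y is
  regular on N, multiplication by y is then zero on the homology of K \<otimes> P \<otimes> N, so
  the long exact sequence of 0 -> N -> N -> N/yN -> 0 breaks into short ones; hence the shift by
  exactly one. The constant c is the top degree for the residue field; it is never computed. It
  exists because P is bounded and the homology does not vanish for N = R.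

  The value s + n - depth L, for a complex with homology L^(a i), comes from taking Koszul complexes
  on a maximal regular sequence ys of L and on the n generators in both orders. With ys first, the
  homology becomes (L/ysL)^(a i), still with top degree s, and a socle class in it climbs one degree
  with every generator. With ys last, each entry acts as zero on homology and also adds one degree.

  Every comparison is made for arbitrary maximal regular sequences, so that these have a common
  length is a by-product. Tor is handled only as injectivity of maps between tensor
  products.\<close>

definition mhom ::
    "('a, 'r) ring_scheme \<Rightarrow> ('a, 'm, 's) module_scheme \<Rightarrow> ('a, 'n, 't) module_scheme \<Rightarrow> ('m \<Rightarrow> 'n) \<Rightarrow> bool" where
  "mhom R M N f \<longleftrightarrow> module R M \<and> module R N \<and> f \<in> mod_hom R M N"

definition ker0 :: "('a, 'm, 's) module_scheme \<Rightarrow> ('a, 'n, 't) module_scheme \<Rightarrow> ('m \<Rightarrow> 'n) \<Rightarrow> bool" where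
  "ker0 M N f \<longleftrightarrow> (\<forall>x\<in>carrier M. f x = \<zero>\<^bsub>N\<^esub> \<longrightarrow> x = \<zero>\<^bsub>M\<^esub>)"

definition ses where
  "ses R A B C f g \<longleftrightarrow> mhom R A B f \<and> mhom R B C g \<and> ker0 A B f \<and> g ` carrier B = carrier C \<and>
     (\<forall>b\<in>carrier B. g b = \<zero>\<^bsub>C\<^esub> \<longleftrightarrow> b \<in> f ` carrier A)"

lemma mhomI:
  assumes "module R M" "module R N"
    and "\<And>x. x \<in> carrier M \<Longrightarrow> f x \<in> carrier N"
    and "\<And>x y. x \<in> carrier M \<Longrightarrow> y \<in> carrier M \<Longrightarrow> f (x \<oplus>\<^bsub>M\<^esub> y) = f x \<oplus>\<^bsub>N\<^esub> f y"
    and "\<And>r x. r \<in> carrier R \<Longrightarrow> x \<in> carrier M \<Longrightarrow> f (r \<odot>\<^bsub>M\<^esub> x) = r \<odot>\<^bsub>N\<^esub> f x"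
  shows "mhom R M N f"
  unfolding mhom_def using assms mod_homI[of M f N R] by blast

lemma mhomD:
  assumes "mhom R M N f"
  shows mhom_dom: "module R M" and mhom_cod: "module R N" and mhom_mod_hom: "f \<in> mod_hom R M N"
    and mhom_closed: "x \<in> carrier M \<Longrightarrow> f x \<in> carrier N"
    and mhom_add: "x \<in> carrier M \<Longrightarrow> y \<in> carrier M \<Longrightarrow> f (x \<oplus>\<^bsub>M\<^esub> y) = f x \<oplus>\<^bsub>N\<^esub> f y"
    and mhom_smult: "r \<in> carrier R \<Longrightarrow> x \<in> carrier M \<Longrightarrow> f (r \<odot>\<^bsub>M\<^esub> x) = r \<odot>\<^bsub>N\<^esub> f x"
    and mhom_zero: "f \<zero>\<^bsub>M\<^esub> = \<zero>\<^bsub>N\<^esub>"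
    and mhom_minus: "x \<in> carrier M \<Longrightarrow> y \<in> carrier M \<Longrightarrow> f (x \<ominus>\<^bsub>M\<^esub> y) = f x \<ominus>\<^bsub>N\<^esub> f y"
  using assms mod_homD[of f R M N] mod_hom_zero[of R M N f] mod_hom_minus[of R M N f]
  unfolding mhom_def by blast+

lemma mhom_neg:
  assumes "mhom R M N f" "x \<in> carrier M"
  shows "f (\<ominus>\<^bsub>M\<^esub> x) = \<ominus>\<^bsub>N\<^esub> f x"
proof -
  interpret M: module R M by (rule mhom_dom[OF assms(1)])
  interpret N: module R N by (rule mhom_cod[OF assms(1)])
  show ?thesis
    using mhom_minus[OF assms(1) M.zero_closed assms(2)] mhom_zero[OF assms(1)] assms(2)
      mhom_closed[OF assms] by (simp add: a_minus_def)
qed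

lemma mhom_comp: "mhom R M N f \<Longrightarrow> mhom R N K g \<Longrightarrow> mhom R M K (\<lambda>x. g (f x))"
  using mod_hom_comp[of f R M N g K] unfolding mhom_def by blast

lemma mhom_id: "module R M \<Longrightarrow> mhom R M M (\<lambda>x. x)"
  by (intro mhomI) auto

lemma mhom_0: "module R M \<Longrightarrow> module R N \<Longrightarrow> mhom R M N (\<lambda>_. \<zero>\<^bsub>N\<^esub>)"
proof -
  assume M: "module R M" "module R N"
  interpret N: module R N by fact
  show ?thesis using M by (intro mhomI) auto
qed

lemma mhom_cong:
  assumes "mhom R M N f" "\<And>x. x \<in> carrier M \<Longrightarrow> g x = f x"
  shows "mhom R M N g"
proof -
  interpret M: module R M by (rule mhom_dom[OF assms(1)])
  show ?thesis using mhomD[OF assms(1)] assms(2) by (intro mhomI) auto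
qed

lemma mhom_sum:
  assumes "mhom R M N f" "mhom R M N g"
  shows "mhom R M N (\<lambda>x. f x \<oplus>\<^bsub>N\<^esub> g x)"
proof -
  interpret M: module R M by (rule mhom_dom[OF assms(1)])
  interpret N: module R N by (rule mhom_cod[OF assms(1)])
  show ?thesis using mhomD[OF assms(1)] mhomD[OF assms(2)] M.module_axioms N.module_axioms
    by (intro mhomI) (auto simp: N.a_ac N.smult_r_distr)
qed

lemma mhom_image_submodule:
  assumes "mhom R M N f"
  shows "submodule (f ` carrier M) R N"
proof -
  interpret M: module R M by (rule mhom_dom[OF assms(1)])
  interpret N: module R N by (rule mhom_cod[OF assms(1)])
  note f = mhomD[OF assms]
  show ?thesis
  proof (rule N.submoduleI)
    show "f ` carrier M \<subseteq> carrier N" using f(4) by auto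
    show "\<zero>\<^bsub>N\<^esub> \<in> f ` carrier M" using f(7) M.zero_closed by (metis image_eqI)
    fix a assume "a \<in> f ` carrier M"
    then obtain x where x: "x \<in> carrier M" "a = f x" by auto
    show "\<ominus>\<^bsub>N\<^esub> a \<in> f ` carrier M"
      using mhom_neg[OF assms x(1)] x by (metis M.a_inv_closed image_eqI)
    { fix r assume "r \<in> carrier R"
      then show "r \<odot>\<^bsub>N\<^esub> a \<in> f ` carrier M" using x f(6) by (metis M.smult_closed image_eqI) }
    fix b assume "b \<in> f ` carrier M"
    then obtain y where y: "y \<in> carrier M" "b = f y" by auto
    show "a \<oplus>\<^bsub>N\<^esub> b \<in> f ` carrier M" using x y f(5) by (metis M.a_closed image_eqI)
  qed
qed

lemma mhom_kernel_submodule: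
  assumes "mhom R M N f"
  shows "submodule {x \<in> carrier M. f x = \<zero>\<^bsub>N\<^esub>} R M"
  using kernel_submodule[OF mhom_dom[OF assms] mhom_cod[OF assms] mhom_mod_hom[OF assms]] .

lemma mhom_eq_iff:
  assumes "mhom R M N f" "ker0 M N f" "x \<in> carrier M" "y \<in> carrier M"
  shows "f x = f y \<longleftrightarrow> x = y"
proof -
  interpret M: module R M by (rule mhom_dom[OF assms(1)])
  interpret N: module R N by (rule mhom_cod[OF assms(1)])
  show ?thesis
    using mhomD[OF assms(1)] assms(2-4) M.minus_eq_zero_iff N.minus_eq_zero_iff
    unfolding ker0_def by (metis M.minus_closed)
qed

lemma ker0D: "ker0 M N f \<Longrightarrow> x \<in> carrier M \<Longrightarrow> f x = \<zero>\<^bsub>N\<^esub> \<Longrightarrow> x = \<zero>\<^bsub>M\<^esub>"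
  by (simp add: ker0_def)

lemma ker0_comp:
  assumes "mhom R A B f" "ker0 A B f" "ker0 B C g"
  shows "ker0 A C (\<lambda>x. g (f x))"
  using assms mhom_closed[OF assms(1)] by (auto simp: ker0_def)

lemma ker0_comp_rev:
  assumes "mhom R B C g" "ker0 A C (\<lambda>x. g (f x))"
  shows "ker0 A B f"
  using assms mhom_zero[OF assms(1)] by (auto simp: ker0_def)

lemma mhom_inverse:
  assumes f: "mhom R M N f" "ker0 M N f" "f ` carrier M = carrier N"
  obtains g where "mhom R N M g" "\<And>x. x \<in> carrier M \<Longrightarrow> g (f x) = x" "\<And>y. y \<in> carrier N \<Longrightarrow> f (g y) = y"
proof -
  interpret M: module R M by (rule mhom_dom[OF f(1)])
  interpret N: module R N by (rule mhom_cod[OF f(1)])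
  define g where "g = inv_into (carrier M) f"
  have inj: "inj_on f (carrier M)" using mhom_eq_iff[OF f(1,2)] by (auto intro: inj_onI)
  have 1: "g (f x) = x" if "x \<in> carrier M" for x using that inj by (simp add: g_def)
  have 2: "f (g y) = y" "g y \<in> carrier M" if "y \<in> carrier N" for y
    using that f(3) by (auto simp: g_def f_inv_into_f inv_into_into)
  have "mhom R N M g"
  proof (rule mhomI)
    show "module R N" "module R M" by unfold_locales
    fix x assume x: "x \<in> carrier N"
    show "g x \<in> carrier M" using 2 x by blast
    { fix r assume "r \<in> carrier R"
      then show "g (r \<odot>\<^bsub>N\<^esub> x) = r \<odot>\<^bsub>M\<^esub> g x"
        using 1[of "r \<odot>\<^bsub>M\<^esub> g x"] 2[OF x] mhom_smult[OF f(1)] by simp }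
    fix y assume y: "y \<in> carrier N"
    show "g (x \<oplus>\<^bsub>N\<^esub> y) = g x \<oplus>\<^bsub>M\<^esub> g y"
      using 1[of "g x \<oplus>\<^bsub>M\<^esub> g y"] 2[OF x] 2[OF y] mhom_add[OF f(1)] by simp
  qed
  then show thesis using 1 2 that by blast
qed

lemma msub_module: "module R M \<Longrightarrow> submodule U R M \<Longrightarrow> module R (M\<lparr>carrier := U\<rparr>)"
  by (rule submodule.submodule_is_module)

lemma mhom_inclusion:
  assumes "module R M" "submodule U R M"
  shows "mhom R (M\<lparr>carrier := U\<rparr>) M (\<lambda>x. x)"
  using submodule.submodule_is_module[OF assms(2,1)] assms(1) module.submoduleE(1)[OF assms(1,2)]
  by (intro mhomI) auto

lemma mhom_restrict_cod:
  assumes "mhom R M N f" "submodule U R N" "f ` carrier M \<subseteq> U"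
  shows "mhom R M (N\<lparr>carrier := U\<rparr>) f"
  using mhomD[OF assms(1)] msub_module[OF mhom_cod[OF assms(1)] assms(2)] assms(3)
  by (intro mhomI) auto

lemma mhom_restrict_dom:
  assumes "mhom R M N f" "submodule U R M"
  shows "mhom R (M\<lparr>carrier := U\<rparr>) N f"
  using mhom_comp[OF mhom_inclusion[OF mhom_dom[OF assms(1)] assms(2)] assms(1)] .

lemma sesD:
  assumes "ses R A B C f g"
  shows "mhom R A B f" "mhom R B C g" "ker0 A B f" "g ` carrier B = carrier C"
    and "b \<in> carrier B \<Longrightarrow> g b = \<zero>\<^bsub>C\<^esub> \<Longrightarrow> \<exists>a\<in>carrier A. b = f a"
    and "a \<in> carrier A \<Longrightarrow> g (f a) = \<zero>\<^bsub>C\<^esub>"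
    and "c \<in> carrier C \<Longrightarrow> \<exists>b\<in>carrier B. g b = c"
proof -
  show 1: "mhom R A B f" "mhom R B C g" "ker0 A B f" "g ` carrier B = carrier C"
    using assms unfolding ses_def by blast+
  show "b \<in> carrier B \<Longrightarrow> g b = \<zero>\<^bsub>C\<^esub> \<Longrightarrow> \<exists>a\<in>carrier A. b = f a"
    using assms unfolding ses_def by blast
  show "g (f a) = \<zero>\<^bsub>C\<^esub>" if "a \<in> carrier A"
    using assms mhom_closed[OF 1(1) that] that unfolding ses_def by blast
  show "c \<in> carrier C \<Longrightarrow> \<exists>b\<in>carrier B. g b = c" using 1(4) by (metis imageE)
qed

lemma sesI:
  assumes "mhom R A B f" "mhom R B C g" "ker0 A B f"
    and "\<And>c. c \<in> carrier C \<Longrightarrow> \<exists>b\<in>carrier B. g b = c"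
    and "\<And>a. a \<in> carrier A \<Longrightarrow> g (f a) = \<zero>\<^bsub>C\<^esub>"
    and "\<And>b. b \<in> carrier B \<Longrightarrow> g b = \<zero>\<^bsub>C\<^esub> \<Longrightarrow> \<exists>a\<in>carrier A. b = f a"
  shows "ses R A B C f g"
proof -
  have "g ` carrier B = carrier C" using assms(4) mhom_closed[OF assms(2)] by (auto simp: image_iff)
  moreover have "\<forall>b\<in>carrier B. g b = \<zero>\<^bsub>C\<^esub> \<longleftrightarrow> b \<in> f ` carrier A" using assms(5,6) by blast
  ultimately show ?thesis unfolding ses_def using assms(1-3) by blast
qed

lemma (in abelian_group) a_inv_zero [simp]: "\<ominus> \<zero> = \<zero>"
  by (rule minus_equality) auto

subsection \<open>Functoriality of the tensor product\<close>

abbreviation tens where "tens R M N \<equiv> carrier (tensor R M N)"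

text \<open>The quotient map by \<open>H\<close> vanishes on pure tensors, hence equals the zero map
  by \<open>tensor_hom_ext\<close>; this puts every element into \<open>H\<close>.\<close>

lemma tensor_induct:
  assumes "module R M" "module R N" "submodule H R (tensor R M N)"
    and "\<And>x y. x \<in> carrier M \<Longrightarrow> y \<in> carrier N \<Longrightarrow> pure_tensor R M N x y \<in> H"
    and u: "u \<in> tens R M N"
  shows "u \<in> H"
proof -
  let ?T = "tensor R M N"
  have T: "module R ?T" by (rule tensor_is_module[OF assms(1,2)])
  interpret T: module R ?T by (rule T)
  interpret H: abelian_subgroup H ?T by (rule abelian_subgroup_of_submodule[OF T assms(3)])
  note q = quot_module[OF T assms(3)]
  have m: "mhom R ?T (quot_module ?T H) (\<lambda>x. H +>\<^bsub>?T\<^esub> x)"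
    using quot_proj_hom[OF T assms(3)] q(6) T unfolding mhom_def by blast
  have z: "mhom R ?T (quot_module ?T H) (\<lambda>_. \<zero>\<^bsub>quot_module ?T H\<^esub>)" by (rule mhom_0[OF T q(6)])
  have "H +>\<^bsub>?T\<^esub> u = \<zero>\<^bsub>quot_module ?T H\<^esub>"
  proof (rule tensor_hom_ext[OF assms(1,2) q(6) mhom_mod_hom[OF m] mhom_mod_hom[OF z] _ u])
    fix x y assume xy: "x \<in> carrier M" "y \<in> carrier N"
    have p: "pure_tensor R M N x y \<in> carrier ?T" by (rule pure_tensor_closed[OF assms(1,2) xy])
    show "H +>\<^bsub>?T\<^esub> pure_tensor R M N x y = \<zero>\<^bsub>quot_module ?T H\<^esub>"
      unfolding q(4) q(5)[OF p T.zero_closed] using assms(4)[OF xy] p by (simp add: a_minus_def)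
  qed
  then have "u \<ominus>\<^bsub>?T\<^esub> \<zero>\<^bsub>?T\<^esub> \<in> H" unfolding q(4) q(5)[OF u T.zero_closed] .
  then show ?thesis using u by (simp add: T.minus_eq)
qed

text \<open>The bifunctor \<open>f \<otimes> g\<close>, needed because syzygies are taken in both
  arguments while \<open>tensor_map\<close> moves only the first. Its values outside the carrier are
  arbitrary, so all identities below are stated for \<open>u\<close> in the carrier.\<close>

definition tmap where
  "tmap R M N M' N' f g = (SOME h. mhom R (tensor R M N) (tensor R M' N') h \<and>
     (\<forall>x\<in>carrier M. \<forall>y\<in>carrier N. h (pure_tensor R M N x y) = pure_tensor R M' N' (f x) (g y)))"

lemma
  assumes f: "mhom R M M' f" and g: "mhom R N N' g"
  shows tmap_mhom: "mhom R (tensor R M N) (tensor R M' N') (tmap R M N M' N' f g)"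
    and tmap_pure: "x \<in> carrier M \<Longrightarrow> y \<in> carrier N \<Longrightarrow>
      tmap R M N M' N' f g (pure_tensor R M N x y) = pure_tensor R M' N' (f x) (g y)"
proof -
  note m = mhom_dom[OF f] mhom_cod[OF f] mhom_dom[OF g] mhom_cod[OF g]
  obtain h where "h\<in>mod_hom R (tensor R M N) (tensor R M' N')"
    "\<forall>x\<in>carrier M. \<forall>y\<in>carrier N. h (pure_tensor R M N x y) = pure_tensor R M' N' (f x) (g y)"
    using tensor_lift[OF m(1,3) tensor_is_module[OF m(2,4)], of "\<lambda>x y. pure_tensor R M' N' (f x) (g y)"]
      pure_tensor_closed[OF m(2,4)] pure_tensor_bilinear[OF m(2,4)] mhomD[OF f] mhomD[OF g] by auto
  then have "\<exists>h. mhom R (tensor R M N) (tensor R M' N') h \<and>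
     (\<forall>x\<in>carrier M. \<forall>y\<in>carrier N. h (pure_tensor R M N x y) = pure_tensor R M' N' (f x) (g y))"
    using tensor_is_module[OF m(1,3)] tensor_is_module[OF m(2,4)] unfolding mhom_def by blast
  from someI_ex[OF this, folded tmap_def]
  show "mhom R (tensor R M N) (tensor R M' N') (tmap R M N M' N' f g)"
    and "x \<in> carrier M \<Longrightarrow> y \<in> carrier N \<Longrightarrow>
      tmap R M N M' N' f g (pure_tensor R M N x y) = pure_tensor R M' N' (f x) (g y)" by blast+
qed

lemma tensor_mhom_ext:
  assumes "module R M" "module R N" "mhom R (tensor R M N) K f" "mhom R (tensor R M N) K g"
    and "\<And>x y. x \<in> carrier M \<Longrightarrow> y \<in> carrier N \<Longrightarrow> f (pure_tensor R M N x y) = g (pure_tensor R M N x y)"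
    and "X \<in> tens R M N"
  shows "f X = g X"
  using tensor_hom_ext[OF assms(1,2) mhom_cod[OF assms(3)] mhom_mod_hom[OF assms(3)] mhom_mod_hom[OF assms(4)] assms(5,6)] .

lemma tmap_comp:
  assumes f: "mhom R M M' f" and g: "mhom R N N' g" and f': "mhom R M' M'' f'" and g': "mhom R N' N'' g'"
    and u: "u \<in> tens R M N"
  shows "tmap R M' N' M'' N'' f' g' (tmap R M N M' N' f g u) = tmap R M N M'' N'' (\<lambda>x. f' (f x)) (\<lambda>x. g' (g x)) u"
proof (rule tensor_mhom_ext[OF mhom_dom[OF f] mhom_dom[OF g]
      mhom_comp[OF tmap_mhom[OF f g] tmap_mhom[OF f' g']] tmap_mhom[OF mhom_comp[OF f f'] mhom_comp[OF g g']] _ u])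
  fix x y assume "x \<in> carrier M" "y \<in> carrier N"
  then show "tmap R M' N' M'' N'' f' g' (tmap R M N M' N' f g (pure_tensor R M N x y)) =
           tmap R M N M'' N'' (\<lambda>x. f' (f x)) (\<lambda>x. g' (g x)) (pure_tensor R M N x y)"
    by (simp add: tmap_pure[OF f g] tmap_pure[OF f' g'] tmap_pure[OF mhom_comp[OF f f'] mhom_comp[OF g g']]
        mhom_closed[OF f] mhom_closed[OF g])
qed

lemma tmap_cong:
  assumes f: "mhom R M M' f" and g: "mhom R N N' g"
    and f': "\<And>x. x \<in> carrier M \<Longrightarrow> f' x = f x" and g': "\<And>x. x \<in> carrier N \<Longrightarrow> g' x = g x"
    and u: "u \<in> tens R M N"
  shows "tmap R M N M' N' f' g' u = tmap R M N M' N' f g u"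
proof -
  note f1 = mhom_cong[OF f f'] and g1 = mhom_cong[OF g g']
  show ?thesis
    by (rule tensor_mhom_ext[OF mhom_dom[OF f] mhom_dom[OF g] tmap_mhom[OF f1 g1] tmap_mhom[OF f g] _ u])
      (simp_all add: tmap_pure[OF f1 g1] tmap_pure[OF f g] f' g')
qed

lemma tmap_id:
  assumes M: "module R M" and N: "module R N" and u: "u \<in> tens R M N"
    and f: "\<And>x. x \<in> carrier M \<Longrightarrow> f x = x" and g: "\<And>x. x \<in> carrier N \<Longrightarrow> g x = x"
  shows "tmap R M N M N f g u = u"
proof -
  note f1 = mhom_cong[OF mhom_id[OF M] f] and g1 = mhom_cong[OF mhom_id[OF N] g]
  show ?thesis
    by (rule tensor_mhom_ext[OF M N tmap_mhom[OF f1 g1] mhom_id[OF tensor_is_module[OF M N]] _ u])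
      (simp_all add: tmap_pure[OF f1 g1] f g)
qed

text \<open>The link to the differential of \<open>tensor_complex\<close>, which is defined through
  \<open>tensor_map\<close>.\<close>

lemma tensor_map_eq_tmap:
  assumes f: "mhom R M M' f" and N: "module R N" and u: "u \<in> tens R M N"
  shows "tensor_map R M M' N f u = tmap R M N M' N f (\<lambda>x. x) u"
proof -
  note m = mhom_dom[OF f] mhom_cod[OF f] N mhom_mod_hom[OF f]
  have h: "mhom R (tensor R M N) (tensor R M' N) (tensor_map R M M' N f)"
    unfolding mhom_def by (intro conjI tensor_is_module tensor_map_hom(1) m)
  show ?thesis
    by (rule tensor_mhom_ext[OF m(1,3) h tmap_mhom[OF f mhom_id[OF N]] _ u])
      (simp add: tensor_map_hom(2)[OF m] tmap_pure[OF f mhom_id[OF N]])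
qed

lemma pure_tensor_zero:
  assumes "module R M" "module R N"
  shows "y \<in> carrier N \<Longrightarrow> pure_tensor R M N \<zero>\<^bsub>M\<^esub> y = \<zero>\<^bsub>tensor R M N\<^esub>"
    and "x \<in> carrier M \<Longrightarrow> pure_tensor R M N x \<zero>\<^bsub>N\<^esub> = \<zero>\<^bsub>tensor R M N\<^esub>"
proof -
  interpret M: module R M by fact
  interpret N: module R N by fact
  interpret T: module R "tensor R M N" by (rule tensor_is_module[OF assms])
  note c = pure_tensor_closed[OF assms]
  show "pure_tensor R M N \<zero>\<^bsub>M\<^esub> y = \<zero>\<^bsub>tensor R M N\<^esub>" if y: "y \<in> carrier N"
  proof -
    have "pure_tensor R M N (\<zero>\<^bsub>R\<^esub> \<odot>\<^bsub>M\<^esub> \<zero>\<^bsub>M\<^esub>) y = \<zero>\<^bsub>R\<^esub> \<odot>\<^bsub>tensor R M N\<^esub> pure_tensor R M N \<zero>\<^bsub>M\<^esub> y"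
      by (rule pure_tensor_bilinear(3)[OF assms M.zero_closed y M.R.zero_closed])
    then show ?thesis using c[OF M.zero_closed y] by simp
  qed
  show "pure_tensor R M N x \<zero>\<^bsub>N\<^esub> = \<zero>\<^bsub>tensor R M N\<^esub>" if x: "x \<in> carrier M"
  proof -
    have "pure_tensor R M N x (\<zero>\<^bsub>R\<^esub> \<odot>\<^bsub>N\<^esub> \<zero>\<^bsub>N\<^esub>) = \<zero>\<^bsub>R\<^esub> \<odot>\<^bsub>tensor R M N\<^esub> pure_tensor R M N x \<zero>\<^bsub>N\<^esub>"
      by (rule pure_tensor_bilinear(4)[OF assms x N.zero_closed M.R.zero_closed])
    then show ?thesis using c[OF x N.zero_closed] by simp
  qed
qed

lemma tmap_add_left:
  assumes f: "mhom R M M' f" and f': "mhom R M M' f'" and g: "mhom R N N' g" and u: "u \<in> tens R M N"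
  shows "tmap R M N M' N' (\<lambda>x. f x \<oplus>\<^bsub>M'\<^esub> f' x) g u = tmap R M N M' N' f g u \<oplus>\<^bsub>tensor R M' N'\<^esub> tmap R M N M' N' f' g u"
  by (rule tensor_mhom_ext[OF mhom_dom[OF f] mhom_dom[OF g] tmap_mhom[OF mhom_sum[OF f f'] g]
        mhom_sum[OF tmap_mhom[OF f g] tmap_mhom[OF f' g]] _ u])
    (simp add: tmap_pure[OF mhom_sum[OF f f'] g] tmap_pure[OF f g] tmap_pure[OF f' g] mhom_closed[OF f]
      mhom_closed[OF f'] mhom_closed[OF g] pure_tensor_bilinear(1)[OF mhom_cod[OF f] mhom_cod[OF g]])

lemma tmap_0_left:
  assumes "module R M" "module R M'" and g: "mhom R N N' g" and u: "u \<in> tens R M N"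
  shows "tmap R M N M' N' (\<lambda>_. \<zero>\<^bsub>M'\<^esub>) g u = \<zero>\<^bsub>tensor R M' N'\<^esub>"
  by (rule tensor_mhom_ext[OF assms(1) mhom_dom[OF g] tmap_mhom[OF mhom_0[OF assms(1,2)] g]
        mhom_0[OF tensor_is_module[OF assms(1) mhom_dom[OF g]] tensor_is_module[OF assms(2) mhom_cod[OF g]]] _ u])
    (simp add: tmap_pure[OF mhom_0[OF assms(1,2)] g] mhom_closed[OF g] pure_tensor_zero[OF assms(2) mhom_cod[OF g]])

lemma tmap_smult:
  assumes M: "module R M" and N: "module R N" and r: "r \<in> carrier R" and u: "u \<in> tens R M N"
    and g: "\<And>x. x \<in> carrier N \<Longrightarrow> g x = r \<odot>\<^bsub>N\<^esub> x"
  shows "tmap R M N M N (\<lambda>x. x) g u = r \<odot>\<^bsub>tensor R M N\<^esub> u"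
proof -
  interpret N: module R N by (rule N)
  interpret T: module R "tensor R M N" by (rule tensor_is_module[OF M N])
  have s: "mhom R K K (\<lambda>x. r \<odot>\<^bsub>K\<^esub> x)" if "module R K" for K :: "('a, 'x, 'y) module_scheme"
  proof -
    interpret K: module R K by (rule that)
    show ?thesis using r by (intro mhomI that) (auto simp: K.smult_r_distr K.smult_assoc1[symmetric] N.R.m_comm)
  qed
  have g1: "mhom R N N g" by (rule mhom_cong[OF s[OF N] g])
  have s': "mhom R (tensor R M N) (tensor R M N) (\<lambda>x. r \<odot>\<^bsub>tensor R M N\<^esub> x)"
    using r by (intro mhomI T.module_axioms) (auto simp: T.smult_r_distr T.smult_assoc1[symmetric] N.R.m_comm)
  show ?thesis
    by (rule tensor_mhom_ext[OF M N tmap_mhom[OF mhom_id[OF M] g1] s' _ u])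
      (simp add: tmap_pure[OF mhom_id[OF M] g1] g pure_tensor_bilinear(4)[OF M N] r)
qed

lemma tmap_surj:
  assumes f: "mhom R M M' f" and g: "mhom R N N' g" and sf: "f ` carrier M = carrier M'" and sg: "g ` carrier N = carrier N'"
  shows "tmap R M N M' N' f g ` tens R M N = tens R M' N'"
proof
  note h = tmap_mhom[OF f g]
  show "tmap R M N M' N' f g ` tens R M N \<subseteq> tens R M' N'" using mhom_closed[OF h] by auto
  show "tens R M' N' \<subseteq> tmap R M N M' N' f g ` tens R M N"
  proof
    fix u assume u: "u \<in> tens R M' N'"
    show "u \<in> tmap R M N M' N' f g ` tens R M N"
    proof (rule tensor_induct[OF mhom_cod[OF f] mhom_cod[OF g] mhom_image_submodule[OF h] _ u])
      fix x y assume "x \<in> carrier M'" "y \<in> carrier N'"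
      then obtain x' y' where xy: "x' \<in> carrier M" "y' \<in> carrier N" "x = f x'" "y = g y'" 
        using sf sg by (metis imageE)
      show "pure_tensor R M' N' x y \<in> tmap R M N M' N' f g ` tens R M N"
        using tmap_pure[OF f g xy(1,2)] pure_tensor_closed[OF mhom_dom[OF f] mhom_dom[OF g] xy(1,2)] xy(3,4)
        by (metis image_eqI)
    qed
  qed
qed

section \<open>Symmetry of the tensor product\<close>

definition tswap where
  "tswap R M N = (SOME h. mhom R (tensor R M N) (tensor R N M) h \<and>
     (\<forall>x\<in>carrier M. \<forall>y\<in>carrier N. h (pure_tensor R M N x y) = pure_tensor R N M y x))"

lemma
  assumes M: "module R M" and N: "module R N"
  shows tswap_mhom: "mhom R (tensor R M N) (tensor R N M) (tswap R M N)"
    and tswap_pure: "x \<in> carrier M \<Longrightarrow> y \<in> carrier N \<Longrightarrow> tswap R M N (pure_tensor R M N x y) = pure_tensor R N M y x"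
proof -
  obtain h where "h\<in>mod_hom R (tensor R M N) (tensor R N M)"
    "\<forall>x\<in>carrier M. \<forall>y\<in>carrier N. h (pure_tensor R M N x y) = pure_tensor R N M y x"
    using tensor_lift[OF M N tensor_is_module[OF N M], of "\<lambda>x y. pure_tensor R N M y x"]
      pure_tensor_closed[OF N M] pure_tensor_bilinear[OF N M] by auto
  then have "\<exists>h. mhom R (tensor R M N) (tensor R N M) h \<and>
     (\<forall>x\<in>carrier M. \<forall>y\<in>carrier N. h (pure_tensor R M N x y) = pure_tensor R N M y x)"
    using tensor_is_module[OF M N] tensor_is_module[OF N M] unfolding mhom_def by blast
  from someI_ex[OF this, folded tswap_def]
  show "mhom R (tensor R M N) (tensor R N M) (tswap R M N)"
    and "x \<in> carrier M \<Longrightarrow> y \<in> carrier N \<Longrightarrow> tswap R M N (pure_tensor R M N x y) = pure_tensor R N M y x" by blast+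
qed

lemma tswap_tswap:
  assumes M: "module R M" and N: "module R N" and u: "u \<in> tens R M N"
  shows "tswap R N M (tswap R M N u) = u"
  by (rule tensor_mhom_ext[OF M N mhom_comp[OF tswap_mhom[OF M N] tswap_mhom[OF N M]] mhom_id[OF tensor_is_module[OF M N]] _ u])
    (simp add: tswap_pure[OF M N] tswap_pure[OF N M])

lemma tswap_tmap:
  assumes f: "mhom R M M' f" and g: "mhom R N N' g" and u: "u \<in> tens R M N"
  shows "tswap R M' N' (tmap R M N M' N' f g u) = tmap R N M N' M' g f (tswap R M N u)"
proof -
  note m = mhom_dom[OF f] mhom_dom[OF g] mhom_cod[OF f] mhom_cod[OF g]
  show ?thesis
    by (rule tensor_mhom_ext[OF m(1,2) mhom_comp[OF tmap_mhom[OF f g] tswap_mhom[OF m(3,4)]]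
          mhom_comp[OF tswap_mhom[OF m(1,2)] tmap_mhom[OF g f]] _ u])
      (simp add: tswap_pure[OF m(1,2)] tswap_pure[OF m(3,4)] tmap_pure[OF f g] tmap_pure[OF g f]
        mhom_closed[OF f] mhom_closed[OF g])
qed

subsection \<open>Exactness properties of the tensor product\<close>

lemma quot_mhom:
  assumes "module R M" "submodule H R M"
  shows "mhom R M (quot_module M H) (\<lambda>x. H +>\<^bsub>M\<^esub> x)"
  using quot_proj_hom[OF assms] quot_is_module[OF assms] assms(1) unfolding mhom_def by blast

lemma quot_eq_zero:
  assumes "module R M" "submodule H R M" "x \<in> carrier M"
  shows "H +>\<^bsub>M\<^esub> x = \<zero>\<^bsub>quot_module M H\<^esub> \<longleftrightarrow> x \<in> H"
proof -
  interpret M: module R M by fact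
  show ?thesis
    unfolding quot_zero[OF assms(1,2)] quot_eq[OF assms(1,2,3) M.zero_closed]
    using assms(3) by (simp add: M.minus_eq)
qed

text \<open>The classical construction of an inverse: with \<open>W\<close> the image of
  \<open>A \<otimes> N\<close>, sending \<open>g x \<otimes> y\<close> to the class of
  \<open>x \<otimes> y\<close> defines a map from \<open>C \<otimes> N\<close> to
  \<open>(B \<otimes> N) / W\<close>. Composed with \<open>g \<otimes> id\<close> it is the
  projection, so whatever \<open>g \<otimes> id\<close> kills lies in \<open>W\<close>.\<close>

lemma tensor_right_exact_left:
  assumes f: "mhom R A B f" and g: "mhom R B C g" and gs: "g ` carrier B = carrier C"
    and ex: "\<And>b. b \<in> carrier B \<Longrightarrow> g b = \<zero>\<^bsub>C\<^esub> \<Longrightarrow> \<exists>a\<in>carrier A. b = f a"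
    and N: "module R N" and u: "u \<in> tens R B N" and gu: "tmap R B N C N g (\<lambda>x. x) u = \<zero>\<^bsub>tensor R C N\<^esub>"
  shows "\<exists>v\<in>tens R A N. u = tmap R A N B N f (\<lambda>x. x) v"
proof -
  note A = mhom_dom[OF f] and B = mhom_dom[OF g] and C = mhom_cod[OF g]
  note i = mhom_id[OF N]
  let ?T = "tensor R B N"
  define W where "W = tmap R A N B N f (\<lambda>x. x) ` tens R A N"
  have W: "submodule W R ?T" unfolding W_def by (rule mhom_image_submodule[OF tmap_mhom[OF f i]])
  have T: "module R ?T" by (rule tensor_is_module[OF B N])
  interpret A: module R A by (rule A)
  interpret B: module R B by (rule B)
  interpret C: module R C by (rule C)
  interpret N: module R N by (rule N)
  interpret T: module R ?T by (rule T)
  let ?Q = "quot_module ?T W"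
  let ?p = "\<lambda>x. W +>\<^bsub>?T\<^esub> x"
  have p: "mhom R ?T ?Q ?p" by (rule quot_mhom[OF T W])
  interpret Q: module R ?Q by (rule mhom_cod[OF p])
  have pt: "pure_tensor R B N x y \<in> carrier ?T" if "x \<in> carrier B" "y \<in> carrier N" for x y
    using pure_tensor_closed[OF B N that] .
  define sec where "sec c = (SOME b. b \<in> carrier B \<and> g b = c)" for c
  have sec: "sec c \<in> carrier B" "g (sec c) = c" if "c \<in> carrier C" for c
  proof -
    have "\<exists>b. b \<in> carrier B \<and> g b = c" using gs that by (metis imageE)
    from someI_ex[OF this] show "sec c \<in> carrier B" "g (sec c) = c" unfolding sec_def by blast+
  qed
  define b where "b c y = ?p (pure_tensor R B N (sec c) y)" for c y
  \<comment> \<open>Independence of the chosen preimage: two preimages of \<open>g x\<close> differ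
    by some \<open>f a\<close>, and \<open>f a \<otimes> y\<close> lies in \<open>W\<close>.\<close>
  have bg: "b (g x) y = ?p (pure_tensor R B N x y)" if x: "x \<in> carrier B" and y: "y \<in> carrier N" for x y
  proof -
    note s = sec[OF mhom_closed[OF g x]]
    have "g (sec (g x) \<ominus>\<^bsub>B\<^esub> x) = \<zero>\<^bsub>C\<^esub>"
      using s x mhom_closed[OF g x] by (simp add: mhom_minus[OF g] C.minus_eq_zero_iff)
    then obtain a where a: "a \<in> carrier A" "sec (g x) \<ominus>\<^bsub>B\<^esub> x = f a" using ex s x by blast
    have fa: "f a \<in> carrier B" using mhom_closed[OF f a(1)] .
    have "f a \<oplus>\<^bsub>B\<^esub> x = sec (g x)" unfolding a(2)[symmetric] using s x by (simp add: B.minus_eq B.a_assoc B.l_neg)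
    then have "pure_tensor R B N (sec (g x)) y = pure_tensor R B N (f a) y \<oplus>\<^bsub>?T\<^esub> pure_tensor R B N x y"
      using pure_tensor_bilinear(1)[OF B N fa y x] by simp
    moreover have fw: "pure_tensor R B N (f a) y \<in> W"
      unfolding W_def using tmap_pure[OF f i a(1) y] pure_tensor_closed[OF A N a(1) y] by (metis image_eqI)
    then have "?p (pure_tensor R B N (f a) y) = \<zero>\<^bsub>?Q\<^esub>" using quot_eq_zero[OF T W pt[OF fa y]] by simp
    ultimately show ?thesis
      unfolding b_def using mhom_add[OF p pt[OF fa y] pt[OF x y]] mhom_closed[OF p pt[OF x y]] by simp
  qed
  have "\<exists>h\<in>mod_hom R (tensor R C N) ?Q. \<forall>x\<in>carrier C. \<forall>y\<in>carrier N. h (pure_tensor R C N x y) = b x y"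
  proof (rule tensor_lift[OF C N Q.module_axioms])
    fix c y assume c: "c \<in> carrier C" and y: "y \<in> carrier N"
    obtain x where x: "x \<in> carrier B" "c = g x" using sec[OF c] by metis
    show "b c y \<in> carrier ?Q" unfolding x(2) bg[OF x(1) y] using mhom_closed[OF p pt[OF x(1) y]] .
    { fix y' assume y': "y' \<in> carrier N"
      show "b c (y \<oplus>\<^bsub>N\<^esub> y') = b c y \<oplus>\<^bsub>?Q\<^esub> b c y'"
        unfolding x(2) using x(1) y y' by (simp add: bg pure_tensor_bilinear(2)[OF B N] mhom_add[OF p] pt) }
    { fix r assume r: "r \<in> carrier R"
      show "b c (r \<odot>\<^bsub>N\<^esub> y) = r \<odot>\<^bsub>?Q\<^esub> b c y"
        unfolding x(2) using x(1) y r by (simp add: bg pure_tensor_bilinear(4)[OF B N] mhom_smult[OF p] pt)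
      show "b (r \<odot>\<^bsub>C\<^esub> c) y = r \<odot>\<^bsub>?Q\<^esub> b c y"
        unfolding x(2) mhom_smult[OF g r x(1), symmetric] using x(1) y r
        by (simp add: bg pure_tensor_bilinear(3)[OF B N] mhom_smult[OF p] pt) }
    { fix c' assume c': "c' \<in> carrier C"
      obtain x' where x': "x' \<in> carrier B" "c' = g x'" using sec[OF c'] by metis
      show "b (c \<oplus>\<^bsub>C\<^esub> c') y = b c y \<oplus>\<^bsub>?Q\<^esub> b c' y"
        unfolding x(2) x'(2) mhom_add[OF g x(1) x'(1), symmetric] using x(1) x'(1) y
        by (simp add: bg pure_tensor_bilinear(1)[OF B N] mhom_add[OF p] pt) }
  qed
  then obtain h where "h\<in>mod_hom R (tensor R C N) ?Q"
    and hb: "\<And>x y. x\<in>carrier C \<Longrightarrow> y\<in>carrier N \<Longrightarrow> h (pure_tensor R C N x y) = b x y" by blast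
  then have h: "mhom R (tensor R C N) ?Q h"
    unfolding mhom_def using tensor_is_module[OF C N] Q.module_axioms by blast
  note tg = tmap_mhom[OF g i]
  have "h (tmap R B N C N g (\<lambda>x. x) u) = ?p u"
    by (rule tensor_mhom_ext[OF B N mhom_comp[OF tg h] p _ u])
      (simp add: tmap_pure[OF g i] hb mhom_closed[OF g] bg)
  then have "?p u = \<zero>\<^bsub>?Q\<^esub>" unfolding gu using mhom_zero[OF h] by simp
  then have "u \<in> W" using quot_eq_zero[OF T W u] by simp
  then show ?thesis unfolding W_def by blast
qed

text \<open>Exactness in the other argument is transported by the swap, which is natural by
  \<open>tswap_tmap\<close>.\<close>

lemma tensor_right_exact_right:
  assumes f: "mhom R A B f" and g: "mhom R B C g" and gs: "g ` carrier B = carrier C"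
    and ex: "\<And>b. b \<in> carrier B \<Longrightarrow> g b = \<zero>\<^bsub>C\<^esub> \<Longrightarrow> \<exists>a\<in>carrier A. b = f a"
    and N: "module R N" and u: "u \<in> tens R N B" and gu: "tmap R N B N C (\<lambda>x. x) g u = \<zero>\<^bsub>tensor R N C\<^esub>"
  shows "\<exists>v\<in>tens R N A. u = tmap R N A N B (\<lambda>x. x) f v"
proof -
  note A = mhom_dom[OF f] and B = mhom_dom[OF g] and C = mhom_cod[OF g]
  note i = mhom_id[OF N]
  let ?u = "tswap R N B u"
  have u': "?u \<in> tens R B N" using mhom_closed[OF tswap_mhom[OF N B] u] .
  have "tmap R B N C N g (\<lambda>x. x) ?u = \<zero>\<^bsub>tensor R C N\<^esub>"
    using tswap_tmap[OF i g u] mhom_zero[OF tswap_mhom[OF N C]] unfolding gu by simp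
  from tensor_right_exact_left[OF f g gs ex N u' this] obtain v
    where v: "v \<in> tens R A N" "?u = tmap R A N B N f (\<lambda>x. x) v" by blast
  have "u = tmap R N A N B (\<lambda>x. x) f (tswap R A N v)"
    using tswap_tswap[OF N B u] tswap_tmap[OF f i v(1)] unfolding v(2) by simp
  then show ?thesis using mhom_closed[OF tswap_mhom[OF A N] v(1)] by blast
qed

text \<open>Projective modules are flat: reduce to a free module, whose tensor product with \<open>N\<close> is
  detected by the coordinate maps to \<open>N\<close>.\<close>

definition tensor_coordinates where
  "tensor_coordinates R B N c \<longleftrightarrow> (\<forall>b\<in>B. mhom R (tensor R (free_module R B) N) N (c b)) \<and>
    (\<forall>b\<in>B. \<forall>f\<in>carrier (free_module R B). \<forall>y\<in>carrier N. c b (pure_tensor R (free_module R B) N f y) = f b \<odot>\<^bsub>N\<^esub> y) \<and>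
    (\<forall>u\<in>tens R (free_module R B) N. (\<forall>b\<in>B. c b u = \<zero>\<^bsub>N\<^esub>) \<longrightarrow> u = \<zero>\<^bsub>tensor R (free_module R B) N\<^esub>)"

lemma tensor_coordinatesD:
  assumes "tensor_coordinates R B N c"
  shows "b \<in> B \<Longrightarrow> mhom R (tensor R (free_module R B) N) N (c b)"
    and "b \<in> B \<Longrightarrow> f \<in> carrier (free_module R B) \<Longrightarrow> y \<in> carrier N \<Longrightarrow>
      c b (pure_tensor R (free_module R B) N f y) = f b \<odot>\<^bsub>N\<^esub> y"
    and "u \<in> tens R (free_module R B) N \<Longrightarrow> (\<And>b. b \<in> B \<Longrightarrow> c b u = \<zero>\<^bsub>N\<^esub>) \<Longrightarrow>
      u = \<zero>\<^bsub>tensor R (free_module R B) N\<^esub>"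
  using assms unfolding tensor_coordinates_def by simp_all

text \<open>The coordinate at \<open>b\<close> sends \<open>f \<otimes> y\<close> to
  \<open>f b y\<close>. These maps detect zero because every \<open>u\<close> is a finite sum of
  terms \<open>e b \<otimes> c b u\<close> with basis vectors \<open>e b\<close>: the elements with
  such an expansion form a submodule that contains all pure tensors.\<close>

lemma tensor_coordinates_exist:
  fixes R :: "('a, 'r) ring_scheme" and N :: "('a, 'n, 't) module_scheme" and B :: "'i set"
  assumes N: "module R N"
  shows "\<exists>c. tensor_coordinates R B N c"
proof -
  interpret N: module R N by (rule N)
  let ?F = "free_module R B"
  let ?T = "tensor R ?F N"
  have F: "module R ?F" by (rule free_module_is_module[OF N.R.is_cring])
  interpret F: module R ?F by (rule F)
  have T: "module R ?T" by (rule tensor_is_module[OF F N])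
  interpret T: module R ?T by (rule T)
  note pc = pure_tensor_closed[OF F N]
  have fc: "f i \<in> carrier R" if "f \<in> carrier ?F" for f i using that by (simp add: free_module_simps)
  have "\<exists>h. mhom R ?T N h \<and> (\<forall>f\<in>carrier ?F. \<forall>y\<in>carrier N. h (pure_tensor R ?F N f y) = f b \<odot>\<^bsub>N\<^esub> y)" for b
  proof -
    have sm: "f b \<odot>\<^bsub>N\<^esub> (r \<odot>\<^bsub>N\<^esub> y) = r \<odot>\<^bsub>N\<^esub> (f b \<odot>\<^bsub>N\<^esub> y)"
      if "f \<in> carrier ?F" "r \<in> carrier R" "y \<in> carrier N" for f r y
      using fc[OF that(1), of b] that(2,3) by (simp add: N.smult_assoc1[symmetric] N.R.m_comm)
    have "\<exists>h\<in>mod_hom R ?T N. \<forall>f\<in>carrier ?F. \<forall>y\<in>carrier N. h (pure_tensor R ?F N f y) = f b \<odot>\<^bsub>N\<^esub> y"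
      by (rule tensor_lift[OF F N N])
        (auto simp: fc free_module_simps(2-) N.smult_l_distr N.smult_r_distr N.smult_assoc1 sm)
    then show ?thesis using T N unfolding mhom_def by blast
  qed
  then obtain c where c: "\<And>b. mhom R ?T N (c b)"
    "\<And>b f y. f \<in> carrier ?F \<Longrightarrow> y \<in> carrier N \<Longrightarrow> c b (pure_tensor R ?F N f y) = f b \<odot>\<^bsub>N\<^esub> y" by metis
  let ?e = "\<lambda>b y. pure_tensor R ?F N (free_basis R b) y"
  have eb: "free_basis R b \<in> carrier ?F" if "b \<in> B" for b by (rule free_basis_closed[OF N.R.is_cring that])
  \<comment> \<open>The expansion is demanded over every finite index set between \<open>A\<close>
    and \<open>B\<close>, so that the expansions of two elements can be added over a common index
    set.\<close>
  define good where "good A u \<longleftrightarrow> finite A \<and> A \<subseteq> B \<and>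
    (\<forall>A'. finite A' \<longrightarrow> A \<subseteq> A' \<longrightarrow> A' \<subseteq> B \<longrightarrow> u = (\<Oplus>\<^bsub>?T\<^esub>b\<in>A'. ?e b (c b u)))" for A u
  have cl: "(\<lambda>b. ?e b (c b u)) \<in> A \<rightarrow> carrier ?T" if "u \<in> carrier ?T" "A \<subseteq> B" for u A
    using that eb mhom_closed[OF c(1)] pc by auto
  have g0: "good {} \<zero>\<^bsub>?T\<^esub>"
  proof -
    have "\<zero>\<^bsub>?T\<^esub> = (\<Oplus>\<^bsub>?T\<^esub>b\<in>A'. ?e b (c b \<zero>\<^bsub>?T\<^esub>))" if "A' \<subseteq> B" for A'
    proof -
      have "(\<Oplus>\<^bsub>?T\<^esub>b\<in>A'. ?e b (c b \<zero>\<^bsub>?T\<^esub>)) = (\<Oplus>\<^bsub>?T\<^esub>b\<in>A'. \<zero>\<^bsub>?T\<^esub>)"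
        using that eb by (intro T.finsum_cong') (auto simp: mhom_zero[OF c(1)] pure_tensor_zero[OF F N])
      then show ?thesis by (simp add: T.finsum_zero)
    qed
    then show ?thesis by (auto simp: good_def)
  qed
  have gs: "good A (r \<odot>\<^bsub>?T\<^esub> u)" if "good A u" "r \<in> carrier R" "u \<in> carrier ?T" for A r u
    unfolding good_def
  proof (intro conjI allI impI)
    show "finite A" "A \<subseteq> B" using that(1) by (auto simp: good_def)
    fix A' assume A': "finite A'" "A \<subseteq> A'" "A' \<subseteq> B"
    have u: "u = (\<Oplus>\<^bsub>?T\<^esub>b\<in>A'. ?e b (c b u))" using that(1) A' by (auto simp: good_def)
    have "(\<Oplus>\<^bsub>?T\<^esub>b\<in>A'. ?e b (c b (r \<odot>\<^bsub>?T\<^esub> u))) = (\<Oplus>\<^bsub>?T\<^esub>b\<in>A'. r \<odot>\<^bsub>?T\<^esub> ?e b (c b u))"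
      using A' that eb mhom_closed[OF c(1)] pc
      by (intro T.finsum_cong') (auto simp: mhom_smult[OF c(1)] pure_tensor_bilinear(4)[OF F N])
    also have "\<dots> = r \<odot>\<^bsub>?T\<^esub> (\<Oplus>\<^bsub>?T\<^esub>b\<in>A'. ?e b (c b u))"
      using T.finsum_smult_ldistr[OF A'(1) that(2) cl[OF that(3) A'(3)]] by simp
    finally show "r \<odot>\<^bsub>?T\<^esub> u = (\<Oplus>\<^bsub>?T\<^esub>b\<in>A'. ?e b (c b (r \<odot>\<^bsub>?T\<^esub> u)))" using u by simp
  qed
  have ga: "good (A \<union> A1) (u \<oplus>\<^bsub>?T\<^esub> v)" if "good A u" "good A1 v" "u \<in> carrier ?T" "v \<in> carrier ?T" for A A1 u v
    unfolding good_def
  proof (intro conjI allI impI)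
    show "finite (A \<union> A1)" "A \<union> A1 \<subseteq> B" using that(1,2) by (auto simp: good_def)
    fix A' assume A': "finite A'" "A \<union> A1 \<subseteq> A'" "A' \<subseteq> B"
    have u: "u = (\<Oplus>\<^bsub>?T\<^esub>b\<in>A'. ?e b (c b u))" and v: "v = (\<Oplus>\<^bsub>?T\<^esub>b\<in>A'. ?e b (c b v))"
      using that(1,2) A' unfolding good_def by blast+
    have "(\<Oplus>\<^bsub>?T\<^esub>b\<in>A'. ?e b (c b (u \<oplus>\<^bsub>?T\<^esub> v))) = (\<Oplus>\<^bsub>?T\<^esub>b\<in>A'. ?e b (c b u) \<oplus>\<^bsub>?T\<^esub> ?e b (c b v))"
      using A' that eb mhom_closed[OF c(1)] pc
      by (intro T.finsum_cong') (auto simp: mhom_add[OF c(1)] pure_tensor_bilinear(2)[OF F N])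
    also have "\<dots> = (\<Oplus>\<^bsub>?T\<^esub>b\<in>A'. ?e b (c b u)) \<oplus>\<^bsub>?T\<^esub> (\<Oplus>\<^bsub>?T\<^esub>b\<in>A'. ?e b (c b v))"
      by (rule T.finsum_addf[OF cl[OF that(3) A'(3)] cl[OF that(4) A'(3)]])
    finally show "u \<oplus>\<^bsub>?T\<^esub> v = (\<Oplus>\<^bsub>?T\<^esub>b\<in>A'. ?e b (c b (u \<oplus>\<^bsub>?T\<^esub> v)))" using u v by simp
  qed
  define H where "H = {u \<in> carrier ?T. \<exists>A. good A u}"
  have H: "submodule H R ?T"
  proof (rule T.submoduleI)
    show "H \<subseteq> carrier ?T" "\<zero>\<^bsub>?T\<^esub> \<in> H" using g0 by (auto simp: H_def)
    fix u assume u: "u \<in> H"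
    show s: "r \<odot>\<^bsub>?T\<^esub> u \<in> H" if "r \<in> carrier R" for r using u gs that by (auto simp: H_def)
    show "\<ominus>\<^bsub>?T\<^esub> u \<in> H" using s[of "\<ominus>\<^bsub>R\<^esub> \<one>\<^bsub>R\<^esub>"] u by (simp add: T.smult_l_minus H_def)
    show "u \<oplus>\<^bsub>?T\<^esub> v \<in> H" if "v \<in> H" for v using u ga that unfolding H_def by blast
  qed
  note HE = T.submoduleE[OF H]
  \<comment> \<open>Pure tensors with an arbitrary first entry are reached by induction over the
    free module, starting from the basis vectors.\<close>
  have pH: "\<forall>y\<in>carrier N. pure_tensor R ?F N f y \<in> H" if f: "f \<in> carrier ?F" for f
  proof -
    have "f \<in> {f \<in> carrier ?F. \<forall>y\<in>carrier N. pure_tensor R ?F N f y \<in> H}"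
    proof (rule free_induct[OF N.R.is_cring _ _ f])
      show "submodule {f \<in> carrier ?F. \<forall>y\<in>carrier N. pure_tensor R ?F N f y \<in> H} R ?F"
      proof (rule F.submoduleI)
        fix u assume u: "u \<in> {f \<in> carrier ?F. \<forall>y\<in>carrier N. pure_tensor R ?F N f y \<in> H}"
        then have uc: "u \<in> carrier ?F" by simp
        show s: "r \<odot>\<^bsub>?F\<^esub> u \<in> {f \<in> carrier ?F. \<forall>y\<in>carrier N. pure_tensor R ?F N f y \<in> H}" if "r \<in> carrier R" for r
          using u that HE(4) F.smult_closed[OF that uc] by (simp add: pure_tensor_bilinear(3)[OF F N uc _ that])
        have "\<ominus>\<^bsub>?F\<^esub> u = (\<ominus>\<^bsub>R\<^esub> \<one>\<^bsub>R\<^esub>) \<odot>\<^bsub>?F\<^esub> u" using uc by (simp only: F.smult_l_minus N.R.one_closed F.smult_one)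
        then show "\<ominus>\<^bsub>?F\<^esub> u \<in> {f \<in> carrier ?F. \<forall>y\<in>carrier N. pure_tensor R ?F N f y \<in> H}"
          using s[of "\<ominus>\<^bsub>R\<^esub> \<one>\<^bsub>R\<^esub>"] by simp
        show "u \<oplus>\<^bsub>?F\<^esub> v \<in> {f \<in> carrier ?F. \<forall>y\<in>carrier N. pure_tensor R ?F N f y \<in> H}"
          if "v \<in> {f \<in> carrier ?F. \<forall>y\<in>carrier N. pure_tensor R ?F N f y \<in> H}" for v
          using u that HE(5) F.a_closed[OF uc, of v] by (simp add: pure_tensor_bilinear(1)[OF F N uc])
      qed (use g0 in \<open>auto simp: pure_tensor_zero[OF F N] H_def\<close>)
      fix d assume d: "d \<in> B"
      have ce: "c b (?e d y) = (if b = d then y else \<zero>\<^bsub>N\<^esub>)" if "y \<in> carrier N" for b y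
        unfolding c(2)[OF eb[OF d] that] using that by (simp add: free_basis_def)
      have "good {d} (?e d y)" if y: "y \<in> carrier N" for y
        unfolding good_def
      proof (intro conjI allI impI)
        fix A' assume A': "finite A'" "{d} \<subseteq> A'" "A' \<subseteq> B"
        have "(\<Oplus>\<^bsub>?T\<^esub>b\<in>A'. ?e b (c b (?e d y))) = (\<Oplus>\<^bsub>?T\<^esub>b\<in>A'. if d = b then ?e d y else \<zero>\<^bsub>?T\<^esub>)"
          using A' d y pc[OF eb y] by (intro T.finsum_cong') (simp_all add: ce pure_tensor_zero(2)[OF F N] eb subset_iff)
        also have "\<dots> = ?e d y" using T.finsum_singleton[of d A' "\<lambda>_. ?e d y"] A' d y eb pc by auto
        finally show "?e d y = (\<Oplus>\<^bsub>?T\<^esub>b\<in>A'. ?e b (c b (?e d y)))" by simp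
      qed (use d in auto)
      then show "free_basis R d \<in> {f \<in> carrier ?F. \<forall>y\<in>carrier N. pure_tensor R ?F N f y \<in> H}"
        using eb[OF d] pc by (auto simp: H_def)
    qed
    then show ?thesis by blast
  qed
  have "u = \<zero>\<^bsub>?T\<^esub>" if u: "u \<in> carrier ?T" and z: "\<And>b. b \<in> B \<Longrightarrow> c b u = \<zero>\<^bsub>N\<^esub>" for u
  proof -
    have "u \<in> H" by (rule tensor_induct[OF F N H _ u]) (use pH in blast)
    then obtain A where A: "good A u" by (auto simp: H_def)
    then have "u = (\<Oplus>\<^bsub>?T\<^esub>b\<in>A. ?e b (c b u))" "A \<subseteq> B" by (auto simp: good_def)
    moreover have "(\<Oplus>\<^bsub>?T\<^esub>b\<in>A. ?e b (c b u)) = (\<Oplus>\<^bsub>?T\<^esub>b\<in>A. \<zero>\<^bsub>?T\<^esub>)"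
      using \<open>A \<subseteq> B\<close> z eb by (intro T.finsum_cong') (auto simp: pure_tensor_zero[OF F N] subset_iff)
    ultimately show ?thesis by (simp add: T.finsum_zero)
  qed
  then have "tensor_coordinates R B N c" unfolding tensor_coordinates_def using c by simp
  then show ?thesis by blast
qed

section \<open>Flatness of projective modules\<close>

lemma projective_module: "projective R P \<Longrightarrow> module R P"
  by (simp add: projective_def)

lemma projective_flat_left:
  fixes P :: "('a, 'p) module"
  assumes P: "projective R P" and g: "mhom R N N' g" "ker0 N N' g"
  shows "ker0 (tensor R P N) (tensor R P N') (tmap R P N P N' (\<lambda>x. x) g)"
proof -
  have Pm: "module R P" by (rule projective_module[OF P])
  interpret P: module R P by (rule Pm)
  note N = mhom_dom[OF g(1)] mhom_cod[OF g(1)]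
  let ?F = "free_module R (carrier P)"
  have F: "module R ?F" by (rule free_module_is_module[OF P.R.is_cring])
  obtain p where p: "p \<in> mod_hom R ?F P" "\<And>x. x \<in> carrier P \<Longrightarrow> p (free_basis R x) = x"
    using free_lift[OF Pm, of "carrier P" "\<lambda>x. x"] by auto
  have ps: "p ` carrier ?F = carrier P"
  proof
    show "p ` carrier ?F \<subseteq> carrier P" using mod_hom_closed[OF p(1)] by auto
    show "carrier P \<subseteq> p ` carrier ?F"
    proof
      fix x assume x: "x \<in> carrier P"
      show "x \<in> p ` carrier ?F"
        by (rule image_eqI[of _ _ "free_basis R x"]) (simp_all add: p(2) x free_basis_closed P.R.is_cring)
    qed
  qed
  \<comment> \<open>A section of \<open>p\<close> makes \<open>P\<close> a retract of a free module;
    \<open>u\<close> is moved there, shown to vanish, and brought back by \<open>p\<close>.\<close>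
  obtain s where s: "s \<in> mod_hom R P ?F" "\<And>x. x \<in> carrier P \<Longrightarrow> p (s x) = x"
    using projective_lift[OF P F Pm p(1) ps mhom_mod_hom[OF mhom_id[OF Pm]]] by auto
  have p': "mhom R ?F P p" and s': "mhom R P ?F s" using p s F Pm by (auto simp: mhom_def)
  note iN = mhom_id[OF N(1)] mhom_id[OF N(2)] and iP = mhom_id[OF Pm] and iF = mhom_id[OF F]
  obtain c where "tensor_coordinates R (carrier P) N c" using tensor_coordinates_exist[OF N(1)] by (rule exE)
  note c = tensor_coordinatesD[OF this]
  obtain c' where "tensor_coordinates R (carrier P) N' c'" using tensor_coordinates_exist[OF N(2)] by (rule exE)
  note c' = tensor_coordinatesD[OF this]
  show ?thesis
    unfolding ker0_def
  proof (intro ballI impI)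
    fix u assume u: "u \<in> tens R P N" and gu: "tmap R P N P N' (\<lambda>x. x) g u = \<zero>\<^bsub>tensor R P N'\<^esub>"
    let ?v = "tmap R P N ?F N s (\<lambda>x. x) u"
    have v: "?v \<in> tens R ?F N" by (rule mhom_closed[OF tmap_mhom[OF s' iN(1)] u])
    have gv: "tmap R ?F N ?F N' (\<lambda>x. x) g ?v = \<zero>\<^bsub>tensor R ?F N'\<^esub>"
      using tmap_comp[OF s' iN(1) iF g(1) u] tmap_comp[OF iP g(1) s' iN(2) u] mhom_zero[OF tmap_mhom[OF s' iN(2)]]
      unfolding gu by simp
    have "?v = \<zero>\<^bsub>tensor R ?F N\<^esub>"
    proof (rule c(3)[OF v])
      fix b assume b: "b \<in> carrier P"
      \<comment> \<open>Coordinates are natural in the second argument, so injectivity of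
        \<open>g\<close> can be used one coordinate at a time.\<close>
      have "g (c b ?v) = c' b (tmap R ?F N ?F N' (\<lambda>x. x) g ?v)"
      proof (rule tensor_mhom_ext[OF F N(1) mhom_comp[OF c(1)[OF b] g(1)]
            mhom_comp[OF tmap_mhom[OF iF g(1)] c'(1)[OF b]] _ v])
        fix f y assume f: "f \<in> carrier ?F" and y: "y \<in> carrier N"
        have "f b \<in> carrier R" using f by (simp add: free_module_simps)
        then show "g (c b (pure_tensor R ?F N f y)) = c' b (tmap R ?F N ?F N' (\<lambda>x. x) g (pure_tensor R ?F N f y))"
          using f y b by (simp add: c(2) c'(2) tmap_pure[OF iF g(1)] mhom_closed[OF g(1)] mhom_smult[OF g(1)])
      qed
      also have "\<dots> = \<zero>\<^bsub>N'\<^esub>" unfolding gv using mhom_zero[OF c'(1)[OF b]] .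
      finally show "c b ?v = \<zero>\<^bsub>N\<^esub>" using ker0D[OF g(2) mhom_closed[OF c(1)[OF b] v]] by simp
    qed
    then have "tmap R ?F N P N p (\<lambda>x. x) ?v = \<zero>\<^bsub>tensor R P N\<^esub>" using mhom_zero[OF tmap_mhom[OF p' iN(1)]] by simp
    then show "u = \<zero>\<^bsub>tensor R P N\<^esub>"
      using tmap_comp[OF s' iN(1) p' iN(1) u] tmap_id[OF Pm N(1) u, of "\<lambda>x. p (s x)" "\<lambda>x. x"] s(2) by simp
  qed
qed

lemma ker0_tmap_swap:
  assumes f: "mhom R M M' f" and g: "mhom R N N' g"
    and k: "ker0 (tensor R M N) (tensor R M' N') (tmap R M N M' N' f g)"
  shows "ker0 (tensor R N M) (tensor R N' M') (tmap R N M N' M' g f)"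
  unfolding ker0_def
proof (intro ballI impI)
  note m = mhom_dom[OF f] mhom_dom[OF g] mhom_cod[OF f] mhom_cod[OF g]
  fix u assume u: "u \<in> tens R N M" and gu: "tmap R N M N' M' g f u = \<zero>\<^bsub>tensor R N' M'\<^esub>"
  have u': "tswap R N M u \<in> tens R M N" by (rule mhom_closed[OF tswap_mhom[OF m(2,1)] u])
  have "tmap R M N M' N' f g (tswap R N M u) = \<zero>\<^bsub>tensor R M' N'\<^esub>"
    using tswap_tmap[OF g f u] mhom_zero[OF tswap_mhom[OF m(4,3)]] unfolding gu by simp
  then have "tswap R N M u = \<zero>\<^bsub>tensor R M N\<^esub>" by (rule ker0D[OF k u'])
  then show "u = \<zero>\<^bsub>tensor R N M\<^esub>"
    using tswap_tswap[OF m(2,1) u] mhom_zero[OF tswap_mhom[OF m(1,2)]] by simp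
qed

lemma projective_flat_right:
  fixes P :: "('a, 'p) module"
  assumes P: "projective R P" and g: "mhom R N N' g" "ker0 N N' g"
  shows "ker0 (tensor R N P) (tensor R N' P) (tmap R N P N' P g (\<lambda>x. x))"
  by (rule ker0_tmap_swap[OF mhom_id[OF projective_module[OF P]] g(1) projective_flat_left[OF P g]])

lemma tensor_ses_left:
  fixes P :: "('a, 'p) module"
  assumes P: "projective R P" and s: "ses R A B C f g"
  shows "ses R (tensor R P A) (tensor R P B) (tensor R P C) (tmap R P A P B (\<lambda>x. x) f) (tmap R P B P C (\<lambda>x. x) g)"
proof (rule sesI)
  note d = sesD[OF s]
  note Pm = projective_module[OF P]
  note i = mhom_id[OF Pm]
  note m = mhom_dom[OF d(1)] mhom_cod[OF d(1)] mhom_cod[OF d(2)]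
  show f: "mhom R (tensor R P A) (tensor R P B) (tmap R P A P B (\<lambda>x. x) f)" by (rule tmap_mhom[OF i d(1)])
  show g: "mhom R (tensor R P B) (tensor R P C) (tmap R P B P C (\<lambda>x. x) g)" by (rule tmap_mhom[OF i d(2)])
  show "ker0 (tensor R P A) (tensor R P B) (tmap R P A P B (\<lambda>x. x) f)" by (rule projective_flat_left[OF P d(1,3)])
  show "\<exists>b\<in>tens R P B. tmap R P B P C (\<lambda>x. x) g b = c" if "c \<in> tens R P C" for c
  proof -
    have "c \<in> tmap R P B P C (\<lambda>x. x) g ` tens R P B" using tmap_surj[OF i d(2) _ d(4)] that by simp
    then show ?thesis by blast
  qed
  show "\<exists>a\<in>tens R P A. b = tmap R P A P B (\<lambda>x. x) f a"
    if "b \<in> tens R P B" "tmap R P B P C (\<lambda>x. x) g b = \<zero>\<^bsub>tensor R P C\<^esub>" for b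
    by (rule tensor_right_exact_right[OF d(1,2,4,5) Pm that])
  fix a assume a: "a \<in> tens R P A"
  show "tmap R P B P C (\<lambda>x. x) g (tmap R P A P B (\<lambda>x. x) f a) = \<zero>\<^bsub>tensor R P C\<^esub>"
    unfolding tmap_comp[OF i d(1) i d(2) a]
    by (rule tensor_mhom_ext[OF Pm m(1) tmap_mhom[OF i mhom_comp[OF d(1,2)]] mhom_0[OF tensor_is_module[OF Pm m(1)] tensor_is_module[OF Pm m(3)]] _ a])
     (simp add: tmap_pure[OF i mhom_comp[OF d(1,2)]] d(6) pure_tensor_zero[OF Pm m(3)])
qed

text \<open>A chase in the three by three diagram of tensor products. Lift \<open>z\<close> to
  \<open>A \<otimes> G\<close>; its image in \<open>B \<otimes> G\<close> comes from some
  \<open>u\<close> in \<open>B \<otimes> K\<close>, and the image of \<open>u\<close> in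
  \<open>C \<otimes> K\<close> vanishes by \<open>CK\<close>. So \<open>u\<close> comes from
  \<open>A \<otimes> K\<close>, by \<open>AG\<close> the lift of \<open>z\<close> does too, and
  \<open>z = 0\<close> follows. For flat \<open>G\<close> the assumption \<open>CK\<close> says
  \<open>Tor\<^sub>1(C, N) = 0\<close>.\<close>

lemma tensor_snake:
  assumes s: "ses R A B C f g" and t: "ses R K G N k e"
    and CK: "ker0 (tensor R C K) (tensor R C G) (tmap R C K C G (\<lambda>x. x) k)"
    and AG: "ker0 (tensor R A G) (tensor R B G) (tmap R A G B G f (\<lambda>x. x))"
  shows "ker0 (tensor R A N) (tensor R B N) (tmap R A N B N f (\<lambda>x. x))"
  unfolding ker0_def
proof (intro ballI impI)
  note d = sesD[OF s] and e = sesD[OF t]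
  note A = mhom_dom[OF d(1)] and B = mhom_cod[OF d(1)] and C = mhom_cod[OF d(2)]
    and K = mhom_dom[OF e(1)] and G = mhom_cod[OF e(1)] and N = mhom_cod[OF e(2)]
  note iA = mhom_id[OF A] and iB = mhom_id[OF B] and iC = mhom_id[OF C]
   and iK = mhom_id[OF K] and iG = mhom_id[OF G] and iN = mhom_id[OF N]
  fix z assume z: "z \<in> tens R A N" and fz: "tmap R A N B N f (\<lambda>x. x) z = \<zero>\<^bsub>tensor R B N\<^esub>"
  have "z \<in> tmap R A G A N (\<lambda>x. x) e ` tens R A G" using tmap_surj[OF iA e(2) _ e(4)] z by simp
  then obtain y where y: "y \<in> tens R A G" "z = tmap R A G A N (\<lambda>x. x) e y" by blast
  let ?y = "tmap R A G B G f (\<lambda>x. x) y"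
  have y': "?y \<in> tens R B G" by (rule mhom_closed[OF tmap_mhom[OF d(1) iG] y(1)])
  have "tmap R B G B N (\<lambda>x. x) e ?y = \<zero>\<^bsub>tensor R B N\<^esub>"
    using fz unfolding y(2) tmap_comp[OF iA e(2) d(1) iN y(1)] tmap_comp[OF d(1) iG iB e(2) y(1)] .
  from tensor_right_exact_right[OF e(1,2,4,5) B y' this] obtain u
    where u: "u \<in> tens R B K" "?y = tmap R B K B G (\<lambda>x. x) k u" by blast
  let ?u = "tmap R B K C K g (\<lambda>x. x) u"
  have u': "?u \<in> tens R C K" by (rule mhom_closed[OF tmap_mhom[OF d(2) iK] u(1)])
  have "tmap R C K C G (\<lambda>x. x) k ?u = tmap R B G C G g (\<lambda>x. x) ?y"
    unfolding u(2) tmap_comp[OF d(2) iK iC e(1) u(1)] tmap_comp[OF iB e(1) d(2) iG u(1)] ..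
  also have "\<dots> = tmap R A G C G (\<lambda>x. g (f x)) (\<lambda>x. x) y"
    by (rule tmap_comp[OF d(1) iG d(2) iG y(1)])
  also have "\<dots> = tmap R A G C G (\<lambda>_. \<zero>\<^bsub>C\<^esub>) (\<lambda>x. x) y"
    by (rule tmap_cong[OF mhom_0[OF A C] iG _ _ y(1)]) (auto simp: d(6))
  also have "\<dots> = \<zero>\<^bsub>tensor R C G\<^esub>" by (rule tmap_0_left[OF A C iG y(1)])
  finally have "?u = \<zero>\<^bsub>tensor R C K\<^esub>" by (rule ker0D[OF CK u'])
  from tensor_right_exact_left[OF d(1,2,4,5) K u(1) this] obtain w
    where w: "w \<in> tens R A K" "u = tmap R A K B K f (\<lambda>x. x) w" by blast
  let ?w = "tmap R A K A G (\<lambda>x. x) k w"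
  have w': "?w \<in> tens R A G" by (rule mhom_closed[OF tmap_mhom[OF iA e(1)] w(1)])
  have "tmap R A G B G f (\<lambda>x. x) ?w = ?y"
    unfolding u(2) w(2) tmap_comp[OF iA e(1) d(1) iG w(1)] tmap_comp[OF d(1) iK iB e(1) w(1)] ..
  then have "?w = y" using mhom_eq_iff[OF tmap_mhom[OF d(1) iG] AG w' y(1)] by simp
  then have "z = tmap R A K A N (\<lambda>x. x) (\<lambda>x. e (k x)) w"
    unfolding y(2) using tmap_comp[OF iA e(1) iA e(2) w(1)] by simp
  also have "\<dots> = \<zero>\<^bsub>tensor R A N\<^esub>"
    by (rule tensor_mhom_ext[OF A K tmap_mhom[OF iA mhom_comp[OF e(1,2)]] mhom_0[OF tensor_is_module[OF A K] tensor_is_module[OF A N]] _ w(1)])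
     (simp add: tmap_pure[OF iA mhom_comp[OF e(1,2)]] e(6) pure_tensor_zero[OF A N])
  finally show "z = \<zero>\<^bsub>tensor R A N\<^esub>" .
qed

text \<open>The same chase with the two sequences interchanged. When \<open>B\<close> and
  \<open>G\<close> are flat, it expresses that \<open>Tor\<^sub>1(C, N)\<close> can be read off from
  either sequence.\<close>

lemma tensor_snake_flip:
  assumes s: "ses R A B C f g" and t: "ses R K G N k e"
    and AN: "ker0 (tensor R A N) (tensor R B N) (tmap R A N B N f (\<lambda>x. x))"
    and BK: "ker0 (tensor R B K) (tensor R B G) (tmap R B K B G (\<lambda>x. x) k)"
  shows "ker0 (tensor R C K) (tensor R C G) (tmap R C K C G (\<lambda>x. x) k)"
proof -
  note d = sesD[OF s] and e = sesD[OF t]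
  note B = mhom_cod[OF d(1)] and C = mhom_cod[OF d(2)] and N = mhom_cod[OF e(2)]
  show ?thesis
    by (rule ker0_tmap_swap[OF e(1) mhom_id[OF C]],
        rule tensor_snake[OF t s ker0_tmap_swap[OF d(1) mhom_id[OF N] AN] ker0_tmap_swap[OF mhom_id[OF B] e(1) BK]])
qed

subsection \<open>Powers of a module\<close>

lemma mod_power_simps:
  "v \<in> carrier (mod_power M a) \<longleftrightarrow> v \<in> {..<a} \<rightarrow>\<^sub>E carrier M"
  "\<zero>\<^bsub>mod_power M a\<^esub> = (\<lambda>i\<in>{..<a}. \<zero>\<^bsub>M\<^esub>)"
  "v \<oplus>\<^bsub>mod_power M a\<^esub> w = (\<lambda>i\<in>{..<a}. v i \<oplus>\<^bsub>M\<^esub> w i)"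
  "r \<odot>\<^bsub>mod_power M a\<^esub> v = (\<lambda>i\<in>{..<a}. r \<odot>\<^bsub>M\<^esub> v i)"
  by (simp_all add: mod_power_def)

lemma mod_power_eqI:
  assumes "v \<in> carrier (mod_power M a)" "w \<in> carrier (mod_power M a)" "\<And>i. i < a \<Longrightarrow> v i = w i"
  shows "v = w"
  using assms by (intro PiE_ext[of v "{..<a}" "\<lambda>_. carrier M"]) (auto simp: mod_power_simps)

lemma mod_power_is_module:
  assumes "module R M"
  shows "module R (mod_power M a)"
proof -
  interpret M: module R M by fact
  note s = mod_power_simps
  have c: "v i \<in> carrier M" if "v \<in> carrier (mod_power M a)" "i < a" for v i
    using that by (auto simp: s)
  have e: "v \<in> extensional {..<a}" if "v \<in> carrier (mod_power M a)" for v
    using that by (auto simp: s PiE_def)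
  show ?thesis
  proof (rule moduleI)
    show "abelian_group (mod_power M a)"
    proof (rule abelian_groupI)
      fix v assume v: "v \<in> carrier (mod_power M a)"
      show "\<exists>w\<in>carrier (mod_power M a). w \<oplus>\<^bsub>mod_power M a\<^esub> v = \<zero>\<^bsub>mod_power M a\<^esub>"
        using c[OF v] by (intro bexI[of _ "\<lambda>i\<in>{..<a}. \<ominus>\<^bsub>M\<^esub> v i"]) (auto simp: s M.l_neg intro!: restrict_ext)
      show "\<zero>\<^bsub>mod_power M a\<^esub> \<oplus>\<^bsub>mod_power M a\<^esub> v = v"
        using c[OF v] e[OF v] by (auto simp: s intro!: extensionalityI[of _ "{..<a}"])
      fix w assume w: "w \<in> carrier (mod_power M a)"
      show "v \<oplus>\<^bsub>mod_power M a\<^esub> w \<in> carrier (mod_power M a)"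
        using c[OF v] c[OF w] by (auto simp: s)
      show "v \<oplus>\<^bsub>mod_power M a\<^esub> w = w \<oplus>\<^bsub>mod_power M a\<^esub> v"
        using c[OF v] c[OF w] by (auto simp: s M.a_ac intro!: restrict_ext)
      fix u assume u: "u \<in> carrier (mod_power M a)"
      show "v \<oplus>\<^bsub>mod_power M a\<^esub> w \<oplus>\<^bsub>mod_power M a\<^esub> u = v \<oplus>\<^bsub>mod_power M a\<^esub> (w \<oplus>\<^bsub>mod_power M a\<^esub> u)"
        using c[OF v] c[OF w] c[OF u] by (auto simp: s M.a_ac intro!: restrict_ext)
    qed (auto simp: s)
  next
    fix r q v assume r: "r \<in> carrier R" "q \<in> carrier R" and v: "v \<in> carrier (mod_power M a)"
    show "(r \<otimes>\<^bsub>R\<^esub> q) \<odot>\<^bsub>mod_power M a\<^esub> v = r \<odot>\<^bsub>mod_power M a\<^esub> (q \<odot>\<^bsub>mod_power M a\<^esub> v)"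
      "(r \<oplus>\<^bsub>R\<^esub> q) \<odot>\<^bsub>mod_power M a\<^esub> v = r \<odot>\<^bsub>mod_power M a\<^esub> v \<oplus>\<^bsub>mod_power M a\<^esub> q \<odot>\<^bsub>mod_power M a\<^esub> v"
      using c[OF v] r by (auto simp: s M.smult_assoc1 M.smult_l_distr intro!: restrict_ext)
  next
    fix r v assume r: "r \<in> carrier R" and v: "v \<in> carrier (mod_power M a)"
    show "r \<odot>\<^bsub>mod_power M a\<^esub> v \<in> carrier (mod_power M a)"
      using c[OF v] r by (auto simp: s)
    fix w assume w: "w \<in> carrier (mod_power M a)"
    show "r \<odot>\<^bsub>mod_power M a\<^esub> (v \<oplus>\<^bsub>mod_power M a\<^esub> w) = r \<odot>\<^bsub>mod_power M a\<^esub> v \<oplus>\<^bsub>mod_power M a\<^esub> r \<odot>\<^bsub>mod_power M a\<^esub> w"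
      using c[OF v] c[OF w] r by (auto simp: s M.smult_r_distr intro!: restrict_ext)
  next
    fix v assume v: "v \<in> carrier (mod_power M a)"
    show "\<one>\<^bsub>R\<^esub> \<odot>\<^bsub>mod_power M a\<^esub> v = v"
      using c[OF v] e[OF v] by (auto simp: s intro!: extensionalityI[of _ "{..<a}"])
  qed (rule M.R.is_cring)
qed

definition power_inj :: "('a, 'm, 's) module_scheme \<Rightarrow> nat \<Rightarrow> nat \<Rightarrow> 'm \<Rightarrow> nat \<Rightarrow> 'm" where
  "power_inj M a t x = (\<lambda>i\<in>{..<a}. if i = t then x else \<zero>\<^bsub>M\<^esub>)"

lemma power_proj_mhom: "module R M \<Longrightarrow> t < a \<Longrightarrow> mhom R (mod_power M a) M (\<lambda>v. v t)"
  by (intro mhomI mod_power_is_module) (auto simp: mod_power_simps)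

lemma power_inj_mhom:
  assumes "module R M"
  shows "mhom R M (mod_power M a) (power_inj M a t)"
proof -
  interpret M: module R M by fact
  show ?thesis
    by (intro mhomI mod_power_is_module assms) (auto simp: mod_power_simps power_inj_def intro!: restrict_ext)
qed

lemma power_mhomI:
  assumes "module R K" "module R M" "\<And>t. t < a \<Longrightarrow> mhom R K M (f t)"
  shows "mhom R K (mod_power M a) (\<lambda>x. \<lambda>t\<in>{..<a}. f t x)"
  using mhomD[OF assms(3)]
  by (intro mhomI mod_power_is_module assms(1,2)) (auto simp: mod_power_simps intro!: restrict_ext)

text \<open>Truncating to the first \<open>k\<close> coordinates interpolates between \<open>0\<close> and the identity.\<close>

lemma tensor_power_joint_ker0:
  assumes M: "module R M" and N: "module R N" and u: "u \<in> tens R (mod_power M a) N"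
    and z: "\<And>t. t < a \<Longrightarrow> tmap R (mod_power M a) N M N (\<lambda>v. v t) (\<lambda>x. x) u = \<zero>\<^bsub>tensor R M N\<^esub>"
  shows "u = \<zero>\<^bsub>tensor R (mod_power M a) N\<^esub>"
proof -
  interpret M: module R M by (rule M)
  let ?P = "mod_power M a"
  have P: "module R ?P" by (rule mod_power_is_module[OF M])
  interpret P: module R ?P by (rule P)
  interpret T: module R "tensor R ?P N" by (rule tensor_is_module[OF P N])
  note i = mhom_id[OF N]
  define e where "e k v = (\<lambda>i\<in>{..<a}. if i < k then v i else \<zero>\<^bsub>M\<^esub>)" for k v
  have e: "mhom R ?P ?P (e k)" for k
    unfolding e_def
  proof (rule power_mhomI[OF P M])
    fix t assume "t < a"
    then show "mhom R ?P M (\<lambda>v. if t < k then v t else \<zero>\<^bsub>M\<^esub>)"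
      using power_proj_mhom[OF M] mhom_0[OF P M] by (cases "t < k") simp_all
  qed
  have "tmap R ?P N ?P N (e k) (\<lambda>x. x) u = \<zero>\<^bsub>tensor R ?P N\<^esub>" if "k \<le> a" for k
    using that
  proof (induction k)
    case 0
    have "tmap R ?P N ?P N (e 0) (\<lambda>x. x) u = tmap R ?P N ?P N (\<lambda>_. \<zero>\<^bsub>?P\<^esub>) (\<lambda>x. x) u"
      by (rule tmap_cong[OF mhom_0[OF P P] i _ _ u]) (auto simp: e_def mod_power_simps)
    then show ?case using tmap_0_left[OF P P i u] by simp
  next
    case (Suc k)
    then have k: "k < a" by simp
    note c = mhom_comp[OF power_proj_mhom[OF M k] power_inj_mhom[OF M, of a k]]
    have "tmap R ?P N ?P N (e (Suc k)) (\<lambda>x. x) u =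
        tmap R ?P N ?P N (\<lambda>v. e k v \<oplus>\<^bsub>?P\<^esub> power_inj M a k (v k)) (\<lambda>x. x) u"
    proof (rule tmap_cong[OF mhom_sum[OF e c] i _ _ u])
      fix v assume v: "v \<in> carrier ?P"
      show "e (Suc k) v = e k v \<oplus>\<^bsub>?P\<^esub> power_inj M a k (v k)"
      proof (rule mod_power_eqI[OF mhom_closed[OF e v] mhom_closed[OF mhom_sum[OF e c] v]])
        fix t assume t: "t < a"
        have "v t \<in> carrier M" using v t by (auto simp: mod_power_simps)
        then show "e (Suc k) v t = (e k v \<oplus>\<^bsub>?P\<^esub> power_inj M a k (v k)) t"
          using t by (cases "t = k") (simp_all add: e_def power_inj_def mod_power_simps(3) less_Suc_eq)
      qed
    qed simp
    also have "\<dots> = tmap R ?P N ?P N (e k) (\<lambda>x. x) u \<oplus>\<^bsub>tensor R ?P N\<^esub> tmap R ?P N ?P N (\<lambda>v. power_inj M a k (v k)) (\<lambda>x. x) u"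
      by (rule tmap_add_left[OF e c i u])
    also have "tmap R ?P N ?P N (\<lambda>v. power_inj M a k (v k)) (\<lambda>x. x) u = \<zero>\<^bsub>tensor R ?P N\<^esub>"
      unfolding tmap_comp[OF power_proj_mhom[OF M k] i power_inj_mhom[OF M] i u, symmetric] z[OF k]
      by (rule mhom_zero[OF tmap_mhom[OF power_inj_mhom[OF M] i]])
    finally show ?case using Suc by simp
  qed
  from this[of a] have "tmap R ?P N ?P N (e a) (\<lambda>x. x) u = \<zero>\<^bsub>tensor R ?P N\<^esub>" by simp
  moreover have "e a v = v" if "v \<in> carrier ?P" for v
    using that by (intro mod_power_eqI[of _ M a] mhom_closed[OF e]) (auto simp: e_def)
  ultimately show ?thesis using tmap_id[OF P N u, of "e a" "\<lambda>x. x"] by simp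
qed

text \<open>The comparison of \<open>M\<^sup>a \<otimes> N\<close> with
  \<open>(M \<otimes> N)\<^sup>a\<close> by coordinates. Injectivity is
  \<open>tensor_power_joint_ker0\<close>; for surjectivity a preimage is completed one coordinate at
  a time with the help of \<open>power_inj\<close>.\<close>

lemma tensor_power_iso:
  fixes a :: nat
  assumes M: "module R M" and N: "module R N"
  defines "\<theta> \<equiv> \<lambda>u. \<lambda>t\<in>{..<a}. tmap R (mod_power M a) N M N (\<lambda>v. v t) (\<lambda>x. x) u"
  shows "mhom R (tensor R (mod_power M a) N) (mod_power (tensor R M N) a) \<theta>"
    and "ker0 (tensor R (mod_power M a) N) (mod_power (tensor R M N) a) \<theta>"
    and "\<theta> ` tens R (mod_power M a) N = carrier (mod_power (tensor R M N) a)"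
proof -
  interpret M: module R M by (rule M)
  let ?P = "mod_power M a"
  have P: "module R ?P" by (rule mod_power_is_module[OF M])
  have TM: "module R (tensor R M N)" by (rule tensor_is_module[OF M N])
  interpret TM: module R "tensor R M N" by (rule TM)
  interpret T: module R "tensor R ?P N" by (rule tensor_is_module[OF P N])
  note i = mhom_id[OF N] and p = power_proj_mhom[OF M] and q = power_inj_mhom[OF M, of a]
  show h: "mhom R (tensor R ?P N) (mod_power (tensor R M N) a) \<theta>"
    unfolding \<theta>_def by (intro power_mhomI tmap_mhom p i TM T.module_axioms)
  show "ker0 (tensor R ?P N) (mod_power (tensor R M N) a) \<theta>"
    unfolding ker0_def
  proof (intro ballI impI)
    fix u assume u: "u \<in> tens R ?P N" and z: "\<theta> u = \<zero>\<^bsub>mod_power (tensor R M N) a\<^esub>"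
    show "u = \<zero>\<^bsub>tensor R ?P N\<^esub>"
    proof (rule tensor_power_joint_ker0[OF M N u])
      fix t assume "t < a"
      then show "tmap R ?P N M N (\<lambda>v. v t) (\<lambda>x. x) u = \<zero>\<^bsub>tensor R M N\<^esub>"
        using fun_cong[OF z, of t] by (simp add: \<theta>_def mod_power_simps)
    qed
  qed
  show "\<theta> ` tens R ?P N = carrier (mod_power (tensor R M N) a)"
  proof
    show "\<theta> ` tens R ?P N \<subseteq> carrier (mod_power (tensor R M N) a)" using mhom_closed[OF h] by auto
    show "carrier (mod_power (tensor R M N) a) \<subseteq> \<theta> ` tens R ?P N"
    proof
      fix l assume l: "l \<in> carrier (mod_power (tensor R M N) a)"
      then have lt: "l t \<in> tens R M N" if "t < a" for t using that by (auto simp: mod_power_simps)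
      have "\<exists>u\<in>tens R ?P N. \<forall>t<a. tmap R ?P N M N (\<lambda>v. v t) (\<lambda>x. x) u = (if t < k then l t else \<zero>\<^bsub>tensor R M N\<^esub>)"
        if "k \<le> a" for k
        using that
      proof (induction k)
        case 0
        show ?case by (intro bexI[of _ "\<zero>\<^bsub>tensor R ?P N\<^esub>"]) (auto intro!: mhom_zero[OF tmap_mhom[OF p i]])
      next
        case (Suc k)
        then have k: "k < a" by simp
        from Suc obtain u where u: "u \<in> tens R ?P N"
          "\<And>t. t < a \<Longrightarrow> tmap R ?P N M N (\<lambda>v. v t) (\<lambda>x. x) u = (if t < k then l t else \<zero>\<^bsub>tensor R M N\<^esub>)" by auto
        let ?w = "tmap R M N ?P N (power_inj M a k) (\<lambda>x. x) (l k)"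
        have w: "?w \<in> tens R ?P N" by (rule mhom_closed[OF tmap_mhom[OF q i] lt[OF k]])
        have tw: "tmap R ?P N M N (\<lambda>v. v t) (\<lambda>x. x) ?w = (if t = k then l t else \<zero>\<^bsub>tensor R M N\<^esub>)" if t: "t < a" for t
        proof -
          have "tmap R ?P N M N (\<lambda>v. v t) (\<lambda>x. x) ?w = tmap R M N M N (\<lambda>x. power_inj M a k x t) (\<lambda>x. x) (l k)"
            by (rule tmap_comp[OF q i p[OF t] i lt[OF k]])
          also have "\<dots> = (if t = k then l t else \<zero>\<^bsub>tensor R M N\<^esub>)"
          proof (cases "t = k")
            case True
            then show ?thesis using t tmap_id[OF M N lt[OF k], of "\<lambda>x. power_inj M a k x t" "\<lambda>x. x"]
              by (simp add: power_inj_def)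
          next
            case False
            then have "(\<lambda>x. power_inj M a k x t) = (\<lambda>_. \<zero>\<^bsub>M\<^esub>)" using t by (simp add: power_inj_def)
            then show ?thesis using False tmap_0_left[OF M M i lt[OF k]] by simp
          qed
          finally show ?thesis .
        qed
        show ?case
        proof (intro bexI[of _ "u \<oplus>\<^bsub>tensor R ?P N\<^esub> ?w"] allI impI)
          fix t assume t: "t < a"
          show "tmap R ?P N M N (\<lambda>v. v t) (\<lambda>x. x) (u \<oplus>\<^bsub>tensor R ?P N\<^esub> ?w) = (if t < Suc k then l t else \<zero>\<^bsub>tensor R M N\<^esub>)"
            unfolding mhom_add[OF tmap_mhom[OF p[OF t] i] u(1) w] u(2)[OF t] tw[OF t] using lt[OF t] by auto
        qed (use u w in simp)
      qed
      from this[of a] obtain u where u: "u \<in> tens R ?P N"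
        "\<And>t. t < a \<Longrightarrow> tmap R ?P N M N (\<lambda>v. v t) (\<lambda>x. x) u = l t" by auto
      have "\<theta> u = l" by (rule mod_power_eqI[OF mhom_closed[OF h u(1)] l]) (simp add: \<theta>_def u(2))
      then show "l \<in> \<theta> ` tens R ?P N" using u(1) by blast
    qed
  qed
qed

subsection \<open>Cycles, boundaries and homology of complexes\<close>

abbreviation cyc_mod where "cyc_mod X i \<equiv> (cobj X i)\<lparr>carrier := cycles X i\<rparr>"
abbreviation bd_mod where "bd_mod X i \<equiv> (cobj X i)\<lparr>carrier := boundaries X i\<rparr>"

lemma complexD:
  assumes "is_complex R X"
  shows complex_module: "module R (cobj X i)"
    and complex_mhom: "mhom R (cobj X i) (cobj X (i - 1)) (cdiff X i)"
    and complex_mhom1: "mhom R (cobj X (i + 1)) (cobj X i) (cdiff X (i + 1))"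
    and complex_dd: "x \<in> carrier (cobj X (i + 1)) \<Longrightarrow> cdiff X i (cdiff X (i + 1) x) = \<zero>\<^bsub>cobj X (i - 1)\<^esub>"
proof -
  show m: "module R (cobj X i)" for i using assms by (simp add: is_complex_def)
  show "mhom R (cobj X i) (cobj X (i - 1)) (cdiff X i)" for i
    unfolding mhom_def using m assms by (simp add: is_complex_def)
  from this[of "i + 1"] show "mhom R (cobj X (i + 1)) (cobj X i) (cdiff X (i + 1))" by simp
  show "cdiff X i (cdiff X (i + 1) x) = \<zero>\<^bsub>cobj X (i - 1)\<^esub>" if "x \<in> carrier (cobj X (i + 1))"
  proof -
    have "cdiff X (i + 1 - 1) (cdiff X (i + 1) x) = \<zero>\<^bsub>cobj X (i + 1 - 1 - 1)\<^esub>"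
      using assms that unfolding is_complex_def by blast
    then show ?thesis by simp
  qed
qed

lemma cycles_submodule: "is_complex R X \<Longrightarrow> submodule (cycles X i) R (cobj X i)"
  unfolding cycles_def by (rule mhom_kernel_submodule[OF complex_mhom])

lemma boundaries_submodule: "is_complex R X \<Longrightarrow> submodule (boundaries X i) R (cobj X i)"
  unfolding boundaries_def by (rule mhom_image_submodule[OF complex_mhom1])

lemma boundaries_subset_cycles: "is_complex R X \<Longrightarrow> boundaries X i \<subseteq> cycles X i"
  using complex_dd[of R X _ i] mhom_closed[OF complex_mhom1[of R X i]] by (auto simp: boundaries_def cycles_def)

lemma cyc_mod_module: "is_complex R X \<Longrightarrow> module R (cyc_mod X i)"
  by (rule msub_module[OF complex_module cycles_submodule])

lemma bd_mod_module: "is_complex R X \<Longrightarrow> module R (bd_mod X i)"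
  by (rule msub_module[OF complex_module boundaries_submodule])

lemma boundaries_submodule_cycles: "is_complex R X \<Longrightarrow> submodule (boundaries X i) R (cyc_mod X i)"
  by (rule module.module_incl_imp_submodule[OF cyc_mod_module])
    (simp_all add: bd_mod_module boundaries_subset_cycles)

lemma bd_cyc_mhom: "is_complex R X \<Longrightarrow> mhom R (bd_mod X i) (cyc_mod X i) (\<lambda>x. x)"
  using mhom_inclusion[OF cyc_mod_module boundaries_submodule_cycles] by simp

text \<open>Vanishing homology without cosets; \<open>zero_homology_iff_exact_at\<close> connects it
  with the quotient module.\<close>

definition exact_at :: "('a, 'p) mod_complex \<Rightarrow> int \<Rightarrow> bool" where
  "exact_at X i \<longleftrightarrow> cycles X i \<subseteq> boundaries X i"

text \<open>An isomorphism \<open>H\<^sub>i(X) \<cong> L\<close>, without mentioning the quotient.\<close>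

definition homology_iso where
  "homology_iso R X i L \<longleftrightarrow> (\<exists>\<phi>. ses R (bd_mod X i) (cyc_mod X i) L (\<lambda>x. x) \<phi>)"

lemma zero_homology_iff_exact_at:
  assumes X: "is_complex R X"
  shows "zero_module (homology X i) \<longleftrightarrow> exact_at X i"
proof -
  note q = quot_module[OF cyc_mod_module[OF X] boundaries_submodule_cycles[OF X]]
  note z = quot_eq_zero[OF cyc_mod_module[OF X] boundaries_submodule_cycles[OF X]]
  interpret Z: module R "cyc_mod X i" by (rule cyc_mod_module[OF X])
  show ?thesis
    unfolding zero_module_def homology_def exact_at_def
  proof
    assume a: "carrier (quot_module (cyc_mod X i) (boundaries X i)) = {\<zero>\<^bsub>quot_module (cyc_mod X i) (boundaries X i)\<^esub>}"
    show "cycles X i \<subseteq> boundaries X i"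
    proof
      fix x assume x: "x \<in> cycles X i"
      then have "boundaries X i +>\<^bsub>cyc_mod X i\<^esub> x \<in> carrier (quot_module (cyc_mod X i) (boundaries X i))"
        unfolding q(1) by auto
      then show "x \<in> boundaries X i" using z[of x] x unfolding a by simp
    qed
  next
    assume a: "cycles X i \<subseteq> boundaries X i"
    show "carrier (quot_module (cyc_mod X i) (boundaries X i)) = {\<zero>\<^bsub>quot_module (cyc_mod X i) (boundaries X i)\<^esub>}"
    proof
      show "carrier (quot_module (cyc_mod X i) (boundaries X i)) \<subseteq> {\<zero>\<^bsub>quot_module (cyc_mod X i) (boundaries X i)\<^esub>}"
        unfolding q(1) using z a by auto
      show "{\<zero>\<^bsub>quot_module (cyc_mod X i) (boundaries X i)\<^esub>} \<subseteq> carrier (quot_module (cyc_mod X i) (boundaries X i))"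
        unfolding q(1) q(4) using Z.zero_closed by blast
    qed
  qed
qed

lemma homology_iso_of_mod_iso:
  assumes X: "is_complex R X" and L: "module R L" and "mod_iso R (homology X i) L"
  shows "homology_iso R X i L"
proof -
  note C = cyc_mod_module[OF X, of i] and B = boundaries_submodule_cycles[OF X, of i]
  let ?H = "homology X i"
  obtain f where f: "f \<in> mod_hom R ?H L" "bij_betw f (carrier ?H) (carrier L)"
    using assms(3) by (auto simp: mod_iso_def)
  let ?q = "\<lambda>x. boundaries X i +>\<^bsub>cyc_mod X i\<^esub> x"
  have q: "mhom R (cyc_mod X i) ?H ?q" unfolding homology_def by (rule quot_mhom[OF C B])
  have fh: "mhom R ?H L f" using f(1) L mhom_cod[OF q] by (simp add: mhom_def)
  interpret H: module R ?H by (rule mhom_cod[OF q])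
  have f0: "f y = \<zero>\<^bsub>L\<^esub> \<longleftrightarrow> y = \<zero>\<^bsub>?H\<^esub>" if "y \<in> carrier ?H" for y
    using inj_onD[OF bij_betw_imp_inj_on[OF f(2)], of y "\<zero>\<^bsub>?H\<^esub>"] that mhom_zero[OF fh] by auto
  have q0: "?q x = \<zero>\<^bsub>?H\<^esub> \<longleftrightarrow> x \<in> boundaries X i" if "x \<in> cycles X i" for x
    unfolding homology_def using quot_eq_zero[OF C B] that by simp
  have sub: "boundaries X i \<subseteq> cycles X i" by (rule boundaries_subset_cycles[OF X])
  have "ses R (bd_mod X i) (cyc_mod X i) L (\<lambda>x. x) (\<lambda>x. f (?q x))"
  proof (rule sesI[OF bd_cyc_mhom[OF X] mhom_comp[OF q fh]])
    show "ker0 (bd_mod X i) (cyc_mod X i) (\<lambda>x. x)" by (simp add: ker0_def)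
    fix c assume "c \<in> carrier L"
    then obtain y where y: "y \<in> carrier ?H" "f y = c" using bij_betw_imp_surj_on[OF f(2)] by (metis imageE)
    then obtain x where "x \<in> carrier (cyc_mod X i)" "y = ?q x"
      unfolding homology_def quot_carrier[OF C B] by blast
    then show "\<exists>b\<in>carrier (cyc_mod X i). f (?q b) = c" using y by blast
  next
    fix b assume "b \<in> carrier (bd_mod X i)"
    then show "f (?q b) = \<zero>\<^bsub>L\<^esub>" using sub f0 q0 mhom_closed[OF q, of b] by auto
  next
    fix b assume "b \<in> carrier (cyc_mod X i)" "f (?q b) = \<zero>\<^bsub>L\<^esub>"
    then show "\<exists>a\<in>carrier (bd_mod X i). b = a" using f0 q0 mhom_closed[OF q, of b] by auto
  qed
  then show ?thesis unfolding homology_iso_def by blast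
qed

lemma homology_iso_trans:
  assumes h: "homology_iso R X i L" and f: "mhom R L K f" "ker0 L K f" "f ` carrier L = carrier K"
  shows "homology_iso R X i K"
proof -
  obtain \<phi> where \<phi>: "ses R (bd_mod X i) (cyc_mod X i) L (\<lambda>x. x) \<phi>" using h by (auto simp: homology_iso_def)
  note d = sesD[OF \<phi>]
  have "ses R (bd_mod X i) (cyc_mod X i) K (\<lambda>x. x) (\<lambda>x. f (\<phi> x))"
  proof (rule sesI[OF d(1) mhom_comp[OF d(2) f(1)] d(3)])
    fix c assume "c \<in> carrier K"
    then obtain y where "y \<in> carrier L" "f y = c" using f(3) by (metis imageE)
    then show "\<exists>b\<in>carrier (cyc_mod X i). f (\<phi> b) = c" using d(7) by metis
  next
    fix a assume "a \<in> carrier (bd_mod X i)"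
    then show "f (\<phi> a) = \<zero>\<^bsub>K\<^esub>" using d(6) mhom_zero[OF f(1)] by simp
  next
    fix b assume b: "b \<in> carrier (cyc_mod X i)" "f (\<phi> b) = \<zero>\<^bsub>K\<^esub>"
    show "\<exists>a\<in>carrier (bd_mod X i). b = a"
      by (rule d(5)[OF b(1) ker0D[OF f(2) mhom_closed[OF d(2) b(1)] b(2)]])
  qed
  then show ?thesis unfolding homology_iso_def by blast
qed

subsection \<open>Tor-independence\<close>

lemma cycles_ses:
  assumes X: "is_complex R X"
  shows "ses R (cyc_mod X (i + 1)) (cobj X (i + 1)) (bd_mod X i) (\<lambda>x. x) (cdiff X (i + 1))"
proof (rule sesI)
  show "mhom R (cyc_mod X (i + 1)) (cobj X (i + 1)) (\<lambda>x. x)"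
    by (rule mhom_inclusion[OF complex_module[OF X] cycles_submodule[OF X]])
  show "mhom R (cobj X (i + 1)) (bd_mod X i) (cdiff X (i + 1))"
    by (rule mhom_restrict_cod[OF complex_mhom1[OF X] boundaries_submodule[OF X]]) (simp add: boundaries_def)
qed (auto simp: ker0_def cycles_def boundaries_def)

text \<open>\<open>bd_mod D i\<close> is the syzygy of order \<open>i + 1\<close> of
  \<open>N\<close>, so these sequences cut the resolution into single dimension shifts.\<close>

lemma resolution_ses:
  assumes "projective_resolution R D N" "module R N"
  shows "\<exists>\<epsilon>. ses R (bd_mod D 0) (cobj D 0) N (\<lambda>x. x) \<epsilon>"
    and "0 \<le> i \<Longrightarrow> ses R (bd_mod D (i + 1)) (cobj D (i + 1)) (bd_mod D i) (\<lambda>x. x) (cdiff D (i + 1))"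
proof -
  have X: "is_complex R D" using assms(1) by (simp add: projective_resolution_def)
  obtain \<epsilon> where e: "\<epsilon>\<in>mod_hom R (cobj D 0) N" "\<epsilon> ` carrier (cobj D 0) = carrier N"
    "{x \<in> carrier (cobj D 0). \<epsilon> x = \<zero>\<^bsub>N\<^esub>} = boundaries D 0"
    using assms(1) by (auto simp: projective_resolution_def)
  have "ses R (bd_mod D 0) (cobj D 0) N (\<lambda>x. x) \<epsilon>"
  proof (rule sesI)
    show "mhom R (bd_mod D 0) (cobj D 0) (\<lambda>x. x)"
      by (rule mhom_inclusion[OF complex_module[OF X] boundaries_submodule[OF X]])
    show "mhom R (cobj D 0) N \<epsilon>" using complex_module[OF X] assms(2) e(1) by (simp add: mhom_def)
    show "\<exists>b\<in>carrier (cobj D 0). \<epsilon> b = c" if "c \<in> carrier N" for c using e(2) that by (metis imageE)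
    show "\<epsilon> a = \<zero>\<^bsub>N\<^esub>" if "a \<in> carrier (bd_mod D 0)" for a using that e(3) by auto
    show "\<exists>a\<in>carrier (bd_mod D 0). b = a" if "b \<in> carrier (cobj D 0)" "\<epsilon> b = \<zero>\<^bsub>N\<^esub>" for b
      using that e(3) by auto
  qed (simp add: ker0_def)
  then show "\<exists>\<epsilon>. ses R (bd_mod D 0) (cobj D 0) N (\<lambda>x. x) \<epsilon>" by blast
  assume "0 \<le> i"
  then have "cycles D (i + 1) = boundaries D (i + 1)" using assms(1) by (simp add: projective_resolution_def)
  then show "ses R (bd_mod D (i + 1)) (cobj D (i + 1)) (bd_mod D i) (\<lambda>x. x) (cdiff D (i + 1))"
    using cycles_ses[OF X, of i] by simp
qed

lemma resolution_projective: "projective_resolution R D N \<Longrightarrow> projective R (cobj D i)"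
  and resolution_complex: "projective_resolution R D N \<Longrightarrow> is_complex R D"
  by (simp_all add: projective_resolution_def)

lemma bd_mod_inclusion: "is_complex R X \<Longrightarrow> mhom R (bd_mod X i) (cobj X i) (\<lambda>x. x)"
  by (rule mhom_inclusion[OF complex_module boundaries_submodule])

lemma cyc_mod_inclusion: "is_complex R X \<Longrightarrow> mhom R (cyc_mod X i) (cobj X i) (\<lambda>x. x)"
  by (rule mhom_inclusion[OF complex_module cycles_submodule])

text \<open>For a projective resolution \<open>D\<close> of \<open>N\<close> this says \<open>Tor\<^sub>j(Q, N) = 0\<close> for \<open>j \<ge> 1\<close>, by dimension shifting.\<close>

definition tor_free where
  "tor_free R D Q \<longleftrightarrow> module R Q \<and> (\<forall>i\<ge>0.
     ker0 (tensor R Q (bd_mod D i)) (tensor R Q (cobj D i)) (tmap R Q (bd_mod D i) Q (cobj D i) (\<lambda>x. x) (\<lambda>x. x)))"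

text \<open>The two ways round the square from \<open>A \<otimes> K\<close> to
  \<open>B \<otimes> G\<close> agree; if one composite is injective, so is the first map of the
  other.\<close>

lemma ker0_square:
  assumes f: "mhom R A B f" and g: "mhom R K G g"
    and k: "ker0 (tensor R A K) (tensor R A G) (tmap R A K A G (\<lambda>x. x) g)"
    and l: "ker0 (tensor R A G) (tensor R B G) (tmap R A G B G f (\<lambda>x. x))"
  shows "ker0 (tensor R A K) (tensor R B K) (tmap R A K B K f (\<lambda>x. x))"
proof -
  note i = mhom_id[OF mhom_dom[OF f]] mhom_id[OF mhom_cod[OF f]] mhom_id[OF mhom_dom[OF g]] mhom_id[OF mhom_cod[OF g]]
  have "ker0 (tensor R A K) (tensor R B G) (\<lambda>u. tmap R A G B G f (\<lambda>x. x) (tmap R A K A G (\<lambda>x. x) g u))"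
    by (rule ker0_comp[OF tmap_mhom[OF i(1) g] k l])
  then have "ker0 (tensor R A K) (tensor R B G) (\<lambda>u. tmap R B K B G (\<lambda>x. x) g (tmap R A K B K f (\<lambda>x. x) u))"
    unfolding ker0_def using tmap_comp[OF i(1) g f i(4)] tmap_comp[OF f i(3) i(2) g] by simp
  then show ?thesis by (rule ker0_comp_rev[OF tmap_mhom[OF i(2) g]])
qed

lemma ker0_square':
  assumes f: "mhom R A B f" and g: "mhom R K G g"
    and k: "ker0 (tensor R A K) (tensor R B K) (tmap R A K B K f (\<lambda>x. x))"
    and l: "ker0 (tensor R B K) (tensor R B G) (tmap R B K B G (\<lambda>x. x) g)"
  shows "ker0 (tensor R A K) (tensor R A G) (tmap R A K A G (\<lambda>x. x) g)"
proof -
  note i = mhom_id[OF mhom_dom[OF f]] mhom_id[OF mhom_cod[OF f]] mhom_id[OF mhom_dom[OF g]] mhom_id[OF mhom_cod[OF g]]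
  have "ker0 (tensor R A K) (tensor R B G) (\<lambda>u. tmap R B K B G (\<lambda>x. x) g (tmap R A K B K f (\<lambda>x. x) u))"
    by (rule ker0_comp[OF tmap_mhom[OF f i(3)] k l])
  then have "ker0 (tensor R A K) (tensor R B G) (\<lambda>u. tmap R A G B G f (\<lambda>x. x) (tmap R A K A G (\<lambda>x. x) g u))"
    unfolding ker0_def using tmap_comp[OF i(1) g f i(4)] tmap_comp[OF f i(3) i(2) g] by simp
  then show ?thesis by (rule ker0_comp_rev[OF tmap_mhom[OF f i(4)]])
qed

text \<open>The part of the long exact Tor sequence that is needed: \<open>Tor_j(A, N)\<close> lies
  between \<open>Tor_(j+1)(C, N)\<close> and \<open>Tor_j(B, N)\<close>, and the kernel of
  \<open>A \<otimes> N \<rightarrow> B \<otimes> N\<close> is an image of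
  \<open>Tor_1(C, N)\<close>. Each syzygy sequence of \<open>N\<close> is fed to
  \<open>tensor_snake\<close>.\<close>

lemma tor_free_kernel:
  assumes D: "projective_resolution R D N" and N: "module R N" and s: "ses R A B C f g"
    and B: "tor_free R D B" and C: "tor_free R D C"
  shows "tor_free R D A" and "ker0 (tensor R A N) (tensor R B N) (tmap R A N B N f (\<lambda>x. x))"
proof -
  note d = sesD[OF s]
  note P = resolution_projective[OF D]
  have flat: "ker0 (tensor R A (cobj D i)) (tensor R B (cobj D i)) (tmap R A (cobj D i) B (cobj D i) f (\<lambda>x. x))" for i
    by (rule projective_flat_right[OF P d(1,3)])
  have Ci: "ker0 (tensor R C (bd_mod D i)) (tensor R C (cobj D i)) (tmap R C (bd_mod D i) C (cobj D i) (\<lambda>x. x) (\<lambda>x. x))"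
    and Bi: "ker0 (tensor R B (bd_mod D i)) (tensor R B (cobj D i)) (tmap R B (bd_mod D i) B (cobj D i) (\<lambda>x. x) (\<lambda>x. x))"
    if "0 \<le> i" for i using B C that unfolding tor_free_def by blast+
  obtain \<epsilon> where e: "ses R (bd_mod D 0) (cobj D 0) N (\<lambda>x. x) \<epsilon>" using resolution_ses(1)[OF D N] by blast
  show "ker0 (tensor R A N) (tensor R B N) (tmap R A N B N f (\<lambda>x. x))"
    by (rule tensor_snake[OF s e Ci flat]) simp
  show "tor_free R D A"
    unfolding tor_free_def
  proof (intro conjI allI impI)
    show "module R A" by (rule mhom_dom[OF d(1)])
    fix i :: int assume i: "0 \<le> i"
    \<comment> \<open>The snake for the syzygy of order \<open>i + 1\<close> uses the vanishing for
      \<open>C\<close> at index \<open>i + 1\<close>, one more than the index at which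
      \<open>A\<close> is treated.\<close>
    have AB: "ker0 (tensor R A (bd_mod D i)) (tensor R B (bd_mod D i)) (tmap R A (bd_mod D i) B (bd_mod D i) f (\<lambda>x. x))"
      by (rule tensor_snake[OF s resolution_ses(2)[OF D N i] Ci flat]) (use i in simp)
    show "ker0 (tensor R A (bd_mod D i)) (tensor R A (cobj D i)) (tmap R A (bd_mod D i) A (cobj D i) (\<lambda>x. x) (\<lambda>x. x))"
      by (rule ker0_square'[OF d(1) bd_mod_inclusion[OF resolution_complex[OF D]] AB Bi[OF i]])
  qed
qed

lemma projective_tor_free:
  fixes P :: "('a, 'p) module"
  assumes D: "projective_resolution R D N" and P: "projective R P"
  shows "tor_free R D P"
  unfolding tor_free_def
  by (intro conjI allI impI projective_module[OF P] projective_flat_left[OF P]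
      bd_mod_inclusion[OF resolution_complex[OF D]]) (simp add: ker0_def)

lemma zero_tensor:
  assumes A: "module R A" and N: "module R N" and z: "zero_module A" and u: "u \<in> tens R A N"
  shows "u = \<zero>\<^bsub>tensor R A N\<^esub>"
proof -
  have "tmap R A N A N (\<lambda>x. x) (\<lambda>x. x) u = tmap R A N A N (\<lambda>x. \<zero>\<^bsub>A\<^esub>) (\<lambda>x. x) u"
    by (rule tmap_cong[OF mhom_0[OF A A] mhom_id[OF N] _ _ u]) (use z in \<open>auto simp: zero_module_def\<close>)
  then show ?thesis using tmap_id[OF A N u] tmap_0_left[OF A A mhom_id[OF N] u] by simp
qed

lemma zero_tor_free:
  assumes D: "projective_resolution R D N" and A: "module R A" and z: "zero_module A"
  shows "tor_free R D A"
  unfolding tor_free_def ker0_def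
  by (intro conjI allI impI A ballI zero_tensor[OF A _ z]) (auto simp: bd_mod_module resolution_complex[OF D])

text \<open>Injectivity is checked after projecting to each coordinate, where it is the assumption
  on \<open>M\<close>.\<close>

lemma power_tor_free:
  assumes D: "projective_resolution R D N" and M: "tor_free R D M"
  shows "tor_free R D (mod_power M a)"
  unfolding tor_free_def
proof (intro conjI allI impI)
  have Mm: "module R M" using M by (simp add: tor_free_def)
  note X = resolution_complex[OF D]
  show P: "module R (mod_power M a)" by (rule mod_power_is_module[OF Mm])
  fix i :: int assume i: "0 \<le> i"
  let ?B = "bd_mod D i" and ?D = "cobj D i" and ?P = "mod_power M a"
  have Bm: "module R ?B" and Dm: "module R ?D" using bd_mod_module[OF X] complex_module[OF X] by auto
  note iP = mhom_id[OF P] and iM = mhom_id[OF Mm] and iB = mhom_id[OF Bm] and iD = mhom_id[OF Dm] and b = bd_mod_inclusion[OF X, of i]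
  show "ker0 (tensor R ?P ?B) (tensor R ?P ?D) (tmap R ?P ?B ?P ?D (\<lambda>x. x) (\<lambda>x. x))"
    unfolding ker0_def
  proof (intro ballI impI)
    fix u assume u: "u \<in> tens R ?P ?B" and z: "tmap R ?P ?B ?P ?D (\<lambda>x. x) (\<lambda>x. x) u = \<zero>\<^bsub>tensor R ?P ?D\<^esub>"
    show "u = \<zero>\<^bsub>tensor R ?P ?B\<^esub>"
    proof (rule tensor_power_joint_ker0[OF Mm Bm u])
      fix t assume t: "t < a"
      note p = power_proj_mhom[OF Mm t]
      let ?v = "tmap R ?P ?B M ?B (\<lambda>v. v t) (\<lambda>x. x) u"
      have v: "?v \<in> tens R M ?B" by (rule mhom_closed[OF tmap_mhom[OF p iB] u])
      have "tmap R M ?B M ?D (\<lambda>x. x) (\<lambda>x. x) ?v = tmap R ?P ?D M ?D (\<lambda>v. v t) (\<lambda>x. x) (tmap R ?P ?B ?P ?D (\<lambda>x. x) (\<lambda>x. x) u)"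
        unfolding tmap_comp[OF p iB iM b u] tmap_comp[OF iP b p iD u] ..
      also have "\<dots> = \<zero>\<^bsub>tensor R M ?D\<^esub>" unfolding z by (rule mhom_zero[OF tmap_mhom[OF p iD]])
      finally have "tmap R M ?B M ?D (\<lambda>x. x) (\<lambda>x. x) ?v = \<zero>\<^bsub>tensor R M ?D\<^esub>" .
      moreover have "ker0 (tensor R M ?B) (tensor R M ?D) (tmap R M ?B M ?D (\<lambda>x. x) (\<lambda>x. x))"
        using M i unfolding tor_free_def by blast
      ultimately show "?v = \<zero>\<^bsub>tensor R M ?B\<^esub>" by (intro ker0D[OF _ v])
    qed
  qed
qed

text \<open>Balancing: one step trades a syzygy of the first argument for one of the second.\<close>

lemma tensor_syzygy_shift:
  assumes s: "ses R A B C f g" and t: "ses R K G N k e" and B: "projective R B"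
    and AN: "ker0 (tensor R A N) (tensor R B N) (tmap R A N B N f (\<lambda>x. x))"
  shows "ker0 (tensor R C K) (tensor R C G) (tmap R C K C G (\<lambda>x. x) k)"
  by (rule tensor_snake_flip[OF s t AN projective_flat_left[OF B sesD(1,3)[OF t]]])

text \<open>Balancing of Tor. The assumption is vanishing computed from a resolution of
  \<open>M\<close>, as in the definition of \<open>Tor\<close>; the conclusion is vanishing computed
  from a resolution of \<open>N\<close>, the form that \<open>tor_free_kernel\<close> can carry to
  other first arguments.\<close>

lemma tor_free_of_syzygies:
  assumes F: "projective_resolution R F M" and M: "module R M" and D: "projective_resolution R D N" and N: "module R N"
    and inj: "\<And>j. 0 \<le> j \<Longrightarrow> ker0 (tensor R (bd_mod F j) N) (tensor R (cobj F j) N) (tmap R (bd_mod F j) N (cobj F j) N (\<lambda>x. x) (\<lambda>x. x))"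
  shows "tor_free R D M"
proof -
  note PF = resolution_projective[OF F] and PD = resolution_projective[OF D]
  note CF = resolution_complex[OF F] and CD = resolution_complex[OF D]
  note bF = bd_mod_inclusion[OF CF] and bD = bd_mod_inclusion[OF CD]
  obtain \<epsilon> where eD: "ses R (bd_mod D 0) (cobj D 0) N (\<lambda>x. x) \<epsilon>" using resolution_ses(1)[OF D N] by blast
  obtain \<eta> where eF: "ses R (bd_mod F 0) (cobj F 0) M (\<lambda>x. x) \<eta>" using resolution_ses(1)[OF F M] by blast
  note sD = resolution_ses(2)[OF D N] and sF = resolution_ses(2)[OF F M]
  have flat: "ker0 (tensor R (bd_mod F j) (cobj D i)) (tensor R (cobj F j) (cobj D i))
    (tmap R (bd_mod F j) (cobj D i) (cobj F j) (cobj D i) (\<lambda>x. x) (\<lambda>x. x))" for i j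
    by (rule projective_flat_right[OF PD bF]) (simp add: ker0_def)
  \<comment> \<open>The induction runs along antidiagonals: the case \<open>(j, i + 1)\<close> comes
    from \<open>(j + 1, i)\<close>, which is why \<open>j\<close> is kept arbitrary.\<close>
  have P: "ker0 (tensor R (bd_mod F (int j)) (bd_mod D (int i))) (tensor R (cobj F (int j)) (bd_mod D (int i)))
    (tmap R (bd_mod F (int j)) (bd_mod D (int i)) (cobj F (int j)) (bd_mod D (int i)) (\<lambda>x. x) (\<lambda>x. x))" for i j
  proof (induction i arbitrary: j)
    case 0
    have "ker0 (tensor R (bd_mod F (int j)) (bd_mod D 0)) (tensor R (bd_mod F (int j)) (cobj D 0))
      (tmap R (bd_mod F (int j)) (bd_mod D 0) (bd_mod F (int j)) (cobj D 0) (\<lambda>x. x) (\<lambda>x. x))"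
      by (rule tensor_syzygy_shift[OF sF eD PF inj]) simp_all
    from ker0_square[OF bF bD this flat] show ?case by simp
  next
    case (Suc i)
    have "ker0 (tensor R (bd_mod F (int j)) (bd_mod D (int i + 1))) (tensor R (bd_mod F (int j)) (cobj D (int i + 1)))
      (tmap R (bd_mod F (int j)) (bd_mod D (int i + 1)) (bd_mod F (int j)) (cobj D (int i + 1)) (\<lambda>x. x) (\<lambda>x. x))"
      by (rule tensor_syzygy_shift[OF sF sD PF]) (use Suc[of "Suc j"] in \<open>simp_all add: add.commute\<close>)
    from ker0_square[OF bF bD this flat] show ?case by (simp add: add.commute)
  qed
  have "ker0 (tensor R M (bd_mod D (int i))) (tensor R M (cobj D (int i))) (tmap R M (bd_mod D (int i)) M (cobj D (int i)) (\<lambda>x. x) (\<lambda>x. x))" for i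
  proof (cases i)
    case 0
    then show ?thesis using tensor_syzygy_shift[OF eF eD PF inj] by simp
  next
    case (Suc i')
    then show ?thesis using tensor_syzygy_shift[OF eF sD[of "int i'"] PF] P[of 0 i'] by (simp add: add.commute)
  qed
  then have "ker0 (tensor R M (bd_mod D i)) (tensor R M (cobj D i)) (tmap R M (bd_mod D i) M (cobj D i) (\<lambda>x. x) (\<lambda>x. x))" if "0 \<le> i" for i
    using that nonneg_int_cases by metis
  then show ?thesis unfolding tor_free_def using M by blast
qed

lemma tensor_complex_simps:
  "cobj (tensor_complex R X N) i = tensor R (cobj X i) N"
  "cdiff (tensor_complex R X N) i = tensor_map R (cobj X i) (cobj X (i - 1)) N (cdiff X i)"
  by (simp_all add: tensor_complex_def)

lemma tensor_complex_cdiff: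
  assumes "is_complex R X" "module R N" "u \<in> tens R (cobj X i) N"
  shows "cdiff (tensor_complex R X N) i u = tmap R (cobj X i) N (cobj X (i - 1)) N (cdiff X i) (\<lambda>x. x) u"
  unfolding tensor_complex_simps by (rule tensor_map_eq_tmap[OF complex_mhom[OF assms(1)] assms(2,3)])

lemma tensor_complex_cdiff1:
  assumes "is_complex R X" "module R N" "u \<in> tens R (cobj X (i + 1)) N"
  shows "cdiff (tensor_complex R X N) (i + 1) u = tmap R (cobj X (i + 1)) N (cobj X i) N (cdiff X (i + 1)) (\<lambda>x. x) u"
  using tensor_complex_cdiff[OF assms] by simp

text \<open>Lift an element of \<open>bd_mod F j \<otimes> N\<close> to some \<open>v\<close> in
  degree \<open>j + 1\<close>. If it dies in \<open>cobj F j \<otimes> N\<close>, then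
  \<open>v\<close> is a cycle, hence a boundary, and two successive differentials compose to zero
  already as a map into \<open>bd_mod F j\<close>.\<close>

lemma syzygy_injective_of_exact:
  assumes F: "projective_resolution R F M" and M: "module R M" and N: "module R N"
    and ex: "\<And>i. 1 \<le> i \<Longrightarrow> exact_at (tensor_complex R F N) i" and j: "0 \<le> j"
  shows "ker0 (tensor R (bd_mod F j) N) (tensor R (cobj F j) N) (tmap R (bd_mod F j) N (cobj F j) N (\<lambda>x. x) (\<lambda>x. x))"
  unfolding ker0_def
proof (intro ballI impI)
  note CF = resolution_complex[OF F]
  note bF = bd_mod_inclusion[OF CF, of j]
  note s = sesD[OF resolution_ses(2)[OF F M j]] and i = mhom_id[OF N]
  let ?X = "tensor_complex R F N"
  let ?F = "\<lambda>i. cobj F i"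
  let ?d = "cdiff F (j + 1)"
  fix u assume u: "u \<in> tens R (bd_mod F j) N" and z: "tmap R (bd_mod F j) N (cobj F j) N (\<lambda>x. x) (\<lambda>x. x) u = \<zero>\<^bsub>tensor R (cobj F j) N\<^esub>"
  obtain v where v: "v \<in> tens R (?F (j + 1)) N" "u = tmap R (?F (j + 1)) N (bd_mod F j) N ?d (\<lambda>x. x) v"
    using tmap_surj[OF s(2) i s(4)] u by (auto simp del: module.simps)
  have "cdiff ?X (j + 1) v = tmap R (?F (j + 1)) N (?F j) N ?d (\<lambda>x. x) v"
    using tensor_complex_cdiff[OF CF N v(1)] by simp
  also have "\<dots> = \<zero>\<^bsub>tensor R (?F j) N\<^esub>"
    using z unfolding v(2) tmap_comp[OF s(2) i bF i v(1)] .
  finally have "v \<in> cycles ?X (j + 1)" using v(1) by (simp add: cycles_def tensor_complex_simps(1))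
  then have "v \<in> boundaries ?X (j + 1)" using ex[of "j + 1"] j by (auto simp: exact_at_def)
  then obtain w where w: "w \<in> tens R (?F (j + 1 + 1)) N" "v = cdiff ?X (j + 1 + 1) w"
    by (auto simp: boundaries_def tensor_complex_simps(1))
  note d2 = complex_mhom1[OF CF, of "j + 1"]
  have v2: "v = tmap R (?F (j + 1 + 1)) N (?F (j + 1)) N (cdiff F (j + 1 + 1)) (\<lambda>x. x) w"
    unfolding w(2) by (rule tensor_complex_cdiff1[OF CF N w(1)])
  have "u = tmap R (?F (j + 1 + 1)) N (bd_mod F j) N (\<lambda>x. ?d (cdiff F (j + 1 + 1) x)) (\<lambda>x. x) w"
    unfolding v(2) v2 by (rule tmap_comp[OF d2 i s(2) i w(1)])
  also have "\<dots> = tmap R (?F (j + 1 + 1)) N (bd_mod F j) N (\<lambda>_. \<zero>\<^bsub>bd_mod F j\<^esub>) (\<lambda>x. x) w"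
    by (rule tmap_cong[OF mhom_0[OF mhom_dom[OF d2] mhom_dom[OF bF]] i _ _ w(1)])
      (use complex_dd[OF CF, of _ "j + 1"] in simp_all)
  also have "\<dots> = \<zero>\<^bsub>tensor R (bd_mod F j) N\<^esub>" by (rule tmap_0_left[OF mhom_dom[OF d2] mhom_dom[OF bF] i w(1)])
  finally show "u = \<zero>\<^bsub>tensor R (bd_mod F j) N\<^esub>" .
qed

subsection \<open>Homology of \<open>P \<otimes> N\<close>\<close>

text \<open>Tor-independence from \<open>N\<close> climbs upwards from degree \<open>lo\<close>: the
  cycles are the kernel of a projective module mapping onto the boundaries one degree lower, the
  boundaries are the kernel of the cycles mapping onto a power of \<open>M\<close>, and
  \<open>tor_free_kernel\<close> applies to both. Hence tensoring with \<open>N\<close> keeps these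
  sequences exact and commutes with cycles, boundaries and homology.\<close>

lemma tensor_homology:
  assumes D: "projective_resolution R D N" and N: "module R N" and M: "module R M" and MD: "tor_free R D M"
    and P: "is_complex R P" and pr: "\<And>i. projective R (cobj P i)"
    and lo: "\<And>i. i < lo \<Longrightarrow> zero_module (cobj P i)"
    and H: "\<And>i. homology_iso R P i (mod_power M (a i))"
  shows "homology_iso R (tensor_complex R P N) i (mod_power (tensor R M N) (a i))"
proof -
  note pM = power_tor_free[OF D MD]
  have "\<exists>\<phi>. \<forall>i. ses R (bd_mod P i) (cyc_mod P i) (mod_power M (a i)) (\<lambda>x. x) (\<phi> i)"
    using H unfolding homology_iso_def by metis
  then obtain \<phi> where \<phi>: "\<And>i. ses R (bd_mod P i) (cyc_mod P i) (mod_power M (a i)) (\<lambda>x. x) (\<phi> i)" by blast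
  note cs = cycles_ses[OF P]
  have step: "tor_free R D (cyc_mod P (i + 1))" if "tor_free R D (bd_mod P i)" for i
    by (rule tor_free_kernel(1)[OF D N cs projective_tor_free[OF D pr] that])
  have step2: "tor_free R D (bd_mod P i)" if "tor_free R D (cyc_mod P i)" for i
    by (rule tor_free_kernel(1)[OF D N \<phi> that pM])
  \<comment> \<open>Below \<open>lo\<close> the complex is zero, which starts the induction.\<close>
  have low: "tor_free R D (bd_mod P i)" if "i < lo" for i
  proof (rule zero_tor_free[OF D bd_mod_module[OF P]])
    interpret B: module R "bd_mod P i" by (rule bd_mod_module[OF P])
    show "zero_module (bd_mod P i)"
      using lo[OF that] boundaries_submodule[OF P, of i] complex_module[OF P, of i] B.zero_closed
        module.submoduleE(1)[OF complex_module[OF P] boundaries_submodule[OF P]]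
      unfolding zero_module_def by auto
  qed
  have up: "tor_free R D (bd_mod P (lo - 1 + int n))" for n
  proof (induction n)
    case 0
    then show ?case using low[of "lo - 1"] by simp
  next
    case (Suc n)
    from step2[OF step[OF this]] show ?case by (simp add: ac_simps)
  qed
  have tb: "tor_free R D (bd_mod P i)" for i
  proof (cases "i < lo")
    case False
    then show ?thesis using up[of "nat (i - lo + 1)"] by simp
  qed (rule low)
  have tc: "tor_free R D (cyc_mod P i)" for i using step[OF tb[of "i - 1"]] by simp
  \<comment> \<open>The gain: with boundaries \<open>B\<close> and cycles \<open>Z\<close> of
    \<open>P\<close>, the maps \<open>B \<otimes> N \<rightarrow> Z \<otimes> N\<close> and
    \<open>Z \<otimes> N \<rightarrow> P \<otimes> N\<close> are injective in every degree.\<close>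
  note kb = tor_free_kernel(2)[OF D N \<phi> tc pM]
    and kc = tor_free_kernel(2)[OF D N cs projective_tor_free[OF D pr] tb]
  let ?X = "tensor_complex R P N"
  have X: "is_complex R ?X" by (rule tensor_complex_is_complex[OF P N])
  note iN = mhom_id[OF N]
  note bP = bd_mod_inclusion[OF P] and cP = cyc_mod_inclusion[OF P]
  let ?T = "tensor R (cobj P i) N" and ?Z = "tensor R (cyc_mod P i) N" and ?B = "tensor R (bd_mod P i) N"
  let ?j = "tmap R (cyc_mod P i) N (cobj P i) N (\<lambda>x. x) (\<lambda>x. x)"
  let ?b = "tmap R (bd_mod P i) N (cyc_mod P i) N (\<lambda>x. x) (\<lambda>x. x)"
  note sc = sesD[OF cs[of "i - 1", simplified]]
  note sb = sesD[OF cs[of i]]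
  note s\<phi> = sesD[OF \<phi>[of i]]
  have j: "mhom R ?Z ?T ?j" by (rule tmap_mhom[OF cP iN])
  have jk: "ker0 ?Z ?T ?j" using kc[of "i - 1"] by simp
  \<comment> \<open>The differential of \<open>P \<otimes> N\<close> factors through the boundaries
    tensored with \<open>N\<close>, which embed into the next term. So its kernel is that of
    \<open>?d'\<close>, and right exactness identifies this with the image of
    \<open>?Z\<close>.\<close>
  have cyc: "w \<in> cycles ?X i \<longleftrightarrow> w \<in> ?j ` carrier ?Z" if w: "w \<in> carrier ?T" for w
  proof -
    let ?d' = "tmap R (cobj P i) N (bd_mod P (i - 1)) N (cdiff P i) (\<lambda>x. x)"
    let ?k = "tmap R (bd_mod P (i - 1)) N (cobj P (i - 1)) N (\<lambda>x. x) (\<lambda>x. x)"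
    have k: "ker0 (tensor R (bd_mod P (i - 1)) N) (tensor R (cobj P (i - 1)) N) ?k"
    proof -
      have "ker0 (tensor R (bd_mod P (i - 1)) N) (tensor R (cobj P (i - 1)) N)
        (\<lambda>u. tmap R (cyc_mod P (i - 1)) N (cobj P (i - 1)) N (\<lambda>x. x) (\<lambda>x. x)
          (tmap R (bd_mod P (i - 1)) N (cyc_mod P (i - 1)) N (\<lambda>x. x) (\<lambda>x. x) u))"
        by (rule ker0_comp[OF tmap_mhom[OF bd_cyc_mhom[OF P] iN] kb]) (use kc[of "i - 1 - 1"] in simp)
      then show ?thesis
        unfolding ker0_def using tmap_comp[OF bd_cyc_mhom[OF P, of "i - 1"] iN cP[of "i - 1"] iN] by simp
    qed
    have d': "?d' w \<in> tens R (bd_mod P (i - 1)) N" by (rule mhom_closed[OF tmap_mhom[OF sc(2) iN] w])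
    have kd: "cdiff ?X i w = ?k (?d' w)"
      unfolding tensor_complex_cdiff[OF P N w] tmap_comp[OF sc(2) iN bP iN w] ..
    have "w \<in> cycles ?X i \<longleftrightarrow> ?k (?d' w) = \<zero>\<^bsub>tensor R (cobj P (i - 1)) N\<^esub>"
      unfolding cycles_def mem_Collect_eq kd tensor_complex_simps(1) using w by simp
    also have "\<dots> \<longleftrightarrow> ?d' w = \<zero>\<^bsub>tensor R (bd_mod P (i - 1)) N\<^esub>"
    proof
      assume "?d' w = \<zero>\<^bsub>tensor R (bd_mod P (i - 1)) N\<^esub>"
      then show "?k (?d' w) = \<zero>\<^bsub>tensor R (cobj P (i - 1)) N\<^esub>" using mhom_zero[OF tmap_mhom[OF bP iN]] by simp
    qed (rule ker0D[OF k d'])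
    also have "\<dots> \<longleftrightarrow> w \<in> ?j ` carrier ?Z"
    proof
      assume "?d' w = \<zero>\<^bsub>tensor R (bd_mod P (i - 1)) N\<^esub>"
      from tensor_right_exact_left[OF sc(1,2,4,5) N w this] show "w \<in> ?j ` carrier ?Z" by blast
    next
      assume "w \<in> ?j ` carrier ?Z"
      then obtain z where z: "z \<in> carrier ?Z" "w = ?j z" by blast
      have "?d' w = tmap R (cyc_mod P i) N (bd_mod P (i - 1)) N (\<lambda>_. \<zero>\<^bsub>bd_mod P (i - 1)\<^esub>) (\<lambda>x. x) z"
        unfolding z(2) tmap_comp[OF cP iN sc(2) iN z(1)]
        by (rule tmap_cong[OF mhom_0[OF mhom_dom[OF cP] mhom_cod[OF sc(2)]] iN _ _ z(1)]) (use sc(6) in auto)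
      then show "?d' w = \<zero>\<^bsub>tensor R (bd_mod P (i - 1)) N\<^esub>"
        using tmap_0_left[OF mhom_dom[OF cP] mhom_cod[OF sc(2)] iN z(1)] by simp
    qed
    finally show ?thesis .
  qed
  have cT: "cycles ?X i \<subseteq> carrier ?T" by (auto simp: cycles_def tensor_complex_simps(1))
  have jZ: "?j ` carrier ?Z = cycles ?X i" using cyc cT mhom_closed[OF j] by blast
  have bd: "?j (?b v) \<in> boundaries ?X i" if v: "v \<in> carrier ?B" for v
  proof -
    obtain p where p: "p \<in> tens R (cobj P (i + 1)) N" "v = tmap R (cobj P (i + 1)) N (bd_mod P i) N (cdiff P (i + 1)) (\<lambda>x. x) p"
      using tmap_surj[OF sb(2) iN sb(4)] v by blast
    have "?j (?b v) = tmap R (bd_mod P i) N (cobj P i) N (\<lambda>x. x) (\<lambda>x. x) v"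
      by (rule tmap_comp[OF bd_cyc_mhom[OF P] iN cP iN v])
    also have "\<dots> = tmap R (cobj P (i + 1)) N (cobj P i) N (cdiff P (i + 1)) (\<lambda>x. x) p"
      unfolding p(2) by (rule tmap_comp[OF sb(2) iN bP iN p(1)])
    also have "\<dots> = cdiff ?X (i + 1) p" using tensor_complex_cdiff[OF P N p(1)] by simp
    finally show ?thesis using p(1) by (auto simp: boundaries_def tensor_complex_simps(1))
  qed
  have bd': "\<exists>v\<in>carrier ?B. w = ?j (?b v)" if w: "w \<in> boundaries ?X i" for w
  proof -
    obtain p where p: "p \<in> tens R (cobj P (i + 1)) N" "w = cdiff ?X (i + 1) p"
      using w by (auto simp: boundaries_def tensor_complex_simps(1))
    let ?v = "tmap R (cobj P (i + 1)) N (bd_mod P i) N (cdiff P (i + 1)) (\<lambda>x. x) p"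
    have v: "?v \<in> carrier ?B" by (rule mhom_closed[OF tmap_mhom[OF sb(2) iN] p(1)])
    have "?j (?b ?v) = tmap R (bd_mod P i) N (cobj P i) N (\<lambda>x. x) (\<lambda>x. x) ?v"
      by (rule tmap_comp[OF bd_cyc_mhom[OF P] iN cP iN v])
    also have "\<dots> = tmap R (cobj P (i + 1)) N (cobj P i) N (cdiff P (i + 1)) (\<lambda>x. x) p"
      by (rule tmap_comp[OF sb(2) iN bP iN p(1)])
    also have "\<dots> = w" unfolding p(2) using tensor_complex_cdiff[OF P N p(1)] by simp
    finally show ?thesis using v by metis
  qed
  have j': "mhom R ?Z (cyc_mod ?X i) ?j"
    using mhom_restrict_cod[OF j[folded tensor_complex_simps(1)] cycles_submodule[OF X]] jZ by simp
  have jk': "ker0 ?Z (cyc_mod ?X i) ?j" using jk by (simp add: ker0_def tensor_complex_simps(1))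
  \<comment> \<open>\<open>?j\<close> identifies \<open>?Z\<close> with the cycles of
    \<open>P \<otimes> N\<close>; its inverse followed by \<open>\<phi> i \<otimes> id\<close> is
    the map that exhibits the homology.\<close>
  obtain h where h: "mhom R (cyc_mod ?X i) ?Z h" "\<And>z. z \<in> carrier ?Z \<Longrightarrow> h (?j z) = z"
    "\<And>w. w \<in> carrier (cyc_mod ?X i) \<Longrightarrow> ?j (h w) = w"
    by (rule mhom_inverse[OF j' jk']) (simp_all add: jZ)
  let ?f = "tmap R (cyc_mod P i) N (mod_power M (a i)) N (\<phi> i) (\<lambda>x. x)"
  note f = tmap_mhom[OF s\<phi>(2) iN]
  have "ses R (bd_mod ?X i) (cyc_mod ?X i) (tensor R (mod_power M (a i)) N) (\<lambda>x. x) (\<lambda>w. ?f (h w))"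
  proof (rule sesI[OF bd_cyc_mhom[OF X] mhom_comp[OF h(1) f]])
    show "ker0 (bd_mod ?X i) (cyc_mod ?X i) (\<lambda>x. x)" by (simp add: ker0_def)
    show "\<exists>w\<in>carrier (cyc_mod ?X i). ?f (h w) = c" if c: "c \<in> tens R (mod_power M (a i)) N" for c
    proof -
      obtain z where z: "z \<in> carrier ?Z" "c = ?f z" using tmap_surj[OF s\<phi>(2) iN s\<phi>(4)] c by blast
      then show ?thesis using h(2)[OF z(1)] mhom_closed[OF j' z(1)] by metis
    qed
    show "?f (h w) = \<zero>\<^bsub>tensor R (mod_power M (a i)) N\<^esub>" if w: "w \<in> carrier (bd_mod ?X i)" for w
    proof -
      obtain v where v: "v \<in> carrier ?B" "w = ?j (?b v)" using bd'[of w] w by auto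
      have bv: "?b v \<in> carrier ?Z" by (rule mhom_closed[OF tmap_mhom[OF s\<phi>(1) iN] v(1)])
      have "?f (h w) = tmap R (bd_mod P i) N (mod_power M (a i)) N (\<lambda>x. \<zero>\<^bsub>mod_power M (a i)\<^esub>) (\<lambda>x. x) v"
        unfolding v(2) h(2)[OF bv] tmap_comp[OF s\<phi>(1) iN s\<phi>(2) iN v(1)]
        by (rule tmap_cong[OF mhom_0[OF mhom_dom[OF s\<phi>(1)] mhom_cod[OF s\<phi>(2)]] iN _ _ v(1)]) (use s\<phi>(6) in auto)
      then show ?thesis using tmap_0_left[OF mhom_dom[OF s\<phi>(1)] mhom_cod[OF s\<phi>(2)] iN v(1)] by simp
    qed
    show "\<exists>v\<in>carrier (bd_mod ?X i). w = v"
      if w: "w \<in> carrier (cyc_mod ?X i)" "?f (h w) = \<zero>\<^bsub>tensor R (mod_power M (a i)) N\<^esub>" for w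
    proof -
      from tensor_right_exact_left[OF s\<phi>(1,2,4,5) N mhom_closed[OF h(1) w(1)] w(2)]
      obtain v where "v \<in> carrier ?B" "h w = ?b v" by blast
      then have "w \<in> boundaries ?X i" using bd h(3)[OF w(1)] by metis
      then show ?thesis by simp
    qed
  qed
  then have "homology_iso R ?X i (tensor R (mod_power M (a i)) N)" unfolding homology_iso_def by blast
  then show ?thesis by (rule homology_iso_trans[OF _ tensor_power_iso[OF M N]])
qed

section \<open>The ring as unit of the tensor product\<close>

lemma self_module_simps:
  "carrier (self_module R) = carrier R" "\<zero>\<^bsub>self_module R\<^esub> = \<zero>\<^bsub>R\<^esub>"
  "x \<oplus>\<^bsub>self_module R\<^esub> y = x \<oplus>\<^bsub>R\<^esub> y" "r \<odot>\<^bsub>self_module R\<^esub> x = r \<otimes>\<^bsub>R\<^esub> x"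
  by (simp_all add: self_module_def)

lemma self_module_is_module:
  assumes "cring R"
  shows "module R (self_module R)"
proof -
  interpret R: cring R by fact
  have "abelian_group (self_module R)"
    by (rule abelian_groupI) (auto simp: self_module_simps R.a_ac intro: R.add.l_inv_ex)
  then show ?thesis
    by (intro moduleI assms) (auto simp: self_module_simps R.l_distr R.r_distr R.m_assoc)
qed

lemma tensor_self_iso:
  assumes M: "module R M"
  defines "g \<equiv> \<lambda>x. pure_tensor R M (self_module R) x \<one>\<^bsub>R\<^esub>"
  shows "mhom R M (tensor R M (self_module R)) g" "ker0 M (tensor R M (self_module R)) g"
    "g ` carrier M = tens R M (self_module R)"
proof -
  interpret M: module R M by (rule M)
  let ?S = "self_module R"
  have S: "module R ?S" by (rule self_module_is_module[OF M.R.is_cring])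
  note sc = self_module_simps(1,4,3)
  have T: "module R (tensor R M ?S)" by (rule tensor_is_module[OF M S])
  interpret T: module R "tensor R M ?S" by (rule T)
  have "\<exists>h\<in>mod_hom R (tensor R M ?S) M. \<forall>x\<in>carrier M. \<forall>y\<in>carrier ?S. h (pure_tensor R M ?S x y) = y \<odot>\<^bsub>M\<^esub> x"
    by (rule tensor_lift[OF M S M]) (auto simp: sc M.smult_l_distr M.smult_r_distr M.smult_assoc1,
        metis M.smult_assoc1 M.R.m_comm)
  then obtain h where h: "h \<in> mod_hom R (tensor R M ?S) M"
    "\<And>x y. x\<in>carrier M \<Longrightarrow> y\<in>carrier ?S \<Longrightarrow> h (pure_tensor R M ?S x y) = y \<odot>\<^bsub>M\<^esub> x" by blast
  have hm: "mhom R (tensor R M ?S) M h" using h(1) T M by (simp add: mhom_def)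
  let ?g = "\<lambda>x. pure_tensor R M ?S x \<one>\<^bsub>R\<^esub>"
  have one: "\<one>\<^bsub>R\<^esub> \<in> carrier ?S" by (simp add: sc)
  have g: "mhom R M (tensor R M ?S) ?g"
    by (intro mhomI M T) (simp_all add: pure_tensor_closed[OF M S] pure_tensor_bilinear[OF M S] one)
  have hg: "h (?g x) = x" if "x \<in> carrier M" for x using h(2)[OF that one] that by simp
  have gh: "?g (h u) = u" if u: "u \<in> tens R M ?S" for u
  proof (rule tensor_mhom_ext[OF M S mhom_comp[OF hm g] mhom_id[OF T] _ u])
    fix x y assume x: "x \<in> carrier M" and y: "y \<in> carrier ?S"
    then have yr: "y \<in> carrier R" by (simp add: sc)
    have "pure_tensor R M ?S (y \<odot>\<^bsub>M\<^esub> x) \<one>\<^bsub>R\<^esub> = pure_tensor R M ?S x (y \<odot>\<^bsub>?S\<^esub> \<one>\<^bsub>R\<^esub>)"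
      using pure_tensor_bilinear(3,4)[OF M S x one yr] by simp
    then show "?g (h (pure_tensor R M ?S x y)) = pure_tensor R M ?S x y" using h(2)[OF x y] yr by (simp add: sc)
  qed
  show gm: "mhom R M (tensor R M ?S) g" unfolding g_def by (rule g)
  show "ker0 M (tensor R M ?S) g"
    unfolding ker0_def g_def using hg mhom_zero[OF hm] by metis
  show "g ` carrier M = tens R M ?S"
  proof
    show "g ` carrier M \<subseteq> tens R M ?S" using mhom_closed[OF gm] by blast
    show "tens R M ?S \<subseteq> g ` carrier M"
    proof
      fix u assume u: "u \<in> tens R M ?S"
      show "u \<in> g ` carrier M"
        unfolding g_def by (rule image_eqI[of _ _ "h u"]) (simp_all add: gh[OF u] mhom_closed[OF hm u])
    qed
  qed
qed

subsection \<open>Mapping cones\<close>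

text \<open>Iterated mapping cones must live over one element type, so pairs are encoded in
  \<open>bool list \<Rightarrow> 'p\<close>; the initial complex is moved there by constant functions.\<close>

type_synonym 'p seq = "bool list \<Rightarrow> 'p"

text \<open>The value at \<open>[]\<close> is a fixed default, so that a pair is determined by its
  two halves.\<close>

definition pr :: "'p seq \<Rightarrow> 'p seq \<Rightarrow> 'p seq" where
  "pr f g = (\<lambda>l. case l of [] \<Rightarrow> undefined | b # l' \<Rightarrow> if b then f l' else g l')"
definition p1 :: "'p seq \<Rightarrow> 'p seq" where "p1 h = (\<lambda>l. h (True # l))"
definition p2 :: "'p seq \<Rightarrow> 'p seq" where "p2 h = (\<lambda>l. h (False # l))"

lemma pr_simps [simp]: "p1 (pr f g) = f" "p2 (pr f g) = g"
  by (simp_all add: pr_def p1_def p2_def)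

lemma pr_eq [simp]: "pr f g = pr f' g' \<longleftrightarrow> f = f' \<and> g = g'"
  by (metis pr_simps)

definition pair_mod :: "('a, 'p seq, 's) module_scheme \<Rightarrow> ('a, 'p seq, 't) module_scheme \<Rightarrow> ('a, 'p seq) module" where
  "pair_mod A B = \<lparr>carrier = {pr a b |a b. a \<in> carrier A \<and> b \<in> carrier B}, monoid.mult = undefined, one = undefined,
     ring.zero = pr \<zero>\<^bsub>A\<^esub> \<zero>\<^bsub>B\<^esub>, add = (\<lambda>h k. pr (p1 h \<oplus>\<^bsub>A\<^esub> p1 k) (p2 h \<oplus>\<^bsub>B\<^esub> p2 k)),
     smult = (\<lambda>r h. pr (r \<odot>\<^bsub>A\<^esub> p1 h) (r \<odot>\<^bsub>B\<^esub> p2 h))\<rparr>"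

lemma pair_mod_simps:
  "h \<in> carrier (pair_mod A B) \<longleftrightarrow> (\<exists>a b. h = pr a b \<and> a \<in> carrier A \<and> b \<in> carrier B)"
  "pr a b \<in> carrier (pair_mod A B) \<longleftrightarrow> a \<in> carrier A \<and> b \<in> carrier B"
  "\<zero>\<^bsub>pair_mod A B\<^esub> = pr \<zero>\<^bsub>A\<^esub> \<zero>\<^bsub>B\<^esub>"
  "h \<oplus>\<^bsub>pair_mod A B\<^esub> k = pr (p1 h \<oplus>\<^bsub>A\<^esub> p1 k) (p2 h \<oplus>\<^bsub>B\<^esub> p2 k)"
  "r \<odot>\<^bsub>pair_mod A B\<^esub> h = pr (r \<odot>\<^bsub>A\<^esub> p1 h) (r \<odot>\<^bsub>B\<^esub> p2 h)"
  by (auto simp: pair_mod_def)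

lemma pair_mod_cases:
  assumes "h \<in> carrier (pair_mod A B)"
  obtains a b where "h = pr a b" "a \<in> carrier A" "b \<in> carrier B"
  using assms by (auto simp: pair_mod_simps)

lemma pair_mod_is_module:
  assumes "module R A" "module R B"
  shows "module R (pair_mod A B)"
proof -
  interpret A: module R A by fact
  interpret B: module R B by fact
  show ?thesis
  proof (rule moduleI)
    show "abelian_group (pair_mod A B)"
    proof (rule abelian_groupI)
      fix h assume "h \<in> carrier (pair_mod A B)"
      then obtain a b where h: "h = pr a b" "a \<in> carrier A" "b \<in> carrier B" by (rule pair_mod_cases)
      show "\<exists>k\<in>carrier (pair_mod A B). k \<oplus>\<^bsub>pair_mod A B\<^esub> h = \<zero>\<^bsub>pair_mod A B\<^esub>"
        using h by (intro bexI[of _ "pr (\<ominus>\<^bsub>A\<^esub> a) (\<ominus>\<^bsub>B\<^esub> b)"]) (simp_all add: pair_mod_simps(2-) A.l_neg B.l_neg)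
    qed (auto simp: pair_mod_simps A.a_ac B.a_ac)
  qed (auto simp: pair_mod_simps A.smult_l_distr A.smult_r_distr A.smult_assoc1 B.smult_l_distr
      B.smult_r_distr B.smult_assoc1 A.R.is_cring)
qed

lemma pair_mod_neg:
  assumes "module R A" "module R B" "a \<in> carrier A" "b \<in> carrier B"
  shows "\<ominus>\<^bsub>pair_mod A B\<^esub> pr a b = pr (\<ominus>\<^bsub>A\<^esub> a) (\<ominus>\<^bsub>B\<^esub> b)"
proof -
  interpret A: module R A by fact
  interpret B: module R B by fact
  interpret P: module R "pair_mod A B" by (rule pair_mod_is_module) fact+
  show ?thesis
    using assms(3,4) by (intro P.minus_equality) (auto simp: pair_mod_simps A.l_neg B.l_neg)
qed

text \<open>The mapping cone of multiplication by \<open>x\<close>, in other words the tensor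
  product of \<open>X\<close> with the Koszul complex on the single element \<open>x\<close>. The
  sign in the second component cancels the two mixed terms when the differential is applied
  twice.\<close>

definition cone :: "'a \<Rightarrow> ('a, 'p seq) mod_complex \<Rightarrow> ('a, 'p seq) mod_complex" where
  "cone x X = \<lparr>cobj = (\<lambda>i. pair_mod (cobj X i) (cobj X (i - 1))),
     cdiff = (\<lambda>i h. pr (cdiff X i (p1 h) \<oplus>\<^bsub>cobj X (i - 1)\<^esub> x \<odot>\<^bsub>cobj X (i - 1)\<^esub> p2 h)
       (\<ominus>\<^bsub>cobj X (i - 1 - 1)\<^esub> cdiff X (i - 1) (p2 h)))\<rparr>"

lemma cone_simps:
  "cobj (cone x X) i = pair_mod (cobj X i) (cobj X (i - 1))"
  "cdiff (cone x X) i h = pr (cdiff X i (p1 h) \<oplus>\<^bsub>cobj X (i - 1)\<^esub> x \<odot>\<^bsub>cobj X (i - 1)\<^esub> p2 h)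
       (\<ominus>\<^bsub>cobj X (i - 1 - 1)\<^esub> cdiff X (i - 1) (p2 h))"
  by (simp_all add: cone_def)

lemma cone_simps1:
  "cobj (cone x X) (i + 1) = pair_mod (cobj X (i + 1)) (cobj X i)"
  "cdiff (cone x X) (i + 1) h = pr (cdiff X (i + 1) (p1 h) \<oplus>\<^bsub>cobj X i\<^esub> x \<odot>\<^bsub>cobj X i\<^esub> p2 h)
       (\<ominus>\<^bsub>cobj X (i - 1)\<^esub> cdiff X i (p2 h))"
  by (simp_all add: cone_def)

lemma cone_is_complex:
  assumes X: "is_complex R X" and x: "x \<in> carrier R"
  shows "is_complex R (cone x X)"
  unfolding is_complex_def
proof (intro allI conjI ballI)
  interpret X: module R "cobj X j" for j by (rule complex_module[OF X])
  note d = mhomD[OF complex_mhom[OF X]] and dneg = mhom_neg[OF complex_mhom[OF X]]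
  fix i
  show m: "module R (cobj (cone x X) i)" for i unfolding cone_simps by (intro pair_mod_is_module X.module_axioms)
  have "mhom R (cobj (cone x X) i) (cobj (cone x X) (i - 1)) (cdiff (cone x X) i)"
  proof (rule mhomI[OF m m])
    fix h assume "h \<in> carrier (cobj (cone x X) i)"
    then obtain a b where h: "h = pr a b" "a \<in> carrier (cobj X i)" "b \<in> carrier (cobj X (i - 1))"
      unfolding cone_simps by (rule pair_mod_cases)
    show "cdiff (cone x X) i h \<in> carrier (cobj (cone x X) (i - 1))"
      using h x d(4)[of b "i - 1"] by (simp add: cone_simps pair_mod_simps(2) d(4))
    { fix r assume "r \<in> carrier R"
      then show "cdiff (cone x X) i (r \<odot>\<^bsub>cobj (cone x X) i\<^esub> h) = r \<odot>\<^bsub>cobj (cone x X) (i - 1)\<^esub> cdiff (cone x X) i h"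
        using h x d(4)[of b "i - 1"] by (simp add: cone_simps pair_mod_simps(5) d(4,6) X.smult_r_distr X.smult_r_minus
            X.smult_assoc1[symmetric] X.R.m_comm) }
    fix k assume "k \<in> carrier (cobj (cone x X) i)"
    then obtain a' b' where k: "k = pr a' b'" "a' \<in> carrier (cobj X i)" "b' \<in> carrier (cobj X (i - 1))"
      unfolding cone_simps by (rule pair_mod_cases)
    show "cdiff (cone x X) i (h \<oplus>\<^bsub>cobj (cone x X) i\<^esub> k) = cdiff (cone x X) i h \<oplus>\<^bsub>cobj (cone x X) (i - 1)\<^esub> cdiff (cone x X) i k"
      using h k x d(4)[of b "i - 1"] d(4)[of b' "i - 1"]
      by (simp add: cone_simps pair_mod_simps(4) d(4,5) X.smult_r_distr X.minus_add X.a_ac)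
  qed
  then show "cdiff (cone x X) i \<in> mod_hom R (cobj (cone x X) i) (cobj (cone x X) (i - 1))" by (rule mhom_mod_hom)
  fix h assume "h \<in> carrier (cobj (cone x X) i)"
  then obtain a b where h: "h = pr a b" "a \<in> carrier (cobj X i)" "b \<in> carrier (cobj X (i - 1))"
    unfolding cone_simps by (rule pair_mod_cases)
  have dd: "cdiff X (j - 1) (cdiff X j y) = \<zero>\<^bsub>cobj X (j - 1 - 1)\<^esub>" if "y \<in> carrier (cobj X j)" for j y
    using X that unfolding is_complex_def by blast
  show "cdiff (cone x X) (i - 1) (cdiff (cone x X) i h) = \<zero>\<^bsub>cobj (cone x X) (i - 1 - 1)\<^esub>"
    unfolding h(1) cone_simps pr_simps pair_mod_simps(3) pr_eq
  proof
    show "cdiff X (i - 1) (cdiff X i a \<oplus>\<^bsub>cobj X (i - 1)\<^esub> x \<odot>\<^bsub>cobj X (i - 1)\<^esub> b) \<oplus>\<^bsub>cobj X (i - 1 - 1)\<^esub>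
        x \<odot>\<^bsub>cobj X (i - 1 - 1)\<^esub> (\<ominus>\<^bsub>cobj X (i - 1 - 1)\<^esub> cdiff X (i - 1) b) = \<zero>\<^bsub>cobj X (i - 1 - 1)\<^esub>"
      using h(2,3) x d(4)[of a i] d(4)[of b "i - 1"]
      by (simp add: d(5,6) dd X.smult_r_minus X.r_neg)
    show "\<ominus>\<^bsub>cobj X (i - 1 - 1 - 1)\<^esub> cdiff X (i - 1 - 1) (\<ominus>\<^bsub>cobj X (i - 1 - 1)\<^esub> cdiff X (i - 1) b) = \<zero>\<^bsub>cobj X (i - 1 - 1 - 1)\<^esub>"
      using h(3) d(4)[of b "i - 1"] dd[of b "i - 1"] by (simp add: dneg)
  qed
qed

text \<open>The degree is written \<open>i + 1\<close> here and in the lemmas that follow, so that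
  the component taken from one degree lower sits in degree \<open>i\<close>.\<close>

lemma cone_cyclesE:
  assumes X: "is_complex R X" and x: "x \<in> carrier R" and "h \<in> cycles (cone x X) (i + 1)"
  obtains a b where "h = pr a b" "a \<in> carrier (cobj X (i + 1))" "b \<in> cycles X i"
    "cdiff X (i + 1) a \<oplus>\<^bsub>cobj X i\<^esub> x \<odot>\<^bsub>cobj X i\<^esub> b = \<zero>\<^bsub>cobj X i\<^esub>"
proof -
  interpret X: module R "cobj X j" for j by (rule complex_module[OF X])
  have h: "h \<in> carrier (pair_mod (cobj X (i + 1)) (cobj X i))" "cdiff (cone x X) (i + 1) h = pr \<zero>\<^bsub>cobj X i\<^esub> \<zero>\<^bsub>cobj X (i - 1)\<^esub>"
    using assms(3) by (simp_all add: cycles_def cone_simps pair_mod_simps(3))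
  then obtain a b where ab: "h = pr a b" "a \<in> carrier (cobj X (i + 1))" "b \<in> carrier (cobj X i)"
    by (elim pair_mod_cases)
  have db: "cdiff X i b \<in> carrier (cobj X (i - 1))" using mhom_closed[OF complex_mhom[OF X] ab(3)] .
  have "\<ominus>\<^bsub>cobj X (i - 1)\<^esub> cdiff X i b = \<zero>\<^bsub>cobj X (i - 1)\<^esub>"
    using h(2) unfolding ab(1) cone_simps by simp
  then have "cdiff X i b = \<zero>\<^bsub>cobj X (i - 1)\<^esub>" using X.minus_minus[OF db] by simp
  moreover have "cdiff X (i + 1) a \<oplus>\<^bsub>cobj X i\<^esub> x \<odot>\<^bsub>cobj X i\<^esub> b = \<zero>\<^bsub>cobj X i\<^esub>"
    using h(2) unfolding ab(1) cone_simps by simp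
  ultimately show thesis using that ab by (simp add: cycles_def)
qed

lemma cone_cyclesI:
  assumes X: "is_complex R X" and "a \<in> carrier (cobj X (i + 1))" "b \<in> cycles X i"
    "cdiff X (i + 1) a \<oplus>\<^bsub>cobj X i\<^esub> x \<odot>\<^bsub>cobj X i\<^esub> b = \<zero>\<^bsub>cobj X i\<^esub>"
  shows "pr a b \<in> cycles (cone x X) (i + 1)"
proof -
  interpret X: module R "cobj X j" for j by (rule complex_module[OF X])
  show ?thesis using assms(2-) by (simp add: cycles_def cone_simps pair_mod_simps(2,3))
qed

lemma cone_boundariesE:
  assumes "h \<in> boundaries (cone x X) (i + 1)"
  obtains u v where "u \<in> carrier (cobj X (i + 1 + 1))" "v \<in> carrier (cobj X (i + 1))"
    "h = pr (cdiff X (i + 1 + 1) u \<oplus>\<^bsub>cobj X (i + 1)\<^esub> x \<odot>\<^bsub>cobj X (i + 1)\<^esub> v) (\<ominus>\<^bsub>cobj X i\<^esub> cdiff X (i + 1) v)"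
proof -
  obtain k where k: "k \<in> carrier (pair_mod (cobj X (i + 1 + 1)) (cobj X (i + 1)))" "h = cdiff (cone x X) (i + 1 + 1) k"
    using assms unfolding boundaries_def cone_simps1(1) by blast
  from k(1) obtain u v where uv: "k = pr u v" "u \<in> carrier (cobj X (i + 1 + 1))" "v \<in> carrier (cobj X (i + 1))"
    by (rule pair_mod_cases)
  have "h = pr (cdiff X (i + 1 + 1) u \<oplus>\<^bsub>cobj X (i + 1)\<^esub> x \<odot>\<^bsub>cobj X (i + 1)\<^esub> v) (\<ominus>\<^bsub>cobj X i\<^esub> cdiff X (i + 1) v)"
    unfolding k(2) uv(1) cone_simps1 by simp
  then show thesis using that uv(2,3) by blast
qed

lemma cone_boundariesI:
  assumes "u \<in> carrier (cobj X (i + 1 + 1))" "v \<in> carrier (cobj X (i + 1))"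
    "a = cdiff X (i + 1 + 1) u \<oplus>\<^bsub>cobj X (i + 1)\<^esub> x \<odot>\<^bsub>cobj X (i + 1)\<^esub> v" "b = \<ominus>\<^bsub>cobj X i\<^esub> cdiff X (i + 1) v"
  shows "pr a b \<in> boundaries (cone x X) (i + 1)"
proof -
  have "pr a b = cdiff (cone x X) (i + 1 + 1) (pr u v)" unfolding cone_simps1 assms(3,4) by simp
  moreover have "pr u v \<in> carrier (cobj (cone x X) (i + 1 + 1))" unfolding cone_simps1 using assms(1,2) by (simp add: pair_mod_simps(2))
  ultimately show ?thesis unfolding boundaries_def by (rule image_eqI)
qed

lemma boundariesE:
  assumes "y \<in> boundaries X i"
  obtains v where "v \<in> carrier (cobj X (i + 1))" "y = cdiff X (i + 1) v"
  using assms by (auto simp: boundaries_def)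

lemma boundariesI: "v \<in> carrier (cobj X (i + 1)) \<Longrightarrow> y = cdiff X (i + 1) v \<Longrightarrow> y \<in> boundaries X i"
  by (auto simp: boundaries_def)

lemma exact_atD: "exact_at X i \<Longrightarrow> y \<in> carrier (cobj X i) \<Longrightarrow> cdiff X i y = \<zero>\<^bsub>cobj X (i - 1)\<^esub> \<Longrightarrow> y \<in> boundaries X i"
  by (auto simp: exact_at_def cycles_def)

text \<open>Exactness of \<open>H_(i+1)(X) \<rightarrow> H_(i+1)(cone) \<rightarrow> H_i(X)\<close>.
  If \<open>(a, b)\<close> is a cycle and \<open>b = d v\<close>, then \<open>a + x v\<close> is a
  cycle, say \<open>d u\<close>, and \<open>(a, b)\<close> is the boundary of
  \<open>(u, - v)\<close>.\<close>

lemma exact_at_cone: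
  assumes X: "is_complex R X" and x: "x \<in> carrier R" and e: "exact_at X (i + 1)" "exact_at X i"
  shows "exact_at (cone x X) (i + 1)"
  unfolding exact_at_def
proof
  interpret X: module R "cobj X j" for j by (rule complex_module[OF X])
  note d = mhomD[OF complex_mhom1[OF X]]
  fix h assume "h \<in> cycles (cone x X) (i + 1)"
  then obtain a b where h: "h = pr a b" "a \<in> carrier (cobj X (i + 1))" "b \<in> cycles X i"
    "cdiff X (i + 1) a \<oplus>\<^bsub>cobj X i\<^esub> x \<odot>\<^bsub>cobj X i\<^esub> b = \<zero>\<^bsub>cobj X i\<^esub>" by (rule cone_cyclesE[OF X x])
  obtain v where v: "v \<in> carrier (cobj X (i + 1))" "b = cdiff X (i + 1) v"
    using h(3) e(2) by (auto simp: exact_at_def boundaries_def)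
  have "cdiff X (i + 1) (a \<oplus>\<^bsub>cobj X (i + 1)\<^esub> x \<odot>\<^bsub>cobj X (i + 1)\<^esub> v) = \<zero>\<^bsub>cobj X i\<^esub>"
    using h(2,4) v x by (simp add: d)
  then have "a \<oplus>\<^bsub>cobj X (i + 1)\<^esub> x \<odot>\<^bsub>cobj X (i + 1)\<^esub> v \<in> boundaries X (i + 1)"
    using h(2) v(1) x by (intro exact_atD[OF e(1)]) simp_all
  then obtain u where u: "u \<in> carrier (cobj X (i + 1 + 1))" "a \<oplus>\<^bsub>cobj X (i + 1)\<^esub> x \<odot>\<^bsub>cobj X (i + 1)\<^esub> v = cdiff X (i + 1 + 1) u"
    by (rule boundariesE)
  show "h \<in> boundaries (cone x X) (i + 1)"
    unfolding h(1)
  proof (rule cone_boundariesI[OF u(1)])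
    show "\<ominus>\<^bsub>cobj X (i + 1)\<^esub> v \<in> carrier (cobj X (i + 1))" using v(1) by simp
    show "a = cdiff X (i + 1 + 1) u \<oplus>\<^bsub>cobj X (i + 1)\<^esub> x \<odot>\<^bsub>cobj X (i + 1)\<^esub> (\<ominus>\<^bsub>cobj X (i + 1)\<^esub> v)"
      unfolding u(2)[symmetric] using h(2) v(1) x by (simp add: X.smult_r_minus X.a_assoc X.r_neg)
    show "b = \<ominus>\<^bsub>cobj X i\<^esub> cdiff X (i + 1) (\<ominus>\<^bsub>cobj X (i + 1)\<^esub> v)"
      using v mhom_neg[OF complex_mhom1[OF X] v(1)] d(4)[OF v(1)] by simp
  qed
qed

definition kills where
  "kills x X \<longleftrightarrow> (\<forall>i. \<forall>z\<in>cycles X i. x \<odot>\<^bsub>cobj X i\<^esub> z \<in> boundaries X i)"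

text \<open>Up to sign, multiplication by \<open>x\<close> is the connecting map of the long exact
  sequence of the cone. When it is zero on homology, \<open>0 \<rightarrow> H_(i+1)(X) \<rightarrow>
  H_(i+1)(cone) \<rightarrow> H_i(X) \<rightarrow> 0\<close> is exact, so the outer terms vanish
  together with the middle one.\<close>

lemma exact_at_cone_iff:
  assumes X: "is_complex R X" and x: "x \<in> carrier R" and k: "kills x X"
  shows "exact_at (cone x X) (i + 1) \<longleftrightarrow> exact_at X (i + 1) \<and> exact_at X i"
proof (intro iffI conjI)
  interpret X: module R "cobj X j" for j by (rule complex_module[OF X])
  note d = mhomD[OF complex_mhom1[OF X]]
  assume e: "exact_at (cone x X) (i + 1)"
  show "exact_at X (i + 1)"
    unfolding exact_at_def
  proof
    fix a assume a: "a \<in> cycles X (i + 1)"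
    then have ac: "a \<in> carrier (cobj X (i + 1))" "cdiff X (i + 1) a = \<zero>\<^bsub>cobj X i\<^esub>" by (simp_all add: cycles_def)
    have "pr a \<zero>\<^bsub>cobj X i\<^esub> \<in> cycles (cone x X) (i + 1)"
      by (rule cone_cyclesI[OF X ac(1)]) (use ac x mhom_zero[OF complex_mhom[OF X]] in \<open>simp_all add: cycles_def\<close>)
    then have "pr a \<zero>\<^bsub>cobj X i\<^esub> \<in> boundaries (cone x X) (i + 1)" using e by (auto simp: exact_at_def)
    then obtain u v where uv: "u \<in> carrier (cobj X (i + 1 + 1))" "v \<in> carrier (cobj X (i + 1))"
      "a = cdiff X (i + 1 + 1) u \<oplus>\<^bsub>cobj X (i + 1)\<^esub> x \<odot>\<^bsub>cobj X (i + 1)\<^esub> v" "\<zero>\<^bsub>cobj X i\<^esub> = \<ominus>\<^bsub>cobj X i\<^esub> cdiff X (i + 1) v"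
      by (elim cone_boundariesE) simp
    have "cdiff X (i + 1) v = \<zero>\<^bsub>cobj X i\<^esub>" using X.minus_minus[OF d(4)[OF uv(2)]] unfolding uv(4)[symmetric] by simp
    then have "v \<in> cycles X (i + 1)" using uv(2) by (simp add: cycles_def)
    then have "x \<odot>\<^bsub>cobj X (i + 1)\<^esub> v \<in> boundaries X (i + 1)" using k by (simp add: kills_def)
    moreover have "cdiff X (i + 1 + 1) u \<in> boundaries X (i + 1)" by (rule boundariesI[OF uv(1) refl])
    ultimately show "a \<in> boundaries X (i + 1)"
      unfolding uv(3) using X.submoduleE(5)[OF boundaries_submodule[OF X]] by blast
  qed
  show "exact_at X i"
    unfolding exact_at_def
  proof
    fix b assume b: "b \<in> cycles X i"
    then have bc: "b \<in> carrier (cobj X i)" by (simp add: cycles_def)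
    have "x \<odot>\<^bsub>cobj X i\<^esub> b \<in> boundaries X i" using k b by (simp add: kills_def)
    then obtain w where w: "w \<in> carrier (cobj X (i + 1))" "x \<odot>\<^bsub>cobj X i\<^esub> b = cdiff X (i + 1) w" by (rule boundariesE)
    have "pr (\<ominus>\<^bsub>cobj X (i + 1)\<^esub> w) b \<in> cycles (cone x X) (i + 1)"
      by (rule cone_cyclesI[OF X _ b])
        (use w mhom_neg[OF complex_mhom1[OF X] w(1)] d(4)[OF w(1)] in \<open>simp_all add: X.l_neg\<close>)
    then have "pr (\<ominus>\<^bsub>cobj X (i + 1)\<^esub> w) b \<in> boundaries (cone x X) (i + 1)" using e by (auto simp: exact_at_def)
    then obtain v where v: "v \<in> carrier (cobj X (i + 1))" "b = \<ominus>\<^bsub>cobj X i\<^esub> cdiff X (i + 1) v"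
      by (elim cone_boundariesE) simp
    show "b \<in> boundaries X i"
      by (rule boundariesI[of "\<ominus>\<^bsub>cobj X (i + 1)\<^esub> v"])
        (use v mhom_neg[OF complex_mhom1[OF X] v(1)] in simp_all)
  qed
qed (use exact_at_cone[OF X x] in blast)

subsection \<open>Null-homotopic multiplications\<close>

lemma mhom_scale:
  assumes f: "mhom R A B f" and q: "q \<in> carrier R"
  shows "mhom R A B (\<lambda>y. q \<odot>\<^bsub>B\<^esub> f y)"
proof -
  interpret B: module R B by (rule mhom_cod[OF f])
  show ?thesis using f q mhom_dom[OF f] mhom_cod[OF f]
    by (intro mhomI) (simp_all add: mhomD[OF f] B.smult_r_distr B.smult_assoc1[symmetric] B.R.m_comm)
qed

text \<open>Stronger than \<open>kills\<close> and, unlike it, stable under cones: if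
  \<open>r\<close> merely annihilates the homology of \<open>X\<close>, the long exact sequence
  yields only that \<open>r\<close> squared annihilates the homology of a cone.\<close>

definition null_homotopic where
  "null_homotopic R X r \<longleftrightarrow> (\<exists>s. (\<forall>i. mhom R (cobj X i) (cobj X (i + 1)) (s i)) \<and>
     (\<forall>i. \<forall>y\<in>carrier (cobj X i). cdiff X (i + 1) (s i y) \<oplus>\<^bsub>cobj X i\<^esub> s (i - 1) (cdiff X i y) = r \<odot>\<^bsub>cobj X i\<^esub> y))"

lemma null_homotopic_kills:
  assumes X: "is_complex R X" and n: "null_homotopic R X r"
  shows "kills r X"
  unfolding kills_def
proof (intro allI ballI)
  interpret X: module R "cobj X j" for j by (rule complex_module[OF X])
  obtain s where s: "\<And>i. mhom R (cobj X i) (cobj X (i + 1)) (s i)"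
    "\<And>i y. y \<in> carrier (cobj X i) \<Longrightarrow> cdiff X (i + 1) (s i y) \<oplus>\<^bsub>cobj X i\<^esub> s (i - 1) (cdiff X i y) = r \<odot>\<^bsub>cobj X i\<^esub> y"
    using n by (auto simp: null_homotopic_def)
  fix i z assume "z \<in> cycles X i"
  then have z: "z \<in> carrier (cobj X i)" "cdiff X i z = \<zero>\<^bsub>cobj X (i - 1)\<^esub>" by (simp_all add: cycles_def)
  have sz: "s i z \<in> carrier (cobj X (i + 1))" by (rule mhom_closed[OF s(1) z(1)])
  have "r \<odot>\<^bsub>cobj X i\<^esub> z = cdiff X (i + 1) (s i z)"
    using s(2)[OF z(1)] mhom_zero[OF s(1)[of "i - 1"]] mhom_closed[OF complex_mhom1[OF X] sz] unfolding z(2) by simp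
  then show "r \<odot>\<^bsub>cobj X i\<^esub> z \<in> boundaries X i" by (rule boundariesI[OF sz])
qed

text \<open>The homotopy sends \<open>(a, b)\<close> to \<open>(0, a)\<close>. Then
  \<open>d (0, a) = (x a, - d a)\<close>, and the homotopy applied to \<open>d (a, b)\<close> is
  \<open>(0, d a + x b)\<close>; their sum is \<open>(x a, x b)\<close>.\<close>

lemma cone_null_homotopic_self:
  assumes X: "is_complex R X" and x: "x \<in> carrier R"
  shows "null_homotopic R (cone x X) x"
  unfolding null_homotopic_def
proof (intro exI[of _ "\<lambda>i h. pr \<zero>\<^bsub>cobj X (i + 1)\<^esub> (p1 h)"] conjI allI ballI)
  interpret X: module R "cobj X j" for j by (rule complex_module[OF X])
  note C = cone_is_complex[OF X x]
  note d = mhomD[OF complex_mhom[OF X]]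
  show "mhom R (cobj (cone x X) i) (cobj (cone x X) (i + 1)) (\<lambda>h. pr \<zero>\<^bsub>cobj X (i + 1)\<^esub> (p1 h))" for i
    by (intro mhomI complex_module[OF C]) (auto simp: cone_simps pair_mod_simps)
  fix i h assume "h \<in> carrier (cobj (cone x X) i)"
  then obtain a b where h: "h = pr a b" "a \<in> carrier (cobj X i)" "b \<in> carrier (cobj X (i - 1))"
    unfolding cone_simps by (rule pair_mod_cases)
  show "cdiff (cone x X) (i + 1) (pr \<zero>\<^bsub>cobj X (i + 1)\<^esub> (p1 h)) \<oplus>\<^bsub>cobj (cone x X) i\<^esub>
     pr \<zero>\<^bsub>cobj X (i - 1 + 1)\<^esub> (p1 (cdiff (cone x X) i h)) = x \<odot>\<^bsub>cobj (cone x X) i\<^esub> h"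
    using h x d(4)[of a i] mhom_zero[OF complex_mhom1[OF X, of i]]
    by (simp add: cone_simps pair_mod_simps(4,5) X.a_assoc[symmetric] X.l_neg)
qed

text \<open>The homotopy is \<open>s\<close> on the first component and \<open>- s\<close> on the
  second. The sign matches the one in the differential and makes the mixed terms with
  \<open>x\<close> cancel.\<close>

lemma cone_null_homotopic:
  assumes X: "is_complex R X" and x: "x \<in> carrier R" and r: "r \<in> carrier R" and n: "null_homotopic R X r"
  shows "null_homotopic R (cone x X) r"
proof -
  interpret X: module R "cobj X j" for j by (rule complex_module[OF X])
  note C = cone_is_complex[OF X x]
  note d = mhomD[OF complex_mhom[OF X]] and d1 = mhomD[OF complex_mhom1[OF X]]
    and dn = mhom_neg[OF complex_mhom[OF X]]
  obtain s where s: "\<And>i. mhom R (cobj X i) (cobj X (i + 1)) (s i)"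
    "\<And>i y. y \<in> carrier (cobj X i) \<Longrightarrow> cdiff X (i + 1) (s i y) \<oplus>\<^bsub>cobj X i\<^esub> s (i - 1) (cdiff X i y) = r \<odot>\<^bsub>cobj X i\<^esub> y"
    using n by (auto simp: null_homotopic_def)
  have s': "mhom R (cobj X (i - 1)) (cobj X i) (s (i - 1))" for i using s(1)[of "i - 1"] by simp
  note S = mhomD[OF s(1)] mhom_neg[OF s(1)] and S' = mhomD[OF s'] mhom_neg[OF s']
  let ?s = "\<lambda>i h. pr (s i (p1 h)) (\<ominus>\<^bsub>cobj X i\<^esub> s (i - 1) (p2 h))"
  show ?thesis
    unfolding null_homotopic_def
  proof (intro exI[of _ ?s] conjI allI ballI)
    show "mhom R (cobj (cone x X) i) (cobj (cone x X) (i + 1)) (?s i)" for i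
    proof (rule mhomI[OF complex_module[OF C] complex_module[OF C]])
      fix h assume "h \<in> carrier (cobj (cone x X) i)"
      then obtain a b where h: "h = pr a b" "a \<in> carrier (cobj X i)" "b \<in> carrier (cobj X (i - 1))"
        unfolding cone_simps by (rule pair_mod_cases)
      show "?s i h \<in> carrier (cobj (cone x X) (i + 1))" using h by (simp add: cone_simps pair_mod_simps(2) S(4) S'(4))
      { fix r assume "r \<in> carrier R"
        then show "?s i (r \<odot>\<^bsub>cobj (cone x X) i\<^esub> h) = r \<odot>\<^bsub>cobj (cone x X) (i + 1)\<^esub> ?s i h"
          using h by (simp add: cone_simps pair_mod_simps(5) S(4,6) S'(4,6) X.smult_r_minus) }
      fix k assume "k \<in> carrier (cobj (cone x X) i)"
      then obtain a' b' where k: "k = pr a' b'" "a' \<in> carrier (cobj X i)" "b' \<in> carrier (cobj X (i - 1))"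
        unfolding cone_simps by (rule pair_mod_cases)
      show "?s i (h \<oplus>\<^bsub>cobj (cone x X) i\<^esub> k) = ?s i h \<oplus>\<^bsub>cobj (cone x X) (i + 1)\<^esub> ?s i k"
        using h k by (simp add: cone_simps pair_mod_simps(4) S(4,5) S'(4,5) X.minus_add)
    qed
    fix i h assume "h \<in> carrier (cobj (cone x X) i)"
    then obtain a b where h: "h = pr a b" "a \<in> carrier (cobj X i)" "b \<in> carrier (cobj X (i - 1))"
      unfolding cone_simps by (rule pair_mod_cases)
    have c: "cdiff X (i + 1) (s i a) \<in> carrier (cobj X i)" "s (i - 1) (cdiff X i a) \<in> carrier (cobj X i)"
      "s (i - 1) b \<in> carrier (cobj X i)" "cdiff X i (s (i - 1) b) \<in> carrier (cobj X (i - 1))"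
      "cdiff X (i - 1) b \<in> carrier (cobj X (i - 1 - 1))" "s (i - 1 - 1) (cdiff X (i - 1) b) \<in> carrier (cobj X (i - 1))"
      using h d(4)[of a i] d(4)[of b "i - 1"] d1(4) S(4) S'(4)[of _ i] S'(4)[of _ "i - 1"] d(4)[of "s (i - 1) b" i] by simp_all
    have e: "\<ominus>\<^bsub>cobj X (i - 1)\<^esub> cdiff X i (\<ominus>\<^bsub>cobj X i\<^esub> s (i - 1) b) = cdiff X i (s (i - 1) b)"
      "\<ominus>\<^bsub>cobj X (i - 1)\<^esub> s (i - 1 - 1) (\<ominus>\<^bsub>cobj X (i - 1 - 1)\<^esub> cdiff X (i - 1) b) = s (i - 1 - 1) (cdiff X (i - 1) b)"
      using c dn[OF c(3)] S'(9)[OF c(5)] by simp_all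
    have t2: "cdiff X i (s (i - 1) b) \<oplus>\<^bsub>cobj X (i - 1)\<^esub> s (i - 1 - 1) (cdiff X (i - 1) b) = r \<odot>\<^bsub>cobj X (i - 1)\<^esub> b"
      using s(2)[OF h(3)] by simp
    have xb: "x \<odot>\<^bsub>cobj X i\<^esub> s (i - 1) b \<in> carrier (cobj X i)" using c(3) x by simp
    have "cdiff X (i + 1) (s i a) \<oplus>\<^bsub>cobj X i\<^esub> x \<odot>\<^bsub>cobj X i\<^esub> (\<ominus>\<^bsub>cobj X i\<^esub> s (i - 1) b) \<oplus>\<^bsub>cobj X i\<^esub>
        s (i - 1) (cdiff X i a \<oplus>\<^bsub>cobj X (i - 1)\<^esub> x \<odot>\<^bsub>cobj X (i - 1)\<^esub> b) = r \<odot>\<^bsub>cobj X i\<^esub> a"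
    proof -
      have "s (i - 1) (cdiff X i a \<oplus>\<^bsub>cobj X (i - 1)\<^esub> x \<odot>\<^bsub>cobj X (i - 1)\<^esub> b) =
          s (i - 1) (cdiff X i a) \<oplus>\<^bsub>cobj X i\<^esub> x \<odot>\<^bsub>cobj X i\<^esub> s (i - 1) b"
        using h x d(4)[of a i] by (simp add: S'(5,6))
      moreover have "p \<oplus>\<^bsub>cobj X i\<^esub> \<ominus>\<^bsub>cobj X i\<^esub> q \<oplus>\<^bsub>cobj X i\<^esub> (t \<oplus>\<^bsub>cobj X i\<^esub> q) = p \<oplus>\<^bsub>cobj X i\<^esub> t"
        if "p \<in> carrier (cobj X i)" "q \<in> carrier (cobj X i)" "t \<in> carrier (cobj X i)" for p q t
      proof -
        have "p \<oplus>\<^bsub>cobj X i\<^esub> \<ominus>\<^bsub>cobj X i\<^esub> q \<oplus>\<^bsub>cobj X i\<^esub> (q \<oplus>\<^bsub>cobj X i\<^esub> t) = p \<oplus>\<^bsub>cobj X i\<^esub> ((\<ominus>\<^bsub>cobj X i\<^esub> q \<oplus>\<^bsub>cobj X i\<^esub> q) \<oplus>\<^bsub>cobj X i\<^esub> t)"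
          using that by (simp only: X.a_assoc X.a_closed X.a_inv_closed)
        then show ?thesis using that X.a_comm[of t i q] by (simp add: X.l_neg)
      qed
      ultimately show ?thesis using c(1,2) xb s(2)[OF h(2)] x c(3) by (simp add: X.smult_r_minus)
    qed
    then show "cdiff (cone x X) (i + 1) (?s i h) \<oplus>\<^bsub>cobj (cone x X) i\<^esub> ?s (i - 1) (cdiff (cone x X) i h) = r \<odot>\<^bsub>cobj (cone x X) i\<^esub> h"
      unfolding h(1) cone_simps pair_mod_simps(4,5) pr_simps e using t2 by (simp add: e(1))
  qed
qed

text \<open>Homotopies can be scaled and added, so it is enough to construct them for generators of
  an ideal.\<close>

lemma null_homotopic_ideal:
  assumes X: "is_complex R X"
  shows "ideal {r \<in> carrier R. null_homotopic R X r} R"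
proof -
  interpret X: module R "cobj X j" for j by (rule complex_module[OF X])
  note d1 = mhomD[OF complex_mhom1[OF X]] and d = mhomD[OF complex_mhom[OF X]]
  have mult: "null_homotopic R X (q \<otimes>\<^bsub>R\<^esub> r)" if r: "null_homotopic R X r" "r \<in> carrier R" and q: "q \<in> carrier R" for r q
  proof -
    obtain s where s: "\<And>i. mhom R (cobj X i) (cobj X (i + 1)) (s i)"
      "\<And>i y. y \<in> carrier (cobj X i) \<Longrightarrow> cdiff X (i + 1) (s i y) \<oplus>\<^bsub>cobj X i\<^esub> s (i - 1) (cdiff X i y) = r \<odot>\<^bsub>cobj X i\<^esub> y"
      using r(1) by (auto simp: null_homotopic_def)
    show ?thesis
      unfolding null_homotopic_def
    proof (intro exI[of _ "\<lambda>i y. q \<odot>\<^bsub>cobj X (i + 1)\<^esub> s i y"] conjI allI ballI)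
      show "mhom R (cobj X i) (cobj X (i + 1)) (\<lambda>y. q \<odot>\<^bsub>cobj X (i + 1)\<^esub> s i y)" for i by (rule mhom_scale[OF s(1) q])
      fix i y assume y: "y \<in> carrier (cobj X i)"
      have c: "s i y \<in> carrier (cobj X (i + 1))" "s (i - 1) (cdiff X i y) \<in> carrier (cobj X i)"
        using mhom_closed[OF s(1)] y d(4) mhom_closed[OF s(1)[of "i - 1"]] by simp_all
      show "cdiff X (i + 1) (q \<odot>\<^bsub>cobj X (i + 1)\<^esub> s i y) \<oplus>\<^bsub>cobj X i\<^esub> q \<odot>\<^bsub>cobj X (i - 1 + 1)\<^esub> s (i - 1) (cdiff X i y)
        = (q \<otimes>\<^bsub>R\<^esub> r) \<odot>\<^bsub>cobj X i\<^esub> y"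
        using c q r(2) y s(2)[OF y] d1(4)[OF c(1)]
        by (simp add: d1(6) X.smult_r_distr[symmetric] X.smult_assoc1)
    qed
  qed
  have add: "null_homotopic R X (r \<oplus>\<^bsub>R\<^esub> q)"
    if r: "null_homotopic R X r" "r \<in> carrier R" and q: "null_homotopic R X q" "q \<in> carrier R" for r q
  proof -
    obtain s where s: "\<And>i. mhom R (cobj X i) (cobj X (i + 1)) (s i)"
      "\<And>i y. y \<in> carrier (cobj X i) \<Longrightarrow> cdiff X (i + 1) (s i y) \<oplus>\<^bsub>cobj X i\<^esub> s (i - 1) (cdiff X i y) = r \<odot>\<^bsub>cobj X i\<^esub> y"
      using r(1) by (auto simp: null_homotopic_def)
    obtain t where t: "\<And>i. mhom R (cobj X i) (cobj X (i + 1)) (t i)"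
      "\<And>i y. y \<in> carrier (cobj X i) \<Longrightarrow> cdiff X (i + 1) (t i y) \<oplus>\<^bsub>cobj X i\<^esub> t (i - 1) (cdiff X i y) = q \<odot>\<^bsub>cobj X i\<^esub> y"
      using q(1) by (auto simp: null_homotopic_def)
    show ?thesis
      unfolding null_homotopic_def
    proof (intro exI[of _ "\<lambda>i y. s i y \<oplus>\<^bsub>cobj X (i + 1)\<^esub> t i y"] conjI allI ballI mhom_sum s(1) t(1))
      fix i y assume y: "y \<in> carrier (cobj X i)"
      have c: "s i y \<in> carrier (cobj X (i + 1))" "s (i - 1) (cdiff X i y) \<in> carrier (cobj X i)"
        "t i y \<in> carrier (cobj X (i + 1))" "t (i - 1) (cdiff X i y) \<in> carrier (cobj X i)"
        using mhom_closed[OF s(1)] y d(4) mhom_closed[OF s(1)[of "i - 1"]] mhom_closed[OF t(1)] mhom_closed[OF t(1)[of "i - 1"]]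
        by simp_all
      show "cdiff X (i + 1) (s i y \<oplus>\<^bsub>cobj X (i + 1)\<^esub> t i y) \<oplus>\<^bsub>cobj X i\<^esub>
          (s (i - 1) (cdiff X i y) \<oplus>\<^bsub>cobj X (i - 1 + 1)\<^esub> t (i - 1) (cdiff X i y)) = (r \<oplus>\<^bsub>R\<^esub> q) \<odot>\<^bsub>cobj X i\<^esub> y"
        using c d1(4)[OF c(1)] d1(4)[OF c(3)] y r(2) q(2)
        by (simp add: d1(5) X.smult_l_distr s(2)[symmetric] t(2)[symmetric] X.a_ac)
    qed
  qed
  have zero: "null_homotopic R X \<zero>\<^bsub>R\<^esub>"
    unfolding null_homotopic_def
  proof (intro exI[of _ "\<lambda>i y. \<zero>\<^bsub>cobj X (i + 1)\<^esub>"] conjI allI ballI mhom_0 X.module_axioms)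
    fix i y assume "y \<in> carrier (cobj X i)"
    then show "cdiff X (i + 1) \<zero>\<^bsub>cobj X (i + 1)\<^esub> \<oplus>\<^bsub>cobj X i\<^esub> \<zero>\<^bsub>cobj X (i - 1 + 1)\<^esub> = \<zero>\<^bsub>R\<^esub> \<odot>\<^bsub>cobj X i\<^esub> y"
      using d1(7) by simp
  qed
  show ?thesis
  proof (rule idealI)
    show "ring R" by (rule X.R.ring_axioms)
    show "subgroup {r \<in> carrier R. null_homotopic R X r} (add_monoid R)"
    proof (rule X.R.add.subgroupI)
      show "{r \<in> carrier R. null_homotopic R X r} \<noteq> {}" using zero by blast
      fix a assume "a \<in> {r \<in> carrier R. null_homotopic R X r}"
      then have a: "a \<in> carrier R" "null_homotopic R X a" by auto
      show "\<ominus>\<^bsub>R\<^esub> a \<in> {r \<in> carrier R. null_homotopic R X r}"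
        using mult[OF a(2,1), of "\<ominus>\<^bsub>R\<^esub> \<one>\<^bsub>R\<^esub>"] a(1) by (simp add: X.R.l_minus)
    qed (use add in auto)
  qed (use mult X.R.m_comm in auto)
qed

section \<open>Koszul complexes as iterated cones\<close>

definition koszul where "koszul xs X = foldr cone xs X"

lemma koszul_simps [simp]:
  "koszul [] X = X" "koszul (x # xs) X = cone x (koszul xs X)" "koszul (xs @ ys) X = koszul xs (koszul ys X)"
  by (simp_all add: koszul_def)

lemma koszul_is_complex: "is_complex R X \<Longrightarrow> set xs \<subseteq> carrier R \<Longrightarrow> is_complex R (koszul xs X)"
  by (induction xs) (simp_all add: cone_is_complex)

lemma koszul_null_homotopic:
  assumes X: "is_complex R X" and "set xs \<subseteq> carrier R" "r \<in> set xs"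
  shows "null_homotopic R (koszul xs X) r"
  using assms(2,3)
proof (induction xs)
  case (Cons x xs)
  then have K: "is_complex R (koszul xs X)" using koszul_is_complex[OF X, of xs] by simp
  show ?case
  proof (cases "r = x")
    case True
    then show ?thesis using cone_null_homotopic_self[OF K] Cons.prems by simp
  next
    case False
    then show ?thesis using cone_null_homotopic[OF K, of x r] Cons by auto
  qed
qed simp

text \<open>The entries of the list are null-homotopic, and the elements with this property form an
  ideal, which therefore contains everything the list generates.\<close>

lemma koszul_kills:
  assumes X: "is_complex R X" and "cring R" "set xs \<subseteq> carrier R" "r \<in> genideal R (set xs)"
  shows "kills r (koszul xs X)"
proof -
  interpret R: cring R by fact
  note K = koszul_is_complex[OF X assms(3)]
  have "genideal R (set xs) \<subseteq> {r \<in> carrier R. null_homotopic R (koszul xs X) r}"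
    by (rule R.genideal_minimal[OF null_homotopic_ideal[OF K]]) (use koszul_null_homotopic[OF X assms(3)] assms(3) in auto)
  then show ?thesis using null_homotopic_kills[OF K] assms(4) by auto
qed

subsection \<open>Isomorphisms of complexes\<close>

definition complex_iso where
  "complex_iso R X Y \<phi> \<longleftrightarrow> (\<forall>i. mhom R (cobj X i) (cobj Y i) (\<phi> i) \<and> ker0 (cobj X i) (cobj Y i) (\<phi> i) \<and>
     \<phi> i ` carrier (cobj X i) = carrier (cobj Y i) \<and>
     (\<forall>x\<in>carrier (cobj X i). \<phi> (i - 1) (cdiff X i x) = cdiff Y i (\<phi> i x)))"

lemma complex_isoD:
  assumes "complex_iso R X Y \<phi>"
  shows "mhom R (cobj X i) (cobj Y i) (\<phi> i)" "ker0 (cobj X i) (cobj Y i) (\<phi> i)"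
    "\<phi> i ` carrier (cobj X i) = carrier (cobj Y i)"
    "x \<in> carrier (cobj X i) \<Longrightarrow> \<phi> (i - 1) (cdiff X i x) = cdiff Y i (\<phi> i x)"
    "x \<in> carrier (cobj X (i + 1)) \<Longrightarrow> \<phi> i (cdiff X (i + 1) x) = cdiff Y (i + 1) (\<phi> (i + 1) x)"
    "y \<in> carrier (cobj Y i) \<Longrightarrow> \<exists>x\<in>carrier (cobj X i). \<phi> i x = y"
proof -
  show 1: "mhom R (cobj X i) (cobj Y i) (\<phi> i)" "ker0 (cobj X i) (cobj Y i) (\<phi> i)"
    "\<phi> i ` carrier (cobj X i) = carrier (cobj Y i)"
    "x \<in> carrier (cobj X i) \<Longrightarrow> \<phi> (i - 1) (cdiff X i x) = cdiff Y i (\<phi> i x)" for x i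
    using assms unfolding complex_iso_def by blast+
  show "\<phi> i (cdiff X (i + 1) x) = cdiff Y (i + 1) (\<phi> (i + 1) x)" if "x \<in> carrier (cobj X (i + 1))"
    using 1(4)[OF that] by simp
  show "y \<in> carrier (cobj Y i) \<Longrightarrow> \<exists>x\<in>carrier (cobj X i). \<phi> i x = y" using 1(3) by (metis imageE)
qed

lemma complex_iso_cycles:
  assumes X: "is_complex R X" and i: "complex_iso R X Y \<phi>" and x: "x \<in> carrier (cobj X i)"
  shows "\<phi> i x \<in> cycles Y i \<longleftrightarrow> x \<in> cycles X i"
proof -
  note c = complex_isoD[OF i]
  have d: "cdiff X i x \<in> carrier (cobj X (i - 1))" by (rule mhom_closed[OF complex_mhom[OF X] x])
  have "cdiff X i x = \<zero>\<^bsub>cobj X (i - 1)\<^esub> \<longleftrightarrow> cdiff Y i (\<phi> i x) = \<zero>\<^bsub>cobj Y (i - 1)\<^esub>"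
    using c(4)[OF x] mhom_zero[OF c(1)[of "i - 1"]] ker0D[OF c(2)[of "i - 1"] d] by metis
  then show ?thesis using x mhom_closed[OF c(1) x] by (simp add: cycles_def)
qed

lemma complex_iso_boundaries:
  assumes X: "is_complex R X" and i: "complex_iso R X Y \<phi>" and x: "x \<in> carrier (cobj X i)"
  shows "\<phi> i x \<in> boundaries Y i \<longleftrightarrow> x \<in> boundaries X i"
proof
  note c = complex_isoD[OF i]
  assume "\<phi> i x \<in> boundaries Y i"
  then obtain w where w: "w \<in> carrier (cobj Y (i + 1))" "\<phi> i x = cdiff Y (i + 1) w" by (rule boundariesE)
  obtain v where v: "v \<in> carrier (cobj X (i + 1))" "\<phi> (i + 1) v = w" using c(6)[OF w(1)] by blast
  have d: "cdiff X (i + 1) v \<in> carrier (cobj X i)" by (rule mhom_closed[OF complex_mhom1[OF X] v(1)])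
  have "\<phi> i x = \<phi> i (cdiff X (i + 1) v)" using c(5)[OF v(1)] v(2) w(2) by simp
  then have "x = cdiff X (i + 1) v" using mhom_eq_iff[OF c(1,2) x d] by simp
  then show "x \<in> boundaries X i" by (rule boundariesI[OF v(1)])
next
  note c = complex_isoD[OF i]
  assume "x \<in> boundaries X i"
  then obtain v where v: "v \<in> carrier (cobj X (i + 1))" "x = cdiff X (i + 1) v" by (rule boundariesE)
  show "\<phi> i x \<in> boundaries Y i"
    by (rule boundariesI[OF mhom_closed[OF c(1) v(1)]]) (simp add: v(2) c(5)[OF v(1)])
qed

lemma complex_iso_exact_at:
  assumes X: "is_complex R X" and i: "complex_iso R X Y \<phi>"
  shows "exact_at Y i \<longleftrightarrow> exact_at X i"
proof -
  note c = complex_isoD[OF i]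
  note z = complex_iso_cycles[OF X i] and b = complex_iso_boundaries[OF X i]
  show ?thesis
    unfolding exact_at_def
  proof (intro iffI subsetI)
    fix x assume "cycles Y i \<subseteq> boundaries Y i" "x \<in> cycles X i"
    moreover have "x \<in> carrier (cobj X i)" using \<open>x \<in> cycles X i\<close> by (simp add: cycles_def)
    ultimately show "x \<in> boundaries X i" using z[of x i] b[of x i] by blast
  next
    fix y assume a: "cycles X i \<subseteq> boundaries X i" "y \<in> cycles Y i"
    then have "y \<in> carrier (cobj Y i)" by (simp add: cycles_def)
    then obtain x where "x \<in> carrier (cobj X i)" "\<phi> i x = y" using c(6) by blast
    then show "y \<in> boundaries Y i" using z[of x i] b[of x i] a by blast
  qed
qed

lemma complex_iso_homology_iso:
  assumes X: "is_complex R X" and Y: "is_complex R Y" and i: "complex_iso R X Y \<phi>" and h: "homology_iso R X i L"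
  shows "homology_iso R Y i L"
proof -
  note c = complex_isoD[OF i]
  note z = complex_iso_cycles[OF X i] and b = complex_iso_boundaries[OF X i]
  obtain f where "ses R (bd_mod X i) (cyc_mod X i) L (\<lambda>x. x) f" using h by (auto simp: homology_iso_def)
  note s = sesD[OF this]
  have cX: "cycles X i \<subseteq> carrier (cobj X i)" and cY: "cycles Y i \<subseteq> carrier (cobj Y i)" by (auto simp: cycles_def)
  have "\<phi> i ` cycles X i \<subseteq> cycles Y i" using z cX by blast
  then have m: "mhom R (cyc_mod X i) (cyc_mod Y i) (\<phi> i)"
    by (intro mhom_restrict_cod[OF mhom_restrict_dom[OF c(1) cycles_submodule[OF X]] cycles_submodule[OF Y]]) simp
  have k: "ker0 (cyc_mod X i) (cyc_mod Y i) (\<phi> i)" using c(2)[of i] cX by (auto simp: ker0_def)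
  have su: "\<phi> i ` carrier (cyc_mod X i) = carrier (cyc_mod Y i)"
  proof
    show "\<phi> i ` carrier (cyc_mod X i) \<subseteq> carrier (cyc_mod Y i)" using mhom_closed[OF m] by blast
    show "carrier (cyc_mod Y i) \<subseteq> \<phi> i ` carrier (cyc_mod X i)"
    proof
      fix y assume y: "y \<in> carrier (cyc_mod Y i)"
      then obtain x where "x \<in> carrier (cobj X i)" "\<phi> i x = y" using c(6)[of y i] cY by auto
      then show "y \<in> \<phi> i ` carrier (cyc_mod X i)" using z[of x i] y by auto
    qed
  qed
  obtain g where g: "mhom R (cyc_mod Y i) (cyc_mod X i) g"
    "\<And>x. x \<in> carrier (cyc_mod X i) \<Longrightarrow> g (\<phi> i x) = x" "\<And>y. y \<in> carrier (cyc_mod Y i) \<Longrightarrow> \<phi> i (g y) = y"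
    by (rule mhom_inverse[OF m k su]) blast
  have gb: "g y \<in> boundaries X i \<longleftrightarrow> y \<in> boundaries Y i" if y: "y \<in> carrier (cyc_mod Y i)" for y
  proof -
    have "g y \<in> carrier (cobj X i)" using mhom_closed[OF g(1) y] cX by auto
    then show ?thesis using b[of "g y" i] g(3)[OF y] by simp
  qed
  have "ses R (bd_mod Y i) (cyc_mod Y i) L (\<lambda>x. x) (\<lambda>y. f (g y))"
  proof (rule sesI[OF bd_cyc_mhom[OF Y] mhom_comp[OF g(1) s(2)]])
    show "ker0 (bd_mod Y i) (cyc_mod Y i) (\<lambda>x. x)" by (simp add: ker0_def)
    fix l assume "l \<in> carrier L"
    then obtain x where "x \<in> carrier (cyc_mod X i)" "f x = l" using s(7) by blast
    then show "\<exists>y\<in>carrier (cyc_mod Y i). f (g y) = l" using g(2) mhom_closed[OF m] by metis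
  next
    fix y assume "y \<in> carrier (bd_mod Y i)"
    then have "y \<in> boundaries Y i" "y \<in> carrier (cyc_mod Y i)" using boundaries_subset_cycles[OF Y] by auto
    then show "f (g y) = \<zero>\<^bsub>L\<^esub>" using gb s(6)[of "g y"] by simp
  next
    fix y assume y: "y \<in> carrier (cyc_mod Y i)" "f (g y) = \<zero>\<^bsub>L\<^esub>"
    then have "g y \<in> boundaries X i" using s(5)[OF mhom_closed[OF g(1) y(1)] y(2)] by auto
    then show "\<exists>a\<in>carrier (bd_mod Y i). y = a" using gb[OF y(1)] by simp
  qed
  then show ?thesis unfolding homology_iso_def by blast
qed

lemma complex_iso_id: "is_complex R X \<Longrightarrow> complex_iso R X X (\<lambda>_ x. x)"
  unfolding complex_iso_def by (auto simp: ker0_def intro: mhom_id complex_module)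

lemma complex_iso_comp:
  assumes X: "is_complex R X" and f: "complex_iso R X Y \<phi>" and g: "complex_iso R Y Z \<psi>"
  shows "complex_iso R X Z (\<lambda>i x. \<psi> i (\<phi> i x))"
  unfolding complex_iso_def
proof (intro allI conjI ballI)
  note c = complex_isoD[OF f] and e = complex_isoD[OF g]
  fix i
  show "mhom R (cobj X i) (cobj Z i) (\<lambda>x. \<psi> i (\<phi> i x))" by (rule mhom_comp[OF c(1) e(1)])
  show "ker0 (cobj X i) (cobj Z i) (\<lambda>x. \<psi> i (\<phi> i x))" by (rule ker0_comp[OF c(1,2) e(2)])
  show "(\<lambda>x. \<psi> i (\<phi> i x)) ` carrier (cobj X i) = carrier (cobj Z i)" using c(3)[of i] e(3)[of i] by (metis image_image)
  fix x assume x: "x \<in> carrier (cobj X i)"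
  show "\<psi> (i - 1) (\<phi> (i - 1) (cdiff X i x)) = cdiff Z i (\<psi> i (\<phi> i x))"
    using c(4)[OF x] e(4)[OF mhom_closed[OF c(1) x]] by simp
qed

lemma cone_iso:
  assumes X: "is_complex R X" and Y: "is_complex R Y" and x: "x \<in> carrier R" and f: "complex_iso R X Y \<phi>"
  shows "complex_iso R (cone x X) (cone x Y) (\<lambda>i h. pr (\<phi> i (p1 h)) (\<phi> (i - 1) (p2 h)))"
  unfolding complex_iso_def
proof (intro allI conjI ballI)
  note c = complex_isoD[OF f]
  note CX = cone_is_complex[OF X x] and CY = cone_is_complex[OF Y x]
  interpret X: module R "cobj X j" for j by (rule complex_module[OF X])
  note m = mhomD[OF c(1)] and d = mhomD[OF complex_mhom[OF X]]
  fix i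
  let ?f = "\<lambda>i h. pr (\<phi> i (p1 h)) (\<phi> (i - 1) (p2 h))"
  show "mhom R (cobj (cone x X) i) (cobj (cone x Y) i) (?f i)"
    by (intro mhomI complex_module[OF CX] complex_module[OF CY]) (auto simp: cone_simps pair_mod_simps m(4,5,6))
  show "ker0 (cobj (cone x X) i) (cobj (cone x Y) i) (?f i)"
    using c(2)[of i] c(2)[of "i - 1"] by (auto simp: ker0_def cone_simps pair_mod_simps)
  show "?f i ` carrier (cobj (cone x X) i) = carrier (cobj (cone x Y) i)"
  proof
    show "?f i ` carrier (cobj (cone x X) i) \<subseteq> carrier (cobj (cone x Y) i)"
      by (auto simp: cone_simps pair_mod_simps m(4))
    show "carrier (cobj (cone x Y) i) \<subseteq> ?f i ` carrier (cobj (cone x X) i)"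
    proof
      fix h assume "h \<in> carrier (cobj (cone x Y) i)"
      then obtain a b where h: "h = pr a b" "a \<in> carrier (cobj Y i)" "b \<in> carrier (cobj Y (i - 1))"
        unfolding cone_simps by (rule pair_mod_cases)
      obtain a' b' where "a' \<in> carrier (cobj X i)" "\<phi> i a' = a" "b' \<in> carrier (cobj X (i - 1))" "\<phi> (i - 1) b' = b"
        using c(6)[OF h(2)] c(6)[OF h(3)] by blast
      then show "h \<in> ?f i ` carrier (cobj (cone x X) i)"
        by (intro image_eqI[of _ _ "pr a' b'"]) (simp_all add: h(1) cone_simps pair_mod_simps(2))
    qed
  qed
  fix h assume "h \<in> carrier (cobj (cone x X) i)"
  then obtain a b where h: "h = pr a b" "a \<in> carrier (cobj X i)" "b \<in> carrier (cobj X (i - 1))"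
    unfolding cone_simps by (rule pair_mod_cases)
  have k: "cdiff X i a \<in> carrier (cobj X (i - 1))" "cdiff X (i - 1) b \<in> carrier (cobj X (i - 1 - 1))"
    using d(4) h by blast+
  show "?f (i - 1) (cdiff (cone x X) i h) = cdiff (cone x Y) i (?f i h)"
    unfolding h(1) cone_simps pr_simps c(4)[OF h(2), symmetric] c(4)[OF h(3), symmetric] mhom_neg[OF c(1) k(2)]
    using h(3) k(1) x by (simp add: m(5,6))
qed

text \<open>The two middle components change places. The sign on the last one is the Koszul sign for
  exchanging two generators of degree one; without it the map would not commute with the
  differentials.\<close>

lemma cone_swap:
  assumes X: "is_complex R X" and x: "x \<in> carrier R" and y: "y \<in> carrier R"
  shows "complex_iso R (cone x (cone y X)) (cone y (cone x X))
    (\<lambda>i h. pr (pr (p1 (p1 h)) (p1 (p2 h))) (pr (p2 (p1 h)) (\<ominus>\<^bsub>cobj X (i - 1 - 1)\<^esub> p2 (p2 h))))"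
  unfolding complex_iso_def
proof (intro allI conjI ballI)
  interpret X: module R "cobj X j" for j by (rule complex_module[OF X])
  note d = mhomD[OF complex_mhom[OF X]]
  note Cy = cone_is_complex[OF X y] and Cx = cone_is_complex[OF X x]
  note Cxy = cone_is_complex[OF Cy x] and Cyx = cone_is_complex[OF Cx y]
  fix i
  let ?f = "\<lambda>i h. pr (pr (p1 (p1 h)) (p1 (p2 h))) (pr (p2 (p1 h)) (\<ominus>\<^bsub>cobj X (i - 1 - 1)\<^esub> p2 (p2 h)))"
  have ca: thesis if "h \<in> carrier (cobj (cone x (cone y X)) i)"
    and "\<And>a b c e. h = pr (pr a b) (pr c e) \<Longrightarrow> a \<in> carrier (cobj X i) \<Longrightarrow> b \<in> carrier (cobj X (i - 1)) \<Longrightarrow>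
      c \<in> carrier (cobj X (i - 1)) \<Longrightarrow> e \<in> carrier (cobj X (i - 1 - 1)) \<Longrightarrow> thesis" for h thesis x y
    using that(1) unfolding cone_simps by (elim pair_mod_cases) (use that(2) in blast)
  show "mhom R (cobj (cone x (cone y X)) i) (cobj (cone y (cone x X)) i) (?f i)"
  proof (rule mhomI[OF complex_module[OF Cxy] complex_module[OF Cyx]])
    fix h assume "h \<in> carrier (cobj (cone x (cone y X)) i)"
    then obtain a b c e where h: "h = pr (pr a b) (pr c e)" "a \<in> carrier (cobj X i)" "b \<in> carrier (cobj X (i - 1))"
      "c \<in> carrier (cobj X (i - 1))" "e \<in> carrier (cobj X (i - 1 - 1))" by (rule ca)
    show "?f i h \<in> carrier (cobj (cone y (cone x X)) i)"
      unfolding h(1) cone_simps pair_mod_simps(2) pr_simps using h(2-) by (simp del: diff_diff_eq diff_diff_add)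
    { fix r assume r: "r \<in> carrier R"
      show "?f i (r \<odot>\<^bsub>cobj (cone x (cone y X)) i\<^esub> h) = r \<odot>\<^bsub>cobj (cone y (cone x X)) i\<^esub> ?f i h"
        unfolding h(1) cone_simps pair_mod_simps(5) pr_simps X.smult_r_minus[OF r h(5)] .. }
    fix k assume "k \<in> carrier (cobj (cone x (cone y X)) i)"
    then obtain a' b' c' e' where k: "k = pr (pr a' b') (pr c' e')" "a' \<in> carrier (cobj X i)" "b' \<in> carrier (cobj X (i - 1))"
      "c' \<in> carrier (cobj X (i - 1))" "e' \<in> carrier (cobj X (i - 1 - 1))" by (rule ca)
    show "?f i (h \<oplus>\<^bsub>cobj (cone x (cone y X)) i\<^esub> k) = ?f i h \<oplus>\<^bsub>cobj (cone y (cone x X)) i\<^esub> ?f i k"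
      unfolding h(1) k(1) cone_simps pair_mod_simps(4) pr_simps X.minus_add[OF h(5) k(5)] ..
  qed
  show "ker0 (cobj (cone x (cone y X)) i) (cobj (cone y (cone x X)) i) (?f i)"
    unfolding ker0_def
  proof (intro ballI impI)
    fix h assume "h \<in> carrier (cobj (cone x (cone y X)) i)" and z: "?f i h = \<zero>\<^bsub>cobj (cone y (cone x X)) i\<^esub>"
    then obtain a b c e where h: "h = pr (pr a b) (pr c e)" "a \<in> carrier (cobj X i)" "b \<in> carrier (cobj X (i - 1))"
      "c \<in> carrier (cobj X (i - 1))" "e \<in> carrier (cobj X (i - 1 - 1))" by (elim ca)
    show "h = \<zero>\<^bsub>cobj (cone x (cone y X)) i\<^esub>"
      using z X.minus_minus[OF h(5)] unfolding h(1) cone_simps pair_mod_simps(3) pr_simps pr_eq by auto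
  qed
  show "?f i ` carrier (cobj (cone x (cone y X)) i) = carrier (cobj (cone y (cone x X)) i)"
  proof
    show "?f i ` carrier (cobj (cone x (cone y X)) i) \<subseteq> carrier (cobj (cone y (cone x X)) i)"
    proof (intro image_subsetI)
      fix h assume "h \<in> carrier (cobj (cone x (cone y X)) i)"
      then obtain a b c e where h: "h = pr (pr a b) (pr c e)" "a \<in> carrier (cobj X i)" "b \<in> carrier (cobj X (i - 1))"
        "c \<in> carrier (cobj X (i - 1))" "e \<in> carrier (cobj X (i - 1 - 1))" by (rule ca)
      show "?f i h \<in> carrier (cobj (cone y (cone x X)) i)"
        unfolding h(1) cone_simps pair_mod_simps(2) pr_simps using h(2-) by (simp del: diff_diff_eq diff_diff_add)
    qed
    show "carrier (cobj (cone y (cone x X)) i) \<subseteq> ?f i ` carrier (cobj (cone x (cone y X)) i)"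
    proof
      fix h assume "h \<in> carrier (cobj (cone y (cone x X)) i)"
      then obtain a b c e where h: "h = pr (pr a b) (pr c e)" "a \<in> carrier (cobj X i)" "b \<in> carrier (cobj X (i - 1))"
        "c \<in> carrier (cobj X (i - 1))" "e \<in> carrier (cobj X (i - 1 - 1))" by (rule ca)
      show "h \<in> ?f i ` carrier (cobj (cone x (cone y X)) i)"
      proof (rule image_eqI)
        show "h = ?f i (pr (pr a c) (pr b (\<ominus>\<^bsub>cobj X (i - 1 - 1)\<^esub> e)))"
          unfolding h(1) pr_simps X.minus_minus[OF h(5)] ..
        show "pr (pr a c) (pr b (\<ominus>\<^bsub>cobj X (i - 1 - 1)\<^esub> e)) \<in> carrier (cobj (cone x (cone y X)) i)"
          unfolding cone_simps pair_mod_simps(2) using h(2-) by (simp del: diff_diff_eq diff_diff_add)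
      qed
    qed
  qed
  fix h assume "h \<in> carrier (cobj (cone x (cone y X)) i)"
  then obtain a b c e where h: "h = pr (pr a b) (pr c e)" "a \<in> carrier (cobj X i)" "b \<in> carrier (cobj X (i - 1))"
    "c \<in> carrier (cobj X (i - 1))" "e \<in> carrier (cobj X (i - 1 - 1))" by (rule ca)
  have k: "cdiff X i a \<in> carrier (cobj X (i - 1))" "cdiff X (i - 1) b \<in> carrier (cobj X (i - 1 - 1))"
    "cdiff X (i - 1) c \<in> carrier (cobj X (i - 1 - 1))" "cdiff X (i - 1 - 1) e \<in> carrier (cobj X (i - 1 - 1 - 1))"
    using d(4) h(2-) by blast+
  have sx: "x \<odot>\<^bsub>cobj X j\<^esub> v \<in> carrier (cobj X j)" and sy: "y \<odot>\<^bsub>cobj X j\<^esub> v \<in> carrier (cobj X j)"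
    if "v \<in> carrier (cobj X j)" for v j using that x y by simp_all
  note n = pair_mod_neg[OF X.module_axioms X.module_axioms]
  have e1: "cdiff X i a \<oplus>\<^bsub>cobj X (i - 1)\<^esub> y \<odot>\<^bsub>cobj X (i - 1)\<^esub> b \<oplus>\<^bsub>cobj X (i - 1)\<^esub> x \<odot>\<^bsub>cobj X (i - 1)\<^esub> c =
      cdiff X i a \<oplus>\<^bsub>cobj X (i - 1)\<^esub> x \<odot>\<^bsub>cobj X (i - 1)\<^esub> c \<oplus>\<^bsub>cobj X (i - 1)\<^esub> y \<odot>\<^bsub>cobj X (i - 1)\<^esub> b"
    using k(1) sx[OF h(4)] sy[OF h(3)] by (simp add: X.a_ac)
  have e2: "\<ominus>\<^bsub>cobj X (i - 1 - 1)\<^esub> (cdiff X (i - 1) c \<oplus>\<^bsub>cobj X (i - 1 - 1)\<^esub> y \<odot>\<^bsub>cobj X (i - 1 - 1)\<^esub> e) =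
      \<ominus>\<^bsub>cobj X (i - 1 - 1)\<^esub> cdiff X (i - 1) c \<oplus>\<^bsub>cobj X (i - 1 - 1)\<^esub> y \<odot>\<^bsub>cobj X (i - 1 - 1)\<^esub> (\<ominus>\<^bsub>cobj X (i - 1 - 1)\<^esub> e)"
    unfolding X.minus_add[OF k(3) sy[OF h(5)]] X.smult_r_minus[OF y h(5)] ..
  have e3: "\<ominus>\<^bsub>cobj X (i - 1 - 1)\<^esub> cdiff X (i - 1) b \<oplus>\<^bsub>cobj X (i - 1 - 1)\<^esub> x \<odot>\<^bsub>cobj X (i - 1 - 1)\<^esub> e =
      \<ominus>\<^bsub>cobj X (i - 1 - 1)\<^esub> (cdiff X (i - 1) b \<oplus>\<^bsub>cobj X (i - 1 - 1)\<^esub> x \<odot>\<^bsub>cobj X (i - 1 - 1)\<^esub> (\<ominus>\<^bsub>cobj X (i - 1 - 1)\<^esub> e))"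
    unfolding X.smult_r_minus[OF x h(5)] X.minus_add[OF k(2) X.a_inv_closed[OF sx[OF h(5)]]] X.minus_minus[OF sx[OF h(5)]] ..
  have c1: "cdiff X (i - 1) c \<oplus>\<^bsub>cobj X (i - 1 - 1)\<^esub> y \<odot>\<^bsub>cobj X (i - 1 - 1)\<^esub> e \<in> carrier (cobj X (i - 1 - 1))"
    by (rule X.a_closed[OF k(3) sy[OF h(5)]])
  have c2: "cdiff X (i - 1) b \<oplus>\<^bsub>cobj X (i - 1 - 1)\<^esub> x \<odot>\<^bsub>cobj X (i - 1 - 1)\<^esub> (\<ominus>\<^bsub>cobj X (i - 1 - 1)\<^esub> e) \<in> carrier (cobj X (i - 1 - 1))"
    by (rule X.a_closed[OF k(2) sx[OF X.a_inv_closed[OF h(5)]]])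
  have c3: "\<ominus>\<^bsub>cobj X (i - 1 - 1 - 1)\<^esub> cdiff X (i - 1 - 1) (\<ominus>\<^bsub>cobj X (i - 1 - 1)\<^esub> e) \<in> carrier (cobj X (i - 1 - 1 - 1))"
    by (rule X.a_inv_closed[OF d(4)[OF X.a_inv_closed[OF h(5)]]])
  have e4: "\<ominus>\<^bsub>cobj X (i - 1 - 1 - 1)\<^esub> (\<ominus>\<^bsub>cobj X (i - 1 - 1 - 1)\<^esub> (\<ominus>\<^bsub>cobj X (i - 1 - 1 - 1)\<^esub> cdiff X (i - 1 - 1) e)) =
      \<ominus>\<^bsub>cobj X (i - 1 - 1 - 1)\<^esub> (\<ominus>\<^bsub>cobj X (i - 1 - 1 - 1)\<^esub> cdiff X (i - 1 - 1) (\<ominus>\<^bsub>cobj X (i - 1 - 1)\<^esub> e))"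
    unfolding mhom_neg[OF complex_mhom[OF X] h(5)] ..
  show "?f (i - 1) (cdiff (cone x (cone y X)) i h) = cdiff (cone y (cone x X)) i (?f i h)"
    unfolding h(1) cone_simps pr_simps pair_mod_simps(4,5) n[OF c1 X.a_inv_closed[OF k(4)]] n[OF c2 c3] pr_eq
    by (intro conjI e1 e2 e3 e4)
qed

lemma koszul_cone_iso:
  assumes X: "is_complex R X" and "set xs \<subseteq> carrier R" and y: "y \<in> carrier R"
  shows "\<exists>\<phi>. complex_iso R (koszul xs (cone y X)) (cone y (koszul xs X)) \<phi>"
  using assms(2)
proof (induction xs)
  case Nil
  show ?case using complex_iso_id[OF cone_is_complex[OF X y]] by auto
next
  case (Cons x xs)
  then have x: "x \<in> carrier R" and xs: "set xs \<subseteq> carrier R" by auto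
  note K = koszul_is_complex[OF X xs]
  note Ky = koszul_is_complex[OF cone_is_complex[OF X y] xs]
  obtain \<phi> where "complex_iso R (koszul xs (cone y X)) (cone y (koszul xs X)) \<phi>" using Cons.IH[OF xs] by blast
  from complex_iso_comp[OF cone_is_complex[OF Ky x] cone_iso[OF Ky cone_is_complex[OF K y] x this] cone_swap[OF K x y]]
  show ?case unfolding koszul_simps by blast
qed

text \<open>Used to compare the cones on a regular sequence taken before those on generators of the
  maximal ideal with the same cones taken afterwards.\<close>

lemma koszul_swap:
  assumes X: "is_complex R X" and xs: "set xs \<subseteq> carrier R" and "set ys \<subseteq> carrier R"
  shows "\<exists>\<phi>. complex_iso R (koszul xs (koszul ys X)) (koszul ys (koszul xs X)) \<phi>"
  using assms(3)
proof (induction ys)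
  case Nil
  show ?case using complex_iso_id[OF koszul_is_complex[OF X xs]] by auto
next
  case (Cons y ys)
  then have y: "y \<in> carrier R" and ys: "set ys \<subseteq> carrier R" by auto
  note K = koszul_is_complex[OF X ys]
  obtain \<phi> where f: "complex_iso R (koszul xs (koszul ys X)) (koszul ys (koszul xs X)) \<phi>" using Cons.IH[OF ys] by blast
  obtain \<psi> where g: "complex_iso R (koszul xs (cone y (koszul ys X))) (cone y (koszul xs (koszul ys X))) \<psi>"
    using koszul_cone_iso[OF K xs y] by blast
  from complex_iso_comp[OF koszul_is_complex[OF cone_is_complex[OF K y] xs] g
    cone_iso[OF koszul_is_complex[OF K xs] koszul_is_complex[OF koszul_is_complex[OF X xs] ys] y f]]
  show ?case unfolding koszul_simps by blast
qed

subsection \<open>Moving a complex to the element type of cones\<close>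

definition seq_of :: "'p \<Rightarrow> 'p seq" where "seq_of x = (\<lambda>l. x)"

lemma seq_of_simps [simp]: "seq_of x [] = x" "seq_of x = seq_of y \<longleftrightarrow> x = y"
  by (auto simp: seq_of_def fun_eq_iff)

definition seq_mod :: "('a, 'p, 's) module_scheme \<Rightarrow> ('a, 'p seq) module" where
  "seq_mod A = \<lparr>carrier = seq_of ` carrier A, monoid.mult = undefined, one = undefined, ring.zero = seq_of \<zero>\<^bsub>A\<^esub>,
     add = (\<lambda>h k. seq_of (h [] \<oplus>\<^bsub>A\<^esub> k [])), smult = (\<lambda>r h. seq_of (r \<odot>\<^bsub>A\<^esub> h []))\<rparr>"

lemma seq_mod_simps:
  "h \<in> carrier (seq_mod A) \<longleftrightarrow> (\<exists>a\<in>carrier A. h = seq_of a)"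
  "\<zero>\<^bsub>seq_mod A\<^esub> = seq_of \<zero>\<^bsub>A\<^esub>"
  "h \<oplus>\<^bsub>seq_mod A\<^esub> k = seq_of (h [] \<oplus>\<^bsub>A\<^esub> k [])"
  "r \<odot>\<^bsub>seq_mod A\<^esub> h = seq_of (r \<odot>\<^bsub>A\<^esub> h [])"
  by (auto simp: seq_mod_def)

lemma seq_mod_is_module:
  assumes "module R A"
  shows "module R (seq_mod A)"
proof -
  interpret A: module R A by fact
  show ?thesis
  proof (rule moduleI)
    show "abelian_group (seq_mod A)"
    proof (rule abelian_groupI)
      fix h assume "h \<in> carrier (seq_mod A)"
      then obtain a where "h = seq_of a" "a \<in> carrier A" by (auto simp: seq_mod_simps)
      then show "\<exists>k\<in>carrier (seq_mod A). k \<oplus>\<^bsub>seq_mod A\<^esub> h = \<zero>\<^bsub>seq_mod A\<^esub>"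
        by (intro bexI[of _ "seq_of (\<ominus>\<^bsub>A\<^esub> a)"]) (auto simp: seq_mod_simps A.l_neg)
    qed (auto simp: seq_mod_simps A.a_ac)
  qed (auto simp: seq_mod_simps A.smult_l_distr A.smult_r_distr A.smult_assoc1 A.R.is_cring)
qed

definition seq_complex :: "('a, 'p) mod_complex \<Rightarrow> ('a, 'p seq) mod_complex" where
  "seq_complex X = \<lparr>cobj = (\<lambda>i. seq_mod (cobj X i)), cdiff = (\<lambda>i h. seq_of (cdiff X i (h [])))\<rparr>"

lemma seq_complex_simps:
  "cobj (seq_complex X) i = seq_mod (cobj X i)" "cdiff (seq_complex X) i h = seq_of (cdiff X i (h []))"
  by (simp_all add: seq_complex_def)

lemma seq_of_mhom: "mhom R A B f \<Longrightarrow> mhom R (seq_mod A) (seq_mod B) (\<lambda>h. seq_of (f (h [])))"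
  by (rule mhomI) (auto simp: seq_mod_simps mhomD intro: seq_mod_is_module)

lemma seq_complex_is_complex:
  assumes X: "is_complex R X"
  shows "is_complex R (seq_complex X)"
  unfolding is_complex_def
proof (intro allI conjI ballI)
  fix i
  show "module R (cobj (seq_complex X) i)"
    unfolding seq_complex_simps by (rule seq_mod_is_module[OF complex_module[OF X]])
  show "cdiff (seq_complex X) i \<in> mod_hom R (cobj (seq_complex X) i) (cobj (seq_complex X) (i - 1))"
    using mhom_mod_hom[OF seq_of_mhom[OF complex_mhom[OF X]]] by (simp add: seq_complex_def)
  fix h assume "h \<in> carrier (cobj (seq_complex X) i)"
  then obtain a where a: "h = seq_of a" "a \<in> carrier (cobj X i)" by (auto simp: seq_complex_simps seq_mod_simps)
  have "cdiff X (i - 1) (cdiff X i a) = \<zero>\<^bsub>cobj X (i - 1 - 1)\<^esub>"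
    using X a(2) unfolding is_complex_def by blast
  then show "cdiff (seq_complex X) (i - 1) (cdiff (seq_complex X) i h) = \<zero>\<^bsub>cobj (seq_complex X) (i - 1 - 1)\<^esub>"
    unfolding seq_complex_simps seq_mod_simps a(1) seq_of_simps .
qed

lemma seq_complex_iso:
  assumes X: "is_complex R X"
  shows "complex_iso R X (seq_complex X) (\<lambda>_. seq_of)"
  unfolding complex_iso_def seq_complex_simps
proof (intro allI conjI ballI)
  interpret X: module R "cobj X j" for j by (rule complex_module[OF X])
  show "mhom R (cobj X i) (seq_mod (cobj X i)) seq_of" for i
    by (intro mhomI seq_mod_is_module X.module_axioms) (auto simp: seq_mod_simps)
qed (auto simp: ker0_def seq_mod_simps)

subsection \<open>Homology of cones\<close>

text \<open>If \<open>x\<close> is regular on all homology modules, the long exact sequence of the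
  cone reduces to \<open>H_i(cone) = H_i(X) / x H_i(X)\<close>; \<open>\<rho>\<close> presents this
  quotient. For a cycle \<open>(a, b)\<close> the relation \<open>x b = - d a\<close> makes
  \<open>x\<close> kill the class of \<open>b\<close>, so \<open>b = d v\<close>, and the class
  attached to \<open>(a, b)\<close> is that of the cycle \<open>a + x v\<close> modulo
  \<open>x\<close>.\<close>

lemma homology_iso_cone:
  assumes X: "is_complex R X" and x: "x \<in> carrier R" and H: "\<And>i. homology_iso R X i (L i)"
    and reg: "\<And>i. regular_on (L i) x"
    and \<rho>: "\<And>i. mhom R (L i) (L' i) (\<rho> i)" "\<And>i. \<rho> i ` carrier (L i) = carrier (L' i)"
    and ker: "\<And>i l. l \<in> carrier (L i) \<Longrightarrow> \<rho> i l = \<zero>\<^bsub>L' i\<^esub> \<longleftrightarrow> (\<exists>l'\<in>carrier (L i). l = x \<odot>\<^bsub>L i\<^esub> l')"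
  shows "homology_iso R (cone x X) i (L' i)"
proof -
  have main: "homology_iso R (cone x X) (i + 1) (L' (i + 1))" for i
  proof -
    interpret X: module R "cobj X j" for j by (rule complex_module[OF X])
    note d = mhomD[OF complex_mhom1[OF X]] and dneg = mhom_neg[OF complex_mhom1[OF X]]
    note C = cone_is_complex[OF X x]
    obtain \<phi> where "ses R (bd_mod X (i + 1)) (cyc_mod X (i + 1)) (L (i + 1)) (\<lambda>x. x) \<phi>"
      using H[of "i + 1"] by (auto simp: homology_iso_def)
    note p = sesD[OF this]
    obtain \<phi>0 where "ses R (bd_mod X i) (cyc_mod X i) (L i) (\<lambda>x. x) \<phi>0"
      using H[of i] by (auto simp: homology_iso_def)
    note q = sesD[OF this]
    note \<rho>1 = \<rho>(1)[of "i + 1"]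
    interpret L: module R "L (i + 1)" by (rule mhom_dom[OF \<rho>1])
    interpret L': module R "L' (i + 1)" by (rule mhom_cod[OF \<rho>1])
    let ?X1 = "cobj X (i + 1)" and ?X = "cobj X i"
    let ?g = "\<lambda>y. \<rho> (i + 1) (\<phi> y)"
    have g: "mhom R (cyc_mod X (i + 1)) (L' (i + 1)) ?g" by (rule mhom_comp[OF p(2) \<rho>1])
    have gc: "?g y \<in> carrier (L' (i + 1))" if "y \<in> cycles X (i + 1)" for y using mhom_closed[OF g] that by simp
    have gadd: "?g (y \<oplus>\<^bsub>?X1\<^esub> z) = ?g y \<oplus>\<^bsub>L' (i + 1)\<^esub> ?g z" if "y \<in> cycles X (i + 1)" "z \<in> cycles X (i + 1)" for y z
      using mhom_add[OF g] that by simp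
    have gsm: "?g (r \<odot>\<^bsub>?X1\<^esub> y) = r \<odot>\<^bsub>L' (i + 1)\<^esub> ?g y" if "r \<in> carrier R" "y \<in> cycles X (i + 1)" for r y
      using mhom_smult[OF g] that by simp
    have gx: "?g (x \<odot>\<^bsub>?X1\<^esub> y) = \<zero>\<^bsub>L' (i + 1)\<^esub>" if y: "y \<in> cycles X (i + 1)" for y
    proof -
      have y': "y \<in> carrier (cyc_mod X (i + 1))" using y by simp
      have "\<phi> (x \<odot>\<^bsub>?X1\<^esub> y) = x \<odot>\<^bsub>L (i + 1)\<^esub> \<phi> y" using mhom_smult[OF p(2) x y'] by simp
      then show ?thesis using ker[of "\<phi> (x \<odot>\<^bsub>?X1\<^esub> y)" "i + 1"] mhom_closed[OF p(2) y'] x by auto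
    qed
    have cyc: "y \<in> cycles X (i + 1) \<longleftrightarrow> y \<in> carrier ?X1 \<and> cdiff X (i + 1) y = \<zero>\<^bsub>?X\<^esub>" for y
      by (simp add: cycles_def)
    \<comment> \<open>The only place where regularity enters: it forces \<open>b\<close> to be a
      boundary.\<close>
    have lift: "\<exists>v\<in>carrier ?X1. cdiff X (i + 1) v = b \<and> a \<oplus>\<^bsub>?X1\<^esub> x \<odot>\<^bsub>?X1\<^esub> v \<in> cycles X (i + 1)"
      if "a \<in> carrier ?X1" "b \<in> cycles X i" "cdiff X (i + 1) a \<oplus>\<^bsub>?X\<^esub> x \<odot>\<^bsub>?X\<^esub> b = \<zero>\<^bsub>?X\<^esub>" for a b
    proof -
      have b: "b \<in> carrier (cyc_mod X i)" "b \<in> carrier ?X" using that(2) by (simp_all add: cycles_def)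
      have da: "cdiff X (i + 1) a \<in> carrier ?X" by (rule d(4)[OF that(1)])
      have "x \<odot>\<^bsub>?X\<^esub> b = \<ominus>\<^bsub>?X\<^esub> cdiff X (i + 1) a"
        using that(3) da b(2) x
        by (intro X.minus_equality[symmetric]) (simp_all add: X.a_comm[of "x \<odot>\<^bsub>?X\<^esub> b" i "cdiff X (i + 1) a"])
      also have "\<dots> = cdiff X (i + 1) (\<ominus>\<^bsub>?X1\<^esub> a)" using dneg[OF that(1)] by simp
      finally have "x \<odot>\<^bsub>?X\<^esub> b \<in> carrier (bd_mod X i)" using that(1) by (auto intro: boundariesI[of "\<ominus>\<^bsub>?X1\<^esub> a"])
      then have "\<phi>0 (x \<odot>\<^bsub>?X\<^esub> b) = \<zero>\<^bsub>L i\<^esub>" by (rule q(6))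
      then have "x \<odot>\<^bsub>L i\<^esub> \<phi>0 b = \<zero>\<^bsub>L i\<^esub>" using mhom_smult[OF q(2) x b(1)] by simp
      then have "\<phi>0 b = \<zero>\<^bsub>L i\<^esub>" using reg[of i] mhom_closed[OF q(2) b(1)] by (simp add: regular_on_def)
      then have "b \<in> boundaries X i" using q(5)[OF b(1)] by simp
      then obtain v where v: "v \<in> carrier ?X1" "b = cdiff X (i + 1) v" by (rule boundariesE)
      have "cdiff X (i + 1) (a \<oplus>\<^bsub>?X1\<^esub> x \<odot>\<^bsub>?X1\<^esub> v) = \<zero>\<^bsub>?X\<^esub>"
        using that(1,3) v x by (simp add: d)
      then show ?thesis using v that(1) x cyc by auto
    qed
    define sec where "sec b = (SOME v. v \<in> carrier ?X1 \<and> cdiff X (i + 1) v = b)" for b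
    define \<psi> where "\<psi> h = ?g (p1 h \<oplus>\<^bsub>?X1\<^esub> x \<odot>\<^bsub>?X1\<^esub> sec (p2 h))" for h
    \<comment> \<open>The value does not depend on \<open>v\<close>: another choice differs from it
      by a cycle, and \<open>x\<close> times a cycle is zero in \<open>L'\<close>.\<close>
    have key: "\<psi> (pr a b) = ?g (a \<oplus>\<^bsub>?X1\<^esub> x \<odot>\<^bsub>?X1\<^esub> v)" and keyc: "a \<oplus>\<^bsub>?X1\<^esub> x \<odot>\<^bsub>?X1\<^esub> v \<in> cycles X (i + 1)"
      if ab: "a \<in> carrier ?X1" "b \<in> cycles X i" "cdiff X (i + 1) a \<oplus>\<^bsub>?X\<^esub> x \<odot>\<^bsub>?X\<^esub> b = \<zero>\<^bsub>?X\<^esub>"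
        and v: "v \<in> carrier ?X1" "cdiff X (i + 1) v = b" for a b v
    proof -
      have c: "a \<oplus>\<^bsub>?X1\<^esub> x \<odot>\<^bsub>?X1\<^esub> w \<in> cycles X (i + 1)" if "w \<in> carrier ?X1" "cdiff X (i + 1) w = b" for w
        using ab(1,3) that x by (simp add: cyc d)
      show "a \<oplus>\<^bsub>?X1\<^esub> x \<odot>\<^bsub>?X1\<^esub> v \<in> cycles X (i + 1)" using c v by blast
      have s: "sec b \<in> carrier ?X1 \<and> cdiff X (i + 1) (sec b) = b"
        unfolding sec_def by (rule someI[of _ v]) (use v in simp)
      have z: "sec b \<ominus>\<^bsub>?X1\<^esub> v \<in> cycles X (i + 1)"
        using s v d(4)[OF v(1)] by (simp add: cyc d X.minus_closed) (simp add: X.minus_eq_zero_iff)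
      have "a \<oplus>\<^bsub>?X1\<^esub> x \<odot>\<^bsub>?X1\<^esub> sec b = (a \<oplus>\<^bsub>?X1\<^esub> x \<odot>\<^bsub>?X1\<^esub> v) \<oplus>\<^bsub>?X1\<^esub> x \<odot>\<^bsub>?X1\<^esub> (sec b \<ominus>\<^bsub>?X1\<^esub> v)"
      proof -
        have "x \<odot>\<^bsub>?X1\<^esub> v \<oplus>\<^bsub>?X1\<^esub> x \<odot>\<^bsub>?X1\<^esub> (sec b \<ominus>\<^bsub>?X1\<^esub> v) = x \<odot>\<^bsub>?X1\<^esub> (v \<oplus>\<^bsub>?X1\<^esub> (sec b \<ominus>\<^bsub>?X1\<^esub> v))"
          using s v(1) x by (simp add: X.smult_r_distr X.minus_closed)
        also have "v \<oplus>\<^bsub>?X1\<^esub> (sec b \<ominus>\<^bsub>?X1\<^esub> v) = sec b"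
          using s v(1) X.a_comm[of v "i + 1" "sec b \<ominus>\<^bsub>?X1\<^esub> v"] by (simp add: X.minus_eq X.a_assoc X.l_neg)
        finally show ?thesis using s v(1) x ab(1) by (simp add: X.a_assoc X.minus_closed)
      qed
      then have "\<psi> (pr a b) = ?g (a \<oplus>\<^bsub>?X1\<^esub> x \<odot>\<^bsub>?X1\<^esub> v) \<oplus>\<^bsub>L' (i + 1)\<^esub> ?g (x \<odot>\<^bsub>?X1\<^esub> (sec b \<ominus>\<^bsub>?X1\<^esub> v))"
        unfolding \<psi>_def pr_simps using gadd[OF c[OF v]] X.submoduleE(4)[OF cycles_submodule[OF X] x z] by simp
      then show "\<psi> (pr a b) = ?g (a \<oplus>\<^bsub>?X1\<^esub> x \<odot>\<^bsub>?X1\<^esub> v)"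
        using gx[OF z] gc[OF c[OF v]] by simp
    qed
    have el: thesis if h: "h \<in> cycles (cone x X) (i + 1)" and
      t: "\<And>a b v. h = pr a b \<Longrightarrow> a \<in> carrier ?X1 \<Longrightarrow> b \<in> cycles X i \<Longrightarrow>
        cdiff X (i + 1) a \<oplus>\<^bsub>?X\<^esub> x \<odot>\<^bsub>?X\<^esub> b = \<zero>\<^bsub>?X\<^esub> \<Longrightarrow> v \<in> carrier ?X1 \<Longrightarrow> cdiff X (i + 1) v = b \<Longrightarrow> thesis" for h thesis
    proof -
      from h obtain a b where ab: "h = pr a b" "a \<in> carrier ?X1" "b \<in> cycles X i"
        "cdiff X (i + 1) a \<oplus>\<^bsub>?X\<^esub> x \<odot>\<^bsub>?X\<^esub> b = \<zero>\<^bsub>?X\<^esub>" by (rule cone_cyclesE[OF X x])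
      with lift[OF ab(2-4)] t show thesis by blast
    qed
    have CX: "cobj (cone x X) (i + 1) = pair_mod ?X1 ?X" by (simp add: cone_simps)
    have \<psi>: "mhom R (cyc_mod (cone x X) (i + 1)) (L' (i + 1)) \<psi>"
    proof (rule mhomI[OF cyc_mod_module[OF C] L'.module_axioms])
      fix h assume "h \<in> carrier (cyc_mod (cone x X) (i + 1))"
      then have hc: "h \<in> cycles (cone x X) (i + 1)" by simp
      then obtain a b v where h: "h = pr a b" "a \<in> carrier ?X1" "b \<in> cycles X i"
        "cdiff X (i + 1) a \<oplus>\<^bsub>?X\<^esub> x \<odot>\<^bsub>?X\<^esub> b = \<zero>\<^bsub>?X\<^esub>" "v \<in> carrier ?X1" "cdiff X (i + 1) v = b" by (rule el)
      have bc: "b \<in> carrier ?X" using h(3) by (simp add: cycles_def)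
      note kh = key[OF h(2-6)] and kc = keyc[OF h(2-6)]
      show "\<psi> h \<in> carrier (L' (i + 1))" unfolding h(1) kh by (rule gc[OF kc])
      { fix r assume r: "r \<in> carrier R"
        have rh: "r \<odot>\<^bsub>cyc_mod (cone x X) (i + 1)\<^esub> h = pr (r \<odot>\<^bsub>?X1\<^esub> a) (r \<odot>\<^bsub>?X\<^esub> b)"
          unfolding h(1) by (simp add: CX pair_mod_simps(5))
        have e: "r \<odot>\<^bsub>?X1\<^esub> a \<oplus>\<^bsub>?X1\<^esub> x \<odot>\<^bsub>?X1\<^esub> (r \<odot>\<^bsub>?X1\<^esub> v) = r \<odot>\<^bsub>?X1\<^esub> (a \<oplus>\<^bsub>?X1\<^esub> x \<odot>\<^bsub>?X1\<^esub> v)"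
          using h(2,5) x r by (simp add: X.smult_r_distr X.smult_assoc1[symmetric] X.R.m_comm)
        have e2: "cdiff X (i + 1) (r \<odot>\<^bsub>?X1\<^esub> a) \<oplus>\<^bsub>?X\<^esub> x \<odot>\<^bsub>?X\<^esub> (r \<odot>\<^bsub>?X\<^esub> b) = \<zero>\<^bsub>?X\<^esub>"
        proof -
          have "cdiff X (i + 1) (r \<odot>\<^bsub>?X1\<^esub> a) \<oplus>\<^bsub>?X\<^esub> x \<odot>\<^bsub>?X\<^esub> (r \<odot>\<^bsub>?X\<^esub> b) = r \<odot>\<^bsub>?X\<^esub> (cdiff X (i + 1) a \<oplus>\<^bsub>?X\<^esub> x \<odot>\<^bsub>?X\<^esub> b)"
            using h(2) bc x r d(4)[OF h(2)] by (simp add: d(6) X.smult_r_distr X.smult_assoc1[symmetric] X.R.m_comm)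
          then show ?thesis unfolding h(4) using r by simp
        qed
        have "\<psi> (pr (r \<odot>\<^bsub>?X1\<^esub> a) (r \<odot>\<^bsub>?X\<^esub> b)) = ?g (r \<odot>\<^bsub>?X1\<^esub> a \<oplus>\<^bsub>?X1\<^esub> x \<odot>\<^bsub>?X1\<^esub> (r \<odot>\<^bsub>?X1\<^esub> v))"
          by (rule key[OF _ X.submoduleE(4)[OF cycles_submodule[OF X] r h(3)] e2]) (use h r in \<open>simp_all add: d(6)\<close>)
        then show "\<psi> (r \<odot>\<^bsub>cyc_mod (cone x X) (i + 1)\<^esub> h) = r \<odot>\<^bsub>L' (i + 1)\<^esub> \<psi> h"
          unfolding rh unfolding h(1) kh e gsm[OF r kc] . }
      fix k assume "k \<in> carrier (cyc_mod (cone x X) (i + 1))"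
      then have "k \<in> cycles (cone x X) (i + 1)" by simp
      then obtain a' b' v' where k: "k = pr a' b'" "a' \<in> carrier ?X1" "b' \<in> cycles X i"
        "cdiff X (i + 1) a' \<oplus>\<^bsub>?X\<^esub> x \<odot>\<^bsub>?X\<^esub> b' = \<zero>\<^bsub>?X\<^esub>" "v' \<in> carrier ?X1" "cdiff X (i + 1) v' = b'" by (rule el)
      have bc': "b' \<in> carrier ?X" using k(3) by (simp add: cycles_def)
      note kk = key[OF k(2-6)] and kc' = keyc[OF k(2-6)]
      have rh: "h \<oplus>\<^bsub>cyc_mod (cone x X) (i + 1)\<^esub> k = pr (a \<oplus>\<^bsub>?X1\<^esub> a') (b \<oplus>\<^bsub>?X\<^esub> b')"
        unfolding h(1) k(1) by (simp add: CX pair_mod_simps(4))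
      have e: "(a \<oplus>\<^bsub>?X1\<^esub> a') \<oplus>\<^bsub>?X1\<^esub> x \<odot>\<^bsub>?X1\<^esub> (v \<oplus>\<^bsub>?X1\<^esub> v') = (a \<oplus>\<^bsub>?X1\<^esub> x \<odot>\<^bsub>?X1\<^esub> v) \<oplus>\<^bsub>?X1\<^esub> (a' \<oplus>\<^bsub>?X1\<^esub> x \<odot>\<^bsub>?X1\<^esub> v')"
        using h(2,5) k(2,5) x by (simp add: X.smult_r_distr X.a_ac)
      have e2: "cdiff X (i + 1) (a \<oplus>\<^bsub>?X1\<^esub> a') \<oplus>\<^bsub>?X\<^esub> x \<odot>\<^bsub>?X\<^esub> (b \<oplus>\<^bsub>?X\<^esub> b') = \<zero>\<^bsub>?X\<^esub>"
      proof -
        have "cdiff X (i + 1) (a \<oplus>\<^bsub>?X1\<^esub> a') \<oplus>\<^bsub>?X\<^esub> x \<odot>\<^bsub>?X\<^esub> (b \<oplus>\<^bsub>?X\<^esub> b') =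
            (cdiff X (i + 1) a \<oplus>\<^bsub>?X\<^esub> x \<odot>\<^bsub>?X\<^esub> b) \<oplus>\<^bsub>?X\<^esub> (cdiff X (i + 1) a' \<oplus>\<^bsub>?X\<^esub> x \<odot>\<^bsub>?X\<^esub> b')"
          using h(2) k(2) bc bc' x d(4)[OF h(2)] d(4)[OF k(2)] by (simp add: d(5) X.smult_r_distr X.a_ac)
        then show ?thesis unfolding h(4) k(4) by simp
      qed
      have "\<psi> (pr (a \<oplus>\<^bsub>?X1\<^esub> a') (b \<oplus>\<^bsub>?X\<^esub> b')) = ?g ((a \<oplus>\<^bsub>?X1\<^esub> a') \<oplus>\<^bsub>?X1\<^esub> x \<odot>\<^bsub>?X1\<^esub> (v \<oplus>\<^bsub>?X1\<^esub> v'))"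
        by (rule key[OF _ X.submoduleE(5)[OF cycles_submodule[OF X] h(3) k(3)] e2]) (use h k in \<open>simp_all add: d(5)\<close>)
      then show "\<psi> (h \<oplus>\<^bsub>cyc_mod (cone x X) (i + 1)\<^esub> k) = \<psi> h \<oplus>\<^bsub>L' (i + 1)\<^esub> \<psi> k"
        unfolding rh unfolding h(1) k(1) kh kk e gadd[OF kc kc'] .
    qed
    have "ses R (bd_mod (cone x X) (i + 1)) (cyc_mod (cone x X) (i + 1)) (L' (i + 1)) (\<lambda>x. x) \<psi>"
    proof (rule sesI[OF bd_cyc_mhom[OF C] \<psi>])
      show "ker0 (bd_mod (cone x X) (i + 1)) (cyc_mod (cone x X) (i + 1)) (\<lambda>x. x)" by (simp add: ker0_def)
      fix c assume "c \<in> carrier (L' (i + 1))"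
      then obtain l where l: "l \<in> carrier (L (i + 1))" "\<rho> (i + 1) l = c" using \<rho>(2)[of "i + 1"] by (metis imageE)
      then obtain z where z: "z \<in> carrier (cyc_mod X (i + 1))" "\<phi> z = l" using p(7) by blast
      then have zc: "z \<in> carrier ?X1" "cdiff X (i + 1) z = \<zero>\<^bsub>?X\<^esub>" by (simp_all add: cyc)
      have z0: "\<zero>\<^bsub>?X\<^esub> \<in> cycles X i" using cyc_mod_module[OF X, of i] mhom_zero[OF complex_mhom[OF X]] by (simp add: cycles_def)
      have "\<psi> (pr z \<zero>\<^bsub>?X\<^esub>) = ?g (z \<oplus>\<^bsub>?X1\<^esub> x \<odot>\<^bsub>?X1\<^esub> \<zero>\<^bsub>?X1\<^esub>)"
        by (rule key[OF zc(1) z0]) (use zc x d(7) in simp_all)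
      also have "\<dots> = c" using zc(1) x z(2) l(2) by simp
      finally have "\<psi> (pr z \<zero>\<^bsub>?X\<^esub>) = c" .
      moreover have "pr z \<zero>\<^bsub>?X\<^esub> \<in> cycles (cone x X) (i + 1)"
        by (rule cone_cyclesI[OF X zc(1) z0]) (use zc x in simp)
      ultimately show "\<exists>b\<in>carrier (cyc_mod (cone x X) (i + 1)). \<psi> b = c" by auto
    next
      fix h assume "h \<in> carrier (bd_mod (cone x X) (i + 1))"
      then have hb: "h \<in> boundaries (cone x X) (i + 1)" by simp
      then obtain u v where uv: "u \<in> carrier (cobj X (i + 1 + 1))" "v \<in> carrier ?X1"
        "h = pr (cdiff X (i + 1 + 1) u \<oplus>\<^bsub>?X1\<^esub> x \<odot>\<^bsub>?X1\<^esub> v) (\<ominus>\<^bsub>?X\<^esub> cdiff X (i + 1) v)" by (rule cone_boundariesE)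
      let ?a = "cdiff X (i + 1 + 1) u \<oplus>\<^bsub>?X1\<^esub> x \<odot>\<^bsub>?X1\<^esub> v" and ?b = "\<ominus>\<^bsub>?X\<^esub> cdiff X (i + 1) v"
      have du: "cdiff X (i + 1 + 1) u \<in> carrier ?X1" by (rule d(4)[OF uv(1)])
      have "h \<in> cycles (cone x X) (i + 1)" using boundaries_subset_cycles[OF C] hb by blast
      then obtain a b where ab: "h = pr a b" "a \<in> carrier ?X1" "b \<in> cycles X i"
        "cdiff X (i + 1) a \<oplus>\<^bsub>?X\<^esub> x \<odot>\<^bsub>?X\<^esub> b = \<zero>\<^bsub>?X\<^esub>" by (rule cone_cyclesE[OF X x])
      then have ab': "a = ?a" "b = ?b" using uv(3) by auto
      have "\<psi> (pr a b) = ?g (a \<oplus>\<^bsub>?X1\<^esub> x \<odot>\<^bsub>?X1\<^esub> (\<ominus>\<^bsub>?X1\<^esub> v))"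
        by (rule key[OF ab(2-4)]) (use uv(2) in \<open>simp_all add: ab'(2) dneg\<close>)
      also have "a \<oplus>\<^bsub>?X1\<^esub> x \<odot>\<^bsub>?X1\<^esub> (\<ominus>\<^bsub>?X1\<^esub> v) = cdiff X (i + 1 + 1) u"
        unfolding ab'(1) using du uv(2) x by (simp only: X.smult_r_minus X.a_assoc X.r_neg X.smult_closed X.a_inv_closed X.r_zero)
      also have "\<phi> (cdiff X (i + 1 + 1) u) = \<zero>\<^bsub>L (i + 1)\<^esub>"
        by (rule p(6)) (use boundariesI[OF uv(1) refl] in simp)
      finally show "\<psi> h = \<zero>\<^bsub>L' (i + 1)\<^esub>" unfolding ab(1) using mhom_zero[OF \<rho>1] by simp
    next
      fix h assume h0: "h \<in> carrier (cyc_mod (cone x X) (i + 1))" and z: "\<psi> h = \<zero>\<^bsub>L' (i + 1)\<^esub>"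
      then have "h \<in> cycles (cone x X) (i + 1)" by simp
      then obtain a b v where h: "h = pr a b" "a \<in> carrier ?X1" "b \<in> cycles X i"
        "cdiff X (i + 1) a \<oplus>\<^bsub>?X\<^esub> x \<odot>\<^bsub>?X\<^esub> b = \<zero>\<^bsub>?X\<^esub>" "v \<in> carrier ?X1" "cdiff X (i + 1) v = b" by (rule el)
      note kh = key[OF h(2-6)] and kc = keyc[OF h(2-6)]
      have kc2: "a \<oplus>\<^bsub>?X1\<^esub> x \<odot>\<^bsub>?X1\<^esub> v \<in> carrier (cyc_mod X (i + 1))" using kc by simp
      \<comment> \<open>The class of \<open>a + x v\<close> is a multiple \<open>x l\<close>.
        Subtracting \<open>x w\<close>, where the cycle \<open>w\<close> has class \<open>l\<close>,
        leaves a boundary \<open>d u\<close>, and \<open>(a, b)\<close> is the boundary of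
        \<open>(u, w - v)\<close>.\<close>
      obtain l where l: "l \<in> carrier (L (i + 1))" "\<phi> (a \<oplus>\<^bsub>?X1\<^esub> x \<odot>\<^bsub>?X1\<^esub> v) = x \<odot>\<^bsub>L (i + 1)\<^esub> l"
        using z ker[OF mhom_closed[OF p(2) kc2]] unfolding h(1) kh by blast
      obtain w where w: "w \<in> carrier (cyc_mod X (i + 1))" "\<phi> w = l" using p(7)[OF l(1)] by blast
      then have wc: "w \<in> carrier ?X1" "cdiff X (i + 1) w = \<zero>\<^bsub>?X\<^esub>" by (simp_all add: cyc)
      interpret Z: module R "cyc_mod X (i + 1)" by (rule cyc_mod_module[OF X])
      have xw: "x \<odot>\<^bsub>?X1\<^esub> (\<ominus>\<^bsub>?X1\<^esub> w) \<in> cycles X (i + 1)"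
        by (rule X.submoduleE(4)[OF cycles_submodule[OF X] x X.submoduleE(3)[OF cycles_submodule[OF X]]]) (use w in simp)
      have "\<phi> (x \<odot>\<^bsub>?X1\<^esub> (\<ominus>\<^bsub>?X1\<^esub> w)) = \<ominus>\<^bsub>L (i + 1)\<^esub> (x \<odot>\<^bsub>L (i + 1)\<^esub> l)"
      proof -
        have "\<ominus>\<^bsub>?X1\<^esub> w = (\<ominus>\<^bsub>R\<^esub> \<one>\<^bsub>R\<^esub>) \<odot>\<^bsub>?X1\<^esub> w" using wc(1) by (simp add: X.smult_l_minus)
        then have "x \<odot>\<^bsub>?X1\<^esub> (\<ominus>\<^bsub>?X1\<^esub> w) = (x \<otimes>\<^bsub>R\<^esub> \<ominus>\<^bsub>R\<^esub> \<one>\<^bsub>R\<^esub>) \<odot>\<^bsub>?X1\<^esub> w" using wc(1) x by (simp only: X.smult_assoc1 X.R.a_inv_closed X.R.one_closed)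
        then have "\<phi> (x \<odot>\<^bsub>?X1\<^esub> (\<ominus>\<^bsub>?X1\<^esub> w)) = (x \<otimes>\<^bsub>R\<^esub> \<ominus>\<^bsub>R\<^esub> \<one>\<^bsub>R\<^esub>) \<odot>\<^bsub>L (i + 1)\<^esub> l"
          using mhom_smult[OF p(2) _ w(1), of "x \<otimes>\<^bsub>R\<^esub> \<ominus>\<^bsub>R\<^esub> \<one>\<^bsub>R\<^esub>"] x w(2) by simp
        then show ?thesis using x l(1) by (simp add: X.R.r_minus L.smult_l_minus)
      qed
      then have "\<phi> (a \<oplus>\<^bsub>?X1\<^esub> x \<odot>\<^bsub>?X1\<^esub> v \<oplus>\<^bsub>?X1\<^esub> x \<odot>\<^bsub>?X1\<^esub> (\<ominus>\<^bsub>?X1\<^esub> w)) = \<zero>\<^bsub>L (i + 1)\<^esub>"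
        using mhom_add[OF p(2) kc2, of "x \<odot>\<^bsub>?X1\<^esub> (\<ominus>\<^bsub>?X1\<^esub> w)"] xw l x by (simp add: L.r_neg)
      then have "a \<oplus>\<^bsub>?X1\<^esub> x \<odot>\<^bsub>?X1\<^esub> v \<oplus>\<^bsub>?X1\<^esub> x \<odot>\<^bsub>?X1\<^esub> (\<ominus>\<^bsub>?X1\<^esub> w) \<in> boundaries X (i + 1)"
        using p(5)[of "a \<oplus>\<^bsub>?X1\<^esub> x \<odot>\<^bsub>?X1\<^esub> v \<oplus>\<^bsub>?X1\<^esub> x \<odot>\<^bsub>?X1\<^esub> (\<ominus>\<^bsub>?X1\<^esub> w)"]
          X.submoduleE(5)[OF cycles_submodule[OF X] kc xw] by simp
      then obtain u where u: "u \<in> carrier (cobj X (i + 1 + 1))"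
        "a \<oplus>\<^bsub>?X1\<^esub> x \<odot>\<^bsub>?X1\<^esub> v \<oplus>\<^bsub>?X1\<^esub> x \<odot>\<^bsub>?X1\<^esub> (\<ominus>\<^bsub>?X1\<^esub> w) = cdiff X (i + 1 + 1) u" by (rule boundariesE)
      have "pr a b \<in> boundaries (cone x X) (i + 1)"
      proof (rule cone_boundariesI[OF u(1)])
        show "w \<oplus>\<^bsub>?X1\<^esub> \<ominus>\<^bsub>?X1\<^esub> v \<in> carrier ?X1" using wc(1) h(5) by simp
        have xv: "x \<odot>\<^bsub>?X1\<^esub> v \<in> carrier ?X1" and xw: "x \<odot>\<^bsub>?X1\<^esub> w \<in> carrier ?X1" using x h(5) wc(1) by simp_all
        have t: "a \<oplus>\<^bsub>?X1\<^esub> p \<oplus>\<^bsub>?X1\<^esub> \<ominus>\<^bsub>?X1\<^esub> q \<oplus>\<^bsub>?X1\<^esub> (q \<oplus>\<^bsub>?X1\<^esub> \<ominus>\<^bsub>?X1\<^esub> p) = a" if "p \<in> carrier ?X1" "q \<in> carrier ?X1" for p q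
        proof -
          have "a \<oplus>\<^bsub>?X1\<^esub> p \<oplus>\<^bsub>?X1\<^esub> \<ominus>\<^bsub>?X1\<^esub> q \<oplus>\<^bsub>?X1\<^esub> (q \<oplus>\<^bsub>?X1\<^esub> \<ominus>\<^bsub>?X1\<^esub> p)
            = a \<oplus>\<^bsub>?X1\<^esub> (p \<oplus>\<^bsub>?X1\<^esub> ((\<ominus>\<^bsub>?X1\<^esub> q \<oplus>\<^bsub>?X1\<^esub> q) \<oplus>\<^bsub>?X1\<^esub> \<ominus>\<^bsub>?X1\<^esub> p))"
            using that h(2) by (simp only: X.a_assoc X.a_closed X.a_inv_closed)
          then show ?thesis using that h(2) by (simp add: X.l_neg X.r_neg)
        qed
        show "a = cdiff X (i + 1 + 1) u \<oplus>\<^bsub>?X1\<^esub> x \<odot>\<^bsub>?X1\<^esub> (w \<oplus>\<^bsub>?X1\<^esub> \<ominus>\<^bsub>?X1\<^esub> v)"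
          unfolding u(2)[symmetric] X.smult_r_distr[OF x wc(1) X.a_inv_closed[OF h(5)]] X.smult_r_minus[OF x wc(1)]
            X.smult_r_minus[OF x h(5)] t[OF xv xw] ..
        show "b = \<ominus>\<^bsub>?X\<^esub> cdiff X (i + 1) (w \<oplus>\<^bsub>?X1\<^esub> \<ominus>\<^bsub>?X1\<^esub> v)"
          using wc h(5,6) d(4)[OF h(5)] by (simp add: d(5) dneg)
      qed
      then show "\<exists>a\<in>carrier (bd_mod (cone x X) (i + 1)). h = a" unfolding h(1) by simp
    qed
    then show ?thesis unfolding homology_iso_def by blast
  qed
  from main[of "i - 1"] show ?thesis by simp
qed

section \<open>Top homology and socle classes\<close>

definition top_homology :: "('a, 'p) mod_complex \<Rightarrow> int \<Rightarrow> bool" where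
  "top_homology X c \<longleftrightarrow> \<not> exact_at X c \<and> (\<forall>i>c. exact_at X i)"

lemma top_homology_unique: "top_homology X c \<Longrightarrow> top_homology X d \<Longrightarrow> c = d"
  unfolding top_homology_def by (metis linorder_neqE)

text \<open>A strengthening of \<open>top_homology\<close> that passes to cones on elements of
  \<open>S\<close>: the top degree rises with such a cone exactly when the element kills some
  nonzero class in the top homology, and the class \<open>z\<close> provides one that serves all of
  \<open>S\<close> at once.\<close>

definition socle_at where
  "socle_at S X s \<longleftrightarrow> (\<forall>i>s. exact_at X i) \<and>
     (\<exists>z\<in>cycles X s. z \<notin> boundaries X s \<and> (\<forall>r\<in>S. r \<odot>\<^bsub>cobj X s\<^esub> z \<in> boundaries X s))"

lemma socle_at_top: "socle_at S X s \<Longrightarrow> top_homology X s"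
  by (auto simp: socle_at_def top_homology_def exact_at_def)

text \<open>If \<open>x z = d w\<close>, then \<open>(- w, z)\<close> is a cycle of the cone. It is
  not a boundary, since second components of boundaries are boundaries of \<open>X\<close>. That it
  is again annihilated by \<open>S\<close> uses exactness of \<open>X\<close> above
  \<open>s\<close>.\<close>

lemma socle_at_cone:
  assumes X: "is_complex R X" and S: "S \<subseteq> carrier R" and x: "x \<in> S" and s: "socle_at S X s"
  shows "socle_at S (cone x X) (s + 1)"
proof -
  have xc: "x \<in> carrier R" using S x by blast
  interpret X: module R "cobj X j" for j by (rule complex_module[OF X])
  note d = mhomD[OF complex_mhom1[OF X]] and dneg = mhom_neg[OF complex_mhom1[OF X]]
  have ex: "exact_at X i" if "i > s" for i using s that by (simp add: socle_at_def)
  obtain z where z: "z \<in> cycles X s" "z \<notin> boundaries X s" "\<And>r. r \<in> S \<Longrightarrow> r \<odot>\<^bsub>cobj X s\<^esub> z \<in> boundaries X s"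
    using s by (auto simp: socle_at_def)
  have zc: "z \<in> carrier (cobj X s)" using z(1) by (simp add: cycles_def)
  obtain w where w: "w \<in> carrier (cobj X (s + 1))" "x \<odot>\<^bsub>cobj X s\<^esub> z = cdiff X (s + 1) w" using z(3)[OF x] by (rule boundariesE)
  let ?w = "\<ominus>\<^bsub>cobj X (s + 1)\<^esub> w"
  have "pr ?w z \<in> cycles (cone x X) (s + 1)"
    by (rule cone_cyclesI[OF X _ z(1)]) (use w d(4)[OF w(1)] in \<open>simp_all add: dneg X.l_neg\<close>)
  moreover have "pr ?w z \<notin> boundaries (cone x X) (s + 1)"
  proof
    assume "pr ?w z \<in> boundaries (cone x X) (s + 1)"
    then obtain v where v: "v \<in> carrier (cobj X (s + 1))" "z = \<ominus>\<^bsub>cobj X s\<^esub> cdiff X (s + 1) v" by (elim cone_boundariesE) simp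
    have "z \<in> boundaries X s" by (rule boundariesI[of "\<ominus>\<^bsub>cobj X (s + 1)\<^esub> v"]) (use v in \<open>simp_all add: dneg\<close>)
    then show False using z(2) by simp
  qed
  moreover have "r \<odot>\<^bsub>cobj (cone x X) (s + 1)\<^esub> pr ?w z \<in> boundaries (cone x X) (s + 1)" if r: "r \<in> S" for r
  proof -
    have rc: "r \<in> carrier R" using S r by blast
    obtain y where y: "y \<in> carrier (cobj X (s + 1))" "r \<odot>\<^bsub>cobj X s\<^esub> z = cdiff X (s + 1) y" using z(3)[OF r] by (rule boundariesE)
    \<comment> \<open>The obstruction to \<open>r (- w, z)\<close> being a boundary:
      \<open>?t\<close> is a cycle in degree \<open>s + 1\<close>, and there \<open>X\<close> is
      exact.\<close>
    let ?t = "r \<odot>\<^bsub>cobj X (s + 1)\<^esub> ?w \<oplus>\<^bsub>cobj X (s + 1)\<^esub> x \<odot>\<^bsub>cobj X (s + 1)\<^esub> y"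
    have "cdiff X (s + 1) ?t = r \<odot>\<^bsub>cobj X s\<^esub> (\<ominus>\<^bsub>cobj X s\<^esub> (x \<odot>\<^bsub>cobj X s\<^esub> z)) \<oplus>\<^bsub>cobj X s\<^esub> x \<odot>\<^bsub>cobj X s\<^esub> (r \<odot>\<^bsub>cobj X s\<^esub> z)"
      using w y rc xc by (simp add: d dneg)
    also have "\<dots> = \<zero>\<^bsub>cobj X s\<^esub>"
      using zc rc xc by (simp add: X.smult_r_minus X.smult_assoc1[symmetric] X.R.m_comm X.l_neg)
    finally have "?t \<in> boundaries X (s + 1)" using w y rc xc by (intro exact_atD[OF ex]) simp_all
    then obtain u where u: "u \<in> carrier (cobj X (s + 1 + 1))" "?t = cdiff X (s + 1 + 1) u" by (rule boundariesE)
    have e: "r \<odot>\<^bsub>cobj (cone x X) (s + 1)\<^esub> pr ?w z = pr (r \<odot>\<^bsub>cobj X (s + 1)\<^esub> ?w) (r \<odot>\<^bsub>cobj X s\<^esub> z)"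
      by (simp add: cone_simps1 pair_mod_simps(5))
    show ?thesis
      unfolding e
    proof (rule cone_boundariesI[OF u(1)])
      show "\<ominus>\<^bsub>cobj X (s + 1)\<^esub> y \<in> carrier (cobj X (s + 1))" using y by simp
      show "r \<odot>\<^bsub>cobj X (s + 1)\<^esub> ?w = cdiff X (s + 1 + 1) u \<oplus>\<^bsub>cobj X (s + 1)\<^esub> x \<odot>\<^bsub>cobj X (s + 1)\<^esub> (\<ominus>\<^bsub>cobj X (s + 1)\<^esub> y)"
        unfolding u(2)[symmetric] using w y rc xc by (simp only: X.smult_r_minus X.a_assoc X.r_neg X.smult_closed X.a_inv_closed X.r_zero)
      show "r \<odot>\<^bsub>cobj X s\<^esub> z = \<ominus>\<^bsub>cobj X s\<^esub> cdiff X (s + 1) (\<ominus>\<^bsub>cobj X (s + 1)\<^esub> y)"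
        using y d(4)[OF y(1)] by (simp add: dneg)
    qed
  qed
  moreover have "exact_at (cone x X) i" if "i > s + 1" for i
    using exact_at_cone[OF X xc ex ex, of "i - 1"] that by simp
  ultimately show ?thesis unfolding socle_at_def by blast
qed

lemma socle_at_koszul:
  assumes X: "is_complex R X" and S: "S \<subseteq> carrier R" and s: "socle_at S X s" and "set xs \<subseteq> S"
  shows "socle_at S (koszul xs X) (s + int (length xs))"
  using assms(4)
proof (induction xs)
  case (Cons x xs)
  then have "set xs \<subseteq> carrier R" using S by auto
  then have "is_complex R (koszul xs X)" by (rule koszul_is_complex[OF X])
  then have "socle_at S (koszul (x # xs) X) (s + int (length xs) + 1)"
    unfolding koszul_simps using Cons by (intro socle_at_cone[OF _ S]) simp_all
  then show ?case by (simp add: algebra_simps)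
qed (use s in simp)

text \<open>A cone on an element that acts as zero on homology raises the top degree by exactly one;
  this is used to undo such a cone.\<close>

lemma top_homology_cone:
  assumes X: "is_complex R X" and x: "x \<in> carrier R" and k: "kills x X" and t: "top_homology (cone x X) (c + 1)"
  shows "top_homology X c"
proof -
  note e = exact_at_cone_iff[OF X x k]
  have "exact_at X i" if "i > c" for i using e[of i] t that by (simp add: top_homology_def)
  moreover have "\<not> (exact_at X (c + 1) \<and> exact_at X c)" using e[of c] t by (simp add: top_homology_def)
  ultimately show ?thesis by (auto simp: top_homology_def)
qed

subsection \<open>Short exact sequences of complexes\<close>

definition complex_ses where
  "complex_ses R A B C f g \<longleftrightarrow> is_complex R A \<and> is_complex R B \<and> is_complex R C \<and>
     (\<forall>i. ses R (cobj A i) (cobj B i) (cobj C i) (f i) (g i) \<and>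
       (\<forall>x\<in>carrier (cobj A i). f (i - 1) (cdiff A i x) = cdiff B i (f i x)) \<and>
       (\<forall>x\<in>carrier (cobj B i). g (i - 1) (cdiff B i x) = cdiff C i (g i x)))"

lemma complex_sesD:
  assumes "complex_ses R A B C f g"
  shows "is_complex R A" "is_complex R B" "is_complex R C"
    "ses R (cobj A i) (cobj B i) (cobj C i) (f i) (g i)"
    "x \<in> carrier (cobj A i) \<Longrightarrow> f (i - 1) (cdiff A i x) = cdiff B i (f i x)"
    "y \<in> carrier (cobj B i) \<Longrightarrow> g (i - 1) (cdiff B i y) = cdiff C i (g i y)"
    "x \<in> carrier (cobj A (i + 1)) \<Longrightarrow> f i (cdiff A (i + 1) x) = cdiff B (i + 1) (f (i + 1) x)"
    "y \<in> carrier (cobj B (i + 1)) \<Longrightarrow> g i (cdiff B (i + 1) y) = cdiff C (i + 1) (g (i + 1) y)"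
proof -
  show "is_complex R A" "is_complex R B" "is_complex R C"
    "ses R (cobj A i) (cobj B i) (cobj C i) (f i) (g i)"
    using assms unfolding complex_ses_def by blast+
  show 1: "f (i - 1) (cdiff A i x) = cdiff B i (f i x)" if "x \<in> carrier (cobj A i)" for i
    using assms that unfolding complex_ses_def by blast
  show 2: "g (i - 1) (cdiff B i y) = cdiff C i (g i y)" if "y \<in> carrier (cobj B i)" for i
    using assms that unfolding complex_ses_def by blast
  show "f i (cdiff A (i + 1) x) = cdiff B (i + 1) (f (i + 1) x)" if "x \<in> carrier (cobj A (i + 1))"
    using 1[OF that] by simp
  show "g i (cdiff B (i + 1) y) = cdiff C (i + 1) (g (i + 1) y)" if "y \<in> carrier (cobj B (i + 1))"
    using 2[OF that] by simp
qed

lemma complex_ses_pull: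
  assumes s: "complex_ses R A B C f g" and b: "b \<in> carrier (cobj B i)" and gb: "g i b \<in> boundaries C i"
  shows "\<exists>a\<in>carrier (cobj A i). \<exists>b'\<in>carrier (cobj B (i + 1)). b = f i a \<oplus>\<^bsub>cobj B i\<^esub> cdiff B (i + 1) b'"
proof -
  note c = complex_sesD[OF s]
  note e = sesD[OF c(4)]
  interpret B: module R "cobj B j" for j by (rule complex_module[OF c(2)])
  interpret C: module R "cobj C j" for j by (rule complex_module[OF c(3)])
  obtain w where w: "w \<in> carrier (cobj C (i + 1))" "g i b = cdiff C (i + 1) w" using gb by (rule boundariesE)
  obtain b' where b': "b' \<in> carrier (cobj B (i + 1))" "g (i + 1) b' = w" using e(7)[OF w(1)] by blast
  have db: "cdiff B (i + 1) b' \<in> carrier (cobj B i)" by (rule mhom_closed[OF complex_mhom1[OF c(2)] b'(1)])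
  have "g i (b \<ominus>\<^bsub>cobj B i\<^esub> cdiff B (i + 1) b') = \<zero>\<^bsub>cobj C i\<^esub>"
    using mhom_minus[OF e(2) b db] c(8)[OF b'(1)] b'(2) w(2) C.minus_eq_zero_iff mhom_closed[OF e(2) b] by simp
  then obtain a where a: "a \<in> carrier (cobj A i)" "b \<ominus>\<^bsub>cobj B i\<^esub> cdiff B (i + 1) b' = f i a"
    using e(5)[OF B.minus_closed[OF b db]] by blast
  have "b = f i a \<oplus>\<^bsub>cobj B i\<^esub> cdiff B (i + 1) b'"
    unfolding a(2)[symmetric] using b db by (simp add: B.minus_eq B.a_assoc B.l_neg)
  then show ?thesis using a(1) b'(1) by blast
qed

text \<open>The long exact sequence at \<open>H_i(A)\<close>. It is phrased for a single cycle
  because in one application \<open>f\<close> acts on homology as a multiplication that is zero, so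
  that the premise on \<open>f i z\<close> holds for every cycle.\<close>

lemma les_injective:
  assumes s: "complex_ses R A B C f g" and e: "exact_at C (i + 1)" and z: "z \<in> cycles A i" and fz: "f i z \<in> boundaries B i"
  shows "z \<in> boundaries A i"
proof -
  note c = complex_sesD[OF s]
  note h = sesD[OF c(4)]
  have zc: "z \<in> carrier (cobj A i)" using z by (simp add: cycles_def)
  interpret B: module R "cobj B j" for j by (rule complex_module[OF c(2)])
  obtain b where b: "b \<in> carrier (cobj B (i + 1))" "f i z = cdiff B (i + 1) b" using fz by (rule boundariesE)
  have "cdiff C (i + 1) (g (i + 1) b) = \<zero>\<^bsub>cobj C i\<^esub>"
    using c(8)[OF b(1)] b(2) h(6)[OF zc] by simp
  then have "g (i + 1) b \<in> boundaries C (i + 1)" using mhom_closed[OF h(2) b(1)] by (intro exact_atD[OF e]) simp_all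
  from complex_ses_pull[OF s b(1) this] obtain a b' where a: "a \<in> carrier (cobj A (i + 1))" "b' \<in> carrier (cobj B (i + 1 + 1))"
    "b = f (i + 1) a \<oplus>\<^bsub>cobj B (i + 1)\<^esub> cdiff B (i + 1 + 1) b'" by blast
  note dB = mhomD[OF complex_mhom1[OF c(2)]] and dA = mhom_closed[OF complex_mhom1[OF c(1)]]
  have "f i z = f i (cdiff A (i + 1) a)"
    unfolding b(2) c(7)[OF a(1)] a(3)
    using complex_dd[OF c(2) a(2)] dB(5)[OF mhom_closed[OF h(1) a(1)] dB(4)[OF a(2)]] dB(4)[OF mhom_closed[OF h(1) a(1)]] by simp
  then have "z = cdiff A (i + 1) a" using mhom_eq_iff[OF h(1,3) zc dA[OF a(1)]] by simp
  then show ?thesis by (rule boundariesI[OF a(1)])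
qed

lemma les_middle:
  assumes s: "complex_ses R A B C f g" and eA: "exact_at A i" and eC: "exact_at C i"
  shows "exact_at B i"
  unfolding exact_at_def
proof
  note c = complex_sesD[OF s]
  note h = sesD[OF c(4)]
  interpret B: module R "cobj B j" for j by (rule complex_module[OF c(2)])
  note dB = mhomD[OF complex_mhom1[OF c(2)]] and dBi = mhomD[OF complex_mhom[OF c(2)]]
  fix b assume "b \<in> cycles B i"
  then have b: "b \<in> carrier (cobj B i)" "cdiff B i b = \<zero>\<^bsub>cobj B (i - 1)\<^esub>" by (simp_all add: cycles_def)
  have "g i b \<in> boundaries C i"
    using mhom_closed[OF h(2) b(1)] c(6)[OF b(1)] b(2) mhom_zero[OF h(2)] by (intro exact_atD[OF eC]) simp_all
  from complex_ses_pull[OF s b(1) this] obtain a b' where a: "a \<in> carrier (cobj A i)" "b' \<in> carrier (cobj B (i + 1))"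
    "b = f i a \<oplus>\<^bsub>cobj B i\<^esub> cdiff B (i + 1) b'" by blast
  note fa = mhom_closed[OF h(1) a(1)] and db = dB(4)[OF a(2)]
  have "cdiff B i (f i a) = \<zero>\<^bsub>cobj B (i - 1)\<^esub>"
    using b(2) unfolding a(3) dBi(5)[OF fa db] complex_dd[OF c(2) a(2)] using dBi(4)[OF fa] by simp
  then have "f (i - 1) (cdiff A i a) = \<zero>\<^bsub>cobj B (i - 1)\<^esub>" using c(5)[OF a(1)] by simp
  then have "cdiff A i a = \<zero>\<^bsub>cobj A (i - 1)\<^esub>"
    by (rule ker0D[OF h(3) mhom_closed[OF complex_mhom[OF c(1)] a(1)]])
  then have "a \<in> boundaries A i" by (rule exact_atD[OF eA a(1)])
  then obtain v where v: "v \<in> carrier (cobj A (i + 1))" "a = cdiff A (i + 1) v" by (rule boundariesE)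
  note fv = mhom_closed[OF h(1) v(1)]
  show "b \<in> boundaries B i"
  proof (rule boundariesI)
    show "f (i + 1) v \<oplus>\<^bsub>cobj B (i + 1)\<^esub> b' \<in> carrier (cobj B (i + 1))" using fv a(2) by simp
    show "b = cdiff B (i + 1) (f (i + 1) v \<oplus>\<^bsub>cobj B (i + 1)\<^esub> b')"
      unfolding dB(5)[OF fv a(2)] c(7)[OF v(1), symmetric] v(2)[symmetric] by (rule a(3))
  qed
qed

lemma les_right:
  assumes s: "complex_ses R A B C f g" and eB: "exact_at B (i + 1)" and eA: "exact_at A i"
  shows "exact_at C (i + 1)"
  unfolding exact_at_def
proof
  note c = complex_sesD[OF s]
  note h = sesD[OF c(4)]
  interpret B: module R "cobj B j" for j by (rule complex_module[OF c(2)])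
  interpret C: module R "cobj C j" for j by (rule complex_module[OF c(3)])
  note dB = mhomD[OF complex_mhom1[OF c(2)]]
  fix y assume "y \<in> cycles C (i + 1)"
  then have y: "y \<in> carrier (cobj C (i + 1))" "cdiff C (i + 1) y = \<zero>\<^bsub>cobj C i\<^esub>" by (simp_all add: cycles_def)
  obtain b where b: "b \<in> carrier (cobj B (i + 1))" "g (i + 1) b = y" using h(7)[OF y(1)] by blast
  have "g i (cdiff B (i + 1) b) = \<zero>\<^bsub>cobj C i\<^esub>" using c(8)[OF b(1)] b(2) y(2) by simp
  then obtain a where a: "a \<in> carrier (cobj A i)" "cdiff B (i + 1) b = f i a" using h(5)[OF dB(4)[OF b(1)]] by blast
  have "f (i - 1) (cdiff A i a) = \<zero>\<^bsub>cobj B (i - 1)\<^esub>"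
    using c(5)[OF a(1)] complex_dd[OF c(2) b(1)] a(2) by simp
  then have "cdiff A i a = \<zero>\<^bsub>cobj A (i - 1)\<^esub>"
    by (rule ker0D[OF h(3) mhom_closed[OF complex_mhom[OF c(1)] a(1)]])
  then have "a \<in> boundaries A i" by (rule exact_atD[OF eA a(1)])
  then obtain v where v: "v \<in> carrier (cobj A (i + 1))" "a = cdiff A (i + 1) v" by (rule boundariesE)
  note fv = mhom_closed[OF h(1) v(1)]
  have "cdiff B (i + 1) (b \<ominus>\<^bsub>cobj B (i + 1)\<^esub> f (i + 1) v) = \<zero>\<^bsub>cobj B i\<^esub>"
    using dB(8)[OF b(1) fv] c(7)[OF v(1)] a(2) v(2) B.minus_eq_zero_iff[of "f i a" i "f i a"] mhom_closed[OF h(1) a(1)] by simp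
  then have "b \<ominus>\<^bsub>cobj B (i + 1)\<^esub> f (i + 1) v \<in> boundaries B (i + 1)"
    using b(1) fv by (intro exact_atD[OF eB]) (simp_all add: B.minus_closed)
  then obtain u where u: "u \<in> carrier (cobj B (i + 1 + 1))" "b \<ominus>\<^bsub>cobj B (i + 1)\<^esub> f (i + 1) v = cdiff B (i + 1 + 1) u" by (rule boundariesE)
  have "y = g (i + 1) (b \<ominus>\<^bsub>cobj B (i + 1)\<^esub> f (i + 1) v)"
    unfolding mhom_minus[OF h(2) b(1) fv] h(6)[OF v(1)] b(2) using y(1) by (simp add: C.minus_eq)
  also have "\<dots> = cdiff C (i + 1 + 1) (g (i + 1 + 1) u)" unfolding u(2) by (rule c(8)[OF u(1)])
  finally show "y \<in> boundaries C (i + 1)" by (rule boundariesI[OF mhom_closed[OF h(2) u(1)]])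
qed

section \<open>Cones and Koszul complexes of short exact sequences\<close>

lemma seq_complex_ses:
  assumes s: "complex_ses R A B C f g"
  shows "complex_ses R (seq_complex A) (seq_complex B) (seq_complex C)
    (\<lambda>i h. seq_of (f i (h []))) (\<lambda>i h. seq_of (g i (h [])))"
proof -
  note c = complex_sesD[OF s]
  note h = sesD[OF c(4)]
  have "ses R (cobj (seq_complex A) i) (cobj (seq_complex B) i) (cobj (seq_complex C) i)
    (\<lambda>h. seq_of (f i (h []))) (\<lambda>h. seq_of (g i (h [])))" for i
    unfolding seq_complex_simps
  proof (rule sesI[OF seq_of_mhom[OF h(1)] seq_of_mhom[OF h(2)]])
    show "ker0 (seq_mod (cobj A i)) (seq_mod (cobj B i)) (\<lambda>h. seq_of (f i (h [])))"
      using h(3)[of i] by (auto simp: ker0_def seq_mod_simps)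
    show "\<exists>b\<in>carrier (seq_mod (cobj B i)). seq_of (g i (b [])) = k" if k: "k \<in> carrier (seq_mod (cobj C i))" for k
    proof -
      obtain y where y: "y \<in> carrier (cobj C i)" "k = seq_of y" using k by (auto simp: seq_mod_simps)
      obtain b where "b \<in> carrier (cobj B i)" "g i b = y" using h(7)[OF y(1)] by blast
      then show ?thesis by (intro bexI[of _ "seq_of b"]) (auto simp: seq_mod_simps y(2))
    qed
    show "seq_of (g i (seq_of (f i (a [])) [])) = \<zero>\<^bsub>seq_mod (cobj C i)\<^esub>" if "a \<in> carrier (seq_mod (cobj A i))" for a
      using that h(6) by (auto simp: seq_mod_simps)
    show "\<exists>a\<in>carrier (seq_mod (cobj A i)). b = seq_of (f i (a []))"
      if b: "b \<in> carrier (seq_mod (cobj B i))" "seq_of (g i (b [])) = \<zero>\<^bsub>seq_mod (cobj C i)\<^esub>" for b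
    proof -
      obtain y where y: "y \<in> carrier (cobj B i)" "b = seq_of y" using b by (auto simp: seq_mod_simps)
      have "g i y = \<zero>\<^bsub>cobj C i\<^esub>" using b(2) y(2) by (simp add: seq_mod_simps)
      then obtain a where "a \<in> carrier (cobj A i)" "y = f i a" using h(5)[OF y(1)] by blast
      then show ?thesis by (intro bexI[of _ "seq_of a"]) (auto simp: seq_mod_simps y(2))
    qed
  qed
  then show ?thesis
    unfolding complex_ses_def
    by (intro conjI allI ballI seq_complex_is_complex c) (auto simp: seq_complex_simps seq_mod_simps c)
qed

lemma cone_map_mhom:
  assumes X: "is_complex R X" and Y: "is_complex R Y" and x: "x \<in> carrier R"
    and m: "\<And>i. mhom R (cobj X i) (cobj Y i) (\<phi> i)"
  shows "mhom R (cobj (cone x X) i) (cobj (cone x Y) i) (\<lambda>h. pr (\<phi> i (p1 h)) (\<phi> (i - 1) (p2 h)))"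
  by (rule mhomI[OF complex_module[OF cone_is_complex[OF X x]] complex_module[OF cone_is_complex[OF Y x]]])
    (auto simp: cone_simps pair_mod_simps mhomD(4-6)[OF m])

lemma cone_map_comm:
  assumes X: "is_complex R X" and x: "x \<in> carrier R" and m: "\<And>i. mhom R (cobj X i) (cobj Y i) (\<phi> i)"
    and dd: "\<And>i z. z \<in> carrier (cobj X i) \<Longrightarrow> \<phi> (i - 1) (cdiff X i z) = cdiff Y i (\<phi> i z)"
    and k: "k \<in> carrier (cobj (cone x X) i)"
  shows "pr (\<phi> (i - 1) (p1 (cdiff (cone x X) i k))) (\<phi> (i - 1 - 1) (p2 (cdiff (cone x X) i k))) =
      cdiff (cone x Y) i (pr (\<phi> i (p1 k)) (\<phi> (i - 1) (p2 k)))"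
proof -
  interpret X: module R "cobj X j" for j by (rule complex_module[OF X])
  obtain a b where ab: "k = pr a b" "a \<in> carrier (cobj X i)" "b \<in> carrier (cobj X (i - 1))"
    using k unfolding cone_simps by (rule pair_mod_cases)
  note d = mhom_closed[OF complex_mhom[OF X]]
  note da = d[OF ab(2)] and db = d[OF ab(3)]
  show ?thesis
    unfolding ab(1) cone_simps pr_simps mhom_add[OF m da X.smult_closed[OF x ab(3)]]
      mhom_smult[OF m x ab(3)] mhom_neg[OF m db] dd[OF ab(2)] dd[OF ab(3)] ..
qed

lemma cone_ses:
  assumes s: "complex_ses R A B C f g" and x: "x \<in> carrier R"
  shows "complex_ses R (cone x A) (cone x B) (cone x C)
    (\<lambda>i h. pr (f i (p1 h)) (f (i - 1) (p2 h))) (\<lambda>i h. pr (g i (p1 h)) (g (i - 1) (p2 h)))"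
proof -
  note c = complex_sesD[OF s]
  note h = sesD[OF c(4)]
  note F = mhomD[OF h(1)] and G = mhomD[OF h(2)]
  note cl = cone_map_mhom[OF _ _ x] and comm = cone_map_comm[OF _ x]
  have "ses R (cobj (cone x A) i) (cobj (cone x B) i) (cobj (cone x C) i)
    (\<lambda>h. pr (f i (p1 h)) (f (i - 1) (p2 h))) (\<lambda>h. pr (g i (p1 h)) (g (i - 1) (p2 h)))" for i
  proof (rule sesI[OF cl[OF c(1,2) h(1)] cl[OF c(2,3) h(2)]])
    show "ker0 (cobj (cone x A) i) (cobj (cone x B) i) (\<lambda>h. pr (f i (p1 h)) (f (i - 1) (p2 h)))"
      using h(3)[of i] h(3)[of "i - 1"] by (auto simp: ker0_def cone_simps pair_mod_simps)
    show "\<exists>b\<in>carrier (cobj (cone x B) i). pr (g i (p1 b)) (g (i - 1) (p2 b)) = k" if k: "k \<in> carrier (cobj (cone x C) i)" for k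
    proof -
      obtain a b where ab: "k = pr a b" "a \<in> carrier (cobj C i)" "b \<in> carrier (cobj C (i - 1))"
        using k unfolding cone_simps by (rule pair_mod_cases)
      obtain a' b' where "a' \<in> carrier (cobj B i)" "g i a' = a" "b' \<in> carrier (cobj B (i - 1))" "g (i - 1) b' = b"
        using h(7)[OF ab(2)] h(7)[OF ab(3)] by blast
      then show ?thesis by (intro bexI[of _ "pr a' b'"]) (auto simp: ab(1) cone_simps pair_mod_simps)
    qed
    show "pr (g i (p1 (pr (f i (p1 a)) (f (i - 1) (p2 a))))) (g (i - 1) (p2 (pr (f i (p1 a)) (f (i - 1) (p2 a))))) = \<zero>\<^bsub>cobj (cone x C) i\<^esub>"
      if "a \<in> carrier (cobj (cone x A) i)" for a
      using that h(6) by (auto simp: cone_simps pair_mod_simps)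
    show "\<exists>a\<in>carrier (cobj (cone x A) i). k = pr (f i (p1 a)) (f (i - 1) (p2 a))"
      if k: "k \<in> carrier (cobj (cone x B) i)" "pr (g i (p1 k)) (g (i - 1) (p2 k)) = \<zero>\<^bsub>cobj (cone x C) i\<^esub>" for k
    proof -
      obtain a b where ab: "k = pr a b" "a \<in> carrier (cobj B i)" "b \<in> carrier (cobj B (i - 1))"
        using k(1) unfolding cone_simps by (rule pair_mod_cases)
      have "g i a = \<zero>\<^bsub>cobj C i\<^esub>" "g (i - 1) b = \<zero>\<^bsub>cobj C (i - 1)\<^esub>"
        using k(2) unfolding ab(1) by (simp_all add: cone_simps pair_mod_simps(3))
      then obtain a' b' where "a' \<in> carrier (cobj A i)" "a = f i a'" "b' \<in> carrier (cobj A (i - 1))" "b = f (i - 1) b'"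
        using h(5)[OF ab(2)] h(5)[OF ab(3)] by blast
      then show ?thesis by (intro bexI[of _ "pr a' b'"]) (auto simp: ab(1) cone_simps pair_mod_simps)
    qed
  qed
  then show ?thesis
    unfolding complex_ses_def
    by (intro conjI allI ballI cone_is_complex[OF _ x] c comm[OF c(1) h(1) c(5)] comm[OF c(2) h(2) c(6)])
qed

definition cone_map :: "(int \<Rightarrow> 'p seq \<Rightarrow> 'q seq) \<Rightarrow> int \<Rightarrow> 'p seq \<Rightarrow> 'q seq" where
  "cone_map \<phi> = (\<lambda>i h. pr (\<phi> i (p1 h)) (\<phi> (i - 1) (p2 h)))"

definition koszul_map :: "'a list \<Rightarrow> (int \<Rightarrow> 'p seq \<Rightarrow> 'q seq) \<Rightarrow> int \<Rightarrow> 'p seq \<Rightarrow> 'q seq" where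
  "koszul_map xs \<phi> = (cone_map ^^ length xs) \<phi>"

lemma koszul_ses:
  assumes s: "complex_ses R A B C f g" and "set xs \<subseteq> carrier R"
  shows "complex_ses R (koszul xs A) (koszul xs B) (koszul xs C) (koszul_map xs f) (koszul_map xs g)"
  using assms(2)
proof (induction xs)
  case (Cons x xs)
  then show ?case
    using cone_ses[of R _ _ _ "koszul_map xs f" "koszul_map xs g" x] by (simp add: koszul_map_def cone_map_def)
qed (simp add: koszul_map_def s)

text \<open>Keeps track of multiplication by \<open>y\<close> through the iterated cones; this is
  how the map induced by \<open>N \<rightarrow> N\<close> is later recognised as zero on
  homology.\<close>

lemma koszul_map_smult:
  assumes "\<And>i z. z \<in> carrier (cobj A i) \<Longrightarrow> f i z = y \<odot>\<^bsub>cobj A i\<^esub> z" and "z \<in> carrier (cobj (koszul xs A) i)"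
  shows "koszul_map xs f i z = y \<odot>\<^bsub>cobj (koszul xs A) i\<^esub> z"
  using assms(2)
proof (induction xs arbitrary: i z)
  case Nil
  then show ?case using assms(1) by (simp add: koszul_map_def)
next
  case (Cons x xs)
  then obtain a b where ab: "z = pr a b" "a \<in> carrier (cobj (koszul xs A) i)" "b \<in> carrier (cobj (koszul xs A) (i - 1))"
    unfolding koszul_simps cone_simps by (elim pair_mod_cases)
  have "koszul_map (x # xs) f i z = pr (koszul_map xs f i a) (koszul_map xs f (i - 1) b)"
    by (simp add: koszul_map_def cone_map_def ab(1))
  then show ?case
    unfolding koszul_simps cone_simps pair_mod_simps(5) ab(1) pr_simps Cons.IH[OF ab(2)] Cons.IH[OF ab(3)] .
qed

subsection \<open>Noetherian modules\<close>

definition sub_sum :: "('a, 'm, 's) module_scheme \<Rightarrow> 'm set \<Rightarrow> 'm set \<Rightarrow> 'm set" where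
  "sub_sum M U V = {u \<oplus>\<^bsub>M\<^esub> v |u v. u \<in> U \<and> v \<in> V}"

lemma submoduleD:
  assumes "module R M" "submodule U R M"
  shows "U \<subseteq> carrier M" "\<zero>\<^bsub>M\<^esub> \<in> U"
    "u \<in> U \<Longrightarrow> \<ominus>\<^bsub>M\<^esub> u \<in> U" "r \<in> carrier R \<Longrightarrow> u \<in> U \<Longrightarrow> r \<odot>\<^bsub>M\<^esub> u \<in> U"
    "u \<in> U \<Longrightarrow> v \<in> U \<Longrightarrow> u \<oplus>\<^bsub>M\<^esub> v \<in> U" "u \<in> U \<Longrightarrow> v \<in> U \<Longrightarrow> u \<ominus>\<^bsub>M\<^esub> v \<in> U"
proof -
  interpret M: module R M by fact
  note E = M.submoduleE[OF assms(2)]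
  show "U \<subseteq> carrier M" "u \<in> U \<Longrightarrow> \<ominus>\<^bsub>M\<^esub> u \<in> U" "r \<in> carrier R \<Longrightarrow> u \<in> U \<Longrightarrow> r \<odot>\<^bsub>M\<^esub> u \<in> U"
    "u \<in> U \<Longrightarrow> v \<in> U \<Longrightarrow> u \<oplus>\<^bsub>M\<^esub> v \<in> U" using E by auto
  show "u \<in> U \<Longrightarrow> v \<in> U \<Longrightarrow> u \<ominus>\<^bsub>M\<^esub> v \<in> U" using E(3,5) by (simp add: M.minus_eq)
  show "\<zero>\<^bsub>M\<^esub> \<in> U" using subgroup.one_closed[OF submodule.axioms(1)[OF assms(2)]] by simp
qed

lemma add_minus_cancel:
  assumes "module R M" "u \<in> carrier M" "v \<in> carrier M"
  shows "(u \<oplus>\<^bsub>M\<^esub> v) \<ominus>\<^bsub>M\<^esub> v = u" "(u \<oplus>\<^bsub>M\<^esub> v) \<ominus>\<^bsub>M\<^esub> u = v" "u \<oplus>\<^bsub>M\<^esub> (v \<ominus>\<^bsub>M\<^esub> u) = v" "(u \<ominus>\<^bsub>M\<^esub> v) \<oplus>\<^bsub>M\<^esub> v = u"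
proof -
  interpret M: module R M by fact
  show 1: "(u \<oplus>\<^bsub>M\<^esub> v) \<ominus>\<^bsub>M\<^esub> v = u" using assms(2,3) by (simp add: M.minus_eq M.a_assoc M.r_neg)
  show "(u \<ominus>\<^bsub>M\<^esub> v) \<oplus>\<^bsub>M\<^esub> v = u" using assms(2,3) by (simp add: M.minus_eq M.a_assoc M.l_neg)
  show "(u \<oplus>\<^bsub>M\<^esub> v) \<ominus>\<^bsub>M\<^esub> u = v"
    unfolding M.a_comm[OF assms(2,3)] using assms(2,3) by (simp add: M.minus_eq M.a_assoc M.r_neg)
  show "u \<oplus>\<^bsub>M\<^esub> (v \<ominus>\<^bsub>M\<^esub> u) = v"
    unfolding M.a_comm[OF assms(2) M.minus_closed[OF assms(3,2)]] using assms(2,3) by (simp add: M.minus_eq M.a_assoc M.l_neg)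
qed

lemma sub_sum_submodule:
  assumes M: "module R M" and U: "submodule U R M" and V: "submodule V R M"
  shows "submodule (sub_sum M U V) R M" and "U \<subseteq> sub_sum M U V" and "V \<subseteq> sub_sum M U V"
proof -
  interpret M: module R M by (rule M)
  note u = submoduleD[OF M U] and v = submoduleD[OF M V]
  show "U \<subseteq> sub_sum M U V"
  proof
    fix x assume "x \<in> U"
    moreover from this have "x = x \<oplus>\<^bsub>M\<^esub> \<zero>\<^bsub>M\<^esub>" using u(1) by auto
    ultimately show "x \<in> sub_sum M U V" unfolding sub_sum_def using v(2) by blast
  qed
  show "V \<subseteq> sub_sum M U V"
  proof
    fix x assume "x \<in> V"
    moreover from this have "x = \<zero>\<^bsub>M\<^esub> \<oplus>\<^bsub>M\<^esub> x" using v(1) by auto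
    ultimately show "x \<in> sub_sum M U V" unfolding sub_sum_def using u(2) by blast
  qed
  show "submodule (sub_sum M U V) R M"
  proof (rule M.submoduleI)
    show "sub_sum M U V \<subseteq> carrier M" using u(1) v(1) by (auto simp: sub_sum_def)
    show "\<zero>\<^bsub>M\<^esub> \<in> sub_sum M U V" using \<open>U \<subseteq> sub_sum M U V\<close> u(2) by blast
    fix a assume "a \<in> sub_sum M U V"
    then obtain p q where a: "a = p \<oplus>\<^bsub>M\<^esub> q" "p \<in> U" "q \<in> V" by (auto simp: sub_sum_def)
    have pq: "p \<in> carrier M" "q \<in> carrier M" using a u(1) v(1) by auto
    have "\<ominus>\<^bsub>M\<^esub> a = \<ominus>\<^bsub>M\<^esub> p \<oplus>\<^bsub>M\<^esub> \<ominus>\<^bsub>M\<^esub> q" using a pq by (simp add: M.minus_add)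
    then show "\<ominus>\<^bsub>M\<^esub> a \<in> sub_sum M U V" using u(3)[OF a(2)] v(3)[OF a(3)] unfolding sub_sum_def by blast
    { fix r assume r: "r \<in> carrier R"
      have "r \<odot>\<^bsub>M\<^esub> a = r \<odot>\<^bsub>M\<^esub> p \<oplus>\<^bsub>M\<^esub> r \<odot>\<^bsub>M\<^esub> q" using a pq r by (simp add: M.smult_r_distr)
      then show "r \<odot>\<^bsub>M\<^esub> a \<in> sub_sum M U V" using u(4)[OF r a(2)] v(4)[OF r a(3)] unfolding sub_sum_def by blast }
    fix b assume "b \<in> sub_sum M U V"
    then obtain p' q' where b: "b = p' \<oplus>\<^bsub>M\<^esub> q'" "p' \<in> U" "q' \<in> V" by (auto simp: sub_sum_def)
    have pq': "p' \<in> carrier M" "q' \<in> carrier M" using b u(1) v(1) by auto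
    have "a \<oplus>\<^bsub>M\<^esub> b = (p \<oplus>\<^bsub>M\<^esub> p') \<oplus>\<^bsub>M\<^esub> (q \<oplus>\<^bsub>M\<^esub> q')" using a(1) b(1) pq pq' by (simp add: M.a_ac)
    then show "a \<oplus>\<^bsub>M\<^esub> b \<in> sub_sum M U V" using u(5)[OF a(2) b(2)] v(5)[OF a(3) b(3)] unfolding sub_sum_def by blast
  qed
qed

lemma submodule_self_iff_ideal:
  assumes "cring R"
  shows "submodule I R (self_module R) \<longleftrightarrow> ideal I R"
proof -
  interpret R: cring R by fact
  have S: "module R (self_module R)" by (rule self_module_is_module[OF assms])
  interpret S: module R "self_module R" by (rule S)
  show ?thesis
  proof
    assume I: "submodule I R (self_module R)"
    note i = submoduleD[OF S I, unfolded self_module_simps]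
    have neg: "\<ominus>\<^bsub>R\<^esub> a \<in> I" if "a \<in> I" for a
      using i(4)[of "\<ominus>\<^bsub>R\<^esub> \<one>\<^bsub>R\<^esub>" a] that i(1) by (auto simp: R.l_minus subset_iff)
    show "ideal I R"
    proof (rule idealI[OF R.ring_axioms])
      show "subgroup I (add_monoid R)"
        using i neg by (intro R.add.subgroupI) auto
      fix a x assume a: "a \<in> I" "x \<in> carrier R"
      then show "x \<otimes>\<^bsub>R\<^esub> a \<in> I" using i(4) by simp
      then show "a \<otimes>\<^bsub>R\<^esub> x \<in> I" using a i(1) R.m_comm[of a x] by auto
    qed
  next
    assume "ideal I R"
    then interpret I: ideal I R .
    show "submodule I R (self_module R)"
    proof (rule S.submoduleI)
      fix a assume a: "a \<in> I"
      then have ac: "a \<in> carrier R" using I.Icarr by simp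
      have "\<ominus>\<^bsub>self_module R\<^esub> a = (\<ominus>\<^bsub>R\<^esub> \<one>\<^bsub>R\<^esub>) \<odot>\<^bsub>self_module R\<^esub> a"
        using ac S.smult_l_minus[of "\<one>\<^bsub>R\<^esub>" a] by (simp add: self_module_simps)
      then show "\<ominus>\<^bsub>self_module R\<^esub> a \<in> I" using I.I_l_closed[OF a] by (simp add: self_module_simps)
    qed (auto simp: self_module_simps I.Icarr I.I_l_closed)
  qed
qed

lemma cyclic_mhom:
  assumes "module R M" "a \<in> carrier M"
  shows "mhom R (self_module R) M (\<lambda>r. r \<odot>\<^bsub>M\<^esub> a)"
proof -
  interpret M: module R M by fact
  show ?thesis using assms(2)
    by (intro mhomI self_module_is_module M.R.is_cring M.module_axioms)
      (auto simp: self_module_simps M.smult_l_distr M.smult_assoc1)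
qed

lemma scale_mhom: "module R M \<Longrightarrow> y \<in> carrier R \<Longrightarrow> mhom R M M (\<lambda>n. y \<odot>\<^bsub>M\<^esub> n)"
  by (rule mhom_scale[OF mhom_id])

abbreviation cyclic where "cyclic R M a \<equiv> (\<lambda>r. r \<odot>\<^bsub>M\<^esub> a) ` carrier R"
abbreviation scaled where "scaled M y \<equiv> (\<lambda>n. y \<odot>\<^bsub>M\<^esub> n) ` carrier M"

lemma cyclic_submodule: "module R M \<Longrightarrow> a \<in> carrier M \<Longrightarrow> submodule (cyclic R M a) R M"
  using mhom_image_submodule[OF cyclic_mhom] by (simp add: self_module_simps)

lemma scaled_submodule: "module R M \<Longrightarrow> y \<in> carrier R \<Longrightarrow> submodule (scaled M y) R M"
  by (rule mhom_image_submodule[OF scale_mhom])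

lemma colon_submodule:
  assumes h: "mhom R A M h" and U: "submodule U R M"
  shows "submodule {a \<in> carrier A. h a \<in> U} R A"
proof -
  interpret A: module R A by (rule mhom_dom[OF h])
  note u = submoduleD[OF mhom_cod[OF h] U]
  show ?thesis
    using u by (intro A.submoduleI) (auto simp: mhomD[OF h] mhom_neg[OF h])
qed

lemma zero_submodule: "module R M \<Longrightarrow> submodule {\<zero>\<^bsub>M\<^esub>} R M"
proof -
  assume M: "module R M"
  then interpret M: module R M .
  show ?thesis by (rule M.submoduleI) auto
qed

lemma mod_span_empty:
  assumes "module R M"
  shows "mod_span R M {} = {\<zero>\<^bsub>M\<^esub>}"
  using mod_span_subset[OF zero_submodule[OF assms], of "{}"] submoduleD(2)[OF assms mod_span_submodule[OF assms]] by blast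

lemma mod_span_insert:
  assumes M: "module R M" and a: "a \<in> carrier M" and S: "S \<subseteq> carrier M"
  shows "mod_span R M (insert a S) \<subseteq> sub_sum M (cyclic R M a) (mod_span R M S)"
proof (rule mod_span_subset)
  interpret M: module R M by (rule M)
  note s = sub_sum_submodule[OF M cyclic_submodule[OF M a] mod_span_submodule[OF M S]]
  show "submodule (sub_sum M (cyclic R M a) (mod_span R M S)) R M" by (rule s(1))
  have "a = \<one>\<^bsub>R\<^esub> \<odot>\<^bsub>M\<^esub> a" using a by simp
  then have "a \<in> cyclic R M a" by blast
  then show "insert a S \<subseteq> sub_sum M (cyclic R M a) (mod_span R M S)"
    using s(2,3) mod_span_superset[of S R M] by blast
qed

definition noetherian_module where
  "noetherian_module R M \<longleftrightarrow> (\<forall>U. submodule U R M \<longrightarrow> (\<exists>S. finite S \<and> S \<subseteq> U \<and> mod_span R M S = U))"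

lemma noetherian_moduleD:
  "noetherian_module R M \<Longrightarrow> submodule U R M \<Longrightarrow> \<exists>S. finite S \<and> S \<subseteq> U \<and> mod_span R M S = U"
  by (simp add: noetherian_module_def)

text \<open>The coefficients with which \<open>a\<close> occurs in elements of \<open>W\<close>,
  modulo \<open>V\<close>. The set is the preimage of \<open>W + V\<close> under the map that sends
  \<open>r\<close> to \<open>r a\<close>.\<close>

lemma coefficient_ideal:
  assumes M: "module R M" and V: "submodule V R M" and W: "submodule W R M" and a: "a \<in> carrier M"
  shows "ideal {r \<in> carrier R. \<exists>s\<in>V. r \<odot>\<^bsub>M\<^esub> a \<oplus>\<^bsub>M\<^esub> s \<in> W} R"
proof -
  interpret M: module R M by (rule M)
  have "{r \<in> carrier (self_module R). r \<odot>\<^bsub>M\<^esub> a \<in> sub_sum M W V} = {r \<in> carrier R. \<exists>s\<in>V. r \<odot>\<^bsub>M\<^esub> a \<oplus>\<^bsub>M\<^esub> s \<in> W}"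
  proof (intro equalityI subsetI)
    note w = submoduleD[OF M W] and v = submoduleD[OF M V]
    fix r
    { assume "r \<in> {r \<in> carrier (self_module R). r \<odot>\<^bsub>M\<^esub> a \<in> sub_sum M W V}"
      then have r: "r \<in> carrier R" "r \<odot>\<^bsub>M\<^esub> a \<in> sub_sum M W V" by (simp_all add: self_module_simps)
      then obtain p s where ps: "r \<odot>\<^bsub>M\<^esub> a = p \<oplus>\<^bsub>M\<^esub> s" "p \<in> W" "s \<in> V" by (auto simp: sub_sum_def)
      have "p \<in> carrier M" "s \<in> carrier M" using ps w(1) v(1) by auto
      then have "r \<odot>\<^bsub>M\<^esub> a \<oplus>\<^bsub>M\<^esub> \<ominus>\<^bsub>M\<^esub> s = p" unfolding ps(1) by (simp add: M.a_assoc M.r_neg)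
      then have "r \<odot>\<^bsub>M\<^esub> a \<oplus>\<^bsub>M\<^esub> \<ominus>\<^bsub>M\<^esub> s \<in> W" using ps(2) by simp
      then show "r \<in> {r \<in> carrier R. \<exists>s\<in>V. r \<odot>\<^bsub>M\<^esub> a \<oplus>\<^bsub>M\<^esub> s \<in> W}" using v(3)[OF ps(3)] r(1) by auto }
    { assume "r \<in> {r \<in> carrier R. \<exists>s\<in>V. r \<odot>\<^bsub>M\<^esub> a \<oplus>\<^bsub>M\<^esub> s \<in> W}"
      then obtain s where r: "r \<in> carrier R" and s: "s \<in> V" "r \<odot>\<^bsub>M\<^esub> a \<oplus>\<^bsub>M\<^esub> s \<in> W" by auto
      have "s \<in> carrier M" using s v(1) by auto
      then have "r \<odot>\<^bsub>M\<^esub> a = (r \<odot>\<^bsub>M\<^esub> a \<oplus>\<^bsub>M\<^esub> s) \<oplus>\<^bsub>M\<^esub> \<ominus>\<^bsub>M\<^esub> s" using a r by (simp add: M.a_assoc M.r_neg)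
      moreover have "\<ominus>\<^bsub>M\<^esub> s \<in> V" by (rule v(3)[OF s(1)])
      ultimately have "r \<odot>\<^bsub>M\<^esub> a \<in> sub_sum M W V" unfolding sub_sum_def using s(2) by auto
      then show "r \<in> {r \<in> carrier (self_module R). r \<odot>\<^bsub>M\<^esub> a \<in> sub_sum M W V}" using r by (simp add: self_module_simps) }
  qed
  then show ?thesis
    using colon_submodule[OF cyclic_mhom[OF M a] sub_sum_submodule(1)[OF M W V]]
    by (simp add: submodule_self_iff_ideal[OF M.R.is_cring])
qed

text \<open>Induction on the number of generators. With one new generator \<open>a\<close> and the
  span \<open>V\<close> of the old ones, \<open>U\<close> is generated by lifts of finitely many
  generators of the ideal of coefficients of \<open>a\<close> together with generators of
  \<open>U \<inter> V\<close>.\<close>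

lemma fin_gen_noetherian_module:
  assumes nr: "noetherian_ring R" and M: "module R M" and fg: "fin_gen R M"
  shows "noetherian_module R M"
proof -
  interpret M: module R M by (rule M)
  interpret NR: noetherian_ring R by (rule nr)
  have "\<forall>U. submodule U R M \<longrightarrow> U \<subseteq> mod_span R M G \<longrightarrow> (\<exists>S. finite S \<and> S \<subseteq> U \<and> mod_span R M S = U)"
    if "finite G" "G \<subseteq> carrier M" for G
    using that
  proof (induction G rule: finite_induct)
    case empty
    show ?case
    proof (intro allI impI)
      fix U assume U: "submodule U R M" "U \<subseteq> mod_span R M {}"
      then have "U = {\<zero>\<^bsub>M\<^esub>}" using submoduleD(2)[OF M U(1)] unfolding mod_span_empty[OF M] by auto
      then show "\<exists>S. finite S \<and> S \<subseteq> U \<and> mod_span R M S = U" using mod_span_empty[OF M] by auto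
    qed
  next
    case (insert a G)
    then have a: "a \<in> carrier M" and G: "G \<subseteq> carrier M" by auto
    let ?V = "mod_span R M G"
    have V: "submodule ?V R M" by (rule mod_span_submodule[OF M G])
    note v = submoduleD[OF M V]
    show ?case
    proof (intro allI impI)
      fix U assume U: "submodule U R M" "U \<subseteq> mod_span R M (insert a G)"
      note u = submoduleD[OF M U(1)]
      have UV: "submodule (U \<inter> ?V) R M" using u v by (intro M.submoduleI) auto
      obtain T where T: "finite T" "T \<subseteq> U \<inter> ?V" "mod_span R M T = U \<inter> ?V"
        using insert.IH[OF G, rule_format, OF UV Int_lower2] by (elim exE conjE)
      let ?I = "\<lambda>W. {r \<in> carrier R. \<exists>s\<in>?V. r \<odot>\<^bsub>M\<^esub> a \<oplus>\<^bsub>M\<^esub> s \<in> W}"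
      obtain A where A: "A \<subseteq> carrier R" "finite A" "?I U = genideal R A"
        using NR.finetely_gen[OF coefficient_ideal[OF M V U(1) a]] by (elim bexE exE conjE)
      have "A \<subseteq> ?I U" unfolding A(3) by (rule M.R.genideal_self[OF A(1)])
      then have "\<forall>r\<in>A. \<exists>s\<in>?V. r \<odot>\<^bsub>M\<^esub> a \<oplus>\<^bsub>M\<^esub> s \<in> U" by blast
      then obtain s where s: "\<And>r. r \<in> A \<Longrightarrow> s r \<in> ?V \<and> r \<odot>\<^bsub>M\<^esub> a \<oplus>\<^bsub>M\<^esub> s r \<in> U" by metis
      let ?S = "(\<lambda>r. r \<odot>\<^bsub>M\<^esub> a \<oplus>\<^bsub>M\<^esub> s r) ` A \<union> T"
      have S: "finite ?S" "?S \<subseteq> U" using A(2) T s by auto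
      then have Sc: "?S \<subseteq> carrier M" using u(1) by blast
      let ?W = "mod_span R M ?S"
      have W: "submodule ?W R M" by (rule mod_span_submodule[OF M Sc])
      note w = submoduleD[OF M W]
      have SW: "?S \<subseteq> ?W" by (rule mod_span_superset)
      have WU: "?W \<subseteq> U" by (rule mod_span_subset[OF U(1) S(2)])
      have "A \<subseteq> ?I ?W"
      proof
        fix r assume r: "r \<in> A"
        then have "r \<odot>\<^bsub>M\<^esub> a \<oplus>\<^bsub>M\<^esub> s r \<in> ?W" using SW by blast
        then show "r \<in> ?I ?W" using s[OF r] A(1) r by blast
      qed
      then have I: "?I U \<subseteq> ?I ?W" unfolding A(3) by (rule M.R.genideal_minimal[OF coefficient_ideal[OF M V W a]])
      have "U \<subseteq> ?W"
      proof
        fix x assume x: "x \<in> U"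
        then have "x \<in> sub_sum M (cyclic R M a) ?V" using U(2) mod_span_insert[OF M a G] by blast
        then obtain r t where rt: "x = r \<odot>\<^bsub>M\<^esub> a \<oplus>\<^bsub>M\<^esub> t" "r \<in> carrier R" "t \<in> ?V" by (auto simp: sub_sum_def)
        \<comment> \<open>An element of \<open>?W\<close> with the same coefficient \<open>r\<close>
          is subtracted from \<open>x\<close>; the difference lies in \<open>U \<inter> ?V\<close>,
          which is inside \<open>?W\<close>.\<close>
        then have "r \<in> ?I U" using x by blast
        then have "r \<in> ?I ?W" using I by blast
        then obtain t' where t': "t' \<in> ?V" "r \<odot>\<^bsub>M\<^esub> a \<oplus>\<^bsub>M\<^esub> t' \<in> ?W" by blast
        have tc: "t \<in> carrier M" "t' \<in> carrier M" using rt t' v(1) by auto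
        have e: "x \<ominus>\<^bsub>M\<^esub> (r \<odot>\<^bsub>M\<^esub> a \<oplus>\<^bsub>M\<^esub> t') = t \<ominus>\<^bsub>M\<^esub> t'"
        proof -
          have ra: "r \<odot>\<^bsub>M\<^esub> a \<in> carrier M" using rt(2) a by simp
          have "x \<ominus>\<^bsub>M\<^esub> (r \<odot>\<^bsub>M\<^esub> a \<oplus>\<^bsub>M\<^esub> t') = (t \<oplus>\<^bsub>M\<^esub> r \<odot>\<^bsub>M\<^esub> a) \<oplus>\<^bsub>M\<^esub> (\<ominus>\<^bsub>M\<^esub> (r \<odot>\<^bsub>M\<^esub> a) \<oplus>\<^bsub>M\<^esub> \<ominus>\<^bsub>M\<^esub> t')"
            unfolding rt(1) M.minus_eq M.minus_add[OF ra tc(2)] M.a_comm[OF ra tc(1)] ..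
          also have "\<dots> = t \<oplus>\<^bsub>M\<^esub> ((r \<odot>\<^bsub>M\<^esub> a \<oplus>\<^bsub>M\<^esub> \<ominus>\<^bsub>M\<^esub> (r \<odot>\<^bsub>M\<^esub> a)) \<oplus>\<^bsub>M\<^esub> \<ominus>\<^bsub>M\<^esub> t')"
            using ra tc by (simp only: M.a_assoc M.a_closed M.a_inv_closed)
          finally show ?thesis using ra tc by (simp add: M.r_neg M.minus_eq)
        qed
        have "x \<ominus>\<^bsub>M\<^esub> (r \<odot>\<^bsub>M\<^esub> a \<oplus>\<^bsub>M\<^esub> t') \<in> U \<inter> ?V"
          using u(6)[OF x subsetD[OF WU t'(2)]] v(6)[OF rt(3) t'(1)] unfolding e by blast
        moreover have "U \<inter> ?V \<subseteq> ?W" unfolding T(3)[symmetric] using SW by (intro mod_span_subset[OF W]) blast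
        ultimately have "x \<ominus>\<^bsub>M\<^esub> (r \<odot>\<^bsub>M\<^esub> a \<oplus>\<^bsub>M\<^esub> t') \<in> ?W" by blast
        from w(5)[OF this t'(2)] show "x \<in> ?W"
          unfolding add_minus_cancel(4)[OF M subsetD[OF u(1) x] subsetD[OF w(1) t'(2)]] .
      qed
      then show "\<exists>S. finite S \<and> S \<subseteq> U \<and> mod_span R M S = U" using WU S by blast
    qed
  qed
  note main = this
  obtain G where G: "finite G" "G \<subseteq> carrier M" "mod_span R M G = carrier M" using fg by (auto simp: fin_gen_def)
  show ?thesis
    unfolding noetherian_module_def
  proof (intro allI impI)
    fix U assume U: "submodule U R M"
    show "\<exists>S. finite S \<and> S \<subseteq> U \<and> mod_span R M S = U"
      by (rule main[OF G(1,2), rule_format, OF U]) (use submoduleD(1)[OF M U] G(3) in simp)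
  qed
qed

text \<open>The union of a chain of submodules is finitely generated, and its generators already lie
  in one member; so Zorn's lemma applies.\<close>

lemma noetherian_module_max:
  assumes M: "module R M" and n: "noetherian_module R M" and ne: "\<U> \<noteq> {}" and sub: "\<And>U. U \<in> \<U> \<Longrightarrow> submodule U R M"
  shows "\<exists>U\<in>\<U>. \<forall>V\<in>\<U>. U \<subseteq> V \<longrightarrow> V = U"
proof (rule subset_Zorn_nonempty[OF ne])
  interpret M: module R M by (rule M)
  fix C assume C: "C \<noteq> {}" "subset.chain \<U> C"
  have CU: "C \<subseteq> \<U>" and ch: "\<And>A B. A \<in> C \<Longrightarrow> B \<in> C \<Longrightarrow> A \<subseteq> B \<or> B \<subseteq> A" using C(2) by (auto simp: subset.chain_def)
  have s: "submodule A R M" if "A \<in> C" for A using sub CU that by blast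
  note d = submoduleD[OF M s]
  have UC: "submodule (\<Union>C) R M"
  proof (rule M.submoduleI)
    show "\<Union>C \<subseteq> carrier M" using d(1) by blast
    show "\<zero>\<^bsub>M\<^esub> \<in> \<Union>C" using C(1) d(2) by blast
    fix a assume "a \<in> \<Union>C"
    then obtain A where A: "A \<in> C" "a \<in> A" by blast
    show "\<ominus>\<^bsub>M\<^esub> a \<in> \<Union>C" using d(3)[OF A] A(1) by blast
    show "r \<odot>\<^bsub>M\<^esub> a \<in> \<Union>C" if "r \<in> carrier R" for r using d(4)[OF A(1) that A(2)] A(1) by blast
    fix b assume "b \<in> \<Union>C"
    then obtain B where B: "B \<in> C" "b \<in> B" by blast
    show "a \<oplus>\<^bsub>M\<^esub> b \<in> \<Union>C" using ch[OF A(1) B(1)] d(5)[OF A(1)] d(5)[OF B(1)] A B by blast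
  qed
  obtain S where S: "finite S" "S \<subseteq> \<Union>C" "mod_span R M S = \<Union>C"
    using noetherian_moduleD[OF n UC] by (elim exE conjE)
  obtain B where B: "B \<in> C" "S \<subseteq> B" by (rule finite_subset_Union_chain[OF S(1,2) C(1,2)])
  have "\<Union>C \<subseteq> B" unfolding S(3)[symmetric] by (rule mod_span_subset[OF s[OF B(1)] B(2)])
  then have "\<Union>C = B" using B(1) by blast
  then show "\<Union>C \<in> \<U>" using B(1) CU by blast
qed

lemma noetherian_module_induct:
  assumes M: "module R M" and n: "noetherian_module R M" and U: "submodule U R M"
    and step: "\<And>U. submodule U R M \<Longrightarrow> (\<And>V. submodule V R M \<Longrightarrow> U \<subset> V \<Longrightarrow> P V) \<Longrightarrow> P U"
  shows "P U"
proof (rule ccontr)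
  assume "\<not> P U"
  then have "{U. submodule U R M \<and> \<not> P U} \<noteq> {}" using U by blast
  from noetherian_module_max[OF M n this] obtain V where V: "submodule V R M" "\<not> P V"
    "\<And>W. submodule W R M \<Longrightarrow> \<not> P W \<Longrightarrow> V \<subseteq> W \<Longrightarrow> W = V" by blast
  have "P V" by (rule step[OF V(1)]) (use V(3) in blast)
  then show False using V(2) by simp
qed

lemma self_module_fin_gen:
  assumes "cring R"
  shows "fin_gen R (self_module R)"
proof -
  interpret R: cring R by fact
  let ?S = "self_module R"
  have S: "module R ?S" by (rule self_module_is_module[OF assms])
  have s: "submodule (mod_span R ?S {\<one>\<^bsub>R\<^esub>}) R ?S" by (rule mod_span_submodule[OF S]) (simp add: self_module_simps)
  have "carrier ?S \<subseteq> mod_span R ?S {\<one>\<^bsub>R\<^esub>}"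
  proof
    fix r assume "r \<in> carrier ?S"
    then have r: "r \<in> carrier R" by (simp add: self_module_simps)
    have "\<one>\<^bsub>R\<^esub> \<in> mod_span R ?S {\<one>\<^bsub>R\<^esub>}" by (rule subsetD[OF mod_span_superset]) simp
    from submoduleD(4)[OF S s r this] show "r \<in> mod_span R ?S {\<one>\<^bsub>R\<^esub>}" using r by (simp add: self_module_simps)
  qed
  then have "mod_span R ?S {\<one>\<^bsub>R\<^esub>} = carrier ?S" using submoduleD(1)[OF S s] by blast
  then show ?thesis unfolding fin_gen_def by (intro exI[of _ "{\<one>\<^bsub>R\<^esub>}"]) (simp add: self_module_simps)
qed

lemma noetherian_module_maxE:
  assumes M: "module R M" and n: "noetherian_module R M" and U: "submodule U0 R M" "P U0"
  shows "\<exists>U. submodule U R M \<and> P U \<and> (\<forall>V. submodule V R M \<longrightarrow> P V \<longrightarrow> U \<subseteq> V \<longrightarrow> V = U)"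
proof -
  have "{U. submodule U R M \<and> P U} \<noteq> {}" using U by auto
  from noetherian_module_max[OF M n this] obtain U where U: "U \<in> {U. submodule U R M \<and> P U}"
    "\<forall>V\<in>{U. submodule U R M \<and> P U}. U \<subseteq> V \<longrightarrow> V = U" by auto
  show ?thesis by (rule exI[of _ U]) (use U in simp)
qed

subsection \<open>Noetherian local rings\<close>

context noetherian_local_ring
begin

lemma max_ideal_maximal: "maximalideal (max_ideal R) R"
  unfolding max_ideal_def by (rule theI'[OF unique_maximalideal])

lemma max_ideal_is_ideal: "ideal (max_ideal R) R"
  using max_ideal_maximal by (rule maximalideal.axioms(1))

lemma max_ideal_subset: "max_ideal R \<subseteq> carrier R"
  using ideal.Icarr[OF max_ideal_is_ideal] by blast

lemma max_ideal_carr: "y \<in> max_ideal R \<Longrightarrow> y \<in> carrier R"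
  using max_ideal_subset by blast

lemma one_notin_max_ideal: "\<one> \<notin> max_ideal R"
  using ideal.one_imp_carrier[OF max_ideal_is_ideal] maximalideal.I_notcarr[OF max_ideal_maximal] by auto

lemma self_noetherian: "noetherian_module R (self_module R)"
  by (rule fin_gen_noetherian_module[OF _ self_module_is_module[OF is_cring] self_module_fin_gen[OF is_cring]]) unfold_locales

text \<open>An ideal maximal among the proper ones above \<open>I\<close> is a maximal ideal, and
  the ring has only one.\<close>

lemma proper_ideal_in_max_ideal:
  assumes I: "ideal I R" "\<one> \<notin> I"
  shows "I \<subseteq> max_ideal R"
proof -
  have "I \<subseteq> I \<and> \<one> \<notin> I" using I by simp
  from noetherian_module_maxE[OF self_module_is_module[OF is_cring] self_noetherian, unfolded submodule_self_iff_ideal[OF is_cring],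
      where P = "\<lambda>J. I \<subseteq> J \<and> \<one> \<notin> J", OF I(1) this]
  obtain J where "ideal J R" "I \<subseteq> J" "\<one> \<notin> J" "\<forall>K. ideal K R \<longrightarrow> I \<subseteq> K \<and> \<one> \<notin> K \<longrightarrow> J \<subseteq> K \<longrightarrow> K = J"
    by (elim exE conjE)
  then have J: "ideal J R" "I \<subseteq> J" "\<one> \<notin> J" "\<And>K. ideal K R \<Longrightarrow> I \<subseteq> K \<Longrightarrow> \<one> \<notin> K \<Longrightarrow> J \<subseteq> K \<Longrightarrow> K = J" by simp_all
  have "maximalideal J R"
  proof (rule maximalidealI[OF J(1)])
    show "carrier R \<noteq> J" using J(3) by blast
    fix K assume K: "ideal K R" "J \<subseteq> K" "K \<subseteq> carrier R"
    show "K = J \<or> K = carrier R"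
    proof (cases "\<one> \<in> K")
      case True
      then show ?thesis using ideal.one_imp_carrier[OF K(1)] by simp
    next
      case False
      then show ?thesis using J(4)[OF K(1) _ False K(2)] J(2) K(2) by blast
    qed
  qed
  then have "J = max_ideal R" using unique_maximalideal max_ideal_maximal by blast
  then show ?thesis using J(2) by simp
qed

lemma unit_of_notin_max_ideal:
  assumes u: "u \<in> carrier R" "u \<notin> max_ideal R"
  obtains v where "v \<in> carrier R" "v \<otimes> u = \<one>"
proof -
  have "ideal (PIdl u) R" by (rule cgenideal_ideal[OF u(1)])
  moreover have "u \<in> PIdl u" by (rule cgenideal_self[OF u(1)])
  ultimately have "\<one> \<in> PIdl u" using proper_ideal_in_max_ideal u(2) by blast
  then show thesis using that unfolding cgenideal_def by auto
qed

lemma one_minus_notin_max_ideal: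
  assumes y: "y \<in> max_ideal R" and r: "r \<in> carrier R"
  shows "\<one> \<ominus> r \<otimes> y \<notin> max_ideal R"
proof
  assume a: "\<one> \<ominus> r \<otimes> y \<in> max_ideal R"
  interpret m: ideal "max_ideal R" R by (rule max_ideal_is_ideal)
  have yc: "y \<in> carrier R" by (rule max_ideal_carr[OF y])
  have "(\<one> \<ominus> r \<otimes> y) \<oplus> r \<otimes> y \<in> max_ideal R" using a m.I_l_closed[OF y r] by (rule m.a_closed)
  moreover have "(\<one> \<ominus> r \<otimes> y) \<oplus> r \<otimes> y = \<one>" using yc r by (simp add: minus_eq a_assoc l_neg)
  ultimately show False using one_notin_max_ideal by simp
qed

text \<open>Take \<open>V\<close> maximal among the proper submodules above \<open>U\<close>. Some
  \<open>y k\<close> lies outside \<open>V\<close>, hence \<open>V + R y k\<close> is everything and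
  \<open>(1 - r y) k\<close> lies in \<open>V\<close> for some \<open>r\<close>. As
  \<open>1 - r y\<close> is a unit, \<open>k\<close> lies in \<open>V\<close>, which contradicts the
  choice of \<open>k\<close>.\<close>

lemma nakayama:
  assumes M: "module R M" and n: "noetherian_module R M" and U: "submodule U R M" and y: "y \<in> max_ideal R"
    and e: "sub_sum M U (scaled M y) = carrier M"
  shows "U = carrier M"
proof (rule ccontr)
  interpret M: module R M by (rule M)
  assume "U \<noteq> carrier M"
  then have "U \<subseteq> U \<and> U \<noteq> carrier M" by simp
  from noetherian_module_maxE[OF M n, where P = "\<lambda>V. U \<subseteq> V \<and> V \<noteq> carrier M", OF U this]
  obtain V where "submodule V R M" "U \<subseteq> V" "V \<noteq> carrier M"
    "\<forall>W. submodule W R M \<longrightarrow> U \<subseteq> W \<and> W \<noteq> carrier M \<longrightarrow> V \<subseteq> W \<longrightarrow> W = V" by (elim exE conjE)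
  then have V: "submodule V R M" "U \<subseteq> V" "V \<noteq> carrier M"
    "\<And>W. submodule W R M \<Longrightarrow> U \<subseteq> W \<Longrightarrow> W \<noteq> carrier M \<Longrightarrow> V \<subseteq> W \<Longrightarrow> W = V" by simp_all
  note v = submoduleD[OF M V(1)]
  have yc: "y \<in> carrier R" by (rule max_ideal_carr[OF y])
  have "\<exists>k\<in>carrier M. y \<odot>\<^bsub>M\<^esub> k \<notin> V"
  proof (rule ccontr)
    assume "\<not> (\<exists>k\<in>carrier M. y \<odot>\<^bsub>M\<^esub> k \<notin> V)"
    then have "sub_sum M U (scaled M y) \<subseteq> V" using V(2) v(5) unfolding sub_sum_def by blast
    then show False using e v(1) V(3) by blast
  qed
  then obtain k where k: "k \<in> carrier M" "y \<odot>\<^bsub>M\<^esub> k \<notin> V" by blast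
  have yk: "y \<odot>\<^bsub>M\<^esub> k \<in> carrier M" using k(1) yc by simp
  note s = sub_sum_submodule[OF M V(1) cyclic_submodule[OF M yk]]
  have "y \<odot>\<^bsub>M\<^esub> k = \<one> \<odot>\<^bsub>M\<^esub> (y \<odot>\<^bsub>M\<^esub> k)" using yk by simp
  then have "y \<odot>\<^bsub>M\<^esub> k \<in> sub_sum M V (cyclic R M (y \<odot>\<^bsub>M\<^esub> k))" using s(3) by blast
  then have "sub_sum M V (cyclic R M (y \<odot>\<^bsub>M\<^esub> k)) = carrier M" using V(4)[OF s(1) _ _ s(2)] V(2) s(2) k(2) by blast
  then obtain p r where pr: "k = p \<oplus>\<^bsub>M\<^esub> r \<odot>\<^bsub>M\<^esub> (y \<odot>\<^bsub>M\<^esub> k)" "p \<in> V" "r \<in> carrier R"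
    using k(1) unfolding sub_sum_def by blast
  have pc: "p \<in> carrier M" using pr(2) v(1) by blast
  have "(\<one> \<ominus> r \<otimes> y) \<odot>\<^bsub>M\<^esub> k = k \<ominus>\<^bsub>M\<^esub> r \<odot>\<^bsub>M\<^esub> (y \<odot>\<^bsub>M\<^esub> k)"
    using k(1) pr(3) yc by (simp add: minus_eq M.minus_eq M.smult_l_distr M.smult_l_minus M.smult_assoc1)
  also have "\<dots> = p" using add_minus_cancel(1)[OF M pc, of "r \<odot>\<^bsub>M\<^esub> (y \<odot>\<^bsub>M\<^esub> k)"] pr(1,3) yk by simp
  finally have 1: "(\<one> \<ominus> r \<otimes> y) \<odot>\<^bsub>M\<^esub> k \<in> V" using pr(2) by simp
  have uc: "\<one> \<ominus> r \<otimes> y \<in> carrier R" using pr(3) yc by simp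
  from unit_of_notin_max_ideal[OF uc one_minus_notin_max_ideal[OF y pr(3)]]
  obtain w where w: "w \<in> carrier R" "w \<otimes> (\<one> \<ominus> r \<otimes> y) = \<one>" .
  have "w \<odot>\<^bsub>M\<^esub> ((\<one> \<ominus> r \<otimes> y) \<odot>\<^bsub>M\<^esub> k) = k" using w k(1) uc by (simp add: M.smult_assoc1[symmetric])
  then have "k \<in> V" using v(4)[OF w(1) 1] by simp
  then show False using k(2) v(4)[OF yc] by blast
qed

text \<open>A product with one factor from \<open>q - p\<close> for each \<open>q\<close> in
  \<open>F\<close> lies in all these ideals, and outside \<open>p\<close> by primality.\<close>

lemma avoid_prime:
  assumes "finite F" "\<And>q. q \<in> F \<Longrightarrow> ideal q R" "\<And>q. q \<in> F \<Longrightarrow> \<not> q \<subseteq> p" "\<one> \<notin> p"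
    and prime: "\<And>r s. r \<in> carrier R \<Longrightarrow> s \<in> carrier R \<Longrightarrow> r \<otimes> s \<in> p \<Longrightarrow> r \<in> p \<or> s \<in> p"
  shows "\<exists>c\<in>carrier R. c \<notin> p \<and> (\<forall>q\<in>F. c \<in> q)"
  using assms(1-3)
proof (induction F rule: finite_induct)
  case empty
  then show ?case using assms(4) by blast
next
  case (insert q F)
  have iq: "ideal q R" by (rule insert.prems(1)) simp
  obtain c where c: "c \<in> carrier R" "c \<notin> p" "\<And>q. q \<in> F \<Longrightarrow> c \<in> q" using insert.IH insert.prems by auto
  obtain d where d: "d \<in> q" "d \<notin> p" using insert.prems(2)[of q] by blast
  have dc: "d \<in> carrier R" by (rule ideal.Icarr[OF iq d(1)])
  have "c \<otimes> d \<notin> p" using prime[OF c(1) dc] c(2) d(2) by blast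
  moreover have "c \<otimes> d \<in> q" by (rule ideal.I_l_closed[OF iq d(1) c(1)])
  moreover have "c \<otimes> d \<in> q'" if "q' \<in> F" for q'
    by (rule ideal.I_r_closed[OF _ c(3)[OF that] dc]) (use insert.prems(1) that in blast)
  ultimately show ?case using c(1) dc by blast
qed

text \<open>The maximal ones among the annihilators of the nonzero elements of \<open>M / U\<close> are finitely many
  primes, and they cover the zero divisors. By prime avoidance one of them is the maximal ideal.\<close>

lemma socle_exists:
  assumes M: "module R M" and n: "noetherian_module R M" and U: "submodule U R M" and ne: "U \<noteq> carrier M"
    and zd: "\<And>y. y \<in> max_ideal R \<Longrightarrow> \<exists>k\<in>carrier M. k \<notin> U \<and> y \<odot>\<^bsub>M\<^esub> k \<in> U"
  shows "\<exists>z\<in>carrier M. z \<notin> U \<and> (\<forall>y\<in>max_ideal R. y \<odot>\<^bsub>M\<^esub> z \<in> U)"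
proof -
  interpret M: module R M by (rule M)
  interpret m: ideal "max_ideal R" R by (rule max_ideal_is_ideal)
  note u = submoduleD[OF M U]
  define ann where "ann z = {r \<in> carrier R. r \<odot>\<^bsub>M\<^esub> z \<in> U}" for z
  have ai: "ideal (ann z) R" if "z \<in> carrier M" for z
    using colon_submodule[OF cyclic_mhom[OF M that] U] by (simp add: ann_def self_module_simps submodule_self_iff_ideal[OF is_cring])
  define AA where "AA = ann ` (carrier M - U)"
  have AAi: "ideal q R" if "q \<in> AA" for q using that ai by (auto simp: AA_def)
  \<comment> \<open>The maximal members of the family of annihilators; they turn out to be prime and
    finite in number.\<close>
  define MA where "MA = {p \<in> AA. \<forall>q\<in>AA. p \<subseteq> q \<longrightarrow> q = p}"
  have MAi: "ideal q R" if "q \<in> MA" for q using that AAi by (auto simp: MA_def)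
  have above: "\<exists>p\<in>MA. ann z \<subseteq> p" if z: "z \<in> carrier M" "z \<notin> U" for z
  proof -
    have "ann z \<in> AA \<and> ann z \<subseteq> ann z" using z by (simp add: AA_def)
    from noetherian_module_maxE[OF self_module_is_module[OF is_cring] self_noetherian, unfolded submodule_self_iff_ideal[OF is_cring],
        where P = "\<lambda>q. q \<in> AA \<and> ann z \<subseteq> q", OF ai[OF z(1)] this]
    obtain p where p: "ideal p R" "p \<in> AA" "ann z \<subseteq> p"
      "\<forall>q. ideal q R \<longrightarrow> q \<in> AA \<and> ann z \<subseteq> q \<longrightarrow> p \<subseteq> q \<longrightarrow> q = p" by (elim exE conjE)
    have "q = p" if "q \<in> AA" "p \<subseteq> q" for q using p(4) AAi[OF that(1)] that p(3) by auto
    then have "p \<in> MA" using p(2) by (simp add: MA_def)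
    then show ?thesis using p(3) by auto
  qed
  have one: "\<one> \<notin> p" if "p \<in> MA" for p using that by (auto simp: MA_def AA_def ann_def)
  \<comment> \<open>If \<open>r s\<close> annihilates \<open>z\<close> modulo \<open>U\<close> and
    \<open>s\<close> does not, then the annihilator of \<open>s z\<close> contains that of
    \<open>z\<close>; by maximality the two are equal, and the former contains
    \<open>r\<close>.\<close>
  have prime: "r \<in> p \<or> s \<in> p" if p: "p \<in> MA" and rs: "r \<in> carrier R" "s \<in> carrier R" "r \<otimes> s \<in> p" for p r s
  proof (rule disjCI)
    assume s: "s \<notin> p"
    obtain z where z: "z \<in> carrier M" "z \<notin> U" "p = ann z" using p by (auto simp: MA_def AA_def)
    have sz: "s \<odot>\<^bsub>M\<^esub> z \<in> carrier M" "s \<odot>\<^bsub>M\<^esub> z \<notin> U" using s z rs(2) by (auto simp: ann_def)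
    have "ann z \<subseteq> ann (s \<odot>\<^bsub>M\<^esub> z)"
    proof
      fix t assume "t \<in> ann z"
      then have t: "t \<in> carrier R" "t \<odot>\<^bsub>M\<^esub> z \<in> U" by (auto simp: ann_def)
      have "t \<odot>\<^bsub>M\<^esub> (s \<odot>\<^bsub>M\<^esub> z) = s \<odot>\<^bsub>M\<^esub> (t \<odot>\<^bsub>M\<^esub> z)"
        using t(1) rs(2) z(1) by (simp add: M.smult_assoc1[symmetric] m_comm)
      then show "t \<in> ann (s \<odot>\<^bsub>M\<^esub> z)" using t u(4)[OF rs(2) t(2)] by (simp add: ann_def)
    qed
    then have "ann (s \<odot>\<^bsub>M\<^esub> z) = p" using p sz unfolding z(3) by (auto simp: MA_def AA_def)
    moreover have "r \<in> ann (s \<odot>\<^bsub>M\<^esub> z)" using rs z by (simp add: ann_def M.smult_assoc1)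
    ultimately show "r \<in> p" by simp
  qed
  define zf where "zf p = (SOME z. z \<in> carrier M \<and> z \<notin> U \<and> ann z = p)" for p
  have zf: "zf p \<in> carrier M" "zf p \<notin> U" "ann (zf p) = p" if p: "p \<in> MA" for p
  proof -
    have "\<exists>z. z \<in> carrier M \<and> z \<notin> U \<and> ann z = p" using p by (auto simp: MA_def AA_def)
    from someI_ex[OF this] show "zf p \<in> carrier M" "zf p \<notin> U" "ann (zf p) = p" unfolding zf_def by blast+
  qed
  \<comment> \<open>Choose a finite \<open>F\<close> for which the span of the witnesses
    \<open>zf q\<close> is maximal. For any \<open>p\<close> in \<open>MA\<close> the witness
    \<open>zf p\<close> already lies in this span. If no \<open>q\<close> in \<open>F\<close> were
    contained in \<open>p\<close>, a \<open>c\<close> outside \<open>p\<close> but in all these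
    \<open>q\<close> would annihilate the whole span modulo \<open>U\<close> and so lie in
    \<open>p\<close>. Hence some \<open>q\<close> is contained in \<open>p\<close>, and
    \<open>p = q\<close> by maximality.\<close>
  have fin: "finite MA"
  proof -
    let ?sp = "\<lambda>F. mod_span R M (zf ` F)"
    have sp: "submodule (?sp F) R M" if "F \<subseteq> MA" for F by (rule mod_span_submodule[OF M]) (use zf(1) that in blast)
    have "\<exists>F. finite F \<and> F \<subseteq> MA \<and> ?sp {} = ?sp F" by (intro exI[of _ "{}"]) simp
    from noetherian_module_maxE[OF M n, where P = "\<lambda>W. \<exists>F. finite F \<and> F \<subseteq> MA \<and> W = ?sp F", OF sp[OF empty_subsetI] this]
    obtain W F where W: "submodule W R M" and F: "finite F" "F \<subseteq> MA" "W = ?sp F"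
      and W3: "\<forall>V. submodule V R M \<longrightarrow> (\<exists>F. finite F \<and> F \<subseteq> MA \<and> V = ?sp F) \<longrightarrow> W \<subseteq> V \<longrightarrow> V = W" by (elim exE conjE)
    have Wmax: "?sp G = W" if "finite G" "G \<subseteq> MA" "W \<subseteq> ?sp G" for G
      by (rule W3[rule_format, OF sp[OF that(2)] _ that(3)]) (use that in auto)
    have "p \<in> F" if p: "p \<in> MA" for p
    proof -
      have "zf ` F \<subseteq> ?sp (insert p F)"
        by (rule order_trans[OF _ mod_span_superset]) auto
      then have "?sp F \<subseteq> ?sp (insert p F)"
        by (intro mod_span_subset[OF sp]) (use F(2) p in auto)
      then have "?sp (insert p F) = ?sp F" using Wmax[of "insert p F"] F p by simp
      moreover have "zf p \<in> ?sp (insert p F)" by (rule subsetD[OF mod_span_superset]) simp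
      ultimately have zp: "zf p \<in> ?sp F" by simp
      have "\<exists>q\<in>F. q \<subseteq> p"
      proof (rule ccontr)
        assume a: "\<not> (\<exists>q\<in>F. q \<subseteq> p)"
        have "\<exists>c\<in>carrier R. c \<notin> p \<and> (\<forall>q\<in>F. c \<in> q)"
          by (rule avoid_prime[OF F(1) _ _ one[OF p] prime[OF p]]) (use MAi F(2) a in blast)+
        then obtain c where c: "c \<in> carrier R" "c \<notin> p" "\<And>q. q \<in> F \<Longrightarrow> c \<in> q" by blast
        have "?sp F \<subseteq> {k \<in> carrier M. c \<odot>\<^bsub>M\<^esub> k \<in> U}"
        proof (rule mod_span_subset[OF colon_submodule[OF scale_mhom[OF M c(1)] U]])
          show "zf ` F \<subseteq> {k \<in> carrier M. c \<odot>\<^bsub>M\<^esub> k \<in> U}"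
          proof (intro image_subsetI)
            fix q assume q: "q \<in> F"
            then have qM: "q \<in> MA" using F(2) by blast
            have "c \<in> ann (zf q)" using c(3)[OF q] zf(3)[OF qM] by simp
            then show "zf q \<in> {k \<in> carrier M. c \<odot>\<^bsub>M\<^esub> k \<in> U}" using zf(1)[OF qM] by (simp add: ann_def)
          qed
        qed
        then have "c \<in> ann (zf p)" using zp c(1) by (auto simp: ann_def)
        then show False using zf(3)[OF p] c(2) by simp
      qed
      then obtain q where q: "q \<in> F" "q \<subseteq> p" by blast
      have "p = q" using q F(2) p by (auto simp: MA_def)
      then show ?thesis using q(1) by simp
    qed
    then have "MA \<subseteq> F" by (rule subsetI)
    then show ?thesis using F(1) by (rule finite_subset)
  qed
  \<comment> \<open>Prime avoidance. The members of \<open>MA\<close> are pairwise incomparable, so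
    the elements needed to correct \<open>y\<close> exist.\<close>
  have avoid: "\<exists>y\<in>max_ideal R. \<forall>p\<in>A. y \<notin> p" if "finite A" "A \<subseteq> MA" "\<And>p. p \<in> A \<Longrightarrow> \<not> max_ideal R \<subseteq> p" for A
    using that
  proof (induction A rule: finite_induct)
    case empty
    show ?case by (intro bexI[of _ \<zero>]) simp_all
  next
    case (insert p A)
    then obtain y where y: "y \<in> max_ideal R" "\<And>q. q \<in> A \<Longrightarrow> y \<notin> q" by auto
    have p: "p \<in> MA" using insert.prems(1) by blast
    show ?case
    proof (cases "y \<in> p")
      case False
      then show ?thesis using y by blast
    next
      case True
      have "\<not> q \<subseteq> p" if "q \<in> A" for q
      proof
        assume "q \<subseteq> p"
        then have "p = q" using that insert.prems(1) p by (auto simp: MA_def)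
        then show False using that insert.hyps(2) by simp
      qed
      then have "\<exists>c\<in>carrier R. c \<notin> p \<and> (\<forall>q\<in>A. c \<in> q)"
        by (intro avoid_prime[OF insert.hyps(1) _ _ one[OF p] prime[OF p]]) (use MAi insert.prems(1) in auto)
      then obtain c where c: "c \<in> carrier R" "c \<notin> p" "\<And>q. q \<in> A \<Longrightarrow> c \<in> q" by blast
      obtain w where w: "w \<in> max_ideal R" "w \<notin> p" using insert.prems(2)[of p] by blast
      have wc: "w \<in> carrier R" and yc: "y \<in> carrier R" using max_ideal_carr w(1) y(1) by auto
      \<comment> \<open>\<open>y\<close> lies in \<open>p\<close> and in no ideal of
        \<open>A\<close>, while \<open>?t\<close> lies in every ideal of \<open>A\<close> and not in
        \<open>p\<close>; their sum therefore avoids all of them.\<close>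
      let ?t = "w \<otimes> c"
      have tc: "?t \<in> carrier R" using wc c(1) by simp
      have tp: "?t \<notin> p" using prime[OF p wc c(1)] w(2) c(2) by blast
      have tm: "?t \<in> max_ideal R" by (rule m.I_r_closed[OF w(1) c(1)])
      have ab: "(a \<oplus> b) \<ominus> b = a" if "a \<in> carrier R" "b \<in> carrier R" for a b
        using that by (simp add: minus_eq a_assoc r_neg)
      have cancel: "(y \<oplus> ?t) \<ominus> y = ?t" "(y \<oplus> ?t) \<ominus> ?t = y"
        using ab[OF tc yc] ab[OF yc tc] unfolding a_comm[OF tc yc] by simp_all
      have diff: "a \<ominus> b \<in> q" if "ideal q R" "a \<in> q" "b \<in> q" for a b q
      proof -
        interpret q: ideal q R by (rule that(1))
        show ?thesis unfolding minus_eq by (rule q.a_closed[OF that(2) q.a_inv_closed[OF that(3)]])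
      qed
      have "y \<oplus> ?t \<notin> p"
      proof
        assume "y \<oplus> ?t \<in> p"
        from diff[OF MAi[OF p] this True] show False using tp unfolding cancel by simp
      qed
      moreover have "y \<oplus> ?t \<notin> q" if q: "q \<in> A" for q
      proof
        have qi: "ideal q R" using MAi insert.prems(1) q by blast
        have "?t \<in> q" by (rule ideal.I_l_closed[OF qi c(3)[OF q] wc])
        moreover assume "y \<oplus> ?t \<in> q"
        ultimately show False using diff[OF qi, of "y \<oplus> ?t" ?t] y(2)[OF q] unfolding cancel by simp
      qed
      moreover have "y \<oplus> ?t \<in> max_ideal R" using y(1) tm by (rule m.a_closed)
      ultimately show ?thesis by blast
    qed
  qed
  have "\<exists>p\<in>MA. max_ideal R \<subseteq> p"
  proof (rule ccontr)
    assume "\<not> (\<exists>p\<in>MA. max_ideal R \<subseteq> p)"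
    then obtain y where y: "y \<in> max_ideal R" "\<And>p. p \<in> MA \<Longrightarrow> y \<notin> p" using avoid[OF fin subset_refl] by blast
    obtain k where k: "k \<in> carrier M" "k \<notin> U" "y \<odot>\<^bsub>M\<^esub> k \<in> U" using zd[OF y(1)] by blast
    then have "y \<in> ann k" using max_ideal_carr[OF y(1)] by (simp add: ann_def)
    then show False using above[OF k(1,2)] y(2) by blast
  qed
  then obtain p where p: "p \<in> MA" "max_ideal R \<subseteq> p" by blast
  show ?thesis using zf[OF p(1)] p(2) by (intro bexI[of _ "zf p"]) (auto simp: ann_def)
qed

subsection \<open>Maximal regular sequences\<close>

text \<open>Regularity is rephrased with the submodules \<open>(ys) M\<close> of the fixed module
  \<open>M\<close>, so that the noetherian condition on \<open>M\<close> can compare different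
  sequences.\<close>

definition seq_sub where
  "seq_sub M ys = mod_span R M {r \<odot>\<^bsub>M\<^esub> x |r x. r \<in> set ys \<and> x \<in> carrier M}"

lemma seq_sub_submodule:
  assumes M: "module R M" and ys: "set ys \<subseteq> carrier R"
  shows "submodule (seq_sub M ys) R M"
proof -
  interpret M: module R M by (rule M)
  show ?thesis unfolding seq_sub_def by (rule mod_span_submodule[OF M]) (use ys in auto)
qed

lemma seq_sub_Nil: "module R M \<Longrightarrow> seq_sub M [] = {\<zero>\<^bsub>M\<^esub>}"
  by (simp add: seq_sub_def mod_span_empty)

lemma seq_sub_append:
  assumes M: "module R M" and ys: "set ys \<subseteq> carrier R" and y: "y \<in> carrier R"
  shows "seq_sub M (ys @ [y]) = sub_sum M (seq_sub M ys) (scaled M y)"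
proof
  have ysy: "set (ys @ [y]) \<subseteq> carrier R" using ys y by simp
  note S = seq_sub_submodule[OF M ys] and T = seq_sub_submodule[OF M ysy]
  note s = sub_sum_submodule[OF M S scaled_submodule[OF M y]] and t = submoduleD[OF M T]
  have sup: "{r \<odot>\<^bsub>M\<^esub> x |r x. r \<in> set zs \<and> x \<in> carrier M} \<subseteq> seq_sub M zs" for zs
    unfolding seq_sub_def by (rule mod_span_superset)
  show "seq_sub M (ys @ [y]) \<subseteq> sub_sum M (seq_sub M ys) (scaled M y)"
    unfolding seq_sub_def[of M "ys @ [y]"]
  proof (rule mod_span_subset[OF s(1)])
    show "{r \<odot>\<^bsub>M\<^esub> x |r x. r \<in> set (ys @ [y]) \<and> x \<in> carrier M} \<subseteq> sub_sum M (seq_sub M ys) (scaled M y)"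
    proof
      fix w assume "w \<in> {r \<odot>\<^bsub>M\<^esub> x |r x. r \<in> set (ys @ [y]) \<and> x \<in> carrier M}"
      then obtain r x where w: "w = r \<odot>\<^bsub>M\<^esub> x" "r \<in> set ys \<or> r = y" "x \<in> carrier M" by auto
      then have "w \<in> seq_sub M ys \<or> w \<in> scaled M y" using sup[of ys] by blast
      then show "w \<in> sub_sum M (seq_sub M ys) (scaled M y)" using s(2,3) by blast
    qed
  qed
  have "seq_sub M ys \<subseteq> seq_sub M (ys @ [y])"
    unfolding seq_sub_def[of M ys] by (rule mod_span_subset[OF T]) (use sup[of "ys @ [y]"] in auto)
  moreover have "scaled M y \<subseteq> seq_sub M (ys @ [y])" using sup[of "ys @ [y]"] by auto
  ultimately show "sub_sum M (seq_sub M ys) (scaled M y) \<subseteq> seq_sub M (ys @ [y])"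
    using t(5) unfolding sub_sum_def by blast
qed

end

lemma regular_on_quot_iff:
  assumes M: "module R M" and U: "submodule U R M" and y: "y \<in> carrier R"
  shows "regular_on (quot_module M U) y \<longleftrightarrow> (\<forall>k\<in>carrier M. y \<odot>\<^bsub>M\<^esub> k \<in> U \<longrightarrow> k \<in> U)"
proof -
  interpret M: module R M by (rule M)
  note z = quot_eq_zero[OF M U]
  have "regular_on (quot_module M U) y \<longleftrightarrow> (\<forall>k\<in>carrier M. y \<odot>\<^bsub>quot_module M U\<^esub> (U +>\<^bsub>M\<^esub> k) = \<zero>\<^bsub>quot_module M U\<^esub> \<longrightarrow>
      U +>\<^bsub>M\<^esub> k = \<zero>\<^bsub>quot_module M U\<^esub>)"
    unfolding regular_on_def quot_carrier[OF M U] by blast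
  also have "\<dots> \<longleftrightarrow> (\<forall>k\<in>carrier M. y \<odot>\<^bsub>M\<^esub> k \<in> U \<longrightarrow> k \<in> U)"
    by (rule ball_cong[OF refl]) (simp add: quot_smult[OF M U y] z M.smult_closed[OF y])
  finally show ?thesis .
qed

lemma zero_quot_iff:
  assumes M: "module R M" and U: "submodule U R M"
  shows "zero_module (quot_module M U) \<longleftrightarrow> U = carrier M"
proof -
  interpret M: module R M by (rule M)
  note z = quot_eq_zero[OF M U]
  have "zero_module (quot_module M U) \<longleftrightarrow> (\<forall>k\<in>carrier M. U +>\<^bsub>M\<^esub> k = \<zero>\<^bsub>quot_module M U\<^esub>)"
    unfolding zero_module_def quot_carrier[OF M U] quot_zero[OF M U] using M.zero_closed by blast
  also have "\<dots> \<longleftrightarrow> U = carrier M" using z submoduleD(1)[OF M U] by auto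
  finally show ?thesis .
qed

context noetherian_local_ring
begin

lemma regular_sequence_iff:
  assumes M: "module R M"
  shows "regular_sequence R M ys \<longleftrightarrow> set ys \<subseteq> carrier R \<and>
    (\<forall>i<length ys. \<forall>k\<in>carrier M. ys ! i \<odot>\<^bsub>M\<^esub> k \<in> seq_sub M (take i ys) \<longrightarrow> k \<in> seq_sub M (take i ys)) \<and>
    seq_sub M ys \<noteq> carrier M"
proof (cases "set ys \<subseteq> carrier R")
  case True
  have t: "set (take i ys) \<subseteq> carrier R" for i using True set_take_subset by fast
  have "regular_on (quot_by_seq R M (take i ys)) (ys ! i) \<longleftrightarrow>
      (\<forall>k\<in>carrier M. ys ! i \<odot>\<^bsub>M\<^esub> k \<in> seq_sub M (take i ys) \<longrightarrow> k \<in> seq_sub M (take i ys))" if "i < length ys" for i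
    unfolding quot_by_seq_def seq_sub_def[symmetric]
    by (rule regular_on_quot_iff[OF M seq_sub_submodule[OF M t]]) (use True that in auto)
  moreover have "zero_module (quot_by_seq R M ys) \<longleftrightarrow> seq_sub M ys = carrier M"
    unfolding quot_by_seq_def seq_sub_def[symmetric] by (rule zero_quot_iff[OF M seq_sub_submodule[OF M True]])
  ultimately show ?thesis unfolding regular_sequence_def by auto
qed (simp add: regular_sequence_def)

lemma regular_sequence_append:
  assumes M: "module R M" and r: "regular_sequence R M ys" and y: "y \<in> carrier R"
    and reg: "\<And>k. k \<in> carrier M \<Longrightarrow> y \<odot>\<^bsub>M\<^esub> k \<in> seq_sub M ys \<Longrightarrow> k \<in> seq_sub M ys"
    and ne: "seq_sub M (ys @ [y]) \<noteq> carrier M"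
  shows "regular_sequence R M (ys @ [y])"
  using r y reg ne unfolding regular_sequence_iff[OF M]
  by (auto simp: less_Suc_eq nth_append)

text \<open>A regular sequence in the maximal ideal cannot be extended if and only if the quotient has a nonzero socle.\<close>

definition socle_sequence where
  "socle_sequence M ys \<longleftrightarrow> regular_sequence R M ys \<and> set ys \<subseteq> max_ideal R \<and>
     (\<exists>z\<in>carrier M. z \<notin> seq_sub M ys \<and> (\<forall>y\<in>max_ideal R. y \<odot>\<^bsub>M\<^esub> z \<in> seq_sub M ys))"

text \<open>Among the extensions take one whose submodule \<open>W\<close> is maximal. If
  \<open>M / W\<close> had no socle, \<open>socle_exists\<close> would supply a \<open>y\<close>
  that is regular on \<open>M / W\<close>. Nakayama keeps \<open>W + y M\<close> proper, so
  \<open>y\<close> prolongs the sequence; maximality then gives \<open>y M \<subseteq> W\<close>,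
  and regularity of \<open>y\<close> gives \<open>M = W\<close>.\<close>

lemma socle_sequence_extends:
  assumes M: "module R M" and n: "noetherian_module R M" and r: "regular_sequence R M ys" and m: "set ys \<subseteq> max_ideal R"
  shows "\<exists>zs. socle_sequence M (ys @ zs)"
proof -
  interpret M: module R M by (rule M)
  have sub: "submodule (seq_sub M (ys @ zs)) R M" if "regular_sequence R M (ys @ zs)" for zs
    using that seq_sub_submodule[OF M, of "ys @ zs"] regular_sequence_iff[OF M, of "ys @ zs"] by simp
  let ?P = "\<lambda>W. \<exists>zs. regular_sequence R M (ys @ zs) \<and> set zs \<subseteq> max_ideal R \<and> W = seq_sub M (ys @ zs)"
  have "submodule (seq_sub M ys) R M" using sub[of "[]"] r by simp
  moreover have "?P (seq_sub M ys)" using r by (intro exI[of _ "[]"]) simp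
  ultimately have "\<exists>W. submodule W R M \<and> ?P W \<and> (\<forall>V. submodule V R M \<longrightarrow> ?P V \<longrightarrow> W \<subseteq> V \<longrightarrow> V = W)"
    by (rule noetherian_module_maxE[OF M n, where P = ?P])
  then obtain W zs where W: "submodule W R M"
    and zs: "regular_sequence R M (ys @ zs)" "set zs \<subseteq> max_ideal R" "W = seq_sub M (ys @ zs)"
    and W3: "\<forall>V. submodule V R M \<longrightarrow> ?P V \<longrightarrow> W \<subseteq> V \<longrightarrow> V = W"
    by (elim exE conjE)
  have Wmax: "seq_sub M (ys @ ws) = W"
    if "regular_sequence R M (ys @ ws)" "set ws \<subseteq> max_ideal R" "W \<subseteq> seq_sub M (ys @ ws)" for ws
    by (rule W3[rule_format, OF sub[OF that(1)] _ that(3)]) (use that in auto)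
  have c: "set (ys @ zs) \<subseteq> carrier R" and Wne: "W \<noteq> carrier M" using zs(1) unfolding regular_sequence_iff[OF M] zs(3) by auto
  have "\<exists>z\<in>carrier M. z \<notin> W \<and> (\<forall>y\<in>max_ideal R. y \<odot>\<^bsub>M\<^esub> z \<in> W)"
  proof (rule socle_exists[OF M n W Wne])
    fix y assume y: "y \<in> max_ideal R"
    have yc: "y \<in> carrier R" by (rule max_ideal_carr[OF y])
    show "\<exists>k\<in>carrier M. k \<notin> W \<and> y \<odot>\<^bsub>M\<^esub> k \<in> W"
    proof (rule ccontr)
      assume a: "\<not> (\<exists>k\<in>carrier M. k \<notin> W \<and> y \<odot>\<^bsub>M\<^esub> k \<in> W)"
      let ?V = "seq_sub M ((ys @ zs) @ [y])"
      have V: "?V = sub_sum M W (scaled M y)" unfolding zs(3) by (rule seq_sub_append[OF M c yc])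
      note s = sub_sum_submodule[OF M W scaled_submodule[OF M yc]]
      have "?V \<noteq> carrier M" unfolding V using nakayama[OF M n W y] Wne by blast
      then have "regular_sequence R M ((ys @ zs) @ [y])"
        by (intro regular_sequence_append[OF M zs(1) yc]) (use a zs(3) in auto)
      then have "?V = W" using Wmax[of "zs @ [y]"] s(2) zs(2) y V by simp
      then have "scaled M y \<subseteq> W" using s(3) V by blast
      then have "carrier M \<subseteq> W" using a by blast
      then show False using Wne submoduleD(1)[OF M W] by blast
    qed
  qed
  then have "socle_sequence M (ys @ zs)"
    unfolding socle_sequence_def zs(3)[symmetric] using zs(1,2) m by auto
  then show ?thesis by blast
qed

lemma regular_sequence_Nil:
  assumes M: "module R M" and "\<not> zero_module M"
  shows "regular_sequence R M []"
  using assms by (auto simp: regular_sequence_iff[OF M] seq_sub_Nil[OF M] zero_module_def)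

lemma socle_sequence_exists:
  assumes M: "module R M" and n: "noetherian_module R M" and "\<not> zero_module M"
  shows "\<exists>ys. socle_sequence M ys"
  using socle_sequence_extends[OF M n regular_sequence_Nil[OF M assms(3)]] by simp

text \<open>Every regular sequence in the maximal ideal extends to a socle sequence, so the supremum
  is attained on socle sequences. That these have equal length is left as a premise, to be supplied
  by homology.\<close>

lemma depth_eqI:
  assumes M: "module R M" and n: "noetherian_module R M" and nz: "\<not> zero_module M"
    and d: "\<And>ys. socle_sequence M ys \<Longrightarrow> length ys = d"
  shows "depth R M = enat d"
proof -
  obtain ys where ys: "socle_sequence M ys" using socle_sequence_exists[OF M n nz] by blast
  have "enat (length xs) \<le> enat d" if xs: "regular_sequence R M xs" "set xs \<subseteq> max_ideal R" for xs
  proof -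
    obtain zs where "socle_sequence M (xs @ zs)" using socle_sequence_extends[OF M n xs] by blast
    from d[OF this] show ?thesis by simp
  qed
  moreover have "regular_sequence R M ys" "set ys \<subseteq> max_ideal R" "length ys = d"
    using ys d by (auto simp: socle_sequence_def)
  ultimately show ?thesis
    unfolding depth_def using nz by (auto intro!: antisym SUP_least SUP_upper2[of ys])
qed

end

subsection \<open>Exact sequences of quotients\<close>

lemma quot_map:
  assumes M: "module R M" and U: "submodule U R M" and h: "mhom R A M h" and W: "submodule W R A"
    and WU: "\<And>a. a \<in> W \<Longrightarrow> h a \<in> U"
  shows "\<exists>f. mhom R (quot_module A W) (quot_module M U) f \<and> (\<forall>a\<in>carrier A. f (W +>\<^bsub>A\<^esub> a) = U +>\<^bsub>M\<^esub> h a)"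
proof -
  note A = mhom_dom[OF h]
  note c = mhom_comp[OF h quot_mhom[OF M U]]
  have "\<exists>f\<in>mod_hom R (quot_module A W) (quot_module M U). \<forall>a\<in>carrier A. f (W +>\<^bsub>A\<^esub> a) = U +>\<^bsub>M\<^esub> h a"
    by (rule quot_lift[OF A W quot_is_module[OF M U] mhom_mod_hom[OF c]])
      (use quot_eq_zero[OF M U] WU mhom_closed[OF h] submoduleD(1)[OF A W] in blast)
  then show ?thesis using quot_is_module[OF A W] quot_is_module[OF M U] unfolding mhom_def by blast
qed

text \<open>Used for two maps \<open>h\<close>: the one from \<open>R\<close> sending
  \<open>r\<close> to \<open>r z\<close>, which embeds the residue field, and multiplication by
  \<open>y\<close>.\<close>

lemma quot_ses:
  assumes M: "module R M" and U: "submodule U R M" and h: "mhom R A M h"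
    and W: "W = {a \<in> carrier A. h a \<in> U}"
  shows "\<exists>f g. ses R (quot_module A W) (quot_module M U) (quot_module M (sub_sum M U (h ` carrier A))) f g \<and>
    (\<forall>a\<in>carrier A. f (W +>\<^bsub>A\<^esub> a) = U +>\<^bsub>M\<^esub> h a)"
proof -
  note A = mhom_dom[OF h]
  have Ws: "submodule W R A" unfolding W by (rule colon_submodule[OF h U])
  let ?V = "sub_sum M U (h ` carrier A)"
  note s = sub_sum_submodule[OF M U mhom_image_submodule[OF h]]
  have WU: "h a \<in> U" if "a \<in> W" for a using that by (simp add: W)
  have UV: "u \<in> ?V" if "u \<in> U" for u using that s(2) by blast
  obtain f where f: "mhom R (quot_module A W) (quot_module M U) f" "\<And>a. a\<in>carrier A \<Longrightarrow> f (W +>\<^bsub>A\<^esub> a) = U +>\<^bsub>M\<^esub> h a"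
    using quot_map[OF M U h Ws WU] by blast
  obtain g where g: "mhom R (quot_module M U) (quot_module M ?V) g" "\<And>k. k\<in>carrier M \<Longrightarrow> g (U +>\<^bsub>M\<^esub> k) = ?V +>\<^bsub>M\<^esub> k"
    using quot_map[OF M s(1) mhom_id[OF M] U UV] by blast
  have qA: "carrier (quot_module A W) = {W +>\<^bsub>A\<^esub> a |a. a \<in> carrier A}" by (rule quot_carrier[OF A Ws])
  have qU: "carrier (quot_module M U) = {U +>\<^bsub>M\<^esub> a |a. a \<in> carrier M}" by (rule quot_carrier[OF M U])
  have qV: "carrier (quot_module M ?V) = {?V +>\<^bsub>M\<^esub> a |a. a \<in> carrier M}" by (rule quot_carrier[OF M s(1)])
  have "ses R (quot_module A W) (quot_module M U) (quot_module M ?V) f g"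
  proof (rule sesI[OF f(1) g(1)])
    show "ker0 (quot_module A W) (quot_module M U) f"
      unfolding ker0_def
    proof (intro ballI impI)
      fix X assume "X \<in> carrier (quot_module A W)" and z: "f X = \<zero>\<^bsub>quot_module M U\<^esub>"
      then obtain a where a: "X = W +>\<^bsub>A\<^esub> a" "a \<in> carrier A" unfolding qA by blast
      have "h a \<in> U" using z quot_eq_zero[OF M U mhom_closed[OF h a(2)]] unfolding a(1) f(2)[OF a(2)] by simp
      then have "a \<in> W" using a(2) by (simp add: W)
      then show "X = \<zero>\<^bsub>quot_module A W\<^esub>" unfolding a(1) using quot_eq_zero[OF A Ws a(2)] by simp
    qed
    show "\<exists>b\<in>carrier (quot_module M U). g b = c" if "c \<in> carrier (quot_module M ?V)" for c
      using that g(2) unfolding qU qV by blast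
    show "g (f X) = \<zero>\<^bsub>quot_module M ?V\<^esub>" if X: "X \<in> carrier (quot_module A W)" for X
    proof -
      obtain a where a: "X = W +>\<^bsub>A\<^esub> a" "a \<in> carrier A" using X unfolding qA by blast
      have "h a \<in> ?V" using s(3) a(2) by blast
      then show ?thesis
        unfolding a(1) f(2)[OF a(2)] g(2)[OF mhom_closed[OF h a(2)]] using quot_eq_zero[OF M s(1) mhom_closed[OF h a(2)]] by simp
    qed
    show "\<exists>a\<in>carrier (quot_module A W). X = f a" if X: "X \<in> carrier (quot_module M U)" "g X = \<zero>\<^bsub>quot_module M ?V\<^esub>" for X
    proof -
      obtain k where k: "X = U +>\<^bsub>M\<^esub> k" "k \<in> carrier M" using X unfolding qU by blast
      have "k \<in> ?V" using X(2) quot_eq_zero[OF M s(1) k(2)] unfolding k(1) g(2)[OF k(2)] by simp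
      then obtain u a where ua: "k = u \<oplus>\<^bsub>M\<^esub> h a" "u \<in> U" "a \<in> carrier A" by (auto simp: sub_sum_def)
      have ha: "h a \<in> carrier M" and uc: "u \<in> carrier M" using mhom_closed[OF h ua(3)] submoduleD(1)[OF M U] ua(2) by auto
      have "k \<ominus>\<^bsub>M\<^esub> h a = u" unfolding ua(1) by (rule add_minus_cancel(1)[OF M uc ha])
      then have "X = f (W +>\<^bsub>A\<^esub> a)" unfolding k(1) f(2)[OF ua(3)] using quot_eq[OF M U k(2) ha] ua(2) by simp
      then show ?thesis using ua(3) unfolding qA by blast
    qed
  qed
  then show ?thesis using f(2) by blast
qed

lemma quot_zero_ses:
  assumes M: "module R M"
  shows "ses R (M\<lparr>carrier := {\<zero>\<^bsub>M\<^esub>}\<rparr>) M (quot_module M {\<zero>\<^bsub>M\<^esub>}) (\<lambda>x. x) (\<lambda>x. {\<zero>\<^bsub>M\<^esub>} +>\<^bsub>M\<^esub> x)"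
proof -
  note Z = zero_submodule[OF M]
  show ?thesis
  proof (rule sesI[OF mhom_inclusion[OF M Z] quot_mhom[OF M Z]])
    show "ker0 (M\<lparr>carrier := {\<zero>\<^bsub>M\<^esub>}\<rparr>) M (\<lambda>x. x)" by (simp add: ker0_def)
    show "\<exists>b\<in>carrier M. {\<zero>\<^bsub>M\<^esub>} +>\<^bsub>M\<^esub> b = c" if "c \<in> carrier (quot_module M {\<zero>\<^bsub>M\<^esub>})" for c
      using that unfolding quot_carrier[OF M Z] by blast
  qed (use quot_eq_zero[OF M Z] submoduleD(2)[OF M Z] submoduleD(1)[OF M Z] in auto)
qed

subsection \<open>Vanishing of \<open>H\<^sub>i(K(xs; P \<otimes> N))\<close>\<close>

text \<open>The model of \<open>K \<otimes> P \<otimes> N\<close>; the passage through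
  \<open>seq_complex\<close> provides the element type on which cones can be iterated.\<close>

definition koszul_tensor where
  "koszul_tensor R xs P N = koszul xs (seq_complex (tensor_complex R P N))"

lemma koszul_exact_above:
  assumes X: "is_complex R X" and "set xs \<subseteq> carrier R" and "\<And>i. c < i \<Longrightarrow> exact_at X i" and "c + int (length xs) < i"
  shows "exact_at (koszul xs X) i"
  using assms(2,4)
proof (induction xs arbitrary: i)
  case (Cons x xs)
  then have x: "x \<in> carrier R" and xs: "set xs \<subseteq> carrier R" by auto
  have "exact_at (koszul xs X) (i - 1 + 1)" "exact_at (koszul xs X) (i - 1)"
    using Cons.IH[OF xs] Cons.prems(2) by simp_all
  from exact_at_cone[OF koszul_is_complex[OF X xs] x this] show ?case by simp
qed (use assms(3) in simp)

lemma koszul_exact_all: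
  assumes X: "is_complex R X" and "set xs \<subseteq> carrier R" and "\<And>i. exact_at X i"
  shows "exact_at (koszul xs X) i"
  using koszul_exact_above[OF X assms(2), of "i - 1 - int (length xs)" i] assms(3) by simp

lemma seq_complex_exact_at: "is_complex R X \<Longrightarrow> exact_at (seq_complex X) i \<longleftrightarrow> exact_at X i"
  by (rule complex_iso_exact_at[OF _ seq_complex_iso])

lemma exact_at_zero_module:
  assumes "is_complex R X" "zero_module (cobj X i)"
  shows "exact_at X i"
proof -
  have "cycles X i \<subseteq> {\<zero>\<^bsub>cobj X i\<^esub>}" using assms(2) by (auto simp: cycles_def zero_module_def)
  then show ?thesis
    using submoduleD(2)[OF complex_module[OF assms(1)] boundaries_submodule[OF assms(1)]] by (auto simp: exact_at_def)
qed

lemma zero_moduleI: "module R M \<Longrightarrow> (\<And>x. x \<in> carrier M \<Longrightarrow> x = \<zero>\<^bsub>M\<^esub>) \<Longrightarrow> zero_module M"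
proof -
  assume "module R M"
  then interpret M: module R M .
  show "(\<And>x. x \<in> carrier M \<Longrightarrow> x = \<zero>\<^bsub>M\<^esub>) \<Longrightarrow> zero_module M"
    unfolding zero_module_def using M.zero_closed by blast
qed

lemma zero_module_tensor_left:
  "module R A \<Longrightarrow> module R N \<Longrightarrow> zero_module A \<Longrightarrow> zero_module (tensor R A N)"
  by (rule zero_moduleI[OF tensor_is_module zero_tensor])

lemma zero_module_tensor_right:
  assumes A: "module R A" and N: "module R N" and z: "zero_module N"
  shows "zero_module (tensor R A N)"
proof (rule zero_moduleI[OF tensor_is_module[OF A N]])
  fix u assume u: "u \<in> tens R A N"
  have "tswap R A N u = \<zero>\<^bsub>tensor R N A\<^esub>"
    by (rule zero_tensor[OF N A z mhom_closed[OF tswap_mhom[OF A N] u]])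
  then show "u = \<zero>\<^bsub>tensor R A N\<^esub>"
    using tswap_tswap[OF A N u] mhom_zero[OF tswap_mhom[OF N A]] by simp
qed

lemma tensor_complex_ses:
  assumes P: "is_complex R P" and pr: "\<And>i. projective R (cobj P i)" and s: "ses R A B C f g"
  shows "complex_ses R (tensor_complex R P A) (tensor_complex R P B) (tensor_complex R P C)
    (\<lambda>i. tmap R (cobj P i) A (cobj P i) B (\<lambda>x. x) f) (\<lambda>i. tmap R (cobj P i) B (cobj P i) C (\<lambda>x. x) g)"
proof -
  note d = sesD[OF s]
  note A = mhom_dom[OF d(1)] and B = mhom_cod[OF d(1)] and C = mhom_cod[OF d(2)]
  have comm: "tmap R (cobj P (i - 1)) K (cobj P (i - 1)) L (\<lambda>x. x) h (cdiff (tensor_complex R P K) i u) =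
      cdiff (tensor_complex R P L) i (tmap R (cobj P i) K (cobj P i) L (\<lambda>x. x) h u)"
    if h: "mhom R K L h" and u: "u \<in> tens R (cobj P i) K" for K L h i u
  proof -
    note i = mhom_id[OF complex_module[OF P]] and K = mhom_dom[OF h] and L = mhom_cod[OF h]
    have v: "tmap R (cobj P i) K (cobj P i) L (\<lambda>x. x) h u \<in> tens R (cobj P i) L" by (rule mhom_closed[OF tmap_mhom[OF i h] u])
    show ?thesis
      unfolding tensor_complex_cdiff[OF P K u] tensor_complex_cdiff[OF P L v]
        tmap_comp[OF complex_mhom[OF P] mhom_id[OF K] i h u] tmap_comp[OF i h complex_mhom[OF P] mhom_id[OF L] u] ..
  qed
  show ?thesis
    unfolding complex_ses_def
    by (intro conjI allI ballI tensor_complex_is_complex[OF P] A B C)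
      (simp_all add: tensor_complex_simps(1) tensor_ses_left[OF pr s] comm[OF d(1)] comm[OF d(2)])
qed

context noetherian_local_ring
begin

abbreviation residue_field where "residue_field \<equiv> quot_module (self_module R) (max_ideal R)"

text \<open>The annihilator of \<open>z\<close> modulo \<open>U\<close> contains the maximal ideal
  and is proper because \<open>z\<close> is not in \<open>U\<close>. So it is the maximal ideal, and
  \<open>z\<close> generates a copy of the residue field.\<close>

lemma socle_ses:
  assumes N: "module R N" and U: "submodule U R N" and z: "z \<in> carrier N" "z \<notin> U"
    and m: "\<And>y. y \<in> max_ideal R \<Longrightarrow> y \<odot>\<^bsub>N\<^esub> z \<in> U"
  shows "\<exists>f g. ses R residue_field (quot_module N U) (quot_module N (sub_sum N U (cyclic R N z))) f g"
proof -
  interpret N: module R N by (rule N)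
  let ?W = "{r \<in> carrier (self_module R). r \<odot>\<^bsub>N\<^esub> z \<in> U}"
  have "ideal ?W R"
    using colon_submodule[OF cyclic_mhom[OF N z(1)] U] by (simp add: submodule_self_iff_ideal[OF is_cring])
  then have "?W \<subseteq> max_ideal R" by (rule proper_ideal_in_max_ideal) (use z in simp)
  moreover have "max_ideal R \<subseteq> ?W" using m max_ideal_carr by (auto simp: self_module_simps)
  ultimately have "max_ideal R = ?W" by blast
  from quot_ses[OF N U cyclic_mhom[OF N z(1)] this] show ?thesis by (auto simp: self_module_simps)
qed

text \<open>\<open>W = U\<close> means that \<open>y\<close> is regular on \<open>N / U\<close>. In
  that case the sequence starts with multiplication by \<open>y\<close> on \<open>N / U\<close>
  itself, which the final clause records.\<close>

lemma scale_ses: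
  assumes N: "module R N" and U: "submodule U R N" and y: "y \<in> carrier R"
    and W: "W = {k \<in> carrier N. y \<odot>\<^bsub>N\<^esub> k \<in> U}"
  shows "\<exists>f g. ses R (quot_module N W) (quot_module N U) (quot_module N (sub_sum N U (scaled N y))) f g \<and>
    (W = U \<longrightarrow> (\<forall>x\<in>carrier (quot_module N U). f x = y \<odot>\<^bsub>quot_module N U\<^esub> x))"
proof -
  obtain f g where s: "ses R (quot_module N W) (quot_module N U) (quot_module N (sub_sum N U (scaled N y))) f g"
    and f: "\<And>a. a\<in>carrier N \<Longrightarrow> f (W +>\<^bsub>N\<^esub> a) = U +>\<^bsub>N\<^esub> (y \<odot>\<^bsub>N\<^esub> a)"
    using quot_ses[OF N U scale_mhom[OF N y] W] by blast
  have "f x = y \<odot>\<^bsub>quot_module N U\<^esub> x" if "W = U" and x: "x \<in> carrier (quot_module N U)" for x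
  proof -
    obtain a where a: "x = U +>\<^bsub>N\<^esub> a" "a \<in> carrier N" using x unfolding quot_carrier[OF N U] by blast
    show ?thesis using f[OF a(2)] \<open>W = U\<close> unfolding a(1) quot_smult[OF N U y a(2)] by simp
  qed
  then show ?thesis using s by blast
qed

section \<open>Homology of \<open>K \<otimes> P \<otimes> N\<close> as \<open>N\<close>
  varies\<close>

context
  fixes P :: "('a, 'p) mod_complex" and xs :: "'a list"
  assumes P: "is_complex R P" and pr: "\<And>i. projective R (cobj P i)"
    and xs: "set xs \<subseteq> carrier R" and gen: "genideal R (set xs) = max_ideal R"
begin

abbreviation KT where "KT N \<equiv> koszul_tensor R xs P N"

lemma KT_ses:
  assumes s: "ses R A B C f g"
  shows "\<exists>F G. complex_ses R (KT A) (KT B) (KT C) F G"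
  using koszul_ses[OF seq_complex_ses[OF tensor_complex_ses[OF P pr s]] xs] unfolding koszul_tensor_def by blast

lemma KT_ses_scale:
  assumes s: "ses R A A C f g" and y: "y \<in> carrier R" and f: "\<And>x. x \<in> carrier A \<Longrightarrow> f x = y \<odot>\<^bsub>A\<^esub> x"
  shows "\<exists>F G. complex_ses R (KT A) (KT A) (KT C) F G \<and>
    (\<forall>i. \<forall>z\<in>carrier (cobj (KT A) i). F i z = y \<odot>\<^bsub>cobj (KT A) i\<^esub> z)"
proof -
  let ?f = "\<lambda>i h. seq_of (tmap R (cobj P i) A (cobj P i) A (\<lambda>x. x) f (h []))"
  note A = mhom_dom[OF sesD(1)[OF s]]
  have "?f i z = y \<odot>\<^bsub>cobj (seq_complex (tensor_complex R P A)) i\<^esub> z"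
    if z: "z \<in> carrier (cobj (seq_complex (tensor_complex R P A)) i)" for i z
  proof -
    obtain u where u: "u \<in> tens R (cobj P i) A" "z = seq_of u"
      using z by (auto simp: seq_complex_simps seq_mod_simps tensor_complex_simps)
    show ?thesis
      using tmap_smult[OF complex_module[OF P] A y u(1) f]
      by (simp add: u(2) seq_complex_simps(1) seq_mod_simps(4) tensor_complex_simps(1))
  qed
  from koszul_map_smult[of "seq_complex (tensor_complex R P A)" ?f y, OF this] koszul_ses[OF seq_complex_ses[OF tensor_complex_ses[OF P pr s]] xs]
  show ?thesis unfolding koszul_tensor_def by blast
qed

lemma KT_middle: "ses R A B C f g \<Longrightarrow> exact_at (KT A) i \<Longrightarrow> exact_at (KT C) i \<Longrightarrow> exact_at (KT B) i"
  using KT_ses[of A B C f g] les_middle by blast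

lemma KT_right: "ses R A B C f g \<Longrightarrow> exact_at (KT B) (i + 1) \<Longrightarrow> exact_at (KT A) i \<Longrightarrow> exact_at (KT C) (i + 1)"
  using KT_ses[of A B C f g] les_right by blast

lemma KT_left:
  assumes s: "ses R A B C f g" and B: "exact_at (KT B) i" and C: "exact_at (KT C) (i + 1)"
  shows "exact_at (KT A) i"
proof -
  obtain F G where FG: "complex_ses R (KT A) (KT B) (KT C) F G" using KT_ses[OF s] by blast
  note c = complex_sesD[OF FG]
  show ?thesis
    unfolding exact_at_def
  proof
    fix z assume z: "z \<in> cycles (KT A) i"
    then have zc: "z \<in> carrier (cobj (KT A) i)" "cdiff (KT A) i z = \<zero>\<^bsub>cobj (KT A) (i - 1)\<^esub>" by (simp_all add: cycles_def)
    have "F i z \<in> boundaries (KT B) i"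
      using mhom_closed[OF sesD(1)[OF c(4)] zc(1)] c(5)[OF zc(1)] zc(2) mhom_zero[OF sesD(1)[OF c(4)]]
      by (intro exact_atD[OF B]) simp_all
    then show "z \<in> boundaries (KT A) i" by (rule les_injective[OF FG C z])
  qed
qed

lemma KT_kills: "module R N \<Longrightarrow> y \<in> max_ideal R \<Longrightarrow> kills y (KT N)"
  unfolding koszul_tensor_def
  by (rule koszul_kills[OF seq_complex_is_complex[OF tensor_complex_is_complex[OF P]] is_cring xs]) (simp_all add: gen)

text \<open>On \<open>H_i\<close> the map induced by \<open>f\<close> is multiplication by
  \<open>y\<close>, hence zero, because the maximal ideal kills the Koszul homology. Exactness at
  \<open>i + 1\<close> for \<open>C\<close> makes it injective. So \<open>H_i\<close>
  vanishes.\<close>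

lemma KT_left_scale:
  assumes s: "ses R A A C f g" and y: "y \<in> max_ideal R" and f: "\<And>x. x \<in> carrier A \<Longrightarrow> f x = y \<odot>\<^bsub>A\<^esub> x"
    and C: "exact_at (KT C) (i + 1)"
  shows "exact_at (KT A) i"
proof -
  obtain F G where FG: "complex_ses R (KT A) (KT A) (KT C) F G"
    "\<And>i z. z\<in>carrier (cobj (KT A) i) \<Longrightarrow> F i z = y \<odot>\<^bsub>cobj (KT A) i\<^esub> z"
    using KT_ses_scale[OF s max_ideal_carr[OF y] f] by blast
  show ?thesis
    unfolding exact_at_def
  proof
    fix z assume z: "z \<in> cycles (KT A) i"
    then have "F i z = y \<odot>\<^bsub>cobj (KT A) i\<^esub> z" by (intro FG(2)) (simp add: cycles_def)
    then have "F i z \<in> boundaries (KT A) i"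
      using KT_kills[OF mhom_dom[OF sesD(1)[OF s]] y] z by (simp add: kills_def)
    then show "z \<in> boundaries (KT A) i" by (rule les_injective[OF FG(1) C z])
  qed
qed

lemma KT_exact_of_tensor_exact:
  "module R N \<Longrightarrow> (\<And>i. exact_at (tensor_complex R P N) i) \<Longrightarrow> exact_at (KT N) i"
  unfolding koszul_tensor_def
  using koszul_exact_all[OF seq_complex_is_complex xs] seq_complex_exact_at tensor_complex_is_complex[OF P] by blast

lemma KT_zero: "module R N \<Longrightarrow> zero_module N \<Longrightarrow> exact_at (KT N) i"
  by (rule KT_exact_of_tensor_exact)
    (auto intro!: exact_at_zero_module tensor_complex_is_complex P zero_module_tensor_right complex_module[OF P] simp: tensor_complex_simps(1))

lemma KT_bounded:
  assumes N: "module R N" and hi: "\<And>i. hi < i \<Longrightarrow> zero_module (cobj P i)" and i: "hi + int (length xs) < i"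
  shows "exact_at (KT N) i"
  unfolding koszul_tensor_def
proof (rule koszul_exact_above[OF _ xs _ i])
  show "is_complex R (seq_complex (tensor_complex R P N))" by (intro seq_complex_is_complex tensor_complex_is_complex P N)
  fix j assume "hi < j"
  then show "exact_at (seq_complex (tensor_complex R P N)) j"
    using seq_complex_exact_at[OF tensor_complex_is_complex[OF P N]]
      exact_at_zero_module[OF tensor_complex_is_complex[OF P N]] zero_module_tensor_left[OF complex_module[OF P] N hi]
    by (simp add: tensor_complex_simps(1))
qed

text \<open>Noetherian induction on \<open>U\<close>: vanishing for the residue field propagates to all \<open>N / U\<close>.\<close>

lemma KT_vanishing:
  assumes k: "\<And>i. c < i \<Longrightarrow> exact_at (KT residue_field) i" and N: "module R N" and n: "noetherian_module R N"
    and U: "submodule U R N" and i: "c < i"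
  shows "exact_at (KT (quot_module N U)) i"
proof -
  have "\<forall>i>c. exact_at (KT (quot_module N U)) i"
  proof (rule noetherian_module_induct[OF N n U])
    fix U assume U: "submodule U R N"
      and IH: "\<And>V. submodule V R N \<Longrightarrow> U \<subset> V \<Longrightarrow> \<forall>i>c. exact_at (KT (quot_module N V)) i"
    note u = submoduleD[OF N U]
    interpret N: module R N by (rule N)
    show "\<forall>i>c. exact_at (KT (quot_module N U)) i"
    proof (cases "U = carrier N")
      case True
      then show ?thesis using KT_zero[OF quot_is_module[OF N U]] zero_quot_iff[OF N U] by simp
    next
      case ne: False
      show ?thesis
      proof (cases "\<forall>y\<in>max_ideal R. \<forall>k\<in>carrier N. y \<odot>\<^bsub>N\<^esub> k \<in> U")
        case True
        \<comment> \<open>The maximal ideal annihilates \<open>N / U\<close>, so any nonzero element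
          spans a copy of the residue field, and its cokernel is covered by induction.\<close>
        obtain z where z: "z \<in> carrier N" "z \<notin> U" using ne u(1) by blast
        obtain f g where s: "ses R residue_field (quot_module N U) (quot_module N (sub_sum N U (cyclic R N z))) f g"
          using socle_ses[OF N U z] True z(1) by blast
        note ss = sub_sum_submodule[OF N U cyclic_submodule[OF N z(1)]]
        have "z = \<one> \<odot>\<^bsub>N\<^esub> z" using z(1) by simp
        then have "z \<in> cyclic R N z" by blast
        then have "U \<subset> sub_sum N U (cyclic R N z)" using ss(2,3) z(2) by blast
        then show ?thesis using KT_middle[OF s] k IH[OF ss(1)] by blast
      next
        case False
        \<comment> \<open>Now some \<open>y\<close> acts nontrivially on \<open>N / U\<close>, so
          \<open>?V\<close> is strictly larger than \<open>U\<close>. Either \<open>y\<close> is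
          regular on \<open>N / U\<close> and the vanishing comes from \<open>N / ?V\<close> alone,
          or \<open>?W\<close> is strictly larger than \<open>U\<close> too and both ends of the
          sequence are covered by induction.\<close>
        then obtain y k where y: "y \<in> max_ideal R" "k \<in> carrier N" "y \<odot>\<^bsub>N\<^esub> k \<notin> U" by blast
        note yc = max_ideal_carr[OF y(1)]
        let ?W = "{k \<in> carrier N. y \<odot>\<^bsub>N\<^esub> k \<in> U}" and ?V = "sub_sum N U (scaled N y)"
        have W: "submodule ?W R N" by (rule colon_submodule[OF scale_mhom[OF N yc] U])
        note ss = sub_sum_submodule[OF N U scaled_submodule[OF N yc]]
        have "U \<subset> ?V" using ss(2,3) y(2,3) by blast
        note EV = IH[OF ss(1) this]
        obtain f g where s: "ses R (quot_module N ?W) (quot_module N U) (quot_module N ?V) f g"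
          and f: "?W = U \<longrightarrow> (\<forall>x\<in>carrier (quot_module N U). f x = y \<odot>\<^bsub>quot_module N U\<^esub> x)"
          using scale_ses[OF N U yc refl] by blast
        show ?thesis
        proof (cases "?W = U")
          case True
          show ?thesis
          proof (intro allI impI)
            fix i assume "c < i"
            then show "exact_at (KT (quot_module N U)) i"
              using KT_left_scale[OF s[unfolded True] y(1)] f True EV by simp
          qed
        next
          case False
          have "U \<subseteq> ?W" using u(1) u(4)[OF yc] by blast
          then have "U \<subset> ?W" using False by blast
          then show ?thesis using KT_middle[OF s] EV IH[OF W] by blast
        qed
      qed
    qed
  qed
  then show ?thesis using i by blast
qed

text \<open>\<open>N\<close> and its quotient by zero have different element types. A short exact
  sequence with zero kernel transfers the vanishing between them.\<close>

lemma KT_quot_zero: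
  assumes N: "module R N"
  shows "exact_at (KT (quot_module N {\<zero>\<^bsub>N\<^esub>})) i \<longleftrightarrow> exact_at (KT N) i"
proof -
  have z: "exact_at (KT (N\<lparr>carrier := {\<zero>\<^bsub>N\<^esub>}\<rparr>)) i" for i
    by (rule KT_zero[OF msub_module[OF N zero_submodule[OF N]]]) (simp add: zero_module_def)
  show ?thesis
    using KT_middle[OF quot_zero_ses[OF N] z] KT_right[OF quot_zero_ses[OF N] _ z, of "i - 1"] by auto
qed

text \<open>Starting from the quotient by the whole sequence, where the top degree is that of the
  residue field, the entries are put back one at a time; every step lowers the top degree by
  one.\<close>

lemma KT_top:
  assumes k: "top_homology (KT residue_field) c" and N: "module R N" and n: "noetherian_module R N"
    and ys: "socle_sequence N ys"
  shows "top_homology (KT N) (c - int (length ys))"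
proof -
  have reg: "regular_sequence R N ys" and ym: "set ys \<subseteq> max_ideal R"
    using ys by (auto simp: socle_sequence_def)
  have yc: "set ys \<subseteq> carrier R" using ym max_ideal_subset by blast
  have tc: "set (take j ys) \<subseteq> carrier R" for j using yc set_take_subset by fast
  note S = seq_sub_submodule[OF N tc]
  let ?Q = "\<lambda>j. quot_module N (seq_sub N (take j ys))"
  have van: "exact_at (KT (quot_module N V)) i" if "submodule V R N" "c < i" for V i
    by (rule KT_vanishing[OF _ N n that]) (use k in \<open>simp add: top_homology_def\<close>)
  \<comment> \<open>\<open>e\<close> counts the entries of \<open>ys\<close> already removed from
    the end of the sequence.\<close>
  have "top_homology (KT (?Q (length ys - e))) (c - int e)" if "e \<le> length ys" for e
    using that
  proof (induction e)
    case 0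
    obtain z where z: "z \<in> carrier N" "z \<notin> seq_sub N ys" "\<And>y. y \<in> max_ideal R \<Longrightarrow> y \<odot>\<^bsub>N\<^esub> z \<in> seq_sub N ys"
      using ys by (auto simp: socle_sequence_def)
    note SS = seq_sub_submodule[OF N yc]
    obtain f g where s: "ses R residue_field (quot_module N (seq_sub N ys)) (quot_module N (sub_sum N (seq_sub N ys) (cyclic R N z))) f g"
      using socle_ses[OF N SS z] by blast
    \<comment> \<open>The residue field embeds into \<open>N / (ys) N\<close>. The cokernel has no
      homology in degree \<open>c + 1\<close>, so the nonzero homology of the residue field in
      degree \<open>c\<close> survives.\<close>
    have "\<not> exact_at (KT (quot_module N (seq_sub N ys))) c"
      using KT_left[OF s _ van[OF sub_sum_submodule(1)[OF N SS cyclic_submodule[OF N z(1)]]], of c] k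
      by (auto simp: top_homology_def)
    then show ?case using van[OF SS] by (simp add: top_homology_def)
  next
    case (Suc e)
    define j where "j = length ys - Suc e"
    have j: "j < length ys" "length ys - e = Suc j" using Suc.prems by (auto simp: j_def)
    let ?y = "ys ! j" and ?U = "seq_sub N (take j ys)"
    have y: "?y \<in> max_ideal R" using j(1) ym nth_mem by blast
    note yR = max_ideal_carr[OF y]
    have "{k \<in> carrier N. ?y \<odot>\<^bsub>N\<^esub> k \<in> ?U} = ?U"
      using reg j(1) submoduleD(1,4)[OF N S[of j]] yR unfolding regular_sequence_iff[OF N] by blast
    then have W: "?U = {k \<in> carrier N. ?y \<odot>\<^bsub>N\<^esub> k \<in> ?U}" by simp
    have V: "sub_sum N ?U (scaled N ?y) = seq_sub N (take (Suc j) ys)"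
      unfolding take_Suc_conv_app_nth[OF j(1)] by (rule seq_sub_append[OF N tc yR, symmetric])
    obtain f g where s: "ses R (?Q j) (?Q j) (?Q (Suc j)) f g"
      and f: "\<And>x. x\<in>carrier (?Q j) \<Longrightarrow> f x = ?y \<odot>\<^bsub>?Q j\<^esub> x"
      using scale_ses[OF N S[of j] yR W] unfolding V by blast
    have T: "top_homology (KT (?Q (Suc j))) (c - int e)" using Suc j(2) by simp
    have e1: "exact_at (KT (?Q j)) i" if "c - int (Suc e) < i" for i
      by (rule KT_left_scale[OF s y f]) (use T that in \<open>simp_all add: top_homology_def\<close>)
    \<comment> \<open>Otherwise the homology of \<open>?Q (Suc j)\<close> in degree
      \<open>c - e\<close> would lie between two vanishing groups of \<open>?Q j\<close>, in degrees
      \<open>c - e\<close> and \<open>c - e - 1\<close>.\<close>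
    have "\<not> exact_at (KT (?Q j)) (c - int (Suc e))"
    proof
      assume a: "exact_at (KT (?Q j)) (c - int (Suc e))"
      have "exact_at (KT (?Q (Suc j))) (c - int (Suc e) + 1)" by (rule KT_right[OF s e1 a]) simp
      then show False using T by (simp add: top_homology_def)
    qed
    then show ?case using e1 unfolding j_def[symmetric] by (simp add: top_homology_def)
  qed
  from this[of "length ys"] show ?thesis
    unfolding top_homology_def by (simp add: seq_sub_Nil[OF N] KT_quot_zero[OF N])
qed

end

subsection \<open>Complexes whose homology is a power of one module\<close>

lemma power_map_mhom:
  assumes f: "mhom R A B f"
  shows "mhom R (mod_power A a) (mod_power B a) (\<lambda>v. \<lambda>t\<in>{..<a}. f (v t))"
  using power_mhomI[OF mod_power_is_module[OF mhom_dom[OF f]] mhom_cod[OF f] mhom_comp[OF power_proj_mhom[OF mhom_dom[OF f]] f]] .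

lemma power_map_surj:
  assumes "mhom R A B f" "f ` carrier A = carrier B"
  shows "(\<lambda>v. \<lambda>t\<in>{..<a}. f (v t)) ` carrier (mod_power A a) = carrier (mod_power B a)"
proof
  show "(\<lambda>v. \<lambda>t\<in>{..<a}. f (v t)) ` carrier (mod_power A a) \<subseteq> carrier (mod_power B a)"
    using mhom_closed[OF power_map_mhom[OF assms(1)]] by blast
  show "carrier (mod_power B a) \<subseteq> (\<lambda>v. \<lambda>t\<in>{..<a}. f (v t)) ` carrier (mod_power A a)"
  proof
    fix w assume w: "w \<in> carrier (mod_power B a)"
    have "\<exists>x\<in>carrier A. f x = w t" if t: "t < a" for t
    proof -
      have "w t \<in> f ` carrier A" using w t assms(2) by (auto simp: mod_power_simps)
      then show ?thesis by auto
    qed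
    then obtain v where v: "\<And>t. t < a \<Longrightarrow> v t \<in> carrier A \<and> f (v t) = w t" by metis
    let ?v = "\<lambda>t\<in>{..<a}. v t"
    have vc: "?v \<in> carrier (mod_power A a)" using v by (auto simp: mod_power_simps)
    have "w = (\<lambda>t\<in>{..<a}. f (?v t))"
      by (rule mod_power_eqI[OF w mhom_closed[OF power_map_mhom[OF assms(1)] vc]]) (use v in simp)
    then show "w \<in> (\<lambda>v. \<lambda>t\<in>{..<a}. f (v t)) ` carrier (mod_power A a)" using vc by (rule image_eqI)
  qed
qed

lemma power_map_zero_iff:
  assumes "mhom R A B f" "v \<in> carrier (mod_power A a)"
  shows "(\<lambda>t\<in>{..<a}. f (v t)) = \<zero>\<^bsub>mod_power B a\<^esub> \<longleftrightarrow> (\<forall>t<a. f (v t) = \<zero>\<^bsub>B\<^esub>)"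
proof
  assume e: "(\<lambda>t\<in>{..<a}. f (v t)) = \<zero>\<^bsub>mod_power B a\<^esub>"
  show "\<forall>t<a. f (v t) = \<zero>\<^bsub>B\<^esub>"
  proof (intro allI impI)
    fix t assume "t < a"
    then show "f (v t) = \<zero>\<^bsub>B\<^esub>" using fun_cong[OF e, of t] by (simp add: mod_power_simps)
  qed
qed (auto simp: mod_power_simps intro!: restrict_ext)

text \<open>The sequence says that \<open>y\<close> is regular on \<open>Q\<close> with quotient
  \<open>Q'\<close>. Applied in every coordinate, it supplies the premises of
  \<open>homology_iso_cone\<close>, and the multiplicities \<open>a i\<close> do not change.\<close>

lemma homology_iso_cone_power:
  assumes X: "is_complex R X" and y: "y \<in> carrier R" and s: "ses R Q Q Q' f g"
    and f: "\<And>q. q \<in> carrier Q \<Longrightarrow> f q = y \<odot>\<^bsub>Q\<^esub> q" and H: "\<And>i. homology_iso R X i (mod_power Q (a i))"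
  shows "homology_iso R (cone y X) i (mod_power Q' (a i))"
proof (rule homology_iso_cone[OF X y H])
  note d = sesD[OF s]
  note Q = mhom_dom[OF d(1)]
  interpret Q: module R Q by (rule Q)
  have c: "v t \<in> carrier Q" if "v \<in> carrier (mod_power Q (a i))" "t < a i" for v t i
    using that by (auto simp: mod_power_simps)
  show "regular_on (mod_power Q (a i)) y" for i
    unfolding regular_on_def
  proof (intro ballI impI)
    fix v assume v: "v \<in> carrier (mod_power Q (a i))" and z: "y \<odot>\<^bsub>mod_power Q (a i)\<^esub> v = \<zero>\<^bsub>mod_power Q (a i)\<^esub>"
    interpret PQ: module R "mod_power Q (a i)" by (rule mod_power_is_module[OF Q])
    show "v = \<zero>\<^bsub>mod_power Q (a i)\<^esub>"
    proof (rule mod_power_eqI[OF v PQ.zero_closed])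
      fix t assume t: "t < a i"
      have "y \<odot>\<^bsub>Q\<^esub> v t = \<zero>\<^bsub>Q\<^esub>" using fun_cong[OF z, of t] t by (simp add: mod_power_simps)
      then have "v t = \<zero>\<^bsub>Q\<^esub>" using ker0D[OF d(3) c[OF v t]] f[OF c[OF v t]] by simp
      then show "v t = \<zero>\<^bsub>mod_power Q (a i)\<^esub> t" using t by (simp add: mod_power_simps)
    qed
  qed
  let ?\<rho> = "\<lambda>i v. \<lambda>t\<in>{..<a i}. g (v t)"
  show "mhom R (mod_power Q (a i)) (mod_power Q' (a i)) (?\<rho> i)" for i by (rule power_map_mhom[OF d(2)])
  show "?\<rho> i ` carrier (mod_power Q (a i)) = carrier (mod_power Q' (a i))" for i by (rule power_map_surj[OF d(2,4)])
  fix i v assume v: "v \<in> carrier (mod_power Q (a i))"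
  show "?\<rho> i v = \<zero>\<^bsub>mod_power Q' (a i)\<^esub> \<longleftrightarrow> (\<exists>l\<in>carrier (mod_power Q (a i)). v = y \<odot>\<^bsub>mod_power Q (a i)\<^esub> l)"
    unfolding power_map_zero_iff[OF d(2) v]
  proof
    assume "\<forall>t<a i. g (v t) = \<zero>\<^bsub>Q'\<^esub>"
    then have "\<exists>l\<in>carrier Q. v t = y \<odot>\<^bsub>Q\<^esub> l" if "t < a i" for t using d(5)[OF c[OF v that]] f that by auto
    then obtain l where l: "\<And>t. t < a i \<Longrightarrow> l t \<in> carrier Q \<and> v t = y \<odot>\<^bsub>Q\<^esub> l t" by metis
    let ?l = "\<lambda>t\<in>{..<a i}. l t"
    have lc: "?l \<in> carrier (mod_power Q (a i))" using l by (auto simp: mod_power_simps)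
    interpret PQ: module R "mod_power Q (a i)" by (rule mod_power_is_module[OF Q])
    have "v = y \<odot>\<^bsub>mod_power Q (a i)\<^esub> ?l"
      by (rule mod_power_eqI[OF v PQ.smult_closed[OF y lc]]) (use l in \<open>simp add: mod_power_simps(4)\<close>)
    then show "\<exists>l\<in>carrier (mod_power Q (a i)). v = y \<odot>\<^bsub>mod_power Q (a i)\<^esub> l" using lc by blast
  next
    assume "\<exists>l\<in>carrier (mod_power Q (a i)). v = y \<odot>\<^bsub>mod_power Q (a i)\<^esub> l"
    then obtain l where l: "l \<in> carrier (mod_power Q (a i))" "v = y \<odot>\<^bsub>mod_power Q (a i)\<^esub> l" by blast
    show "\<forall>t<a i. g (v t) = \<zero>\<^bsub>Q'\<^esub>"
      using d(6)[OF c[OF l(1)]] f[OF c[OF l(1)]] by (simp add: l(2) mod_power_simps(4))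
  qed
qed

text \<open>The generators \<open>ws\<close> make the maximal ideal act as zero on homology, and
  null homotopies keep this true under further cones. So each cone on an entry of \<open>ys\<close>
  raises the top degree by exactly one and can be undone.\<close>

lemma top_homology_koszul:
  assumes X: "is_complex R X" and ws: "set ws \<subseteq> carrier R" and gen: "genideal R (set ws) = max_ideal R"
    and "set ys \<subseteq> max_ideal R" and "top_homology (koszul ys (koszul ws X)) (c + int (length ys))"
  shows "top_homology (koszul ws X) c"
  using assms(4,5)
proof (induction ys arbitrary: c)
  case (Cons y ys)
  have ym: "y \<in> max_ideal R" and ys: "set ys \<subseteq> carrier R" using Cons.prems(1) max_ideal_subset by auto
  \<comment> \<open>The list \<open>ys @ ws\<close> describes the iterated cone, and the ideal it
    generates still contains the maximal ideal.\<close>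
  have "genideal R (set ws) \<subseteq> genideal R (set (ys @ ws))"
    by (rule genideal_minimal[OF genideal_ideal]) (use ys ws genideal_self[of "set (ys @ ws)"] in auto)
  then have k: "kills y (koszul ys (koszul ws X))"
    using koszul_kills[OF X is_cring, of "ys @ ws" y] ys ws ym gen by auto
  have "top_homology (koszul ys (koszul ws X)) (c + int (length ys))"
    by (rule top_homology_cone[OF koszul_is_complex[OF koszul_is_complex[OF X ws] ys] max_ideal_carr[OF ym] k])
      (use Cons.prems(2) in \<open>simp add: algebra_simps\<close>)
  then show ?case using Cons by simp
qed simp

text \<open>The cones on \<open>ys\<close> and on \<open>ws\<close> are counted in two orders. With
  \<open>ys\<close> innermost, regularity keeps the top degree at \<open>s\<close>, and each
  generator adds one thanks to a socle class, giving \<open>s + length ws\<close>. With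
  \<open>ys\<close> outermost, each of its entries adds one, so before them the top degree is
  smaller by \<open>length ys\<close>.\<close>

lemma top_homology_of_power_homology:
  assumes X: "is_complex R X" and L: "module R L" and H: "\<And>i. homology_iso R X i (mod_power L (a i))"
    and as: "0 < a s" "\<And>i. s < i \<Longrightarrow> a i = 0" and ws: "set ws \<subseteq> carrier R" and gen: "genideal R (set ws) = max_ideal R"
    and ys: "socle_sequence L ys"
  shows "top_homology (koszul ws (seq_complex X)) (s + int (length ws) - int (length ys))"
proof -
  let ?X = "seq_complex X"
  have X': "is_complex R ?X" by (rule seq_complex_is_complex[OF X])
  interpret L: module R L by (rule L)
  have reg: "regular_sequence R L ys" and ym: "set ys \<subseteq> max_ideal R"
    using ys by (auto simp: socle_sequence_def)
  have yc: "set ys \<subseteq> carrier R" using ym max_ideal_subset by blast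
  have tc: "set (take j ys) \<subseteq> carrier R" for j using yc set_take_subset by fast
  note S = seq_sub_submodule[OF L tc]
  let ?Q = "\<lambda>j. quot_module L (seq_sub L (take j ys))"
  \<comment> \<open>The list is reversed because \<open>koszul\<close> forms the cone on the last
    entry first, whereas \<open>ys ! 0\<close> is the entry that has to act first.\<close>
  have Hj: "\<forall>i. homology_iso R (koszul (rev (take j ys)) ?X) i (mod_power (?Q j) (a i))" if "j \<le> length ys" for j
    using that
  proof (induction j)
    case 0
    note q = quot_mhom[OF L zero_submodule[OF L]]
    have qk: "ker0 L (quot_module L {\<zero>\<^bsub>L\<^esub>}) (\<lambda>x. {\<zero>\<^bsub>L\<^esub>} +>\<^bsub>L\<^esub> x)"
      unfolding ker0_def using quot_eq_zero[OF L zero_submodule[OF L]] by simp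
    have qs: "(\<lambda>x. {\<zero>\<^bsub>L\<^esub>} +>\<^bsub>L\<^esub> x) ` carrier L = carrier (quot_module L {\<zero>\<^bsub>L\<^esub>})"
      unfolding quot_carrier[OF L zero_submodule[OF L]] by blast
    have "homology_iso R ?X i (mod_power (quot_module L {\<zero>\<^bsub>L\<^esub>}) (a i))" for i
    proof (rule homology_iso_trans[OF complex_iso_homology_iso[OF X X' seq_complex_iso[OF X] H] power_map_mhom[OF q] _ power_map_surj[OF q qs]])
      interpret PL: module R "mod_power L (a i)" by (rule mod_power_is_module[OF L])
      show "ker0 (mod_power L (a i)) (mod_power (quot_module L {\<zero>\<^bsub>L\<^esub>}) (a i)) (\<lambda>v. \<lambda>t\<in>{..<a i}. {\<zero>\<^bsub>L\<^esub>} +>\<^bsub>L\<^esub> v t)"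
        unfolding ker0_def
      proof (intro ballI impI)
        fix v assume v: "v \<in> carrier (mod_power L (a i))"
          and z: "(\<lambda>t\<in>{..<a i}. {\<zero>\<^bsub>L\<^esub>} +>\<^bsub>L\<^esub> v t) = \<zero>\<^bsub>mod_power (quot_module L {\<zero>\<^bsub>L\<^esub>}) (a i)\<^esub>"
        show "v = \<zero>\<^bsub>mod_power L (a i)\<^esub>"
        proof (rule mod_power_eqI[OF v PL.zero_closed])
          fix t assume t: "t < a i"
          have "v t \<in> carrier L" using v t by (auto simp: mod_power_simps)
          then have "v t = \<zero>\<^bsub>L\<^esub>" using z t unfolding power_map_zero_iff[OF q v] by (intro ker0D[OF qk]) simp_all
          then show "v t = \<zero>\<^bsub>mod_power L (a i)\<^esub> t" using t by (simp add: mod_power_simps)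
        qed
      qed
    qed
    then show ?case by (simp add: seq_sub_Nil[OF L])
  next
    case (Suc j)
    then have j: "j < length ys" by simp
    let ?y = "ys ! j" and ?U = "seq_sub L (take j ys)"
    have yR: "?y \<in> carrier R" using j yc nth_mem by blast
    have "{k \<in> carrier L. ?y \<odot>\<^bsub>L\<^esub> k \<in> ?U} = ?U"
      using reg j submoduleD(1,4)[OF L S[of j]] yR unfolding regular_sequence_iff[OF L] by blast
    then have W: "?U = {k \<in> carrier L. ?y \<odot>\<^bsub>L\<^esub> k \<in> ?U}" by simp
    have V: "sub_sum L ?U (scaled L ?y) = seq_sub L (take (Suc j) ys)"
      unfolding take_Suc_conv_app_nth[OF j] by (rule seq_sub_append[OF L tc yR, symmetric])
    obtain f g where s: "ses R (?Q j) (?Q j) (?Q (Suc j)) f g"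
      and f: "\<And>x. x\<in>carrier (?Q j) \<Longrightarrow> f x = ?y \<odot>\<^bsub>?Q j\<^esub> x"
      using scale_ses[OF L S[of j] yR W] unfolding V by blast
    have K: "is_complex R (koszul (rev (take j ys)) ?X)" by (rule koszul_is_complex[OF X']) (use tc in simp)
    have e: "koszul (rev (take (Suc j) ys)) ?X = cone ?y (koszul (rev (take j ys)) ?X)"
      unfolding take_Suc_conv_app_nth[OF j] by simp
    show ?case unfolding e using homology_iso_cone_power[OF K yR s f] Suc by simp
  qed
  let ?Q = "quot_module L (seq_sub L ys)" and ?Y = "koszul (rev ys) ?X"
  have SS: "submodule (seq_sub L ys) R L" by (rule seq_sub_submodule[OF L yc])
  have Q: "module R ?Q" by (rule quot_is_module[OF L SS])
  interpret Q: module R ?Q by (rule Q)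
  have HY: "homology_iso R ?Y i (mod_power ?Q (a i))" for i using Hj[of "length ys"] by simp
  have Y: "is_complex R ?Y" by (rule koszul_is_complex[OF X']) (use yc in simp)
  \<comment> \<open>Since \<open>a s\<close> is positive, a socle element of \<open>?Q\<close>
    placed in coordinate \<open>0\<close> yields a nonzero class in degree \<open>s\<close> that the
    maximal ideal annihilates.\<close>
  have "socle_at (max_ideal R) ?Y s"
    unfolding socle_at_def
  proof (intro conjI allI impI)
    fix i assume "s < i"
    then have "a i = 0" by (rule as(2))
    obtain \<phi> where "ses R (bd_mod ?Y i) (cyc_mod ?Y i) (mod_power ?Q (a i)) (\<lambda>x. x) \<phi>" using HY[of i] by (auto simp: homology_iso_def)
    note d = sesD[OF this]
    show "exact_at ?Y i"
      unfolding exact_at_def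
    proof
      fix w assume w: "w \<in> cycles ?Y i"
      then have wc: "w \<in> carrier (cyc_mod ?Y i)" by simp
      have "\<phi> w = \<zero>\<^bsub>mod_power ?Q (a i)\<^esub>"
        using mhom_closed[OF d(2) wc] by (auto simp: \<open>a i = 0\<close> mod_power_simps)
      then show "w \<in> boundaries ?Y i" using d(5)[OF wc] by simp
    qed
  next
    obtain z where z: "z \<in> carrier L" "z \<notin> seq_sub L ys" "\<And>y. y \<in> max_ideal R \<Longrightarrow> y \<odot>\<^bsub>L\<^esub> z \<in> seq_sub L ys"
      using ys by (auto simp: socle_sequence_def)
    obtain \<phi> where "ses R (bd_mod ?Y s) (cyc_mod ?Y s) (mod_power ?Q (a s)) (\<lambda>x. x) \<phi>" using HY[of s] by (auto simp: homology_iso_def)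
    note d = sesD[OF this]
    let ?z = "seq_sub L ys +>\<^bsub>L\<^esub> z"
    note qm = quot_mhom[OF L SS] and q0 = quot_eq_zero[OF L SS]
    have zc: "?z \<in> carrier ?Q" by (rule mhom_closed[OF qm z(1)])
    have z0: "?z \<noteq> \<zero>\<^bsub>?Q\<^esub>" using q0[OF z(1)] z(2) by simp
    note pm = power_inj_mhom[OF Q, of "a s" 0]
    let ?p = "power_inj ?Q (a s) 0"
    obtain w where w: "w \<in> carrier (cyc_mod ?Y s)" "\<phi> w = ?p ?z" using d(7)[OF mhom_closed[OF pm zc]] by blast
    have "?p ?z \<noteq> \<zero>\<^bsub>mod_power ?Q (a s)\<^esub>"
    proof
      assume e: "?p ?z = \<zero>\<^bsub>mod_power ?Q (a s)\<^esub>"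
      show False using fun_cong[OF e, of 0] as(1) z0 by (simp add: power_inj_def mod_power_simps)
    qed
    then have "w \<notin> boundaries ?Y s" using d(6)[of w] w(2) by auto
    moreover have "r \<odot>\<^bsub>cobj ?Y s\<^esub> w \<in> boundaries ?Y s" if r: "r \<in> max_ideal R" for r
    proof -
      have rc: "r \<in> carrier R" by (rule max_ideal_carr[OF r])
      have "r \<odot>\<^bsub>?Q\<^esub> ?z = \<zero>\<^bsub>?Q\<^esub>"
        unfolding quot_smult[OF L SS rc z(1)] using q0[OF L.smult_closed[OF rc z(1)]] z(3)[OF r] by simp
      then have "\<phi> (r \<odot>\<^bsub>cobj ?Y s\<^esub> w) = \<zero>\<^bsub>mod_power ?Q (a s)\<^esub>"
        using mhom_smult[OF d(2) rc w(1)] mhom_smult[OF pm rc zc] mhom_zero[OF pm] w(2) by simp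
      moreover have "r \<odot>\<^bsub>cobj ?Y s\<^esub> w \<in> carrier (cyc_mod ?Y s)"
        using submoduleD(4)[OF complex_module[OF Y] cycles_submodule[OF Y] rc] w(1) by simp
      ultimately show ?thesis using d(5) by auto
    qed
    ultimately show "\<exists>z\<in>cycles ?Y s. z \<notin> boundaries ?Y s \<and> (\<forall>r\<in>max_ideal R. r \<odot>\<^bsub>cobj ?Y s\<^esub> z \<in> boundaries ?Y s)"
      using w(1) by auto
  qed
  moreover have "set ws \<subseteq> max_ideal R" using genideal_self[OF ws] gen by simp
  ultimately have T: "top_homology (koszul ws ?Y) (s + int (length ws))"
    by (rule socle_at_top[OF socle_at_koszul[OF Y max_ideal_subset]])
  \<comment> \<open>The cones on \<open>ys\<close> are moved outside those on \<open>ws\<close>,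
    where \<open>top_homology_koszul\<close> can remove them.\<close>
  have rc: "set (rev ys) \<subseteq> carrier R" using yc by simp
  obtain \<phi> where "complex_iso R (koszul ws ?Y) (koszul (rev ys) (koszul ws ?X)) \<phi>"
    using koszul_swap[OF X' ws rc] by blast
  from complex_iso_exact_at[OF koszul_is_complex[OF Y ws] this]
  have "top_homology (koszul (rev ys) (koszul ws ?X)) (s + int (length ws) - int (length ys) + int (length (rev ys)))"
    using T by (simp add: top_homology_def)
  then show ?thesis by (rule top_homology_koszul[OF X' ws gen, rotated]) (use ym in simp)
qed

end

subsection \<open>Finitely generated tensor products\<close>

lemma pure_tensor_left_mhom:
  assumes "module R M" "module R N" "y \<in> carrier N"
  shows "mhom R M (tensor R M N) (\<lambda>x. pure_tensor R M N x y)"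
  using assms tensor_is_module[OF assms(1,2)]
  by (intro mhomI) (simp_all add: pure_tensor_closed pure_tensor_bilinear)

lemma pure_tensor_right_mhom:
  assumes "module R M" "module R N" "x \<in> carrier M"
  shows "mhom R N (tensor R M N) (\<lambda>y. pure_tensor R M N x y)"
  using assms tensor_is_module[OF assms(1,2)]
  by (intro mhomI) (simp_all add: pure_tensor_closed pure_tensor_bilinear)

text \<open>The pure tensors of generators suffice: one argument at a time is extended from
  generators to all elements by a preimage submodule.\<close>

lemma fin_gen_tensor:
  assumes M: "module R M" and N: "module R N" and "fin_gen R M" "fin_gen R N"
  shows "fin_gen R (tensor R M N)"
proof -
  obtain G where G: "finite G" "G \<subseteq> carrier M" "mod_span R M G = carrier M" using assms(3) by (auto simp: fin_gen_def)
  obtain K where K: "finite K" "K \<subseteq> carrier N" "mod_span R N K = carrier N" using assms(4) by (auto simp: fin_gen_def)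
  let ?T = "tensor R M N"
  let ?S = "(\<lambda>(x, y). pure_tensor R M N x y) ` (G \<times> K)"
  have S: "?S \<subseteq> carrier ?T"
  proof
    fix w assume "w \<in> ?S"
    then obtain x y where "x \<in> G" "y \<in> K" "w = pure_tensor R M N x y" by auto
    then show "w \<in> carrier ?T" using pure_tensor_closed[OF M N] G(2) K(2) by blast
  qed
  let ?H = "mod_span R ?T ?S"
  have H: "submodule ?H R ?T" by (rule mod_span_submodule[OF tensor_is_module[OF M N] S])
  have SH: "pure_tensor R M N x y \<in> ?H" if "x \<in> G" "y \<in> K" for x y
    by (rule subsetD[OF mod_span_superset]) (use that in auto)
  have 1: "pure_tensor R M N x y \<in> ?H" if x: "x \<in> carrier M" and y: "y \<in> K" for x y
  proof -
    have yc: "y \<in> carrier N" using K(2) y by blast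
    have "mod_span R M G \<subseteq> {x \<in> carrier M. pure_tensor R M N x y \<in> ?H}"
      by (rule mod_span_subset[OF colon_submodule[OF pure_tensor_left_mhom[OF M N yc] H]]) (use SH[OF _ y] G(2) in auto)
    then show ?thesis using x G(3) by auto
  qed
  have 2: "pure_tensor R M N x y \<in> ?H" if x: "x \<in> carrier M" and y: "y \<in> carrier N" for x y
  proof -
    have "mod_span R N K \<subseteq> {y \<in> carrier N. pure_tensor R M N x y \<in> ?H}"
      by (rule mod_span_subset[OF colon_submodule[OF pure_tensor_right_mhom[OF M N x] H]]) (use 1[OF x] K(2) in auto)
    then show ?thesis using y K(3) by auto
  qed
  have "carrier ?T \<subseteq> ?H" using tensor_induct[OF M N H 2] by (rule subsetI)
  then have "?H = carrier ?T" using submoduleD(1)[OF tensor_is_module[OF M N] H] by blast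
  moreover have "finite ?S" using G(1) K(1) by simp
  ultimately show ?thesis unfolding fin_gen_def using S by (intro exI[of _ ?S] conjI)
qed

subsection \<open>Finite quasi-projective resolutions\<close>

lemma homology_iso_zero:
  assumes X: "is_complex R X" and e: "exact_at X i" and L: "module R L" "zero_module L"
  shows "homology_iso R X i L"
proof -
  have "cycles X i = boundaries X i" using e boundaries_subset_cycles[OF X] by (auto simp: exact_at_def)
  moreover have "ses R (bd_mod X i) (cyc_mod X i) L (\<lambda>x. x) (\<lambda>_. \<zero>\<^bsub>L\<^esub>)"
    by (rule sesI[OF bd_cyc_mhom[OF X] mhom_0[OF cyc_mod_module[OF X] L(1)]])
      (use calculation L(2) submoduleD(2)[OF complex_module[OF X] boundaries_submodule[OF X], of i]
        in \<open>auto simp: ker0_def zero_module_def\<close>)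
  ultimately show ?thesis unfolding homology_iso_def by blast
qed

lemma exact_at_homology_zero:
  assumes h: "homology_iso R X i L" and e: "exact_at X i"
  shows "zero_module L"
proof -
  obtain \<phi> where "ses R (bd_mod X i) (cyc_mod X i) L (\<lambda>x. x) \<phi>" using h by (auto simp: homology_iso_def)
  note d = sesD[OF this]
  show ?thesis
  proof (rule zero_moduleI[OF mhom_cod[OF d(2)]])
    fix y assume "y \<in> carrier L"
    then obtain x where x: "x \<in> carrier (cyc_mod X i)" "\<phi> x = y" using d(7) by blast
    then have "x \<in> carrier (bd_mod X i)" using e by (auto simp: exact_at_def)
    then show "y = \<zero>\<^bsub>L\<^esub>" using d(6) x(2) by simp
  qed
qed

lemma zero_mod_power_iff:
  assumes M: "module R M" and nz: "\<not> zero_module M"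
  shows "zero_module (mod_power M a) \<longleftrightarrow> a = 0"
proof
  assume z: "zero_module (mod_power M a)"
  obtain x where x: "x \<in> carrier M" "x \<noteq> \<zero>\<^bsub>M\<^esub>" using nz zero_moduleI[OF M] by blast
  show "a = 0"
  proof (rule ccontr)
    assume "a \<noteq> 0"
    have "power_inj M a 0 x = \<zero>\<^bsub>mod_power M a\<^esub>"
      using mhom_closed[OF power_inj_mhom[OF M] x(1), of a 0] z by (simp add: zero_module_def)
    from fun_cong[OF this, of 0] show False using x(2) \<open>a \<noteq> 0\<close> by (simp add: power_inj_def mod_power_simps)
  qed
qed (auto simp: zero_module_def mod_power_def)

lemma zero_mod_power_zero: "module R M \<Longrightarrow> zero_module M \<Longrightarrow> zero_module (mod_power M a)"
  by (rule zero_moduleI[OF mod_power_is_module])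
    (auto simp: zero_module_def mod_power_simps intro!: extensionalityI[of _ "{..<a}"] simp: PiE_def Pi_def)

text \<open>The definition prescribes homology only in degrees from \<open>cinf P\<close> on.
  Setting the multiplicity to zero below makes it valid in all degrees, and boundedness provides the
  largest degree \<open>s\<close> with nonzero multiplicity.\<close>

lemma finite_quasi_projective_resolutionE:
  assumes M: "module R M" and nz: "\<not> zero_module M" and P: "finite_quasi_projective_resolution R P M"
  obtains a :: "int \<Rightarrow> nat" and lo hi s where
    "\<forall>i<lo. zero_module (cobj P i)" "\<forall>i>hi. zero_module (cobj P i)"
    "\<forall>i. homology_iso R P i (mod_power M (a i))" "0 < a s" "\<forall>i>s. a i = 0"
proof -
  have X: "is_complex R P" and ci: "cinf P > -\<infinity>" and cs: "csup P < \<infinity>"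
    using P by (auto simp: finite_quasi_projective_resolution_def quasi_projective_resolution_def)
  obtain a i0 where a: "cinf P \<le> ereal (of_int i0)" "a i0 \<noteq> 0"
    "\<And>i. cinf P \<le> ereal (of_int i) \<Longrightarrow> mod_iso R (homology P i) (mod_power M (a i))"
    using P unfolding finite_quasi_projective_resolution_def quasi_projective_resolution_def by blast
  \<comment> \<open>The bounds of \<open>P\<close> are extended reals; a real number strictly below
    \<open>cinf P\<close> is rounded to an integer, and likewise above
    \<open>csup P\<close>.\<close>
  obtain l where l: "ereal l < cinf P" using ereal_dense2[OF ci] by blast
  have lo: "zero_module (cobj P i)" if "i < \<lfloor>l\<rfloor>" for i
  proof (rule ccontr)
    assume "\<not> zero_module (cobj P i)"
    then have "cinf P \<le> ereal (of_int i)" unfolding cinf_def by (intro INF_lower) simp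
    then have "ereal l < ereal (of_int i)" using l by (rule less_le_trans[rotated])
    then show False using that by (simp add: less_floor_iff)
  qed
  obtain h where h: "csup P < ereal h" using ereal_dense2[OF cs] by blast
  have hi: "zero_module (cobj P i)" if "i > \<lceil>h\<rceil>" for i
  proof (rule ccontr)
    assume "\<not> zero_module (cobj P i)"
    then have "ereal (of_int i) \<le> csup P" unfolding csup_def by (intro SUP_upper) simp
    then have "ereal (of_int i) < ereal h" using h by (rule le_less_trans)
    then show False using that by (simp add: ceiling_less_iff)
  qed
  define b where "b i = (if cinf P \<le> ereal (of_int i) then a i else 0)" for i
  have b: "homology_iso R P i (mod_power M (b i))" for i
  proof (cases "cinf P \<le> ereal (of_int i)")
    case True
    then show ?thesis
      unfolding b_def using homology_iso_of_mod_iso[OF X mod_power_is_module[OF M] a(3)] by simp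
  next
    case False
    then have "zero_module (cobj P i)" unfolding cinf_def by (meson INF_lower mem_Collect_eq)
    moreover have "zero_module (mod_power M (b i))" using zero_mod_power_iff[OF M nz] False by (simp add: b_def)
    ultimately show ?thesis by (intro homology_iso_zero[OF X exact_at_zero_module[OF X] mod_power_is_module[OF M]])
  qed
  \<comment> \<open>This is where \<open>M \<noteq> 0\<close> matters: a zero power of
    \<open>M\<close> must have exponent \<open>0\<close>.\<close>
  have bz: "b i = 0" if "zero_module (cobj P i)" for i
    using exact_at_homology_zero[OF b exact_at_zero_module[OF X that]] zero_mod_power_iff[OF M nz] by simp
  let ?I = "{i. b i \<noteq> 0}"
  have "?I \<subseteq> {\<lfloor>l\<rfloor>..\<lceil>h\<rceil>}"
  proof
    fix i assume "i \<in> ?I"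
    then have "\<not> zero_module (cobj P i)" using bz[of i] by auto
    then show "i \<in> {\<lfloor>l\<rfloor>..\<lceil>h\<rceil>}" using lo[of i] hi[of i] by (simp add: not_less[symmetric]) blast
  qed
  then have fin: "finite ?I" by (rule finite_subset) simp
  have ne: "?I \<noteq> {}" using a(1,2) by (auto simp: b_def)
  have "0 < b (Max ?I)" using Max_in[OF fin ne] by simp
  moreover have "\<forall>i>Max ?I. b i = 0" using Max_ge[OF fin] by (metis mem_Collect_eq not_less)
  ultimately show thesis using that[of "\<lfloor>l\<rfloor>" "\<lceil>h\<rceil>" b "Max ?I"] lo hi b by blast
qed

lemma qpd_finiteE:
  fixes R :: "('a, 'r) ring_scheme"
  assumes "qpd TYPE('p) R M < \<infinity>" "\<not> zero_module M"
  obtains P :: "('a, 'p) mod_complex" where "finite_quasi_projective_resolution R P M"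
proof -
  have "{P :: ('a, 'p) mod_complex. finite_quasi_projective_resolution R P M} \<noteq> {}"
  proof
    assume "{P :: ('a, 'p) mod_complex. finite_quasi_projective_resolution R P M} = {}"
    then show False using assms by (simp add: qpd_def top_ereal_def)
  qed
  then show thesis using that by blast
qed

subsection \<open>The depth formula\<close>

context noetherian_local_ring
begin

lemma depth_zero_module: "zero_module M \<Longrightarrow> depth R M = \<infinity>"
  by (simp add: depth_def)

text \<open>The top degrees of \<open>?K R\<close> and \<open>?K N\<close> are each expressed twice,
  as \<open>c\<close> minus the length of a maximal regular sequence of \<open>R\<close> or
  \<open>N\<close>, and as \<open>t\<close> minus that of one of \<open>M\<close> or
  \<open>M \<otimes> N\<close>. Adding the first equation and the opposite of the second eliminates
  \<open>c\<close> and \<open>t\<close>.\<close>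

lemma depth_formula_nonzero:
  fixes M :: "('a, 'm, 's) module_scheme" and N :: "('a, 'n, 't) module_scheme" and P :: "('a, 'p) mod_complex"
  assumes M: "module R M" "fin_gen R M" "\<not> zero_module M" and N: "module R N" "fin_gen R N" "\<not> zero_module N"
    and P: "finite_quasi_projective_resolution R P M"
    and Tor: "\<And>i. i \<ge> 1 \<Longrightarrow> zero_module (Tor R i M N)"
  shows "depth R M + depth R N = depth R (self_module R) + depth R (tensor R M N)"
proof -
  have nr: "noetherian_ring R" by unfold_locales
  let ?S = "self_module R" and ?MN = "tensor R M N"
  have S: "module R ?S" by (rule self_module_is_module[OF is_cring])
  have Snz: "\<not> zero_module ?S"
  proof
    assume "zero_module ?S"
    then have "\<one> = \<zero>" using one_closed unfolding zero_module_def self_module_simps by blast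
    then show False using one_notin_max_ideal additive_subgroup.zero_closed[OF ideal.axioms(1)[OF max_ideal_is_ideal]] by simp
  qed
  have MN: "module R ?MN" by (rule tensor_is_module[OF M(1) N(1)])
  note noeM = fin_gen_noetherian_module[OF nr M(1,2)] and noeN = fin_gen_noetherian_module[OF nr N(1,2)]
    and noeS = self_noetherian and noeMN = fin_gen_noetherian_module[OF nr MN fin_gen_tensor[OF M(1) N(1) M(2) N(2)]]
  have X: "is_complex R P" and pr: "\<And>i. projective R (cobj P i)"
    using P by (auto simp: finite_quasi_projective_resolution_def quasi_projective_resolution_def)
  obtain a :: "int \<Rightarrow> nat" and lo hi s where a: "\<forall>i<lo. zero_module (cobj P i)" "\<forall>i>hi. zero_module (cobj P i)"
    "\<forall>i. homology_iso R P i (mod_power M (a i))" "0 < a s" "\<forall>i>s. a i = 0"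
    by (rule finite_quasi_projective_resolutionE[OF M(1,3) P])
  obtain A where A: "A \<subseteq> carrier R" "finite A" "max_ideal R = Idl A" using finetely_gen[OF max_ideal_is_ideal] by blast
  obtain xs where "set xs = A" using finite_list[OF A(2)] by blast
  then have xs: "set xs \<subseteq> carrier R" and gen: "Idl (set xs) = max_ideal R" using A by simp_all
  let ?K = "koszul_tensor R xs P"
  define t where "t = s + int (length xs)"

  \<comment> \<open>The Tor hypothesis becomes \<open>tor_free\<close> for \<open>M\<close> along a
    resolution of \<open>N\<close>; \<open>tensor_homology\<close> then extends it through the whole
    complex \<open>P\<close>.\<close>
  have HN: "homology_iso R (tensor_complex R P N) i (mod_power ?MN (a i))" for i
  proof -
    note D = projective_resolution_exists[OF N(1)] and F = projective_resolution_exists[OF M(1)]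
    note TF = tensor_complex_is_complex[OF resolution_complex[OF F] N(1)]
    have ex: "exact_at (tensor_complex R (chosen_resolution R M) N) i" if "1 \<le> i" for i
      using Tor[of "nat i"] that zero_homology_iff_exact_at[OF TF, of i] by (simp add: Tor_def)
    have "tor_free R (chosen_resolution R N) M"
      by (rule tor_free_of_syzygies[OF F M(1) D N(1) syzygy_injective_of_exact[OF F M(1) N(1) ex]])
    from tensor_homology[OF D N(1) M(1) this X pr, of lo a] show ?thesis using a(1,3) by blast
  qed
  \<comment> \<open>For \<open>N = R\<close> the complex \<open>P \<otimes> R\<close> is isomorphic
    to \<open>P\<close>, and its homology is known without any Tor argument.\<close>
  have HS: "homology_iso R (tensor_complex R P ?S) i (mod_power M (a i))" for i
  proof (rule complex_iso_homology_iso[OF X tensor_complex_is_complex[OF X S] _ a(3)[rule_format]])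
    show "complex_iso R P (tensor_complex R P ?S) (\<lambda>i x. pure_tensor R (cobj P i) ?S x \<one>)"
      unfolding complex_iso_def tensor_complex_simps
    proof (intro allI conjI ballI tensor_self_iso complex_module[OF X])
      fix i x assume x: "x \<in> carrier (cobj P i)"
      show "pure_tensor R (cobj P (i - 1)) ?S (cdiff P i x) \<one> =
          tensor_map R (cobj P i) (cobj P (i - 1)) ?S (cdiff P i) (pure_tensor R (cobj P i) ?S x \<one>)"
        using tensor_map_hom(2)[OF complex_module[OF X] complex_module[OF X] S mhom_mod_hom[OF complex_mhom[OF X]] x]
        by (simp add: self_module_simps)
    qed
  qed
  have topS: "top_homology (?K ?S) (t - int (length ys))" if "socle_sequence M ys" for ys
    using top_homology_of_power_homology[OF tensor_complex_is_complex[OF X S] M(1) HS a(4) _ xs gen that] a(5)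
    unfolding koszul_tensor_def t_def by simp
  have topN: "top_homology (?K N) (t - int (length ys))" if "socle_sequence ?MN ys" for ys
    using top_homology_of_power_homology[OF tensor_complex_is_complex[OF X N(1)] MN HN a(4) _ xs gen that] a(5)
    unfolding koszul_tensor_def t_def by simp
  let ?k = "residue_field"
  \<comment> \<open>If the homology for the residue field vanished in all degrees, so would that for
    \<open>R\<close>, against \<open>topS\<close>. As \<open>P\<close> is bounded above, there is a
    largest degree in which it survives.\<close>
  obtain c where c: "top_homology (?K ?k) c"
  proof -
    have k: "module R ?k" by (rule quot_is_module[OF S]) (simp add: submodule_self_iff_ideal[OF is_cring] max_ideal_is_ideal)
    let ?I = "{i. \<not> exact_at (?K ?k) i}"
    have up: "exact_at (?K ?k) i" if "hi + int (length xs) < i" for i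
      by (rule KT_bounded[OF X pr xs gen k _ that]) (use a(2) in blast)
    have "?I \<noteq> {}"
    proof
      assume e: "?I = {}"
      have "exact_at (?K ?S) i" for i
        using KT_vanishing[OF X pr xs gen _ S noeS zero_submodule[OF S], of "i - 1" i] e KT_quot_zero[OF X pr xs gen S] by auto
      moreover obtain ys where "socle_sequence M ys" using socle_sequence_exists[OF M(1) noeM M(3)] by blast
      ultimately show False using topS by (auto simp: top_homology_def)
    qed
    then obtain i0 where i0: "i0 \<in> ?I" by blast
    \<comment> \<open>Cutting off below a known nonvanishing degree leaves a finite set as soon as
      an upper bound is available.\<close>
    let ?J = "{i \<in> ?I. i0 \<le> i}"
    have "?J \<subseteq> {i0..hi + int (length xs)}" using up by (auto simp: not_less[symmetric])
    then have fin: "finite ?J" by (rule finite_subset) simp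
    have ne: "?J \<noteq> {}" using i0 by blast
    have "top_homology (?K ?k) (Max ?J)"
      unfolding top_homology_def
    proof (intro conjI allI impI)
      show "\<not> exact_at (?K ?k) (Max ?J)" using Max_in[OF fin ne] by blast
      fix i assume i: "Max ?J < i"
      show "exact_at (?K ?k) i"
      proof (rule ccontr)
        assume "\<not> exact_at (?K ?k) i"
        moreover have "i0 \<le> Max ?J" using Max_in[OF fin ne] by blast
        ultimately have "i \<in> ?J" using i by auto
        then show False using Max_ge[OF fin] i by (meson not_less)
      qed
    qed
    then show thesis by (rule that)
  qed
  \<comment> \<open>If \<open>M \<otimes> N\<close> were zero, \<open>P \<otimes> N\<close> would be
    exact, whereas \<open>KT_top\<close> finds nonzero homology for the nonzero module
    \<open>N\<close>.\<close>
  have MNnz: "\<not> zero_module ?MN"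
  proof
    assume "zero_module ?MN"
    then have z: "zero_module (mod_power ?MN (a i))" for i by (rule zero_mod_power_zero[OF MN])
    have "exact_at (tensor_complex R P N) i" for i
    proof -
      obtain \<phi> where "ses R (bd_mod (tensor_complex R P N) i) (cyc_mod (tensor_complex R P N) i) (mod_power ?MN (a i)) (\<lambda>x. x) \<phi>"
        using HN by (auto simp: homology_iso_def)
      note d = sesD[OF this]
      show ?thesis
        unfolding exact_at_def
      proof
        fix w assume w: "w \<in> cycles (tensor_complex R P N) i"
        then have wc: "w \<in> carrier (cyc_mod (tensor_complex R P N) i)" by simp
        have "\<phi> w = \<zero>\<^bsub>mod_power ?MN (a i)\<^esub>" using mhom_closed[OF d(2) wc] z by (simp add: zero_module_def)
        then show "w \<in> boundaries (tensor_complex R P N) i" using d(5)[OF wc] by simp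
      qed
    qed
    then have "exact_at (?K N) i" for i by (rule KT_exact_of_tensor_exact[OF X pr xs gen N(1)])
    moreover obtain ys where "socle_sequence N ys" using socle_sequence_exists[OF N(1) noeN N(3)] by blast
    ultimately show False using KT_top[OF X pr xs gen c N(1) noeN] by (auto simp: top_homology_def)
  qed
  note kS = KT_top[OF X pr xs gen c S noeS] and kN = KT_top[OF X pr xs gen c N(1) noeN]
  obtain yM where yM: "socle_sequence M yM" using socle_sequence_exists[OF M(1) noeM M(3)] by blast
  obtain yN where yN: "socle_sequence N yN" using socle_sequence_exists[OF N(1) noeN N(3)] by blast
  obtain yS where yS: "socle_sequence ?S yS" using socle_sequence_exists[OF S noeS Snz] by blast
  obtain yT where yT: "socle_sequence ?MN yT" using socle_sequence_exists[OF MN noeMN MNnz] by blast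
  \<comment> \<open>Both equations hold for every pair of socle sequences. With one member of the
    pair fixed, the length of the other is constant, as \<open>depth_eqI\<close> requires.\<close>
  have e1: "c - int (length p) = t - int (length q)" if "socle_sequence ?S p" "socle_sequence M q" for p q
    using top_homology_unique[OF kS topS] that by blast
  have e2: "c - int (length p) = t - int (length q)" if "socle_sequence N p" "socle_sequence ?MN q" for p q
    using top_homology_unique[OF kN topN] that by blast
  have "depth R M = enat (length yM)"
    by (rule depth_eqI[OF M(1) noeM M(3)]) (use e1[OF yS yM] e1[OF yS] in fastforce)
  moreover have "depth R N = enat (length yN)"
    by (rule depth_eqI[OF N(1) noeN N(3)]) (use e2[OF yN yT] e2[OF _ yT] in fastforce)
  moreover have "depth R ?S = enat (length yS)"
    by (rule depth_eqI[OF S noeS Snz]) (use e1[OF yS yM] e1[OF _ yM] in fastforce)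
  moreover have "depth R ?MN = enat (length yT)"
    by (rule depth_eqI[OF MN noeMN MNnz]) (use e2[OF yN yT] e2[OF yN] in fastforce)
  moreover have "length yM + length yN = length yS + length yT" using e1[OF yS yM] e2[OF yN yT] by linarith
  ultimately show ?thesis by simp
qed

end

theorem theorem1p2:
  fixes R :: "('a, 'r) ring_scheme"
    and M :: "('a, 'm, 's) module_scheme"
    and N :: "('a, 'n, 't) module_scheme"
  assumes "noetherian_local_ring R"
    and "module R M" and "fin_gen R M"
    and "module R N" and "fin_gen R N"
    and "qpd TYPE('p) R M < \<infinity>"
    and "\<And>i. i \<ge> 1 \<Longrightarrow> zero_module (Tor R i M N)"
  shows "depth R M + depth R N = depth R (self_module R) + depth R (tensor R M N)"
proof -
  interpret noetherian_local_ring R by fact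
  \<comment> \<open>If \<open>M\<close> or \<open>N\<close> is zero, so is
    \<open>M \<otimes> N\<close>, and both sides are \<infinity>.\<close>
  consider "zero_module M" | "zero_module N" | "\<not> zero_module M" "\<not> zero_module N" by blast
  then show ?thesis
  proof cases
    case 1
    then show ?thesis
      using zero_module_tensor_left[OF assms(2,4)] by (simp add: depth_zero_module)
  next
    case 2
    then show ?thesis
      using zero_module_tensor_right[OF assms(2,4)] by (simp add: depth_zero_module)
  next
    case 3
    obtain P :: "('a, 'p) mod_complex" where "finite_quasi_projective_resolution R P M"
      by (rule qpd_finiteE[OF assms(6) 3(1)])
    then show ?thesis using depth_formula_nonzero[OF assms(2,3) 3(1) assms(4,5) 3(2) _ assms(7)] by blast
  qed
qed

end
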